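(* Let $p\geq 5$ be a prime, let $L$ be a $\mathbb{Z}_p$-Lie lattice, and let $d=\dim(L)$ be its rank over $\mathbb{Z}_p$. Then $L$ is strongly hereditarily self-similar of index $p$ if and only if $L$ is isomorphic to one of the following Lie lattices: \begin{enumerate} \item the abelian Lie lattice $\mathbb{Z}_p^d$, with $d\geq 1$; \item the metabelian Lie lattice $\mathbb{Z}_p\ltimes\mathbb{Z}_p^{d-1}$, where the canonical generator of $\mathbb{Z}_p$ acts on $\mathbb{Z}_p^{d-1}$ by multiplication by the scalar $p^s$, with $d\geq 2$ and $s\in\mathbb{N}$. \end{enumerate}
   Context: $\mathbb{N}=\{0,1,2,\dots\}$. A $\mathbb{Z}_p$-Lie lattice is a finitely generated free $\mathbb{Z}_p$-module endowed with a structure of Lie algebra over $\mathbb{Z}_p$. In item (2), the Lie lattice has a basis $x,y_1,\dots,y_{d-1}$ over $\mathbb{Z}_p$ with $[x,y_i]=p^sy_i$ and $[y_i,y_j]=0$ for all $i,j$. Let $L$ be a $\mathbb{Z}_p$-Lie lattice. A virtual endomorphism of $L$ of index $p$ is a Lie algebra homomorphism $\varphi:M\to L$ where $M$ is a $\mathbb{Z}_p$-subalgebra of $L$ of index $p$ (index of additive groups). It is simple if there is no nonzero ideal $I$ of $L$ with $I\subseteq M$ and $\varphi(I)\subseteq I$. $L$ is self-similar of index $p$ if there exists a simple virtual endomorphism of $L$ of index $p$. $L$ is strongly hereditarily self-similar of index $p$ if $L$ and all of its nonzero $\mathbb{Z}_p$-subalgebras are self-similar of index $p$. *)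

theory Defs
  imports "HOL-Algebra.Module" "HOL-Algebra.AbelCoset" "HOL-Computational_Algebra.Primes"
begin

section \<open>The ring of p-adic integers\<close>

text \<open>The inverse limit of the rings \<open>\<int>/p^n\<int>\<close>: a p-adic integer is a coherent sequence of
  canonical representatives \<open>f n \<in> {0..<p^n}\<close>.\<close>

type_synonym padic = "nat \<Rightarrow> int"

definition Zp :: "nat \<Rightarrow> padic ring" where
  "Zp p = \<lparr>carrier = {f. (\<forall>n. f n \<in> {0..<int p ^ n}) \<and> (\<forall>n. f (Suc n) mod int p ^ n = f n)},
           monoid.mult = (\<lambda>f g n. (f n * g n) mod int p ^ n),
           monoid.one = (\<lambda>n. 1 mod int p ^ n),
           ring.zero = (\<lambda>n. 0),
           ring.add = (\<lambda>f g n. (f n + g n) mod int p ^ n)\<rparr>"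

section \<open>Lie algebras over a commutative ring\<close>

text \<open>The record \<open>module\<close> inherits the fields \<open>mult\<close> and \<open>one\<close> from \<open>ring\<close>; as in the locale
  \<open>module\<close>, they carry no meaning here. The Lie bracket is a separate field.\<close>

record ('a, 'b) lie_algebra = "('a, 'b) module" +
  bracket :: "'b \<Rightarrow> 'b \<Rightarrow> 'b"

locale lie_algebra = module R L for R (structure) and L (structure) +
  assumes bracket_closed:
      "\<lbrakk>x \<in> carrier L; y \<in> carrier L\<rbrakk> \<Longrightarrow> bracket L x y \<in> carrier L"
    and bracket_add_left:
      "\<lbrakk>x \<in> carrier L; y \<in> carrier L; z \<in> carrier L\<rbrakk> \<Longrightarrow>
        bracket L (x \<oplus>\<^bsub>L\<^esub> y) z = bracket L x z \<oplus>\<^bsub>L\<^esub> bracket L y z"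
    and bracket_add_right:
      "\<lbrakk>x \<in> carrier L; y \<in> carrier L; z \<in> carrier L\<rbrakk> \<Longrightarrow>
        bracket L x (y \<oplus>\<^bsub>L\<^esub> z) = bracket L x y \<oplus>\<^bsub>L\<^esub> bracket L x z"
    and bracket_smult_left:
      "\<lbrakk>a \<in> carrier R; x \<in> carrier L; y \<in> carrier L\<rbrakk> \<Longrightarrow>
        bracket L (a \<odot>\<^bsub>L\<^esub> x) y = a \<odot>\<^bsub>L\<^esub> bracket L x y"
    and bracket_smult_right:
      "\<lbrakk>a \<in> carrier R; x \<in> carrier L; y \<in> carrier L\<rbrakk> \<Longrightarrow>
        bracket L x (a \<odot>\<^bsub>L\<^esub> y) = a \<odot>\<^bsub>L\<^esub> bracket L x y"
    and bracket_self:
      "x \<in> carrier L \<Longrightarrow> bracket L x x = \<zero>\<^bsub>L\<^esub>"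
    and jacobi:
      "\<lbrakk>x \<in> carrier L; y \<in> carrier L; z \<in> carrier L\<rbrakk> \<Longrightarrow>
        bracket L x (bracket L y z) \<oplus>\<^bsub>L\<^esub> bracket L y (bracket L z x)
          \<oplus>\<^bsub>L\<^esub> bracket L z (bracket L x y) = \<zero>\<^bsub>L\<^esub>"

definition lie_subalgebra ::
    "('a, 'm) ring_scheme \<Rightarrow> ('a, 'b, 'n) lie_algebra_scheme \<Rightarrow> 'b set \<Rightarrow> bool" where
  "lie_subalgebra R L M \<longleftrightarrow>
     submodule M R L \<and> (\<forall>x\<in>M. \<forall>y\<in>M. bracket L x y \<in> M)"

definition lie_ideal ::
    "('a, 'm) ring_scheme \<Rightarrow> ('a, 'b, 'n) lie_algebra_scheme \<Rightarrow> 'b set \<Rightarrow> bool" where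
  "lie_ideal R L I \<longleftrightarrow>
     submodule I R L \<and> (\<forall>x\<in>carrier L. \<forall>y\<in>I. bracket L x y \<in> I)"

definition lie_hom ::
    "('a, 'm) ring_scheme \<Rightarrow> ('a, 'b, 'n) lie_algebra_scheme \<Rightarrow>
      ('a, 'c, 'k) lie_algebra_scheme \<Rightarrow> ('b \<Rightarrow> 'c) set" where
  "lie_hom R L L' = {\<phi>. \<phi> \<in> carrier L \<rightarrow> carrier L' \<and>
     (\<forall>x\<in>carrier L. \<forall>y\<in>carrier L. \<phi> (x \<oplus>\<^bsub>L\<^esub> y) = \<phi> x \<oplus>\<^bsub>L'\<^esub> \<phi> y) \<and>
     (\<forall>a\<in>carrier R. \<forall>x\<in>carrier L. \<phi> (a \<odot>\<^bsub>L\<^esub> x) = a \<odot>\<^bsub>L'\<^esub> \<phi> x) \<and>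
     (\<forall>x\<in>carrier L. \<forall>y\<in>carrier L. \<phi> (bracket L x y) = bracket L' (\<phi> x) (\<phi> y))}"

definition lie_isomorphic ::
    "('a, 'm) ring_scheme \<Rightarrow> ('a, 'b, 'n) lie_algebra_scheme \<Rightarrow>
      ('a, 'c, 'k) lie_algebra_scheme \<Rightarrow> bool" where
  "lie_isomorphic R L L' \<longleftrightarrow> (\<exists>\<phi>\<in>lie_hom R L L'. bij_betw \<phi> (carrier L) (carrier L'))"

section \<open>Lattices and their rank\<close>

definition finite_basis ::
    "('a, 'm) ring_scheme \<Rightarrow> ('a, 'b, 'n) module_scheme \<Rightarrow> 'b set \<Rightarrow> bool" where
  "finite_basis R L B \<longleftrightarrow> finite B \<and> B \<subseteq> carrier L \<and>
     (\<forall>x\<in>carrier L. \<exists>!c. c \<in> B \<rightarrow>\<^sub>E carrier R \<and> x = (\<Oplus>\<^bsub>L\<^esub>b\<in>B. c b \<odot>\<^bsub>L\<^esub> b))"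

definition lie_lattice ::
    "('a, 'm) ring_scheme \<Rightarrow> ('a, 'b, 'n) lie_algebra_scheme \<Rightarrow> bool" where
  "lie_lattice R L \<longleftrightarrow> lie_algebra R L \<and> (\<exists>B. finite_basis R L B)"

definition has_rank ::
    "('a, 'm) ring_scheme \<Rightarrow> ('a, 'b, 'n) module_scheme \<Rightarrow> nat \<Rightarrow> bool" where
  "has_rank R L d \<longleftrightarrow> (\<exists>B. finite_basis R L B \<and> card B = d)"

section \<open>Self-similarity\<close>

text \<open>A subalgebra \<open>M\<close> is regarded as a Lie algebra by restricting the carrier of \<open>L\<close>. The index
  \<open>k\<close> is meant to be positive, since \<open>card\<close> is \<open>0\<close> on infinite sets.\<close>

definition virtual_endomorphism ::
    "('a, 'm) ring_scheme \<Rightarrow> nat \<Rightarrow> ('a, 'b, 'n) lie_algebra_scheme \<Rightarrow> 'b set \<Rightarrow>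
      ('b \<Rightarrow> 'b) \<Rightarrow> bool" where
  "virtual_endomorphism R k L M \<phi> \<longleftrightarrow>
     lie_subalgebra R L M \<and> card (a_rcosets\<^bsub>L\<^esub> M) = k \<and> \<phi> \<in> lie_hom R (L\<lparr>carrier := M\<rparr>) L"

definition simple_virtual_endomorphism ::
    "('a, 'm) ring_scheme \<Rightarrow> nat \<Rightarrow> ('a, 'b, 'n) lie_algebra_scheme \<Rightarrow> 'b set \<Rightarrow>
      ('b \<Rightarrow> 'b) \<Rightarrow> bool" where
  "simple_virtual_endomorphism R k L M \<phi> \<longleftrightarrow>
     virtual_endomorphism R k L M \<phi> \<and>
     \<not> (\<exists>I. lie_ideal R L I \<and> I \<noteq> {\<zero>\<^bsub>L\<^esub>} \<and> I \<subseteq> M \<and> \<phi> ` I \<subseteq> I)"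

definition self_similar ::
    "('a, 'm) ring_scheme \<Rightarrow> nat \<Rightarrow> ('a, 'b, 'n) lie_algebra_scheme \<Rightarrow> bool" where
  "self_similar R k L \<longleftrightarrow> (\<exists>M \<phi>. simple_virtual_endomorphism R k L M \<phi>)"

definition strongly_hereditarily_self_similar ::
    "('a, 'm) ring_scheme \<Rightarrow> nat \<Rightarrow> ('a, 'b, 'n) lie_algebra_scheme \<Rightarrow> bool" where
  "strongly_hereditarily_self_similar R k L \<longleftrightarrow>
     self_similar R k L \<and>
     (\<forall>N. lie_subalgebra R L N \<and> N \<noteq> {\<zero>\<^bsub>L\<^esub>} \<longrightarrow> self_similar R k (L\<lparr>carrier := N\<rparr>))"

section \<open>The model Lie algebras\<close>

definition abelian_lie :: "('a, 'm) ring_scheme \<Rightarrow> nat \<Rightarrow> ('a, nat \<Rightarrow> 'a) lie_algebra" where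
  "abelian_lie R n =
     \<lparr>carrier = {..<n} \<rightarrow>\<^sub>E carrier R,
      monoid.mult = undefined,
      monoid.one = undefined,
      ring.zero = (\<lambda>i\<in>{..<n}. \<zero>\<^bsub>R\<^esub>),
      ring.add = (\<lambda>v w. \<lambda>i\<in>{..<n}. v i \<oplus>\<^bsub>R\<^esub> w i),
      smult = (\<lambda>a v. \<lambda>i\<in>{..<n}. a \<otimes>\<^bsub>R\<^esub> v i),
      bracket = (\<lambda>v w. \<lambda>i\<in>{..<n}. \<zero>\<^bsub>R\<^esub>)\<rparr>"

text \<open>The semidirect product \<open>R \<ltimes> R^n\<close> of abelian Lie algebras in which \<open>1 \<in> R\<close> acts on \<open>R^n\<close> as
  multiplication by the scalar \<open>c\<close>, so that \<open>[(a, v), (b, w)] = (0, a c w - b c v)\<close>.\<close>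

definition scalar_semidirect ::
    "('a, 'm) ring_scheme \<Rightarrow> nat \<Rightarrow> 'a \<Rightarrow> ('a, 'a \<times> (nat \<Rightarrow> 'a)) lie_algebra" where
  "scalar_semidirect R n c =
     (let V = abelian_lie R n in
     \<lparr>carrier = carrier R \<times> carrier V,
      monoid.mult = undefined,
      monoid.one = undefined,
      ring.zero = (\<zero>\<^bsub>R\<^esub>, \<zero>\<^bsub>V\<^esub>),
      ring.add = (\<lambda>(a, v) (b, w). (a \<oplus>\<^bsub>R\<^esub> b, v \<oplus>\<^bsub>V\<^esub> w)),
      smult = (\<lambda>r (a, v). (r \<otimes>\<^bsub>R\<^esub> a, r \<odot>\<^bsub>V\<^esub> v)),
      bracket = (\<lambda>(a, v) (b, w).
        (\<zero>\<^bsub>R\<^esub>, ((a \<otimes>\<^bsub>R\<^esub> c) \<odot>\<^bsub>V\<^esub> w) \<ominus>\<^bsub>V\<^esub> ((b \<otimes>\<^bsub>R\<^esub> c) \<odot>\<^bsub>V\<^esub> v)))\<rparr>)"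

end

theory Submission
  imports Defs HOL.Modules "HOL-Combinatorics.Transposition" "HOL-Library.Function_Algebras"
    "HOL-Number_Theory.Cong" "HOL-Algebra.Multiplicative_Group"
begin

text \<open>Both sides are equivalent to \<open>L\<close> being of scalar type: \<open>[x, y] = l x y - l y x\<close> for some linear form \<open>l\<close>.

  Necessity is proved by induction on the rank. Let \<open>\<phi>\<close> be a simple virtual endomorphism of \<open>p L\<close>. The vectors
  to which all powers of \<open>\<phi>\<close> can be applied form an isolated proper subalgebra \<open>B\<close>, of scalar type by
  induction, and multiplication by \<open>p\<close> increases the number of powers of \<open>\<phi>\<close> that can be applied to any
  other vector by a constant \<open>m\<close>. So \<open>E = \<phi> ^^ m \<circ> p\<close> is defined everywhere, and the Fitting decompositions of \<open>E\<close>
  and of \<open>\<phi>\<close> on \<open>B\<close> split the lattice into expanded, isometric and contracted parts. Equivariance determines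
  most of the brackets between these parts; the others are settled by three kinds of subalgebras that
  are not self-similar: Heisenberg lattices, extensions of a cyclic module by the acting element, and
  \<open>sl\<^sub>2\<close>-lattices with widely spaced structure constants.

  Conversely, scalar type is inherited by subalgebras, and a lattice of scalar type has a basis on which
  \<open>l\<close> vanishes with at most one exception. Rotating the other coordinates while dividing one of them by \<open>p\<close>
  is a simple virtual endomorphism.\<close>

section \<open>Lattices over a complete discrete valuation ring\<close>

text \<open>Simplicity excludes invariant ideals only, whereas the dynamics of \<open>\<phi>\<close>
  produces invariant submodules. Passing to \<open>\<pi> L\<close> bridges the gap: a bracket of two
  elements of \<open>\<pi> L\<close> is \<open>\<pi>\<close> times an element of
  \<open>\<pi> L\<close>, so it lies in the domain of every virtual endomorphism of index
  \<open>p\<close>. Therefore the kernel of \<open>\<phi>\<close> is an ideal, \<open>\<phi>\<close>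
  is injective, and the core cannot contain all multiples of \<open>\<pi>\<close>. The way back to
  \<open>L\<close> divides the linear form by \<open>\<pi>\<close>; this is impossible only if the
  form has a unit value, and then the bracket vanishes. Most vanishing statements have one source: a
  relation pulled back along arbitrarily high powers of \<open>\<phi>\<close> makes a vector or a
  scalar divisible by every power of \<open>\<pi>\<close>. The excluded subalgebras arise by
  rescaling: since all subalgebras are available, generators may be multiplied by powers of
  \<open>\<pi>\<close> until the structure constants are as divisible, or as widely spaced, as an
  argument needs.\<close>

text \<open>The predicate \<open>nul\<close> is the kernel of a homomorphism from the ring of scalars onto a discrete valuation
  ring with uniformizer \<open>\<pi>\<close>, and \<open>eff v\<close> says that scalars act on \<open>v\<close> through this quotient.\<close>

locale dvr_module = Modules.module scale
  for scale :: "'r::comm_ring_1 \<Rightarrow> 'v::ab_group_add \<Rightarrow> 'v"  (infixr \<open>*s\<close> 75) +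
  fixes nul :: "'r \<Rightarrow> bool" and \<pi> :: 'r
  assumes nul_0: "nul 0"
    and nul_add: "nul r \<Longrightarrow> nul s \<Longrightarrow> nul (r + s)"
    and nul_mult: "nul r \<Longrightarrow> nul (s * r)"
    and unif_power_not_nul: "\<not> nul (\<pi> ^ k)"
    and unif_not_unit: "\<not> nul (\<pi> * s - 1)"
    and factor: "\<not> nul r \<Longrightarrow> \<exists>k u w. nul (r - \<pi> ^ k * u) \<and> nul (u * w - 1)"
    and scalars_complete: "\<exists>s. \<forall>k. \<exists>t. nul (s - (\<Sum>i<k. \<pi> ^ i * f i) - \<pi> ^ k * t)"
    and scalars_finite_quotient: "\<exists>F. finite F \<and> (\<forall>r. \<exists>f\<in>F. \<exists>t. nul (r - f - \<pi> ^ k * t))"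
begin

definition eff :: "'v \<Rightarrow> bool" where
  "eff v \<longleftrightarrow> (\<forall>r. nul r \<longrightarrow> r *s v = 0)"

text \<open>Scalars act on effective vectors through the quotient by \<open>nul\<close>, so
  coefficients can be unique only modulo \<open>nul\<close>. The family is indexed by an initial
  segment of the naturals to allow induction on its last member.\<close>

definition basis :: "nat \<Rightarrow> (nat \<Rightarrow> 'v) \<Rightarrow> 'v set \<Rightarrow> bool" where
  "basis n b N \<longleftrightarrow> (\<forall>i<n. eff (b i)) \<and> N = range (\<lambda>c. \<Sum>i<n. c i *s b i) \<and>
     (\<forall>c. (\<Sum>i<n. c i *s b i) = 0 \<longrightarrow> (\<forall>i<n. nul (c i)))"

text \<open>Purity: modulo \<open>N\<close> there is no \<open>\<pi>\<close>-torsion. A proper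
  isolated submodule has smaller rank by \<open>submodule_basis\<close>, which drives the main
  induction.\<close>

definition isolated :: "'v set \<Rightarrow> 'v set \<Rightarrow> bool" where
  "isolated L N \<longleftrightarrow> (\<forall>x\<in>L. \<pi> *s x \<in> N \<longrightarrow> x \<in> N)"

text \<open>Virtual endomorphisms are partial, so linearity is demanded on the domain
  \<open>M\<close> of a total function.\<close>

definition lin_on :: "'v set \<Rightarrow> ('v \<Rightarrow> 'v) \<Rightarrow> bool" where
  "lin_on M f \<longleftrightarrow> (\<forall>x\<in>M. \<forall>y\<in>M. f (x + y) = f x + f y) \<and> (\<forall>r. \<forall>x\<in>M. f (r *s x) = r *s f x)"

section \<open>Arithmetic modulo the kernel \<open>nul\<close>\<close>

lemma nul_minus: "nul r \<Longrightarrow> nul (- r)"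
  using nul_mult[of r "-1"] by simp

lemma nul_diff: "nul r \<Longrightarrow> nul s \<Longrightarrow> nul (r - s)"
  using nul_add[of r "- s"] nul_minus by simp

lemma nul_mult_right: "nul r \<Longrightarrow> nul (r * s)"
  using nul_mult[of r s] by (simp add: mult.commute)

lemma nul_commute: "nul (r - s) \<longleftrightarrow> nul (s - r)"
  using nul_minus[of "r - s"] nul_minus[of "s - r"] by auto

lemma nul_trans: "nul (r - s) \<Longrightarrow> nul (s - t) \<Longrightarrow> nul (r - t)"
  using nul_add[of "r - s" "s - t"] by simp

lemma nul_cong: "nul (r - s) \<Longrightarrow> nul r \<longleftrightarrow> nul s"
  using nul_diff[of r "r - s"] nul_add[of "r - s" s] by auto

lemma nul_sum: "(\<And>i. i \<in> A \<Longrightarrow> nul (f i)) \<Longrightarrow> nul (sum f A)"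
  by (induction A rule: infinite_finite_induct) (auto simp: nul_0 nul_add)

text \<open>Multiplying by the inverses of the unit parts turns \<open>r * s\<close> into a power of
  \<open>\<pi>\<close> modulo \<open>nul\<close>, and no such power is null.\<close>

lemma nul_prime:
  assumes "nul (r * s)" shows "nul r \<or> nul s"
proof (rule ccontr)
  assume "\<not> ?thesis"
  then obtain k u w k' u' w' where
    1: "nul (r - \<pi> ^ k * u)" "nul (u * w - 1)" "nul (s - \<pi> ^ k' * u')" "nul (u' * w' - 1)"
    using factor by metis
  have "nul (r * s * w * w' - \<pi> ^ (k + k'))"
  proof -
    have "r * s * w * w' - \<pi> ^ (k + k') =
      (s * w * w') * (r - \<pi> ^ k * u) + (\<pi> ^ k * u * w * w') * (s - \<pi> ^ k' * u') +
      (\<pi> ^ k * \<pi> ^ k' * (u * w)) * (u' * w' - 1) + (\<pi> ^ k * \<pi> ^ k') * (u * w - 1)"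
      by (simp add: algebra_simps power_add)
    then show ?thesis using 1 nul_add nul_mult by auto
  qed
  moreover have "nul (r * s * w * w')"
    using assms nul_mult_right by metis
  ultimately show False
    using unif_power_not_nul nul_cong by blast
qed

lemma unif_not_nul: "\<not> nul \<pi>" "\<not> nul 1"
  using unif_power_not_nul[of 1] unif_power_not_nul[of 0] by auto

lemma unit_or_div: "(\<exists>w. nul (r * w - 1)) \<or> (\<exists>s. nul (r - \<pi> * s))"
proof (cases "nul r")
  case True then show ?thesis by (intro disjI2 exI[of _ 0]) simp
next
  case False
  then obtain k u w where *: "nul (r - \<pi> ^ k * u)" "nul (u * w - 1)" using factor by blast
  show ?thesis
  proof (cases k)
    case 0
    have "r * w - 1 = w * (r - u) + (u * w - 1)" by (simp add: algebra_simps)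
    then show ?thesis using 0 * nul_add nul_mult by (metis mult_1 power_0)
  next
    case (Suc j) then show ?thesis using * by (auto simp: mult.assoc)
  qed
qed

lemma not_nul_power: assumes "\<not> nul r" shows "\<exists>k w. nul (w * r - \<pi> ^ k)"
proof -
  obtain k u w where *: "nul (r - \<pi> ^ k * u)" "nul (u * w - 1)" using factor assms by blast
  have "w * r - \<pi> ^ k = w * (r - \<pi> ^ k * u) + \<pi> ^ k * (u * w - 1)" by (simp add: algebra_simps)
  then show ?thesis using * nul_add nul_mult by metis
qed

text \<open>Otherwise \<open>w * r\<close> is some power \<open>\<pi> ^ k\<close> modulo
  \<open>nul\<close>, and divisibility of \<open>r\<close> by one further power would make
  \<open>\<pi>\<close> a unit.\<close>

lemma nul_separated:
  assumes "\<And>k. \<exists>t. nul (r - \<pi> ^ k * t)" shows "nul r"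
proof (rule ccontr)
  assume "\<not> nul r"
  then obtain k w where 1: "nul (w * r - \<pi> ^ k)" using not_nul_power by blast
  obtain t where 2: "nul (r - \<pi> ^ Suc k * t)" using assms by blast
  have "\<pi> ^ k * (\<pi> * (t * w) - 1) = (w * r - \<pi> ^ k) - w * (r - \<pi> ^ Suc k * t)"
    by (simp add: algebra_simps)
  then have "nul (\<pi> ^ k * (\<pi> * (t * w) - 1))"
    using 1 2 nul_diff nul_mult by metis
  then show False using nul_prime unif_power_not_nul unif_not_unit by blast
qed

lemma eff_nul: "eff v \<Longrightarrow> nul r \<Longrightarrow> r *s v = 0"
  by (simp add: eff_def)

lemma eff_cong: "eff v \<Longrightarrow> nul (r - s) \<Longrightarrow> r *s v = s *s v"
  using eff_nul[of v "r - s"] by (simp add: scale_left_diff_distrib)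

lemma eff_0: "eff 0" and eff_add: "eff v \<Longrightarrow> eff w \<Longrightarrow> eff (v + w)"
  and eff_scale: "eff v \<Longrightarrow> eff (r *s v)"
  by (auto simp: eff_def scale_right_distrib nul_mult_right)

section \<open>Bases of free modules\<close>

lemma basisD:
  assumes "basis n b N"
  shows "\<And>i. i < n \<Longrightarrow> eff (b i)" "\<And>x. x \<in> N \<Longrightarrow> \<exists>c. x = (\<Sum>i<n. c i *s b i)"
    "\<And>c. (\<Sum>i<n. c i *s b i) \<in> N" "\<And>c i. (\<Sum>i<n. c i *s b i) = 0 \<Longrightarrow> i < n \<Longrightarrow> nul (c i)"
  using assms by (auto simp: basis_def)

lemma basis_unique:
  assumes "basis n b N" "(\<Sum>i<n. c i *s b i) = (\<Sum>i<n. d i *s b i)" "i < n"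
  shows "nul (c i - d i)"
  using basisD(4)[OF assms(1), of "\<lambda>i. c i - d i" i] assms(2,3)
  by (simp add: scale_left_diff_distrib sum_subtractf)

lemma basis_sum_cong:
  assumes "basis n b N" "\<And>i. i < n \<Longrightarrow> nul (c i - d i)"
  shows "(\<Sum>i<n. c i *s b i) = (\<Sum>i<n. d i *s b i)"
  using assms basisD(1)[OF assms(1)] by (intro sum.cong refl eff_cong) auto

lemma basis_subspace: assumes "basis n b N" shows "subspace N"
proof (rule subspaceI)
  show "0 \<in> N" using basisD(3)[OF assms, of "\<lambda>i. 0"] by simp
next
  fix x y assume "x \<in> N" "y \<in> N"
  then obtain c d where "x = (\<Sum>i<n. c i *s b i)" "y = (\<Sum>i<n. d i *s b i)"
    using basisD(2)[OF assms] by metis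
  then have "x + y = (\<Sum>i<n. (c i + d i) *s b i)" by (simp add: scale_left_distrib sum.distrib)
  then show "x + y \<in> N" using basisD(3)[OF assms] by simp
next
  fix r x assume "x \<in> N"
  then obtain c where "x = (\<Sum>i<n. c i *s b i)" using basisD(2)[OF assms] by metis
  then have "r *s x = (\<Sum>i<n. (r * c i) *s b i)" by (simp add: scale_sum_right)
  then show "r *s x \<in> N" using basisD(3)[OF assms] by simp
qed

lemma basis_mem: assumes "basis n b N" "i < n" shows "b i \<in> N"
proof -
  have "(\<Sum>j<n. (if j = i then 1 else 0) *s b j) = (\<Sum>j<n. if j = i then b j else 0)"
    by (intro sum.cong) auto
  also have "\<dots> = b i" using assms(2) by simp
  finally show ?thesis using basisD(3)[OF assms(1)] by metis
qed

lemma sum_eff: "(\<And>i. i < (n::nat) \<Longrightarrow> eff (b i)) \<Longrightarrow> eff (\<Sum>i<n. c i *s b i)"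
  by (induction n) (auto intro: eff_0 eff_add eff_scale)

lemma basis_eff: "basis n b N \<Longrightarrow> x \<in> N \<Longrightarrow> eff x"
  using basisD(1,2) sum_eff by metis

lemma basis_torsion_free:
  assumes "basis n b N" "x \<in> N" "r *s x = 0" shows "nul r \<or> x = 0"
proof -
  obtain c where c: "x = (\<Sum>i<n. c i *s b i)" using basisD(2)[OF assms(1,2)] by metis
  have "(\<Sum>i<n. (r * c i) *s b i) = 0" using assms(3) c by (simp add: scale_sum_right)
  then have "nul (r * c i)" if "i < n" for i using basisD(4)[OF assms(1), of "\<lambda>i. r * c i"] that by simp
  then have "nul r \<or> (\<forall>i<n. nul (c i))" using nul_prime by blast
  then show ?thesis using basis_sum_cong[OF assms(1), of c "\<lambda>_. 0"] c by auto
qed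

lemma basis_separated:
  assumes "basis n b N" "x \<in> N" "\<And>k. \<exists>y\<in>N. x = \<pi> ^ k *s y" shows "x = 0"
proof -
  obtain c where c: "x = (\<Sum>i<n. c i *s b i)" using basisD(2)[OF assms(1,2)] by metis
  have "nul (c i)" if i: "i < n" for i
  proof (rule nul_separated)
    fix k
    obtain y where y: "y \<in> N" "x = \<pi> ^ k *s y" using assms(3) by blast
    obtain d where d: "y = (\<Sum>i<n. d i *s b i)" using basisD(2)[OF assms(1) y(1)] by metis
    have "(\<Sum>i<n. c i *s b i) = (\<Sum>i<n. (\<pi> ^ k * d i) *s b i)"
      using c d y by (simp add: scale_sum_right)
    then show "\<exists>t. nul (c i - \<pi> ^ k * t)" using basis_unique[OF assms(1), of c "\<lambda>i. \<pi> ^ k * d i"] i by blast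
  qed
  then show ?thesis using basis_sum_cong[OF assms(1), of c "\<lambda>_. 0"] c by auto
qed

text \<open>Completeness is phrased by remainders, without a topology: \<open>s\<close> is the sum
  of the series, formed coordinate by coordinate.\<close>

lemma basis_complete:
  assumes "basis n b N" "\<And>k::nat. x k \<in> N"
  shows "\<exists>s\<in>N. \<forall>k. \<exists>t\<in>N. s = (\<Sum>i<k. \<pi> ^ i *s x i) + \<pi> ^ k *s t"
proof -
  have "\<forall>k. \<exists>c. x k = (\<Sum>j<n. c j *s b j)" using basisD(2)[OF assms(1)] assms(2) by simp
  from choice[OF this] obtain c where c: "\<And>k. x k = (\<Sum>j<n. c k j *s b j)" by blast
  have "\<forall>j. \<exists>s. \<forall>k. \<exists>t. nul (s - (\<Sum>i<k. \<pi> ^ i * c i j) - \<pi> ^ k * t)"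
    by (intro allI scalars_complete)
  from choice[OF this] obtain s where
    "\<forall>j k. \<exists>t. nul (s j - (\<Sum>i<k. \<pi> ^ i * c i j) - \<pi> ^ k * t)" by blast
  then have "\<forall>j. \<exists>t. \<forall>k. nul (s j - (\<Sum>i<k. \<pi> ^ i * c i j) - \<pi> ^ k * t k)"
    by (intro allI choice) blast
  from choice[OF this] obtain t where
    t: "\<And>j k. nul (s j - (\<Sum>i<k. \<pi> ^ i * c i j) - \<pi> ^ k * t j k)" by blast
  show ?thesis
  proof (intro bexI allI)
    fix k
    have "(\<Sum>j<n. s j *s b j) = (\<Sum>j<n. ((\<Sum>i<k. \<pi> ^ i * c i j) + \<pi> ^ k * t j k) *s b j)"
      by (rule basis_sum_cong[OF assms(1)]) (use t in \<open>simp add: diff_diff_eq\<close>)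
    also have "\<dots> = (\<Sum>j<n. \<Sum>i<k. (\<pi> ^ i * c i j) *s b j) + \<pi> ^ k *s (\<Sum>j<n. t j k *s b j)"
      by (simp add: scale_left_distrib sum.distrib scale_sum_left scale_sum_right)
    also have "(\<Sum>j<n. \<Sum>i<k. (\<pi> ^ i * c i j) *s b j) = (\<Sum>i<k. \<pi> ^ i *s x i)"
      by (subst sum.swap) (simp add: c scale_sum_right)
    finally show "(\<Sum>j<n. s j *s b j) = (\<Sum>i<k. \<pi> ^ i *s x i) + \<pi> ^ k *s (\<Sum>j<n. t j k *s b j)" .
  qed (use basisD(3)[OF assms(1)] in auto)
qed

lemma basis_finite_quotient:
  assumes "basis n b N"
  shows "\<exists>F. finite F \<and> F \<subseteq> N \<and> (\<forall>x\<in>N. \<exists>f\<in>F. \<exists>t\<in>N. x = f + \<pi> ^ k *s t)"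
proof -
  obtain S where S: "finite S" "\<And>r. \<exists>f\<in>S. \<exists>t. nul (r - f - \<pi> ^ k * t)"
    using scalars_finite_quotient by metis
  define F where "F = (\<lambda>c. \<Sum>i<n. c i *s b i) ` (PiE {..<n} (\<lambda>_. S))"
  have "finite F" unfolding F_def using S(1) by (intro finite_imageI finite_PiE) auto
  moreover have "F \<subseteq> N" unfolding F_def using basisD(3)[OF assms] by auto
  moreover have "\<exists>f\<in>F. \<exists>t\<in>N. x = f + \<pi> ^ k *s t" if x: "x \<in> N" for x
  proof -
    obtain c where c: "x = (\<Sum>i<n. c i *s b i)" using basisD(2)[OF assms x] by metis
    have "\<forall>i. \<exists>f. f \<in> S \<and> (\<exists>t. nul (c i - f - \<pi> ^ k * t))" using S(2) by blast
    from choice[OF this] obtain f where f: "\<And>i. f i \<in> S" "\<forall>i. \<exists>t. nul (c i - f i - \<pi> ^ k * t)"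
      by blast
    from choice[OF f(2)] obtain t where ft: "\<And>i. f i \<in> S" "\<And>i. nul (c i - f i - \<pi> ^ k * t i)"
      using f(1) by blast
    have "x = (\<Sum>i<n. (f i + \<pi> ^ k * t i) *s b i)" unfolding c
      by (rule basis_sum_cong[OF assms]) (use ft in \<open>simp add: diff_diff_eq\<close>)
    also have "\<dots> = (\<Sum>i<n. f i *s b i) + \<pi> ^ k *s (\<Sum>i<n. t i *s b i)"
      by (simp add: scale_left_distrib sum.distrib scale_sum_right)
    finally have "x = (\<Sum>i<n. f i *s b i) + \<pi> ^ k *s (\<Sum>i<n. t i *s b i)" .
    then have "\<exists>z\<in>N. x = (\<Sum>i<n. f i *s b i) + \<pi> ^ k *s z"
      by (rule bexI) (rule basisD(3)[OF assms])
    then show ?thesis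
      by (rule bexI)
        (unfold F_def, rule image_eqI[where x = "restrict f {..<n}"], simp, use ft(1) in \<open>simp add: restrict_PiE_iff\<close>)
  qed
  ultimately show ?thesis by blast
qed

text \<open>\<open>gen\<close> says that \<open>N\<close> is the sum of \<open>N'\<close> and the
  line through \<open>x\<close>, and \<open>ind\<close> that the sum is direct.\<close>

lemma basis_extend:
  assumes b: "basis k b N'" and N: "subspace N" "N' \<subseteq> N" "x \<in> N" "eff x"
    and gen: "\<And>y. y \<in> N \<Longrightarrow> \<exists>r. y - r *s x \<in> N'"
    and ind: "\<And>r. r *s x \<in> N' \<Longrightarrow> nul r"
  shows "basis (Suc k) (b(k := x)) N"
proof -
  have s: "(\<Sum>i<Suc k. c i *s (b(k := x)) i) = (\<Sum>i<k. c i *s b i) + c k *s x" for c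
    by (simp add: fun_upd_def)
  have "\<exists>c. y = (\<Sum>i<Suc k. c i *s (b(k := x)) i)" if y: "y \<in> N" for y
  proof -
    obtain r where "y - r *s x \<in> N'" using gen y by blast
    then obtain c where c: "y - r *s x = (\<Sum>i<k. c i *s b i)" using basisD(2)[OF b] by metis
    have "(\<Sum>i<k. (c(k := r)) i *s b i) = (\<Sum>i<k. c i *s b i)" by (intro sum.cong) auto
    then have "y = (\<Sum>i<Suc k. (c(k := r)) i *s (b(k := x)) i)"
      unfolding s using c by (simp add: algebra_simps)
    then show ?thesis by blast
  qed
  moreover have "(\<Sum>i<Suc k. c i *s (b(k := x)) i) \<in> N" for c
    unfolding s using N basisD(3)[OF b] by (auto intro!: subspace_add subspace_scale)
  moreover have "nul (c i)" if "(\<Sum>i<Suc k. c i *s (b(k := x)) i) = 0" "i < Suc k" for c i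
  proof -
    have *: "(\<Sum>i<k. c i *s b i) = (- c k) *s x" using that(1) unfolding s
      by (simp add: eq_neg_iff_add_eq_0)
    have ck: "nul (c k)" using ind[of "- c k"] * basisD(3)[OF b, of c] nul_minus by fastforce
    then have "(\<Sum>i<k. c i *s b i) = 0" using * N(4) eff_nul by simp
    then show ?thesis using ck basisD(4)[OF b] that(2) by (cases "i = k") auto
  qed
  moreover have "\<forall>i<Suc k. eff ((b(k := x)) i)" using basisD(1)[OF b] N(4) by (auto simp: less_Suc_eq)
  ultimately show ?thesis unfolding basis_def by auto
qed

lemma basis_truncate:
  assumes "basis (Suc n) b N"
  shows "basis n b (range (\<lambda>c. \<Sum>i<n. c i *s b i))"
  unfolding basis_def
proof (intro conjI allI impI refl)
  fix c i assume *: "(\<Sum>i<n. c i *s b i) = 0" "i < n"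
  have "(\<Sum>i<Suc n. (c(n := 0)) i *s b i) = (\<Sum>i<n. c i *s b i)" by (auto intro: sum.cong)
  then show "nul (c i)" using basisD(4)[OF assms, of "c(n := 0)" i] * by simp
qed (use basisD(1)[OF assms] in auto)

text \<open>The classical argument over a discrete valuation ring: a vector \<open>x0\<close> of
  \<open>N\<close> whose last coordinate has least valuation splits \<open>N\<close> into the line
  through \<open>x0\<close> and the vectors with vanishing last coordinate. If \<open>N\<close> is
  isolated and the rank does not drop, then \<open>N\<close> contains the truncated lattice, hence
  \<open>\<pi> ^ j *s b n\<close>, hence \<open>b n\<close>, and so it is all of
  \<open>L\<close>.\<close>

lemma submodule_basis:
  assumes "basis n b L" "subspace N" "N \<subseteq> L"
  shows "\<exists>k b'. k \<le> n \<and> basis k b' N \<and> (isolated L N \<and> N \<noteq> L \<longrightarrow> k < n)"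
  using assms
proof (induction n arbitrary: L N)
  case 0
  then have "N = {0}" "L = {0}" using subspace_0 by (auto simp: basis_def)
  then show ?case using 0 by auto
next
  case (Suc n)
  let ?L' = "range (\<lambda>c. \<Sum>i<n. c i *s b i)"
  note b = Suc.prems(1)
  have b': "basis n b ?L'" using basis_truncate[OF b] .
  have sL: "subspace L" "subspace ?L'" using b b' basis_subspace by auto
  have eL: "eff x" if "x \<in> L" for x using basis_eff[OF b that] .
  have split: "\<exists>y\<in>?L'. \<exists>r. x = y + r *s b n" if "x \<in> L" for x
    using basisD(2)[OF b that] by fastforce
  have L'L: "?L' \<subseteq> L"
  proof
    fix x assume "x \<in> ?L'"
    then obtain c where "x = (\<Sum>i<n. c i *s b i)" by blast
    also have "\<dots> = (\<Sum>i<Suc n. (c(n := 0)) i *s b i)" by (auto intro: sum.cong)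
    finally show "x \<in> L" using basisD(3)[OF b] by blast
  qed
  have indep: "nul r" if "y + r *s b n \<in> ?L'" "y \<in> ?L'" for y r
  proof -
    have "(y + r *s b n) - y \<in> ?L'" using that sL(2) subspace_diff by blast
    then obtain c where c: "r *s b n = (\<Sum>i<n. c i *s b i)" by auto
    have "(\<Sum>i<Suc n. (c(n := - r)) i *s b i) = (\<Sum>i<n. c i *s b i) - r *s b n"
      by (auto intro: sum.cong)
    then show ?thesis using basisD(4)[OF b, of "c(n := - r)" n] c nul_minus by fastforce
  qed
  have N': "subspace (N \<inter> ?L')" "N \<inter> ?L' \<subseteq> ?L'" using Suc.prems sL by (auto intro: subspace_inter)
  obtain k b1 where k: "k \<le> n" "basis k b1 (N \<inter> ?L')"
    "isolated ?L' (N \<inter> ?L') \<and> N \<inter> ?L' \<noteq> ?L' \<Longrightarrow> k < n"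
    using Suc.IH[OF b' N'] by blast
  show ?case
  proof (cases "N \<subseteq> ?L'")
    case True
    then show ?thesis using k(1,2) by (intro exI[of _ k] exI[of _ b1]) (auto simp: Int_absorb2)
  next
    case False
    \<comment> \<open>The valuations of last coordinates that occur in \<open>N\<close>;
      multiplication by a unit makes the coordinate equal to \<open>\<pi> ^ j\<close>.\<close>
    define Q where "Q j \<longleftrightarrow> (\<exists>x\<in>N. \<exists>y\<in>?L'. x = y + \<pi> ^ j *s b n)" for j
    have Qex: "\<exists>j. (\<exists>u. nul (r - \<pi> ^ j * u)) \<and> Q j" if x: "x \<in> N" "x = y + r *s b n" "y \<in> ?L'" "\<not> nul r" for x y r
    proof -
      obtain j u w where j: "nul (r - \<pi> ^ j * u)" "nul (u * w - 1)" using factor x(4) by blast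
      have "w * r - \<pi> ^ j = w * (r - \<pi> ^ j * u) + \<pi> ^ j * (u * w - 1)" by (simp add: algebra_simps)
      then have "nul (w * r - \<pi> ^ j)" using j nul_add nul_mult by metis
      then have "w *s x = w *s y + \<pi> ^ j *s b n"
        using x(2) eff_cong[OF basisD(1)[OF b, of n]] by (simp add: scale_right_distrib)
      moreover have "w *s x \<in> N" "w *s y \<in> ?L'" using x Suc.prems(2) sL(2) subspace_scale by blast+
      ultimately show ?thesis using j(1) unfolding Q_def by blast
    qed
    obtain x where x0: "x \<in> N" "x \<notin> ?L'" using False by blast
    then obtain y r where x: "x \<in> N" "x \<notin> ?L'" "y \<in> ?L'" "x = y + r *s b n"
      using split[of x] Suc.prems(3) by blast
    have "\<not> nul r"
    proof
      assume "nul r"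
      then have "x = y" using x(4) eff_nul[OF basisD(1)[OF b, of n]] by simp
      then show False using x by blast
    qed
    then have "\<exists>j. Q j" using Qex[OF x(1,4,3)] by auto
    define j where "j = (LEAST j. Q j)"
    have "Q j" unfolding j_def using \<open>\<exists>j. Q j\<close> LeastI_ex by metis
    then obtain x0 y0 where x0: "x0 \<in> N" "y0 \<in> ?L'" "x0 = y0 + \<pi> ^ j *s b n"
      unfolding Q_def by blast
    have least: "j \<le> j'" if "Q j'" for j' unfolding j_def using that by (rule Least_le)
    have gen: "\<exists>r. y - r *s x0 \<in> N \<inter> ?L'" if y: "y \<in> N" for y
    proof -
      obtain z r where z: "z \<in> ?L'" "y = z + r *s b n" using split Suc.prems(3) y by blast
      have "\<exists>t. nul (r - \<pi> ^ j * t)"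
      proof (cases "nul r")
        case True then show ?thesis by (intro exI[of _ 0]) simp
      next
        case False
        then obtain j' u where u: "nul (r - \<pi> ^ j' * u)" "Q j'" using Qex[OF y z(2,1)] by blast
        then have "\<pi> ^ j' * u = \<pi> ^ j * (\<pi> ^ (j' - j) * u)"
          using least by (simp flip: power_add mult.assoc)
        then show ?thesis using u(1) by metis
      qed
      then obtain t where t: "nul (r - \<pi> ^ j * t)" by blast
      have "r *s b n = (\<pi> ^ j * t) *s b n" using eff_cong[OF basisD(1)[OF b, of n]] t by simp
      then have e1: "y - t *s x0 = z - t *s y0"
        using x0(3) z(2) by (simp add: scale_right_distrib mult.commute)
      have e2: "z - t *s y0 \<in> ?L'"
        using subspace_diff[OF sL(2) z(1) subspace_scale[OF sL(2) x0(2)]] .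
      have "y - t *s x0 \<in> N"
        using subspace_diff[OF Suc.prems(2) y subspace_scale[OF Suc.prems(2) x0(1)]] .
      moreover have "y - t *s x0 \<in> ?L'" unfolding e1 by (rule e2)
      ultimately show ?thesis by (intro exI[of _ t] IntI)
    qed
    have ind: "nul r" if "r *s x0 \<in> N \<inter> ?L'" for r
    proof -
      have "r *s y0 + (r * \<pi> ^ j) *s b n \<in> ?L'" using that x0(3) by (simp add: scale_right_distrib)
      then have "nul (r * \<pi> ^ j)" using indep[OF _ subspace_scale[OF sL(2) x0(2)]] by blast
      then show ?thesis using nul_prime unif_power_not_nul by blast
    qed
    have bas: "basis (Suc k) (b1(k := x0)) N"
      using basis_extend[OF k(2) Suc.prems(2) _ x0(1) _ gen ind] eL x0(1) Suc.prems(3) by blast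
    have "Suc k < Suc n" if iso: "isolated L N" "N \<noteq> L"
    proof (rule ccontr)
      assume "\<not> Suc k < Suc n"
      moreover have "isolated ?L' (N \<inter> ?L')" using iso(1) L'L unfolding isolated_def by auto
      ultimately have "?L' \<subseteq> N" using k(3) by blast
      then have "x0 - y0 \<in> N" using x0 Suc.prems(2) subspace_diff by blast
      then have "\<pi> ^ j *s b n \<in> N" using x0(3) by simp
      then have "b n \<in> N"
      proof (induction j)
        case (Suc j)
        have "\<pi> ^ j *s b n \<in> L" using basis_mem[OF b] sL(1) subspace_scale by blast
        then show ?case using Suc iso(1) unfolding isolated_def by simp
      qed simp
      have "x \<in> N" if x: "x \<in> L" for x
      proof -
        obtain y r where "y \<in> ?L'" "x = y + r *s b n" using split[of x] x by blast
        then show ?thesis using \<open>b n \<in> N\<close> \<open>?L' \<subseteq> N\<close> Suc.prems(2) subspace_add subspace_scale by blast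
      qed
      then have "L \<subseteq> N" by blast
      then show False using iso(2) Suc.prems(3) by blast
    qed
    then show ?thesis using bas k(1) by blast
  qed
qed

section \<open>Lattices and \<open>\<pi>\<close>-adic congruences\<close>

definition lattice :: "'v set \<Rightarrow> bool" where
  "lattice N \<longleftrightarrow> (\<exists>n b. basis n b N)"

lemma lattice_subspace: "lattice N \<Longrightarrow> subspace N"
  and lattice_eff: "lattice N \<Longrightarrow> x \<in> N \<Longrightarrow> eff x"
  and lattice_torsion_free: "lattice N \<Longrightarrow> x \<in> N \<Longrightarrow> r *s x = 0 \<Longrightarrow> nul r \<or> x = 0"
  and lattice_separated: "lattice N \<Longrightarrow> x \<in> N \<Longrightarrow> (\<And>k. \<exists>y\<in>N. x = \<pi> ^ k *s y) \<Longrightarrow> x = 0"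
  unfolding lattice_def
  using basis_subspace basis_eff basis_torsion_free basis_separated by blast+

lemma lattice_submodule: "lattice L \<Longrightarrow> subspace N \<Longrightarrow> N \<subseteq> L \<Longrightarrow> lattice N"
  unfolding lattice_def using submodule_basis by blast

lemma lattice_power_cancel:
  assumes "lattice N" "x \<in> N" "\<pi> ^ k *s x = 0" shows "x = 0"
  using lattice_torsion_free[OF assms] unif_power_not_nul by blast

lemma lattice_power_cancel_eq:
  assumes "lattice N" "x \<in> N" "y \<in> N" "\<pi> ^ k *s x = \<pi> ^ k *s y" shows "x = y"
  using lattice_power_cancel[OF assms(1), of "x - y" k] assms subspace_diff[OF lattice_subspace]
  by (simp add: scale_right_diff_distrib)

lemma lattice_unif_cancel_eq:
  assumes "lattice N" "x \<in> N" "y \<in> N" "\<pi> *s x = \<pi> *s y" shows "x = y"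
  using lattice_power_cancel_eq[OF assms(1-3), of 1] assms(4) by simp

lemma lattice_scale_cancel:
  assumes "lattice N" "x \<in> N" "x \<noteq> 0" "r *s x = s *s x" shows "nul (r - s)"
  using lattice_torsion_free[OF assms(1,2), of "r - s"] assms(3,4)
  by (simp add: scale_left_diff_distrib)

definition cong_mod :: "'v set \<Rightarrow> nat \<Rightarrow> 'v \<Rightarrow> 'v \<Rightarrow> bool" where
  "cong_mod C k x y \<longleftrightarrow> (\<exists>t\<in>C. x = y + \<pi> ^ k *s t)"

lemma cong_mod_refl: "subspace C \<Longrightarrow> cong_mod C k x x"
  unfolding cong_mod_def using subspace_0 by force

lemma cong_mod_sym:
  assumes "subspace C" "cong_mod C k x y" shows "cong_mod C k y x"
proof -
  obtain t where t: "t \<in> C" "x = y + \<pi> ^ k *s t" using assms(2) unfolding cong_mod_def by blast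
  then have "y = x + \<pi> ^ k *s (- t)" by simp
  then show ?thesis unfolding cong_mod_def using subspace_neg[OF assms(1) t(1)] by blast
qed

lemma cong_mod_add:
  assumes "subspace C" "cong_mod C k x y" "cong_mod C k x' y'" shows "cong_mod C k (x + x') (y + y')"
proof -
  obtain t t' where t: "t \<in> C" "x = y + \<pi> ^ k *s t" "t' \<in> C" "x' = y' + \<pi> ^ k *s t'"
    using assms(2,3) unfolding cong_mod_def by blast
  then have "x + x' = (y + y') + \<pi> ^ k *s (t + t')" by (simp add: algebra_simps)
  then show ?thesis unfolding cong_mod_def using subspace_add[OF assms(1) t(1,3)] by blast
qed

lemma cong_mod_scale:
  assumes "subspace C" "cong_mod C k x y" shows "cong_mod C k (r *s x) (r *s y)"
proof -
  obtain t where t: "t \<in> C" "x = y + \<pi> ^ k *s t" using assms(2) unfolding cong_mod_def by blast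
  then have "r *s x = r *s y + \<pi> ^ k *s (r *s t)" by (simp add: algebra_simps)
  then show ?thesis unfolding cong_mod_def using subspace_scale[OF assms(1) t(1)] by blast
qed

lemma cong_mod_trans:
  assumes "subspace C" "cong_mod C k x y" "cong_mod C k y z" shows "cong_mod C k x z"
proof -
  obtain t t' where t: "t \<in> C" "x = y + \<pi> ^ k *s t" "t' \<in> C" "y = z + \<pi> ^ k *s t'"
    using assms(2,3) unfolding cong_mod_def by blast
  then have "x = z + \<pi> ^ k *s (t + t')" by (simp add: algebra_simps)
  then show ?thesis unfolding cong_mod_def using subspace_add[OF assms(1) t(1,3)] by blast
qed

lemma cong_mod_all:
  assumes "lattice C" "x \<in> C" "y \<in> C" "\<And>k. cong_mod C k x y" shows "x = y"
proof -
  have "\<exists>t\<in>C. x - y = \<pi> ^ k *s t" for k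
    using assms(4)[of k] unfolding cong_mod_def by (metis add_diff_cancel_left')
  then have "x - y = 0"
    using lattice_separated[OF assms(1)] subspace_diff[OF lattice_subspace[OF assms(1)]] assms by metis
  then show ?thesis by simp
qed

text \<open>Telescoping turns the sequence into a series with terms \<open>\<pi> ^ i *s t i\<close>,
  to which \<open>basis_complete\<close> applies.\<close>

lemma cong_mod_limit:
  assumes "lattice C" "\<And>k::nat. X k \<in> C" "\<And>k. cong_mod C k (X (Suc k)) (X k)"
  shows "\<exists>s\<in>C. \<forall>k. cong_mod C k s (X k)"
proof -
  obtain n b where b: "basis n b C" using assms(1) unfolding lattice_def by blast
  have "\<forall>k. \<exists>t. t \<in> C \<and> X (Suc k) = X k + \<pi> ^ k *s t" using assms(3) unfolding cong_mod_def by blast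
  from choice[OF this] obtain t where t: "\<And>k. t k \<in> C" "\<And>k. X (Suc k) = X k + \<pi> ^ k *s t k" by blast
  have X: "X k = X 0 + (\<Sum>i<k. \<pi> ^ i *s t i)" for k
    by (induction k) (simp_all add: t(2) add.assoc)
  obtain s where s: "s \<in> C" "\<And>k. \<exists>u\<in>C. s = (\<Sum>i<k. \<pi> ^ i *s t i) + \<pi> ^ k *s u"
    using basis_complete[of n b C t, OF b t(1)] by blast
  have "cong_mod C k (X 0 + s) (X k)" for k
    using s(2)[of k] unfolding cong_mod_def X[of k] by (auto simp: add.assoc)
  then show ?thesis using subspace_add[OF lattice_subspace[OF assms(1)] assms(2)[of 0] s(1)] by blast
qed

section \<open>Linear maps and the Fitting decomposition\<close>

lemma lin_onD:
  assumes "lin_on M f"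
  shows "x \<in> M \<Longrightarrow> y \<in> M \<Longrightarrow> f (x + y) = f x + f y" "x \<in> M \<Longrightarrow> f (r *s x) = r *s f x"
  using assms unfolding lin_on_def by auto

lemma lin_on_0: "lin_on M f \<Longrightarrow> subspace M \<Longrightarrow> f 0 = 0"
  using lin_onD(2)[of M f 0 0] subspace_0 by simp

lemma lin_on_diff:
  assumes "lin_on M f" "subspace M" "x \<in> M" "y \<in> M" shows "f (x - y) = f x - f y"
proof -
  have "f (x + (-1) *s y) = f x + f ((-1) *s y)"
    using lin_onD(1)[OF assms(1,3)] assms subspace_scale by blast
  also have "f ((-1) *s y) = (-1) *s f y" using lin_onD(2) assms by blast
  finally show ?thesis by simp
qed

lemma lin_on_subset: "lin_on M f \<Longrightarrow> N \<subseteq> M \<Longrightarrow> lin_on N f"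
  unfolding lin_on_def by blast

lemma lin_on_sum:
  assumes "lin_on M f" "subspace M" "\<And>i. i < (n::nat) \<Longrightarrow> g i \<in> M"
  shows "f (\<Sum>i<n. g i) = (\<Sum>i<n. f (g i))"
  using assms(3)
proof (induction n)
  case 0 show ?case using lin_on_0[OF assms(1,2)] by simp
next
  case (Suc n)
  have "(\<Sum>i<n. g i) \<in> M" using assms(2) Suc.prems by (intro subspace_sum) auto
  then show ?case using Suc lin_onD(1)[OF assms(1)] by simp
qed

lemma funpow_closed: "f ` C \<subseteq> C \<Longrightarrow> x \<in> C \<Longrightarrow> (f ^^ n) x \<in> C"
  by (induction n) auto

lemma lin_on_funpow:
  assumes "lin_on C f" "f ` C \<subseteq> C" shows "lin_on C (f ^^ n)"
  using assms funpow_closed[of f C] by (induction n) (auto simp: lin_on_def)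

lemma cong_mod_lin:
  assumes "subspace C" "lin_on C f" "f ` C \<subseteq> C" "y \<in> C" "cong_mod C k x y"
  shows "cong_mod C k (f x) (f y)"
proof -
  obtain t where t: "t \<in> C" "x = y + \<pi> ^ k *s t" using assms(5) unfolding cong_mod_def by blast
  then have "f x = f y + \<pi> ^ k *s f t"
    using lin_onD[OF assms(2)] assms(4) subspace_scale[OF assms(1)] by simp
  then show ?thesis unfolding cong_mod_def using assms(3) t(1) by blast
qed

text \<open>\<open>f\<close> induces an endomorphism of the finite module of residues modulo
  \<open>\<pi> ^ k\<close>, so two of its powers agree there. The coincidence propagates to all
  larger exponents by applying further powers of \<open>f\<close>.\<close>

lemma funpow_eventually_periodic:
  assumes C: "lattice C" and f: "lin_on C f" "f ` C \<subseteq> C"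
  shows "\<exists>i q. q \<ge> 1 \<and> (\<forall>a\<ge>i. \<forall>m. \<forall>x\<in>C. cong_mod C k ((f ^^ (a + m * q)) x) ((f ^^ a) x))"
proof -
  obtain n b where b: "basis n b C" using C unfolding lattice_def by blast
  note sub = lattice_subspace[OF C]
  obtain F where F: "finite F" "\<forall>x\<in>C. \<exists>y\<in>F. \<exists>t\<in>C. x = y + \<pi> ^ k *s t"
    using basis_finite_quotient[OF b] by metis
  then have "\<forall>x\<in>C. \<exists>y. y \<in> F \<and> cong_mod C k x y" unfolding cong_mod_def by blast
  from bchoice[OF this] obtain \<rho> where \<rho>: "\<And>x. x \<in> C \<Longrightarrow> \<rho> x \<in> F \<and> cong_mod C k x (\<rho> x)" by blast
  \<comment> \<open>\<open>h i\<close> records the residues of the images of the basis under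
    \<open>f ^^ i\<close>. Its values range over a finite set, and they determine
    \<open>f ^^ i\<close> modulo \<open>\<pi> ^ k\<close>.\<close>
  define h where "h i = restrict (\<lambda>l. \<rho> ((f ^^ i) (b l))) {..<n}" for i
  have "range h \<subseteq> PiE {..<n} (\<lambda>_. F)"
    using \<rho> basis_mem[OF b] funpow_closed[OF f(2)] unfolding h_def
    by (intro image_subsetI) (simp add: restrict_PiE_iff)
  then have "finite (range h)" using F(1) finite_PiE[of "{..<n}" "\<lambda>_. F"] finite_subset by blast
  then have "\<not> inj h" using finite_imageD by fastforce
  then obtain i j where ij: "h i = h j" "i < j" unfolding inj_def by (metis linorder_neqE_nat)
  have bb: "cong_mod C k ((f ^^ j) (b l)) ((f ^^ i) (b l))" if l: "l < n" for l
  proof -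
    have "\<rho> ((f ^^ j) (b l)) = \<rho> ((f ^^ i) (b l))"
      using fun_cong[OF ij(1), of l] l unfolding h_def by simp
    then show ?thesis
      using \<rho> basis_mem[OF b l] funpow_closed[OF f(2)] cong_mod_trans[OF sub] cong_mod_sym[OF sub] by metis
  qed
  have base: "cong_mod C k ((f ^^ j) x) ((f ^^ i) x)" if x: "x \<in> C" for x
  proof -
    obtain c where c: "x = (\<Sum>l<n. c l *s b l)" using basisD(2)[OF b x] by blast
    have "(f ^^ j') x = (\<Sum>l<n. c l *s (f ^^ j') (b l))" for j'
      unfolding c using lin_on_sum[OF lin_on_funpow[OF f] sub, of n "\<lambda>l. c l *s b l"]
        lin_onD(2)[OF lin_on_funpow[OF f]] subspace_scale[OF sub] basis_mem[OF b] by simp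
    moreover have "cong_mod C k (\<Sum>l<m. c l *s (f ^^ j) (b l)) (\<Sum>l<m. c l *s (f ^^ i) (b l))" if "m \<le> n" for m
      using that
      by (induction m) (simp_all add: cong_mod_refl[OF sub] cong_mod_add[OF sub] cong_mod_scale[OF sub] bb)
    ultimately show ?thesis by simp
  qed
  define q where "q = j - i"
  have one: "cong_mod C k ((f ^^ (a + q)) x) ((f ^^ a) x)" if a: "a \<ge> i" and x: "x \<in> C" for a x
  proof -
    have e: "a + q = (a - i) + j" "a = (a - i) + i" using a ij(2) unfolding q_def by auto
    have "cong_mod C k ((f ^^ (a - i)) ((f ^^ j) x)) ((f ^^ (a - i)) ((f ^^ i) x))"
      using cong_mod_lin[OF sub lin_on_funpow[OF f] _ _ base[OF x]] funpow_closed[OF f(2)] x by blast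
    then show ?thesis using e by (metis funpow_add comp_apply)
  qed
  have "cong_mod C k ((f ^^ (a + m * q)) x) ((f ^^ a) x)" if a: "a \<ge> i" and x: "x \<in> C" for a m x
  proof (induction m)
    case (Suc m)
    have "a + Suc m * q = (a + m * q) + q" by simp
    then show ?case using one[of "a + m * q" x] a x Suc cong_mod_trans[OF sub] by (metis le_add1 le_trans)
  qed (simp add: cong_mod_refl[OF sub])
  then show ?thesis using ij(2) unfolding q_def by (intro exI[of _ i] exI[of _ "j - i"]) auto
qed

text \<open>The projection is the limit of the powers \<open>f ^^ fact n\<close>: modulo each power of the uniformizer
  the powers of \<open>f\<close> are eventually periodic.\<close>

lemma fitting_projection:
  assumes C: "lattice C" and f: "lin_on C f" "f ` C \<subseteq> C"
  obtains \<epsilon> where "lin_on C \<epsilon>" "\<epsilon> ` C \<subseteq> C"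
    "\<And>x. x \<in> C \<Longrightarrow> \<epsilon> (\<epsilon> x) = \<epsilon> x"
    "\<And>x. x \<in> C \<Longrightarrow> \<epsilon> x = x \<Longrightarrow> \<exists>y\<in>C. \<epsilon> y = y \<and> f y = x"
    "\<And>x. x \<in> C \<Longrightarrow> \<forall>n. \<exists>y\<in>C. (f ^^ n) y = x \<Longrightarrow> \<epsilon> x = x"
    "\<And>k. \<exists>N. \<forall>x\<in>C. cong_mod C k (\<epsilon> x) ((f ^^ N) x)"
    "\<And>x k. x \<in> C \<Longrightarrow> \<epsilon> x = 0 \<Longrightarrow> \<exists>N. \<forall>n\<ge>N. \<exists>t\<in>C. (f ^^ n) x = \<pi> ^ k *s t"
    "\<And>x. x \<in> C \<Longrightarrow> \<forall>k. \<exists>n. \<exists>t\<in>C. (f ^^ n) x = \<pi> ^ k *s t \<Longrightarrow> \<epsilon> x = 0"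
proof -
  note sub = lattice_subspace[OF C]
  note fc = funpow_closed[OF f(2)]
  note tr = cong_mod_trans[OF sub] and sy = cong_mod_sym[OF sub]
  \<comment> \<open>From a threshold on, \<open>fact n\<close> is a multiple of the period of the
    powers of \<open>f\<close> modulo \<open>\<pi> ^ k\<close>, and \<open>fact n - 1\<close> has
    reached the preperiod \<open>i\<close>.\<close>
  have "\<forall>k. \<exists>N. N \<ge> 1 \<and> (\<forall>n\<ge>N. \<exists>q i. q dvd fact n \<and> i \<le> fact n - 1 \<and> q dvd fact N \<and> i \<le> fact N - 1 \<and>
      (\<forall>a\<ge>i. \<forall>m. \<forall>x\<in>C. cong_mod C k ((f ^^ (a + m * q)) x) ((f ^^ a) x)))"
  proof
    fix k
    obtain i q where iq: "q \<ge> 1" "\<forall>a\<ge>i. \<forall>m. \<forall>x\<in>C. cong_mod C k ((f ^^ (a + m * q)) x) ((f ^^ a) x)"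
      using funpow_eventually_periodic[OF C f] by blast
    have "q dvd (fact n :: nat) \<and> i \<le> fact n - 1" if "n \<ge> i + q + 1" for n
      using that iq(1) fact_ge_self[of n] by (auto intro: dvd_fact)
    note bound = this
    show "\<exists>N. N \<ge> 1 \<and> (\<forall>n\<ge>N. \<exists>q i. q dvd fact n \<and> i \<le> fact n - 1 \<and> q dvd fact N \<and> i \<le> fact N - 1 \<and>
      (\<forall>a\<ge>i. \<forall>m. \<forall>x\<in>C. cong_mod C k ((f ^^ (a + m * q)) x) ((f ^^ a) x)))"
    proof (rule exI[where x = "i + q + 1"], intro conjI allI impI)
      fix n assume n: "i + q + 1 \<le> n"
      show "\<exists>q' i'. q' dvd fact n \<and> i' \<le> fact n - 1 \<and> q' dvd fact (i + q + 1) \<and> i' \<le> fact (i + q + 1) - 1 \<and>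
        (\<forall>a\<ge>i'. \<forall>m. \<forall>x\<in>C. cong_mod C k ((f ^^ (a + m * q')) x) ((f ^^ a) x))"
        using bound[OF n] bound[OF order_refl] iq(2) by blast
    qed simp
  qed
  from choice[OF this] obtain N where N: "\<And>k. N k \<ge> 1"
    "\<And>k n. n \<ge> N k \<Longrightarrow> \<exists>q i. q dvd fact n \<and> i \<le> fact n - 1 \<and> q dvd fact (N k) \<and> i \<le> fact (N k) - 1 \<and>
      (\<forall>a\<ge>i. \<forall>m. \<forall>x\<in>C. cong_mod C k ((f ^^ (a + m * q)) x) ((f ^^ a) x))" by blast
  \<comment> \<open>The exponents are \<open>fact n - 1\<close> instead of \<open>fact n\<close>
    because their limit \<open>g\<close> gives the projection as \<open>f \<circ> g\<close> and
    takes values fixed by it; this yields preimages under \<open>f\<close> of the fixed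
    vectors.\<close>
  have stab: "cong_mod C k ((f ^^ (fact n - 1)) x) ((f ^^ (fact (N k) - 1)) x)"
    if n: "n \<ge> N k" and x: "x \<in> C" for n k x
  proof -
    obtain q i where qi: "q dvd fact n" "q dvd fact (N k)" "i \<le> fact (N k) - 1"
      "\<forall>a\<ge>i. \<forall>m. \<forall>x\<in>C. cong_mod C k ((f ^^ (a + m * q)) x) ((f ^^ a) x)"
      using N(2)[OF n] by blast
    have le: "fact (N k) \<le> (fact n :: nat)" using n by (rule fact_mono)
    then have "q dvd fact n - fact (N k)" using qi dvd_diff_nat by blast
    then obtain m where m: "fact n - fact (N k) = m * q" by (metis dvd_def mult.commute)
    have "fact n - 1 = (fact (N k) - 1) + m * q"
      using m le fact_ge_1[of "N k", where 'a=nat] fact_ge_1[of n, where 'a=nat] by linarith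
    then show ?thesis using qi(3,4) x by metis
  qed
  \<comment> \<open>Beyond the preperiod another \<open>fact n\<close> changes nothing, since it is
    a multiple of the period. This is where idempotence comes from.\<close>
  have double: "cong_mod C k ((f ^^ (fact n - 1 + fact n)) x) ((f ^^ (fact n - 1)) x)"
    if n: "n \<ge> N k" and x: "x \<in> C" for n k x
  proof -
    obtain q i where qi: "q dvd fact n" "i \<le> fact n - 1"
      "\<forall>a\<ge>i. \<forall>m. \<forall>x\<in>C. cong_mod C k ((f ^^ (a + m * q)) x) ((f ^^ a) x)"
      using N(2)[OF n] by blast
    then show ?thesis using x by (metis dvd_def mult.commute)
  qed
  \<comment> \<open>A monotone majorant of \<open>N\<close>, so that both of two consecutive terms
    of the sequence are stable modulo \<open>\<pi> ^ k\<close>.\<close>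
  define M where "M k = (\<Sum>j\<le>k. N j)" for k
  have MN: "N k \<le> M k" "M k \<le> M (Suc k)" for k
    unfolding M_def by (auto intro: member_le_sum)
  have "\<exists>s\<in>C. \<forall>k. cong_mod C k s ((f ^^ (fact (M k) - 1)) x)" if x: "x \<in> C" for x
  proof (rule cong_mod_limit[OF C])
    fix k
    show "(f ^^ (fact (M k) - 1)) x \<in> C" using fc x by blast
    show "cong_mod C k ((f ^^ (fact (M (Suc k)) - 1)) x) ((f ^^ (fact (M k) - 1)) x)"
      using tr[OF stab[OF _ x] sy[OF stab[OF _ x]]] MN le_trans by blast
  qed
  then have "\<forall>x\<in>C. \<exists>s. s \<in> C \<and> (\<forall>k. cong_mod C k s ((f ^^ (fact (M k) - 1)) x))" by blast
  from bchoice[OF this] obtain g where g0: "\<And>x. x \<in> C \<Longrightarrow> g x \<in> C"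
    "\<And>x k. x \<in> C \<Longrightarrow> cong_mod C k (g x) ((f ^^ (fact (M k) - 1)) x)" by blast
  have g: "cong_mod C k (g x) ((f ^^ (fact n - 1)) x)" if "n \<ge> M k" "x \<in> C" for n k x
    using tr[OF g0(2) tr[OF stab sy[OF stab]]] that MN le_trans by meson
  have glin: "lin_on C g" unfolding lin_on_def
  proof (intro conjI ballI allI)
    fix x y assume xy: "x \<in> C" "y \<in> C"
    note xy' = subspace_add[OF sub xy]
    show "g (x + y) = g x + g y"
    proof (rule cong_mod_all[OF C g0(1)[OF xy'] subspace_add[OF sub g0(1)[OF xy(1)] g0(1)[OF xy(2)]]])
      fix k
      show "cong_mod C k (g (x + y)) (g x + g y)"
        using tr[OF g0(2)[OF xy'] sy[OF cong_mod_add[OF sub g0(2)[OF xy(1)] g0(2)[OF xy(2)]], folded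
            lin_onD(1)[OF lin_on_funpow[OF f] xy]]] .
    qed
  next
    fix r x assume x: "x \<in> C"
    note x' = subspace_scale[OF sub x]
    show "g (r *s x) = r *s g x"
    proof (rule cong_mod_all[OF C g0(1)[OF x'] subspace_scale[OF sub g0(1)[OF x]]])
      fix k
      show "cong_mod C k (g (r *s x)) (r *s g x)"
        using tr[OF g0(2)[OF x'] sy[OF cong_mod_scale[OF sub g0(2)[OF x]], folded
            lin_onD(2)[OF lin_on_funpow[OF f] x]]] .
    qed
  qed
  define \<epsilon> where "\<epsilon> x = f (g x)" for x
  have \<epsilon>C: "\<epsilon> x \<in> C" if "x \<in> C" for x using g0(1)[OF that] f(2) unfolding \<epsilon>_def by blast
  have \<epsilon>lin: "lin_on C \<epsilon>" using glin g0(1) f unfolding lin_on_def \<epsilon>_def by auto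
  have \<epsilon>: "cong_mod C k (\<epsilon> x) ((f ^^ fact n) x)" if n: "n \<ge> M k" and x: "x \<in> C" for n k x
  proof -
    have "cong_mod C k (\<epsilon> x) (f ((f ^^ (fact n - 1)) x))"
      unfolding \<epsilon>_def using cong_mod_lin[OF sub f fc[OF x] g[OF n x]] .
    moreover have "f ((f ^^ (fact n - 1)) x) = (f ^^ fact n) x"
      using fact_ge_1[of n, where 'a=nat] by (metis Suc_diff_1 comp_apply fact_gt_zero funpow.simps(2))
    ultimately show ?thesis by simp
  qed
  have \<epsilon>g: "\<epsilon> (g x) = g x" if x: "x \<in> C" for x
  proof (rule cong_mod_all[OF C \<epsilon>C[OF g0(1)[OF x]] g0(1)[OF x]])
    fix k
    have "cong_mod C k (\<epsilon> (g x)) ((f ^^ fact (M k)) (g x))" using \<epsilon> g0(1) x by blast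
    moreover have "cong_mod C k ((f ^^ fact (M k)) (g x)) ((f ^^ fact (M k)) ((f ^^ (fact (M k) - 1)) x))"
      using cong_mod_lin[OF sub lin_on_funpow[OF f] _ fc[OF x] g0(2)[OF x]] fc by blast
    moreover have "(f ^^ fact (M k)) ((f ^^ (fact (M k) - 1)) x) = (f ^^ (fact (M k) - 1 + fact (M k))) x"
      by (metis add.commute comp_apply funpow_add)
    ultimately show "cong_mod C k (\<epsilon> (g x)) (g x)"
      using tr double[OF MN(1) x] sy[OF g0(2)[OF x]] by metis
  qed
  show thesis
  proof (rule that[OF \<epsilon>lin])
    show "\<epsilon> ` C \<subseteq> C" using \<epsilon>C by blast
    show idem: "\<epsilon> (\<epsilon> x) = \<epsilon> x" if x: "x \<in> C" for x
    proof (rule cong_mod_all[OF C])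
      show "\<epsilon> (\<epsilon> x) \<in> C" "\<epsilon> x \<in> C" using \<epsilon>C x by auto
      fix k
      let ?n = "fact (M k) :: nat"
      have "cong_mod C k (\<epsilon> (\<epsilon> x)) ((f ^^ ?n) (\<epsilon> x))" using \<epsilon> \<epsilon>C x by blast
      moreover have "(f ^^ ?n) (\<epsilon> x) = f ((f ^^ ?n) (g x))" unfolding \<epsilon>_def by (metis funpow_swap1)
      moreover have "cong_mod C k (f (\<epsilon> (g x))) (f ((f ^^ ?n) (g x)))"
        using cong_mod_lin[OF sub f fc[OF g0(1)[OF x]] \<epsilon>[OF order_refl g0(1)[OF x]]] .
      ultimately show "cong_mod C k (\<epsilon> (\<epsilon> x)) (\<epsilon> x)" using tr sy \<epsilon>g[OF x] unfolding \<epsilon>_def by metis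
    qed
    show "\<exists>y\<in>C. \<epsilon> y = y \<and> f y = x" if x: "x \<in> C" "\<epsilon> x = x" for x
      using \<epsilon>g g0(1) x unfolding \<epsilon>_def by metis
    show "\<epsilon> x = x" if x: "x \<in> C" "\<forall>n. \<exists>y\<in>C. (f ^^ n) y = x" for x
    proof (rule cong_mod_all[OF C \<epsilon>C[OF x(1)] x(1)])
      fix k
      let ?n = "fact (M k) :: nat"
      obtain y where y: "y \<in> C" "(f ^^ ?n) y = x" using x(2) by blast
      have "cong_mod C k (\<epsilon> x) ((f ^^ ?n) x)" using \<epsilon> x by blast
      moreover have "(f ^^ ?n) x = f ((f ^^ (fact (M k) - 1 + fact (M k))) y)"
      proof -
        have "Suc (fact (M k) - 1 + fact (M k)) = ?n + ?n" using fact_ge_1[of "M k", where 'a=nat] by linarith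
        then have "(f ^^ (?n + ?n)) y = f ((f ^^ (fact (M k) - 1 + fact (M k))) y)"
          by (metis comp_apply funpow.simps(2))
        then show ?thesis using y(2) by (simp add: funpow_add)
      qed
      moreover have "cong_mod C k (f ((f ^^ (fact (M k) - 1 + fact (M k))) y)) (f ((f ^^ (fact (M k) - 1)) y))"
        using cong_mod_lin[OF sub f fc[OF y(1)] double[OF MN(1) y(1)]] .
      moreover have "f ((f ^^ (fact (M k) - 1)) y) = x"
        using y(2) by (metis Suc_diff_1 comp_apply fact_gt_zero funpow.simps(2))
      ultimately show "cong_mod C k (\<epsilon> x) x" using tr by metis
    qed
    show "\<exists>N. \<forall>x\<in>C. cong_mod C k (\<epsilon> x) ((f ^^ N) x)" for k using \<epsilon> by blast
    show "\<exists>N. \<forall>n\<ge>N. \<exists>t\<in>C. (f ^^ n) x = \<pi> ^ k *s t" if x: "x \<in> C" "\<epsilon> x = 0" for x k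
    proof (intro exI allI impI)
      fix n assume n: "n \<ge> (fact (M k) :: nat)"
      have "cong_mod C k ((f ^^ fact (M k)) x) 0" using sy[OF \<epsilon>[OF order_refl x(1)]] x(2) by metis
      then obtain t where t: "t \<in> C" "(f ^^ fact (M k)) x = \<pi> ^ k *s t" unfolding cong_mod_def by auto
      have "(f ^^ n) x = (f ^^ (n - fact (M k))) ((f ^^ fact (M k)) x)"
        using n by (metis comp_apply funpow_add le_add_diff_inverse2)
      also have "\<dots> = \<pi> ^ k *s (f ^^ (n - fact (M k))) t"
        unfolding t(2) using lin_onD(2)[OF lin_on_funpow[OF f] t(1)] .
      finally show "\<exists>t\<in>C. (f ^^ n) x = \<pi> ^ k *s t" using fc t(1) by blast
    qed
    show "\<epsilon> x = 0" if x: "x \<in> C" "\<forall>k. \<exists>n. \<exists>t\<in>C. (f ^^ n) x = \<pi> ^ k *s t" for x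
    proof (rule cong_mod_all[OF C \<epsilon>C[OF x(1)] subspace_0[OF sub]])
      fix k
      obtain n t where t: "t \<in> C" "(f ^^ n) x = \<pi> ^ k *s t" using x(2) by blast
      let ?m = "fact (M k + n) :: nat"
      have "n \<le> ?m" using fact_ge_self[of "M k + n"] by linarith
      then have "(f ^^ ?m) x = (f ^^ (?m - n)) ((f ^^ n) x)"
        by (metis comp_apply funpow_add le_add_diff_inverse2)
      also have "\<dots> = \<pi> ^ k *s (f ^^ (?m - n)) t"
        unfolding t(2) using lin_onD(2)[OF lin_on_funpow[OF f] t(1)] .
      finally have "cong_mod C k ((f ^^ ?m) x) 0" unfolding cong_mod_def using fc t(1) by auto
      then show "cong_mod C k (\<epsilon> x) 0" using tr \<epsilon>[of k "M k + n"] x(1) by (metis le_add1)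
    qed
  qed
qed

section \<open>Divisibility of scalars and spans of three vectors\<close>

definition dv :: "nat \<Rightarrow> 'r \<Rightarrow> bool" where
  "dv k r \<longleftrightarrow> (\<exists>s. nul (r - \<pi> ^ k * s))"

lemma dvI: "nul (r - \<pi> ^ k * s) \<Longrightarrow> dv k r"
  unfolding dv_def by blast

lemma dv_cong: assumes "nul (r - s)" shows "dv k r \<longleftrightarrow> dv k s"
  using assms nul_trans nul_commute unfolding dv_def by blast

lemma dv_add: assumes "dv k r" "dv k s" shows "dv k (r + s)"
proof -
  obtain a b where "nul (r - \<pi> ^ k * a)" "nul (s - \<pi> ^ k * b)" using assms unfolding dv_def by blast
  then have "nul ((r - \<pi> ^ k * a) + (s - \<pi> ^ k * b))" by (rule nul_add)
  then show ?thesis by (intro dvI[of _ _ "a + b"]) (simp add: algebra_simps)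
qed

lemma dv_mult: assumes "dv j r" "dv k s" shows "dv (j + k) (r * s)"
proof -
  obtain a b where ab: "nul (r - \<pi> ^ j * a)" "nul (s - \<pi> ^ k * b)" using assms unfolding dv_def by blast
  have "r * s - \<pi> ^ (j + k) * (a * b) = s * (r - \<pi> ^ j * a) + (\<pi> ^ j * a) * (s - \<pi> ^ k * b)"
    by (simp add: algebra_simps power_add)
  then show ?thesis using ab nul_add nul_mult by (intro dvI[of _ _ "a * b"]) metis
qed

lemma dv_0 [simp]: "dv 0 r"
  by (rule dvI[of _ _ r]) (simp add: nul_0)

lemma dv_mult_left: "dv k r \<Longrightarrow> dv k (s * r)"
  using dv_mult[of 0 s k r] by simp

lemma dv_mult_right: "dv k r \<Longrightarrow> dv k (r * s)"
  using dv_mult[of k r 0 s] by simp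

lemma dv_diff: "dv k r \<Longrightarrow> dv k s \<Longrightarrow> dv k (r - s)"
  using dv_add[of k r "- 1 * s"] dv_mult_left[of k s "- 1"] by simp

lemma dv_mono: assumes "dv k r" "j \<le> k" shows "dv j r"
proof -
  obtain a where "nul (r - \<pi> ^ k * a)" using assms unfolding dv_def by blast
  then have "nul (r - \<pi> ^ j * (\<pi> ^ (k - j) * a))" using assms(2) by (simp flip: mult.assoc power_add)
  then show ?thesis by (rule dvI)
qed

lemma dv_power: "dv k (\<pi> ^ k)"
  by (rule dvI[of _ _ 1]) (simp add: nul_0)

lemma dv_unif: "dv 1 \<pi>"
  using dv_power[of 1] by simp

lemma dv_cancel: assumes "dv (Suc k) (\<pi> * r)" shows "dv k r"
proof -
  obtain a where "nul (\<pi> * r - \<pi> ^ Suc k * a)" using assms unfolding dv_def by blast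
  then have "nul (\<pi> * (r - \<pi> ^ k * a))" by (simp add: algebra_simps)
  then show ?thesis using nul_prime unif_not_nul dvI by blast
qed

lemma dv_prime: assumes "dv 1 (r * s)" shows "dv 1 r \<or> dv 1 s"
proof (rule ccontr)
  assume "\<not> ?thesis"
  then obtain w where "nul (r * w - 1)" and s: "\<not> dv 1 s" using unit_or_div[of r] unfolding dv_def by auto
  then have "nul (s * (r * w - 1))" by (intro nul_mult)
  then have "nul (w * (r * s) - s)" by (simp add: algebra_simps)
  then show False using dv_cong dv_mult_left[OF assms] s by blast
qed

definition span3 :: "'v \<Rightarrow> 'v \<Rightarrow> 'v \<Rightarrow> 'v set" where
  "span3 x y z = {r *s x + s *s y + t *s z |r s t. True}"

lemma span3I: "r *s x + s *s y + t *s z \<in> span3 x y z"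
  unfolding span3_def by blast

lemma span3E:
  assumes "v \<in> span3 x y z" obtains r s t where "v = r *s x + s *s y + t *s z"
  using assms unfolding span3_def by blast

lemma span3_gen: "x \<in> span3 x y z" "y \<in> span3 x y z" "z \<in> span3 x y z"
  using span3I[of 1 x 0 y 0 z] span3I[of 0 x 1 y 0 z] span3I[of 0 x 0 y 1 z] by auto

lemma span3_subspace: "subspace (span3 x y z)"
proof (rule subspaceI)
  show "0 \<in> span3 x y z" using span3I[of 0 x 0 y 0 z] by simp
next
  fix v v' assume "v \<in> span3 x y z" "v' \<in> span3 x y z"
  then obtain r s t r' s' t' where "v = r *s x + s *s y + t *s z" "v' = r' *s x + s' *s y + t' *s z"
    using span3E by metis
  then have "v + v' = (r + r') *s x + (s + s') *s y + (t + t') *s z" by (simp add: algebra_simps)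
  then show "v + v' \<in> span3 x y z" using span3I by simp
next
  fix a v assume "v \<in> span3 x y z"
  then obtain r s t where "v = r *s x + s *s y + t *s z" using span3E by metis
  then have "a *s v = (a * r) *s x + (a * s) *s y + (a * t) *s z" by (simp add: algebra_simps)
  then show "a *s v \<in> span3 x y z" using span3I by simp
qed

lemma span3_least:
  assumes "subspace S" "x \<in> S" "y \<in> S" "z \<in> S" shows "span3 x y z \<subseteq> S"
proof
  fix v assume "v \<in> span3 x y z"
  then obtain r s t where "v = r *s x + s *s y + t *s z" using span3E by metis
  then show "v \<in> S" using subspace_add[OF assms(1)] subspace_scale[OF assms(1)] assms by simp
qed

lemma subspace_range_scale: "subspace (range (\<lambda>r. r *s x))"
  using subspace_span[of "{x}"] unfolding span_singleton .

end

section \<open>Virtual endomorphisms of lattices\<close>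

text \<open>An endomorphism \<open>\<phi>\<close> defined on a submodule \<open>C'\<close> with cyclic quotient \<open>C/C'\<close> killed by the
  uniformizer. The depth of a vector is the number of times \<open>\<phi>\<close> can be applied to it.\<close>

locale partial_endo = dvr_module scale nul \<pi>
  for scale :: "'r::comm_ring_1 \<Rightarrow> 'v::ab_group_add \<Rightarrow> 'v"  (infixr \<open>*s\<close> 75)
    and nul :: "'r \<Rightarrow> bool" and \<pi> :: 'r +
  fixes C C' :: "'v set" and \<phi> :: "'v \<Rightarrow> 'v"
  assumes C_lattice: "lattice C" and C'_subspace: "subspace C'" and C'_subset: "C' \<subseteq> C"
    and unif_C': "x \<in> C \<Longrightarrow> \<pi> *s x \<in> C'"
    and cyclic: "x \<in> C \<Longrightarrow> x \<notin> C' \<Longrightarrow> y \<in> C \<Longrightarrow> \<exists>r. y - r *s x \<in> C'"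
    and \<phi>_lin: "lin_on C' \<phi>" and \<phi>_closed: "x \<in> C' \<Longrightarrow> \<phi> x \<in> C"
begin

definition depth_ge :: "nat \<Rightarrow> 'v set" where
  "depth_ge n = {x \<in> C. \<forall>i<n. (\<phi> ^^ i) x \<in> C'}"

text \<open>The largest submodule of \<open>C'\<close> that \<open>\<phi>\<close> maps into itself.
  In a Lie lattice it need not be an ideal, so simplicity does not make it zero.\<close>

definition core :: "'v set" where
  "core = {x \<in> C. \<forall>i. (\<phi> ^^ i) x \<in> C'}"

lemma C_subspace: "subspace C"
  using C_lattice lattice_subspace by blast

lemma depth_ge_0 [simp]: "depth_ge 0 = C"
  by (simp add: depth_ge_def)

lemma depth_ge_subset: "depth_ge n \<subseteq> C"
  by (auto simp: depth_ge_def)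

lemma depth_ge_mono: "m \<le> n \<Longrightarrow> depth_ge n \<subseteq> depth_ge m"
  by (auto simp: depth_ge_def)

lemma depth_ge_Suc: "x \<in> depth_ge (Suc n) \<longleftrightarrow> x \<in> C' \<and> \<phi> x \<in> depth_ge n"
proof -
  have "(\<forall>i<Suc n. (\<phi> ^^ i) x \<in> C') \<longleftrightarrow> x \<in> C' \<and> (\<forall>i<n. (\<phi> ^^ i) (\<phi> x) \<in> C')"
    by (auto simp: less_Suc_eq_0_disj funpow_swap1)
  then show ?thesis using C'_subset \<phi>_closed by (auto simp: depth_ge_def)
qed

lemma depth_ge_1: "depth_ge (Suc 0) = C'"
  using depth_ge_Suc[of _ 0] \<phi>_closed by auto

lemma depth_ge_add: "x \<in> depth_ge (n + k) \<longleftrightarrow> x \<in> depth_ge n \<and> (\<phi> ^^ n) x \<in> depth_ge k"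
proof (induction n arbitrary: x)
  case 0 then show ?case using depth_ge_subset by auto
next
  case (Suc n)
  then show ?case using depth_ge_Suc[of x "n + k"] depth_ge_Suc[of x n] by (auto simp: funpow_swap1)
qed

lemma core_iff: "x \<in> core \<longleftrightarrow> (\<forall>n. x \<in> depth_ge n)"
  by (auto simp: core_def depth_ge_def)

lemma core_subset: "core \<subseteq> C" "core \<subseteq> C'"
  using core_iff depth_ge_subset depth_ge_1 by blast+

lemma \<phi>_core: "x \<in> core \<Longrightarrow> \<phi> x \<in> core"
  using core_iff depth_ge_Suc by blast

lemma \<phi>_power_core: "x \<in> core \<Longrightarrow> (\<phi> ^^ n) x \<in> core"
  by (induction n) (auto simp: \<phi>_core)

lemma depth_ge_subspace: "subspace (depth_ge n)"
proof (induction n)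
  case 0 show ?case using C_subspace by simp
next
  case (Suc n)
  show ?case
  proof (rule subspaceI)
    show "0 \<in> depth_ge (Suc n)"
      using depth_ge_Suc lin_on_0[OF \<phi>_lin C'_subspace] subspace_0 C'_subspace Suc by metis
  next
    fix x y assume "x \<in> depth_ge (Suc n)" "y \<in> depth_ge (Suc n)"
    then show "x + y \<in> depth_ge (Suc n)"
      using depth_ge_Suc lin_onD(1)[OF \<phi>_lin] subspace_add[OF C'_subspace] subspace_add[OF Suc] by metis
  next
    fix r x assume "x \<in> depth_ge (Suc n)"
    then show "r *s x \<in> depth_ge (Suc n)"
      using depth_ge_Suc lin_onD(2)[OF \<phi>_lin] subspace_scale[OF C'_subspace] subspace_scale[OF Suc] by metis
  qed
qed

lemma core_subspace: "subspace core"
proof (rule subspaceI)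
  show "0 \<in> core" using core_iff depth_ge_subspace subspace_0 by blast
  show "x + y \<in> core" if "x \<in> core" "y \<in> core" for x y
    using that core_iff depth_ge_subspace subspace_add by blast
  show "r *s x \<in> core" if "x \<in> core" for x r
    using that core_iff depth_ge_subspace subspace_scale by blast
qed

lemma \<phi>_power_closed: "x \<in> depth_ge n \<Longrightarrow> (\<phi> ^^ n) x \<in> C"
  using depth_ge_add[of x n 0] by simp

lemma \<phi>_power_lin: "lin_on (depth_ge n) (\<phi> ^^ n)"
proof (induction n)
  case 0 show ?case by (simp add: lin_on_def)
next
  case (Suc n)
  have *: "x \<in> depth_ge n \<and> (\<phi> ^^ n) x \<in> C'" if "x \<in> depth_ge (Suc n)" for x
    using that depth_ge_add[of x n 1] depth_ge_1 by simp
  then show ?case using lin_onD[OF Suc] lin_onD[OF \<phi>_lin] unfolding lin_on_def by simp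
qed

lemma exact_depth:
  assumes "x \<in> C" "x \<notin> depth_ge n"
  obtains j where "j < n" "x \<in> depth_ge j" "x \<notin> depth_ge (Suc j)"
proof -
  define j where "j = (LEAST j. x \<notin> depth_ge (Suc j))"
  obtain n' where n': "n = Suc n'" using assms by (cases n) auto
  have j: "x \<notin> depth_ge (Suc j)" unfolding j_def using LeastI[of "\<lambda>j. x \<notin> depth_ge (Suc j)" n'] assms n' by simp
  have "j \<le> n'" unfolding j_def using assms n' by (intro Least_le) simp
  moreover have "x \<in> depth_ge j"
    using not_less_Least[of _ "\<lambda>j. x \<notin> depth_ge (Suc j)"] assms(1) unfolding j_def[symmetric]
    by (cases j) auto
  ultimately show thesis using that[of j] j n' by simp
qed

text \<open>\<open>m\<close> is the least depth of a multiple of \<open>\<pi>\<close>. Since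
  \<open>\<phi>\<close> commutes with scalars, \<open>\<pi>\<close> raises every depth by at least
  \<open>m\<close>. It never raises a finite depth by more: a power of \<open>\<phi>\<close> moves
  such a vector to some \<open>y\<close> outside \<open>C'\<close>, and \<open>y\<close> generates,
  modulo \<open>C'\<close>, the vector \<open>x0\<close> that realizes the minimum, while
  \<open>\<pi>\<close> times \<open>C'\<close> has depth above \<open>m\<close>.\<close>

lemma depth_dichotomy:
  "(\<forall>x\<in>C. \<pi> *s x \<in> core) \<or>
   (\<exists>m\<ge>1. \<forall>n. \<forall>x\<in>C. \<pi> *s x \<in> depth_ge (n + m) \<longleftrightarrow> x \<in> depth_ge n)"
proof (cases "\<forall>x\<in>C. \<pi> *s x \<in> core")
  case False
  then obtain n0 where n0: "\<exists>x\<in>C. \<pi> *s x \<notin> depth_ge (Suc n0)"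
    using core_iff depth_ge_mono by (metis le_Suc_eq order_refl subsetD)
  define m where "m = (LEAST n. \<exists>x\<in>C. \<pi> *s x \<notin> depth_ge (Suc n))"
  obtain x0 where x0: "x0 \<in> C" "\<pi> *s x0 \<notin> depth_ge (Suc m)"
    using LeastI[of "\<lambda>n. \<exists>x\<in>C. \<pi> *s x \<notin> depth_ge (Suc n)", OF n0] unfolding m_def by blast
  have m1: "m \<ge> 1"
  proof (rule ccontr)
    assume "\<not> m \<ge> 1"
    then have "m = 0" by simp
    then show False using x0 unif_C' depth_ge_1 by simp
  qed
  have m: "\<pi> *s x \<in> depth_ge m" if "x \<in> C" for x
    using not_less_Least[of "m - 1" "\<lambda>n. \<exists>x\<in>C. \<pi> *s x \<notin> depth_ge (Suc n)"] m1 that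
    unfolding m_def[symmetric] by auto
  have up: "\<pi> *s x \<in> depth_ge (n + m)" if x: "x \<in> depth_ge n" for x n
    using depth_ge_add[of "\<pi> *s x" n m] lin_onD(2)[OF \<phi>_power_lin x] m[OF \<phi>_power_closed[OF x]]
      subspace_scale[OF depth_ge_subspace x] by simp
  have "x \<in> depth_ge n" if x: "x \<in> C" "\<pi> *s x \<in> depth_ge (n + m)" for x n
  proof (rule ccontr)
    assume "x \<notin> depth_ge n"
    then obtain j where j: "j < n" "x \<in> depth_ge j" "x \<notin> depth_ge (Suc j)" using exact_depth x by blast
    define y where "y = (\<phi> ^^ j) x"
    have y: "y \<in> C" "y \<notin> C'"
      using j \<phi>_power_closed depth_ge_add[of x j 1] depth_ge_1 unfolding y_def by auto
    have "\<pi> *s x \<in> depth_ge (j + Suc m)" using x(2) depth_ge_mono[of "j + Suc m" "n + m"] j(1) by auto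
    then have "\<pi> *s y \<in> depth_ge (Suc m)"
      unfolding y_def using depth_ge_add lin_onD(2)[OF \<phi>_power_lin j(2)] by metis
    moreover obtain r where "x0 - r *s y \<in> C'" using cyclic y x0(1) by blast
    then have "\<pi> *s (x0 - r *s y) \<in> depth_ge (Suc m)" using up[of _ 1] depth_ge_1 by simp
    ultimately have "\<pi> *s (x0 - r *s y) + r *s (\<pi> *s y) \<in> depth_ge (Suc m)"
      using subspace_add[OF depth_ge_subspace] subspace_scale[OF depth_ge_subspace] by blast
    moreover have "\<pi> *s (x0 - r *s y) + r *s (\<pi> *s y) = \<pi> *s x0" by (simp add: algebra_simps)
    ultimately show False using x0(2) by simp
  qed
  then show ?thesis using up m1 by blast
qed simp

section \<open>The expanding map\<close>

context
  fixes m assumes m_pos: "m \<ge> 1"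
    and raises: "\<forall>n. \<forall>x\<in>C. \<pi> *s x \<in> depth_ge (n + m) \<longleftrightarrow> x \<in> depth_ge n"
begin

lemma unif_raises: "x \<in> C \<Longrightarrow> \<pi> *s x \<in> depth_ge (n + m) \<longleftrightarrow> x \<in> depth_ge n"
  using raises by blast

lemma unif_power_raises: "x \<in> C \<Longrightarrow> \<pi> ^ k *s x \<in> depth_ge (n + k * m) \<longleftrightarrow> x \<in> depth_ge n"
proof (induction k arbitrary: n)
  case (Suc k)
  have "\<pi> ^ Suc k *s x \<in> depth_ge (n + Suc k * m) \<longleftrightarrow> \<pi> *s (\<pi> ^ k *s x) \<in> depth_ge ((n + k * m) + m)"
    by (simp add: algebra_simps)
  then show ?case using unif_raises[OF subspace_scale[OF C_subspace Suc.prems]] Suc by metis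
qed simp

lemma unif_power_depth: "x \<in> C \<Longrightarrow> \<pi> ^ k *s x \<in> depth_ge (k * m)"
  using unif_power_raises[of x k 0] by simp

lemma core_isolated: "isolated C core"
proof -
  have "x \<in> core" if x: "x \<in> C" "\<pi> *s x \<in> core" for x
  proof -
    have "x \<in> depth_ge n" for n using x unif_raises core_iff by blast
    then show ?thesis using core_iff by blast
  qed
  then show ?thesis unfolding isolated_def by blast
qed

lemma depth_zero_core:
  assumes "x \<in> depth_ge n" "(\<phi> ^^ n) x = 0" shows "x \<in> core"
proof -
  have "x \<in> depth_ge (n + k)" for k
    using depth_ge_add assms subspace_0[OF depth_ge_subspace] by simp
  then show ?thesis using core_iff depth_ge_mono by (metis le_add2 subsetD)
qed

text \<open>The factor \<open>\<pi>\<close> supplies the depth that \<open>\<phi> ^^ m\<close>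
  consumes, so the composite is defined on all of \<open>C\<close> and can be iterated.\<close>

definition expand :: "'v \<Rightarrow> 'v" where
  "expand x = (\<phi> ^^ m) (\<pi> *s x)"

lemma unif_in_depth: "x \<in> C \<Longrightarrow> \<pi> *s x \<in> depth_ge m"
  using unif_raises[of x 0] by simp

lemma expand_lin: "lin_on C expand"
  unfolding lin_on_def expand_def
  using lin_onD[OF \<phi>_power_lin[of m] unif_in_depth] unif_in_depth
  by (simp add: scale_right_distrib mult.commute[of \<pi>])

lemma expand_closed: "expand ` C \<subseteq> C"
  using \<phi>_power_closed unif_in_depth unfolding expand_def by auto

lemma expand_power: "x \<in> C \<Longrightarrow> (expand ^^ k) x = (\<phi> ^^ (k * m)) (\<pi> ^ k *s x)"
proof (induction k)
  case (Suc k)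
  have d: "\<pi> ^ k *s x \<in> depth_ge (k * m)" using unif_power_depth Suc.prems by blast
  have "(expand ^^ Suc k) x = expand ((\<phi> ^^ (k * m)) (\<pi> ^ k *s x))"
    using Suc by simp
  also have "\<dots> = (\<phi> ^^ m) (\<pi> *s (\<phi> ^^ (k * m)) (\<pi> ^ k *s x))"
    by (simp add: expand_def)
  also have "\<dots> = (\<phi> ^^ m) ((\<phi> ^^ (k * m)) (\<pi> ^ Suc k *s x))"
    using lin_onD(2)[OF \<phi>_power_lin d, of \<pi>] by simp
  also have "\<dots> = (\<phi> ^^ (Suc k * m)) (\<pi> ^ Suc k *s x)" by (simp add: funpow_add)
  finally show ?case .
qed simp

text \<open>On the core, \<open>expand ^^ k\<close> is \<open>\<pi> ^ k\<close> times a power of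
  \<open>\<phi>\<close> and tends to zero. Conversely, if \<open>(expand ^^ n) x\<close> is
  divisible by \<open>\<pi> ^ k\<close>, comparing depths shows that \<open>x\<close> has depth at
  least \<open>k * m\<close>. Hence the kernel of the Fitting projection is the core.\<close>

lemma expand_fitting:
  obtains \<epsilon> where "lin_on C \<epsilon>" "\<epsilon> ` C \<subseteq> C"
    "\<And>x. x \<in> C \<Longrightarrow> \<epsilon> (\<epsilon> x) = \<epsilon> x"
    "\<And>x. x \<in> C \<Longrightarrow> \<epsilon> x = 0 \<longleftrightarrow> x \<in> core"
    "\<And>x k. x \<in> C \<Longrightarrow> \<epsilon> x = x \<Longrightarrow> \<exists>y\<in>C. \<epsilon> y = y \<and> (expand ^^ k) y = x"
    "\<And>x. x \<in> C \<Longrightarrow> \<forall>k. \<exists>y\<in>C. (expand ^^ k) y = x \<Longrightarrow> \<epsilon> x = x"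
proof -
  show thesis
  proof (rule fitting_projection[OF C_lattice expand_lin expand_closed])
  fix \<epsilon> assume \<epsilon>: "lin_on C \<epsilon>" "\<epsilon> ` C \<subseteq> C"
    "\<And>x. x \<in> C \<Longrightarrow> \<epsilon> (\<epsilon> x) = \<epsilon> x"
    "\<And>x. x \<in> C \<Longrightarrow> \<epsilon> x = x \<Longrightarrow> \<exists>y\<in>C. \<epsilon> y = y \<and> expand y = x"
    "\<And>x. x \<in> C \<Longrightarrow> \<forall>n. \<exists>y\<in>C. (expand ^^ n) y = x \<Longrightarrow> \<epsilon> x = x"
    "\<And>k. \<exists>N. \<forall>x\<in>C. cong_mod C k (\<epsilon> x) ((expand ^^ N) x)"
    "\<And>x k. x \<in> C \<Longrightarrow> \<epsilon> x = 0 \<Longrightarrow> \<exists>N. \<forall>n\<ge>N. \<exists>t\<in>C. (expand ^^ n) x = \<pi> ^ k *s t"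
    "\<And>x. x \<in> C \<Longrightarrow> \<forall>k. \<exists>n. \<exists>t\<in>C. (expand ^^ n) x = \<pi> ^ k *s t \<Longrightarrow> \<epsilon> x = 0"
  show thesis
  proof (rule that[OF \<epsilon>(1-3) _ _ \<epsilon>(5)])
    fix x assume x: "x \<in> C"
    show "\<epsilon> x = 0 \<longleftrightarrow> x \<in> core"
    proof
      assume "\<epsilon> x = 0"
      have "x \<in> depth_ge k" for k
      proof -
        obtain n t where t: "t \<in> C" "(expand ^^ n) x = \<pi> ^ k *s t"
          using \<epsilon>(7)[OF x \<open>\<epsilon> x = 0\<close>, of k] by blast
        have "(\<phi> ^^ (n * m)) (\<pi> ^ n *s x) \<in> depth_ge (k * m)"
          using t(2) unif_power_depth[OF t(1)] expand_power[OF x] by metis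
        then have "\<pi> ^ n *s x \<in> depth_ge (k * m + n * m)"
          using unif_power_depth[OF x] depth_ge_add by (metis add.commute)
        then have "x \<in> depth_ge (k * m)" using unif_power_raises[OF x] by blast
        then show ?thesis using depth_ge_mono[of k "k * m"] m_pos by auto
      qed
      then show "x \<in> core" using core_iff by blast
    next
      assume xc: "x \<in> core"
      show "\<epsilon> x = 0"
      proof (rule \<epsilon>(8)[OF x], rule allI)
        fix k
        have "x \<in> depth_ge (k * m)" using xc core_iff by blast
        then have "(expand ^^ k) x = \<pi> ^ k *s (\<phi> ^^ (k * m)) x"
          using expand_power[OF x] lin_onD(2)[OF \<phi>_power_lin] by simp
        then show "\<exists>n. \<exists>t\<in>C. (expand ^^ n) x = \<pi> ^ k *s t"
          using \<phi>_power_core[OF xc] core_subset by blast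
      qed
    qed
  next
    fix x k assume x: "x \<in> C" "\<epsilon> x = x"
    show "\<exists>y\<in>C. \<epsilon> y = y \<and> (expand ^^ k) y = x"
    proof (induction k)
      case 0 then show ?case using x by auto
    next
      case (Suc k)
      then obtain y where y: "y \<in> C" "\<epsilon> y = y" "(expand ^^ k) y = x" by blast
      then obtain z where "z \<in> C" "\<epsilon> z = z" "expand z = y" using \<epsilon>(4) by blast
      then show ?case using y(3) by (metis comp_apply funpow_Suc_right)
    qed
  qed
  qed
qed

text \<open>With trivial core the Fitting projection is the identity, so \<open>expand\<close> is
  onto; moreover \<open>\<phi> ^^ m\<close> is injective on its domain. Now
  \<open>(\<phi> ^^ m) x\<close> equals \<open>expand y\<close>, which is
  \<open>(\<phi> ^^ m) (\<pi> *s y)\<close>.\<close>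

lemma depth_eq_unif:
  assumes "core = {0}" "x \<in> depth_ge m" shows "\<exists>y\<in>C. x = \<pi> *s y"
proof (rule expand_fitting)
  fix \<epsilon> assume \<epsilon>: "lin_on C \<epsilon>" "\<epsilon> ` C \<subseteq> C" "\<And>x. x \<in> C \<Longrightarrow> \<epsilon> (\<epsilon> x) = \<epsilon> x"
    "\<And>x. x \<in> C \<Longrightarrow> \<epsilon> x = 0 \<longleftrightarrow> x \<in> core"
    "\<And>x k. x \<in> C \<Longrightarrow> \<epsilon> x = x \<Longrightarrow> \<exists>y\<in>C. \<epsilon> y = y \<and> (expand ^^ k) y = x"
    "\<And>x. x \<in> C \<Longrightarrow> \<forall>k. \<exists>y\<in>C. (expand ^^ k) y = x \<Longrightarrow> \<epsilon> x = x"
  define z where "z = (\<phi> ^^ m) x"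
  have z: "z \<in> C" using \<phi>_power_closed assms(2) unfolding z_def by blast
  have \<epsilon>z: "\<epsilon> z \<in> C" using \<epsilon>(2) z by blast
  have "\<epsilon> (z - \<epsilon> z) = 0" using lin_on_diff[OF \<epsilon>(1) C_subspace z \<epsilon>z] \<epsilon>(3)[OF z] by simp
  then have "z - \<epsilon> z = 0" using \<epsilon>(4)[OF subspace_diff[OF C_subspace z \<epsilon>z]] assms(1) by blast
  then obtain y where y: "y \<in> C" "expand y = z" using \<epsilon>(5)[OF z, of 1] by auto
  have yd: "\<pi> *s y \<in> depth_ge m" using unif_in_depth y(1) by blast
  have "(\<phi> ^^ m) (x - \<pi> *s y) = 0"
    using lin_on_diff[OF \<phi>_power_lin depth_ge_subspace assms(2) yd] y(2) unfolding expand_def z_def by simp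
  then have "x - \<pi> *s y \<in> core"
    using depth_zero_core subspace_diff[OF depth_ge_subspace assms(2) yd] by blast
  then show "\<exists>y\<in>C. x = \<pi> *s y" using assms(1) y(1) by auto
qed

end

end

section \<open>Subalgebras that are not self-similar\<close>

locale lie_lattice_space = dvr_module scale nul \<pi>
  for scale :: "'r::comm_ring_1 \<Rightarrow> 'v::ab_group_add \<Rightarrow> 'v"  (infixr \<open>*s\<close> 75)
    and nul :: "'r \<Rightarrow> bool" and \<pi> :: 'r +
  fixes br :: "'v \<Rightarrow> 'v \<Rightarrow> 'v" and G :: "'v set"
  assumes br_add_left: "br (x + y) z = br x z + br y z"
    and br_add_right: "br x (y + z) = br x y + br x z"
    and br_scale_left: "br (r *s x) y = r *s br x y"
    and br_scale_right: "br x (r *s y) = r *s br x y"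
    and br_self [simp]: "br x x = 0"
    and br_jacobi: "br x (br y z) + br y (br z x) + br z (br x y) = 0"
    and ambient_lattice: "lattice G"
    and two_not_nul: "\<not> nul 2"
begin

section \<open>Brackets, subalgebras and simple virtual endomorphisms\<close>

lemma br_0 [simp]: "br 0 x = 0" "br x 0 = 0"
  using br_scale_left[of 0 0 x] br_scale_right[of x 0 0] by auto

lemma br_minus: "br (- x) y = - br x y" "br x (- y) = - br x y"
  using br_scale_left[of "-1" x y] br_scale_right[of x "-1" y] by auto

lemma br_diff: "br (x - y) z = br x z - br y z" "br x (y - z) = br x y - br x z"
  using br_add_left[of x "- y" z] br_add_right[of x y "- z"] br_minus by auto

lemma br_anti: "br y x = - br x y"
proof -
  have "br (x + y) (x + y) = br x y + br y x" by (simp add: br_add_left br_add_right del: br_self) simp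
  then show ?thesis by (simp add: eq_neg_iff_add_eq_0 add.commute)
qed

lemmas br_simps = br_add_left br_add_right br_scale_left br_scale_right br_minus br_diff

definition subalg :: "'v set \<Rightarrow> bool" where
  "subalg N \<longleftrightarrow> subspace N \<and> N \<subseteq> G \<and> (\<forall>x\<in>N. \<forall>y\<in>N. br x y \<in> N)"

definition ideal_of :: "'v set \<Rightarrow> 'v set \<Rightarrow> bool" where
  "ideal_of N I \<longleftrightarrow> subspace I \<and> I \<subseteq> N \<and> (\<forall>x\<in>N. \<forall>y\<in>I. br x y \<in> I)"

text \<open>The quotient of \<open>N\<close> by \<open>M\<close> is a line over the residue field:
  nonzero, killed by \<open>\<pi>\<close> and generated by each nonzero element. Over the p-adic
  integers this is index \<open>p\<close>, see \<open>index_iff\<close>.\<close>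

definition prime_index :: "'v set \<Rightarrow> 'v set \<Rightarrow> bool" where
  "prime_index N M \<longleftrightarrow> M \<noteq> N \<and> (\<forall>x\<in>N. \<pi> *s x \<in> M) \<and>
     (\<forall>x\<in>N. x \<notin> M \<longrightarrow> (\<forall>y\<in>N. \<exists>r. y - r *s x \<in> M))"

definition self_sim :: "'v set \<Rightarrow> bool" where
  "self_sim N \<longleftrightarrow> (\<exists>M \<phi>. subalg M \<and> M \<subseteq> N \<and> prime_index N M \<and> lin_on M \<phi> \<and> \<phi> ` M \<subseteq> N \<and>
     (\<forall>x\<in>M. \<forall>y\<in>M. \<phi> (br x y) = br (\<phi> x) (\<phi> y)) \<and>
     \<not> (\<exists>I. ideal_of N I \<and> I \<noteq> {0} \<and> I \<subseteq> M \<and> \<phi> ` I \<subseteq> I))"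

definition hereditary :: "'v set \<Rightarrow> bool" where
  "hereditary L \<longleftrightarrow> (\<forall>N. subalg N \<and> N \<subseteq> L \<and> N \<noteq> {0} \<longrightarrow> self_sim N)"

lemma subalgD:
  assumes "subalg N"
  shows "subspace N" "lattice N" "N \<subseteq> G" "x \<in> N \<Longrightarrow> y \<in> N \<Longrightarrow> br x y \<in> N"
  using assms lattice_submodule[OF ambient_lattice] unfolding subalg_def by auto

lemma hereditary_subset: "hereditary L \<Longrightarrow> N \<subseteq> L \<Longrightarrow> hereditary N"
  unfolding hereditary_def by blast

lemma self_simE:
  assumes "hereditary L" "subalg N" "N \<subseteq> L" "N \<noteq> {0}"
  obtains M \<phi> where "subalg M" "M \<subseteq> N" "M \<noteq> N" "partial_endo scale nul \<pi> N M \<phi>"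
    "\<And>x y. x \<in> M \<Longrightarrow> y \<in> M \<Longrightarrow> \<phi> (br x y) = br (\<phi> x) (\<phi> y)"
    "\<And>I. ideal_of N I \<Longrightarrow> I \<subseteq> M \<Longrightarrow> (\<And>x. x \<in> I \<Longrightarrow> \<phi> x \<in> I) \<Longrightarrow> I = {0}"
proof -
  have "self_sim N" using assms unfolding hereditary_def by blast
  then obtain M \<phi> where M: "subalg M" "M \<subseteq> N" "prime_index N M" "lin_on M \<phi>" "\<phi> ` M \<subseteq> N"
    "\<forall>x\<in>M. \<forall>y\<in>M. \<phi> (br x y) = br (\<phi> x) (\<phi> y)"
    "\<not> (\<exists>I. ideal_of N I \<and> I \<noteq> {0} \<and> I \<subseteq> M \<and> \<phi> ` I \<subseteq> I)"
    unfolding self_sim_def by (elim exE conjE) (rule that)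
  show thesis
  proof (rule that[OF M(1,2)])
    show "partial_endo scale nul \<pi> N M \<phi>"
    proof
      show "lattice N" "subspace M" "M \<subseteq> N" "lin_on M \<phi>" using M assms subalgD by auto
    qed (use M(3,5) in \<open>auto simp: prime_index_def\<close>)
    show "M \<noteq> N" using M(3) unfolding prime_index_def by (rule conjunct1)
    show "\<phi> (br x y) = br (\<phi> x) (\<phi> y)" if "x \<in> M" "y \<in> M" for x y using M(6) that by simp
    show "I = {0}" if I: "ideal_of N I" "I \<subseteq> M" "\<And>x. x \<in> I \<Longrightarrow> \<phi> x \<in> I" for I
    proof -
      have "\<not> (ideal_of N I \<and> I \<noteq> {0} \<and> I \<subseteq> M \<and> \<phi> ` I \<subseteq> I)"
        using M(7) by (rule contrapos_nn) (rule exI)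
      moreover have "\<phi> ` I \<subseteq> I" using I(3) by (rule image_subsetI)
      ultimately show ?thesis using I(1,2) by simp
    qed
  qed
qed

text \<open>In the span of \<open>\<pi> c\<close>, \<open>v\<close> and \<open>w\<close>, where \<open>w = [c, v]\<close>, the center is spanned by \<open>w\<close>, but brackets lie in
  \<open>\<pi> w\<close>. Hence \<open>\<phi> (\<pi> w) = \<kappa> w\<close>, where \<open>\<kappa>\<close> is a unit because otherwise \<open>\<pi> w\<close> spans an invariant ideal. But
  then \<open>w\<close> is not in the domain, and \<open>\<pi> w\<close> is a bracket of elements of the domain, which makes \<open>\<kappa>\<close>
  divisible by \<open>\<pi>\<close>.\<close>

lemma no_heisenberg:
  assumes L: "hereditary L" "subalg L" and cv: "c \<in> L" "v \<in> L"
    and w: "br c (br c v) = 0" "br v (br c v) = 0"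
  shows "br c v = 0"
proof (rule ccontr)
  define w where "w = br c v"
  assume "br c v \<noteq> 0"
  then have w0: "w \<noteq> 0" unfolding w_def .
  have w1: "br c w = 0" "br v w = 0" "br w c = 0" "br w v = 0" "br v c = - w"
    using w br_anti[of c w] br_anti[of v w] br_anti[of v c] unfolding w_def by auto
  define c1 where "c1 = \<pi> *s c"
  define N where "N = span3 c1 v w"
  have NI: "r *s c1 + s *s v + t *s w \<in> N" for r s t unfolding N_def by (rule span3I)
  have NE: "\<exists>r s t. x = r *s c1 + s *s v + t *s w" if "x \<in> N" for x using that span3E unfolding N_def by blast
  have brN: "br (r *s c1 + s *s v + t *s w) (r' *s c1 + s' *s v + t' *s w) = (r * s' - s * r') *s (\<pi> *s w)"
    for r s t r' s' t'
    unfolding c1_def by (simp add: br_simps w1 w_def[symmetric] algebra_simps)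
  have wL: "w \<in> L" unfolding w_def using subalgD(4)[OF L(2)] cv by blast
  have sN: "subspace N" unfolding N_def by (rule span3_subspace)
  note sL = subalgD(1)[OF L(2)]
  have NL: "N \<subseteq> L" unfolding N_def c1_def using span3_least[OF sL subspace_scale[OF sL cv(1)] cv(2) wL] .
  have brX: "\<exists>q. br x y = (q * \<pi>) *s w" if "x \<in> N" "y \<in> N" for x y
    using NE[OF that(1)] NE[OF that(2)] brN by auto
  have el: "w \<in> N" "v \<in> N" "c1 \<in> N" unfolding N_def by (rule span3_gen)+
  have subN: "subalg N" unfolding subalg_def
  proof (intro conjI ballI)
    fix x y assume "x \<in> N" "y \<in> N"
    then show "br x y \<in> N" using brX el subspace_scale[OF sN] by metis
  qed (use sN NL subalgD(3)[OF L(2)] in auto)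
  note latN = subalgD(2)[OF subN]
  \<comment> \<open>The line through \<open>w\<close> is isolated in \<open>N\<close>: brackets with
    \<open>c\<close> and \<open>v\<close> read off the coordinates of \<open>x\<close> along
    \<open>v\<close> and \<open>c1\<close>, and these must be null.\<close>
  have central: "\<exists>t. x = t *s w" if x: "x \<in> N" "a *s x = b *s w" "\<not> nul a" for x a b
  proof -
    obtain r s t where rst: "x = r *s c1 + s *s v + t *s w" using NE x(1) by meson
    have "br c (a *s x) = (a * s) *s w" "br v (a *s x) = (- (a * r * \<pi>)) *s w"
      unfolding rst c1_def by (simp_all add: br_simps w1 w_def[symmetric] algebra_simps)
    then have "(a * s) *s w = 0" "(- (a * r * \<pi>)) *s w = 0" using x(2) w1 by (simp_all add: br_simps)
    then have "nul (a * s)" "nul (- (a * r * \<pi>))" using lattice_torsion_free[OF latN el(1)] w0 by blast+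
    then have "nul s" "nul r" using x(3) nul_prime unif_not_nul nul_minus by (metis minus_minus)+
    then show ?thesis
      using rst eff_nul lattice_eff[OF latN] el by (intro exI[of _ t]) simp
  qed
  have "N \<noteq> {0}" using el w0 by auto
  then show False
  proof (rule self_simE[OF L(1) subN NL])
  fix M \<phi> assume M: "subalg M" "M \<subseteq> N" "M \<noteq> N" "partial_endo scale nul \<pi> N M \<phi>"
    "\<And>x y. x \<in> M \<Longrightarrow> y \<in> M \<Longrightarrow> \<phi> (br x y) = br (\<phi> x) (\<phi> y)"
    "\<And>I. ideal_of N I \<Longrightarrow> I \<subseteq> M \<Longrightarrow> (\<And>x. x \<in> I \<Longrightarrow> \<phi> x \<in> I) \<Longrightarrow> I = {0}"
  interpret partial_endo scale nul \<pi> N M \<phi> by (rule M(4))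
  have pw: "\<pi> *s w \<in> M" using unif_C' el by blast
  \<comment> \<open>A nonzero multiple of \<open>\<pi> *s w\<close> is a bracket of elements of the
    domain. So a nonzero multiple of its image lies on the line through \<open>w\<close>, and then
    the image itself does by \<open>central\<close>.\<close>
  have "\<phi> (br (\<pi> *s c1) (\<pi> *s v)) = br (\<phi> (\<pi> *s c1)) (\<phi> (\<pi> *s v))"
    using M(5) unif_C' el by blast
  moreover have "br (\<pi> *s c1) (\<pi> *s v) = (\<pi> * \<pi>) *s (\<pi> *s w)"
    unfolding c1_def w_def by (simp add: br_simps algebra_simps)
  ultimately have e1: "(\<pi> * \<pi>) *s \<phi> (\<pi> *s w) = br (\<phi> (\<pi> *s c1)) (\<phi> (\<pi> *s v))"
    using lin_onD(2)[OF \<phi>_lin pw] by metis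
  obtain q where e2: "br (\<phi> (\<pi> *s c1)) (\<phi> (\<pi> *s v)) = (q * \<pi>) *s w"
    using brX[OF \<phi>_closed[OF unif_C'[OF el(3)]] \<phi>_closed[OF unif_C'[OF el(2)]]] by blast
  note q = trans[OF e1 e2]
  have "\<not> nul (\<pi> * \<pi>)" using nul_prime unif_not_nul by blast
  then obtain \<kappa> where \<kappa>: "\<phi> (\<pi> *s w) = \<kappa> *s w"
    using central[OF \<phi>_closed[OF pw] q] by blast
  have unitk: False if "nul (\<kappa> - \<pi> * s)" for s
  proof -
    define I where "I = range (\<lambda>r. r *s (\<pi> *s w))"
    have "\<kappa> *s w = s *s (\<pi> *s w)" using eff_cong[OF lattice_eff[OF latN el(1)] that] by (simp add: mult.commute)
    then have \<phi>r: "\<phi> (r *s \<pi> *s w) = (r * s) *s \<pi> *s w" for r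
      using lin_onD(2)[OF \<phi>_lin pw, of r] \<kappa> by (simp add: mult.assoc)
    have \<phi>I: "\<phi> x \<in> I" if xI: "x \<in> I" for x
    proof -
      obtain r where "x = r *s \<pi> *s w" using xI unfolding I_def by blast
      then show ?thesis unfolding I_def using \<phi>r by (intro range_eqI[of _ _ "r * s"]) simp
    qed
    have "ideal_of N I" unfolding ideal_of_def
    proof (intro conjI ballI)
      show "subspace I" unfolding I_def by (rule subspace_range_scale)
      show "I \<subseteq> N" unfolding I_def using el subspace_scale[OF sN] by blast
    next
      fix x y assume x: "x \<in> N" and "y \<in> I"
      then obtain r where "y = r *s (\<pi> *s w)" unfolding I_def by blast
      moreover obtain a b t where "x = a *s c1 + b *s v + t *s w" using NE x by meson
      ultimately have "br x y = 0" unfolding c1_def by (simp add: br_simps w1)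
      then show "br x y \<in> I" unfolding I_def by (intro range_eqI[of _ _ 0]) simp
    qed
    moreover have "I \<subseteq> M" unfolding I_def using pw subspace_scale[OF C'_subspace] by blast
    ultimately have "I = {0}" using M(6) \<phi>I by blast
    moreover have "\<pi> *s w \<in> I" unfolding I_def by (intro range_eqI[of _ _ 1]) simp
    ultimately have "\<pi> *s w = 0" by blast
    then show False using lattice_torsion_free[OF latN el(1)] w0 unif_not_nul by blast
  qed
  then obtain \<kappa>' where \<kappa>': "nul (\<kappa> * \<kappa>' - 1)" using unit_or_div by blast
  have inv: "\<kappa>' *s (\<kappa> *s w) = w"
    using eff_cong[OF lattice_eff[OF latN el(1)] \<kappa>'] by (simp add: mult.commute)
  show False
  proof (cases "w \<in> M")
    case True
    then have "\<pi> *s \<phi> w = \<kappa> *s w" using \<kappa> lin_onD(2)[OF \<phi>_lin] by simp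
    then have z: "\<pi> *s (\<kappa>' *s \<phi> w) = w" using inv scale_left_commute by metis
    have "\<kappa>' *s \<phi> w \<in> N" using subspace_scale[OF sN \<phi>_closed[OF True]] .
    then obtain t where "\<kappa>' *s \<phi> w = t *s w" using central[of _ \<pi> 1] z unif_not_nul by (metis scale_one)
    then have "(\<pi> * t) *s w = 1 *s w" using z by simp
    then have "nul (\<pi> * t - 1)" using lattice_scale_cancel[OF latN el(1) w0] by blast
    then show False using unif_not_unit by blast
  next
    case False
    \<comment> \<open>Corrections by the central vector \<open>w\<close> move \<open>c1\<close> and
      \<open>v\<close> into the domain without changing their bracket
      \<open>\<pi> *s w\<close>.\<close>
    obtain r s where rs: "c1 - r *s w \<in> M" "v - s *s w \<in> M" using cyclic[OF el(1) False] el by blast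
    have "br (c1 - r *s w) (v - s *s w) = \<pi> *s w"
      unfolding c1_def by (simp add: br_simps w1 w_def[symmetric])
    then have "\<kappa> *s w = br (\<phi> (c1 - r *s w)) (\<phi> (v - s *s w))" using M(5)[OF rs] \<kappa> by simp
    also obtain q where "\<dots> = (q * \<pi>) *s w" using brX[OF \<phi>_closed[OF rs(1)] \<phi>_closed[OF rs(2)]] by blast
    finally have "nul (\<kappa> - q * \<pi>)" using lattice_scale_cancel[OF latN el(1) w0] by blast
    then show False using unitk[of q] by (simp add: mult.commute)
  qed
  qed
qed

section \<open>One element acting on an abelian submodule\<close>

lemma abelian_line_subalg:
  assumes C: "subspace C" "C \<subseteq> G" "\<And>x y. x \<in> C \<Longrightarrow> y \<in> C \<Longrightarrow> br x y = 0"
    and c: "c \<in> G" "\<And>z. z \<in> C \<Longrightarrow> br c z \<in> C"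
  defines "N \<equiv> {r *s c + z |r z. z \<in> C}"
  shows "subalg N"
proof -
  have sN: "subspace N" unfolding N_def
  proof (rule subspaceI)
    show "0 \<in> {r *s c + z |r z. z \<in> C}" using subspace_0[OF C(1)] by (auto intro!: exI[of _ 0])
  next
    fix x y assume "x \<in> {r *s c + z |r z. z \<in> C}" "y \<in> {r *s c + z |r z. z \<in> C}"
    then obtain r z r' z' where *: "x = r *s c + z" "z \<in> C" "y = r' *s c + z'" "z' \<in> C" by blast
    then have "x + y = (r + r') *s c + (z + z')" by (simp add: algebra_simps)
    then show "x + y \<in> {r *s c + z |r z. z \<in> C}" using subspace_add[OF C(1)] * by blast
  next
    fix a x assume "x \<in> {r *s c + z |r z. z \<in> C}"
    then obtain r z where *: "x = r *s c + z" "z \<in> C" by blast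
    then have "a *s x = (a * r) *s c + a *s z" by (simp add: algebra_simps)
    then show "a *s x \<in> {r *s c + z |r z. z \<in> C}" using subspace_scale[OF C(1)] * by blast
  qed
  moreover have "N \<subseteq> G"
    using subspace_add[OF lattice_subspace[OF ambient_lattice]]
      subspace_scale[OF lattice_subspace[OF ambient_lattice]] C(2) c(1) unfolding N_def by blast
  moreover have "br x y \<in> N" if xy: "x \<in> N" "y \<in> N" for x y
  proof -
    obtain r z r' z' where *: "x = r *s c + z" "z \<in> C" "y = r' *s c + z'" "z' \<in> C"
      using xy unfolding N_def by blast
    have "br x y = 0 *s c + (r *s br c z' - r' *s br c z)"
      unfolding *(1,3) using C(3)[OF *(2,4)] br_anti[of c z] by (simp add: br_simps)
    moreover have "r *s br c z' - r' *s br c z \<in> C"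
      using subspace_diff[OF C(1) subspace_scale[OF C(1) c(2)] subspace_scale[OF C(1) c(2)]] * by blast
    ultimately show ?thesis unfolding N_def by blast
  qed
  ultimately show ?thesis unfolding subalg_def by blast
qed

text \<open>A basis \<open>w 0, \<dots>, w (M - 1)\<close> with \<open>br c (w i) = w (i + 1)\<close> makes \<open>C\<close> a cyclic module under
  \<open>T = br c\<close>. A simple virtual endomorphism commutes with \<open>T\<close> up to a unit, so that \<open>T\<close> raises the depth
  by a constant, which is \<open>1\<close> by cyclicity, while \<open>\<pi>\<close> raises it by some \<open>m\<close>. Since \<open>T ^^ M\<close> maps \<open>w 0\<close> into
  \<open>\<pi>\<^sup>2 C\<close>, it follows that \<open>m < M\<close>, and then \<open>w m\<close> is divisible by \<open>\<pi>\<close>, which is absurd.\<close>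

lemma no_cyclic_action:
  assumes L: "hereditary L" "subalg L" and c: "c \<in> L" and CL: "C \<subseteq> L"
    and ab: "\<And>x y. x \<in> C \<Longrightarrow> y \<in> C \<Longrightarrow> br x y = 0"
    and bas: "basis M w C" and M2: "M \<ge> 2"
    and step: "\<And>i. Suc i < M \<Longrightarrow> br c (w i) = w (Suc i)"
    and last: "\<exists>z\<in>C. br c (w (M - 1)) = (\<pi> * \<pi>) *s z"
  shows False
proof -
  define T where "T z = br c z" for z
  have latC: "lattice C" using bas unfolding lattice_def by blast
  note sC = lattice_subspace[OF latC]
  have Tadd: "T (x + y) = T x + T y" and Tscale: "T (r *s x) = r *s T x"
    and Tdiff: "T (x - y) = T x - T y" and T0: "T 0 = 0" for x y r
    unfolding T_def by (simp_all add: br_simps)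
  have Tsum: "T (\<Sum>i<n. f i) = (\<Sum>i<n. T (f i))" for f and n :: nat
    by (induction n) (simp_all add: T0 Tadd)
  have w: "w i \<in> C" if "i < M" for i using basis_mem[OF bas that] .
  have Tw: "T (w i) = w (Suc i)" if "Suc i < M" for i using step that unfolding T_def by blast
  have TwC: "T (w i) \<in> C" if i: "i < M" for i
  proof (cases "Suc i < M")
    case False
    then have "i = M - 1" using i by simp
    then show ?thesis using last subspace_scale[OF sC] unfolding T_def by auto
  qed (use Tw w in auto)
  have TC: "T z \<in> C" if z: "z \<in> C" for z
  proof -
    obtain a where "z = (\<Sum>i<M. a i *s w i)" using basisD(2)[OF bas z] by blast
    then have "T z = (\<Sum>i<M. a i *s T (w i))" using Tsum Tscale by simp
    also have "\<dots> \<in> C" using TwC subspace_scale[OF sC] by (intro subspace_sum[OF sC]) auto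
    finally show ?thesis .
  qed
  have gen: "\<exists>a y. y \<in> C \<and> z = a *s w 0 + T y" if z: "z \<in> C" for z
  proof -
    obtain a where a: "z = (\<Sum>i<M. a i *s w i)" using basisD(2)[OF bas z] by blast
    obtain M' where M': "M = Suc M'" using M2 by (cases M) auto
    have "z = a 0 *s w 0 + (\<Sum>i<M'. a (Suc i) *s w (Suc i))"
      unfolding a M' by (rule sum.lessThan_Suc_shift)
    also have "(\<Sum>i<M'. a (Suc i) *s w (Suc i)) = T (\<Sum>i<M'. a (Suc i) *s w i)"
      unfolding Tsum Tscale using Tw M' by simp
    finally have "z = a 0 *s w 0 + T (\<Sum>i<M'. a (Suc i) *s w i)" .
    moreover have "(\<Sum>i<M'. a (Suc i) *s w i) \<in> C"
      using w M' subspace_scale[OF sC] by (intro subspace_sum[OF sC]) auto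
    ultimately show ?thesis by blast
  qed
  have nodiv: "w i - r *s w j \<noteq> \<pi> *s y" if ij: "i < M" "j < M" "i \<noteq> j" and y: "y \<in> C" for i j r y
  proof
    assume eq: "w i - r *s w j = \<pi> *s y"
    obtain a where a: "y = (\<Sum>i<M. a i *s w i)" using basisD(2)[OF bas y] by blast
    have "(\<Sum>k<M. (if k = i then 1 else if k = j then - r else 0) *s w k) =
        (\<Sum>k<M. (if k = i then w i else 0) + (if k = j then - (r *s w j) else 0))"
      using ij by (intro sum.cong) auto
    also have "\<dots> = w i - r *s w j" using ij by (simp add: sum.distrib)
    also have "\<dots> = (\<Sum>k<M. (\<pi> * a k) *s w k)" unfolding eq a by (simp add: scale_sum_right)
    finally have "nul ((if i = i then 1 else if i = j then - r else 0) - \<pi> * a i)"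
      by (rule basis_unique[OF bas _ ij(1)])
    then have "nul (\<pi> * a i - 1)" using nul_commute[of 1 "\<pi> * a i"] by simp
    then show False using unif_not_unit by blast
  qed
  have nodiv0: "w i \<noteq> \<pi> *s y" if "i < M" "y \<in> C" for i y
    using nodiv[of i "if i = 0 then 1 else 0" y 0] that M2 by (auto split: if_splits)
  have w0: "w i \<noteq> 0" if "i < M" for i using nodiv0[OF that subspace_0[OF sC]] by auto
  \<comment> \<open>For \<open>M = 2\<close> the vector \<open>T (w 1)\<close> could vanish a
    priori, but then \<open>c\<close>, \<open>w 0\<close> and \<open>w 1\<close> would satisfy the
    Heisenberg relations.\<close>
  have TTw0: "T (T (w 0)) \<noteq> 0"
  proof
    assume "T (T (w 0)) = 0"
    then have "br c (br c (w 0)) = 0" "br (w 0) (br c (w 0)) = 0"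
      using ab[OF w[of 0] TC[OF w[of 0]]] M2 unfolding T_def by auto
    then have "br c (w 0) = 0" using no_heisenberg[OF L c] CL w[of 0] M2 by (metis less_le_trans subsetD zero_less_numeral)
    then show False using step[of 0] w0[of 1] M2 by simp
  qed
  define c2 where "c2 = \<pi> *s c"
  define N where "N = {r *s c2 + z |r z. z \<in> C}"
  have c2L: "c2 \<in> L" unfolding c2_def using subspace_scale[OF subalgD(1)[OF L(2)] c] .
  have c2T: "br c2 z = \<pi> *s T z" "br z c2 = - (\<pi> *s T z)" for z
    using br_anti[of c z] unfolding c2_def T_def by (simp_all add: br_simps)
  have subN: "subalg N" unfolding N_def
    using CL c2L subalgD(3)[OF L(2)] c2T(1) TC subspace_scale[OF sC] ab
    by (intro abelian_line_subalg sC) auto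
  note sN = subalgD(1)[OF subN]
  have NL: "N \<subseteq> L"
    unfolding N_def using CL c2L subspace_add[OF subalgD(1)[OF L(2)]] subspace_scale[OF subalgD(1)[OF L(2)]] by blast
  have CN: "C \<subseteq> N"
  proof
    fix z assume "z \<in> C"
    then have "0 *s c2 + z \<in> N" unfolding N_def by blast
    then show "z \<in> N" by simp
  qed
  have c2N: "c2 \<in> N" unfolding N_def using subspace_0[OF sC]
    by (intro CollectI exI[of _ 1] exI[of _ 0]) simp
  have ideal_in_C: "ideal_of N I" if I: "subspace I" "I \<subseteq> C" "\<And>z. z \<in> I \<Longrightarrow> \<pi> *s T z \<in> I" for I
    unfolding ideal_of_def
  proof (intro conjI ballI)
    fix x z assume "x \<in> N" and z: "z \<in> I"
    then obtain r y where x: "x = r *s c2 + y" "y \<in> C" unfolding N_def by blast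
    have "br x z = r *s (\<pi> *s T z)" unfolding x using ab[OF x(2)] z I(2) c2T by (auto simp: br_simps)
    then show "br x z \<in> I" using I(1,3) z subspace_scale by metis
  qed (use I CN in auto)
  have "N \<noteq> {0}" using CN w[of 0] w0[of 0] M2 by auto
  then show False
  proof (rule self_simE[OF L(1) subN NL])
    fix Q \<phi> assume Q: "subalg Q" "Q \<subseteq> N" "Q \<noteq> N" "partial_endo scale nul \<pi> N Q \<phi>"
      "\<And>x y. x \<in> Q \<Longrightarrow> y \<in> Q \<Longrightarrow> \<phi> (br x y) = br (\<phi> x) (\<phi> y)"
      "\<And>I. ideal_of N I \<Longrightarrow> I \<subseteq> Q \<Longrightarrow> (\<And>x. x \<in> I \<Longrightarrow> \<phi> x \<in> I) \<Longrightarrow> I = {0}"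
    interpret N: partial_endo scale nul \<pi> N Q \<phi> by (rule Q(4))
    note sQ = N.C'_subspace
    define C' where "C' = C \<inter> Q"
    have sC': "subspace C'" unfolding C'_def using subspace_inter[OF sC sQ] .
    have piC': "\<pi> *s z \<in> C'" if "z \<in> C" for z
      using that CN N.unif_C' subspace_scale[OF sC] unfolding C'_def by blast
    have \<phi>add: "\<phi> (x + y) = \<phi> x + \<phi> y" if "x \<in> Q" "y \<in> Q" for x y using lin_onD(1)[OF N.\<phi>_lin that] .
    have \<phi>scale: "\<phi> (r *s x) = r *s \<phi> x" if "x \<in> Q" for x r using lin_onD(2)[OF N.\<phi>_lin that] .
    have \<phi>0: "\<phi> 0 = 0" using lin_on_0[OF N.\<phi>_lin sQ] .
    have pc2: "\<pi> *s c2 \<in> Q" using N.unif_C' c2N by blast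
    obtain \<xi> g where \<xi>g: "\<phi> (\<pi> *s c2) = \<xi> *s c2 + g" "g \<in> C"
      using N.\<phi>_closed[OF pc2] unfolding N_def by blast
    have br_c2: "br (r *s c2 + x) (s *s c2 + y) = \<pi> *s (r *s T y - s *s T x)" if "x \<in> C" "y \<in> C" for r s x y
    proof -
      have "T c2 = 0" unfolding T_def c2_def by (simp add: br_simps)
      then show ?thesis using ab[OF that] by (simp add: br_simps c2T Tadd Tscale algebra_simps)
    qed
    have ppT: "(\<pi> * \<pi>) *s T z \<in> C'" if "z \<in> C" for z
      using piC'[OF subspace_scale[OF sC TC[OF that]], of \<pi>] by simp
    have \<phi>ppT: "\<phi> ((\<pi> * \<pi>) *s T z) = br (\<xi> *s c2 + g) (\<phi> z)" if z: "z \<in> C'" for z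
    proof -
      have "\<phi> (br (\<pi> *s c2) z) = br (\<phi> (\<pi> *s c2)) (\<phi> z)" using Q(5) pc2 z unfolding C'_def by blast
      then show ?thesis using \<xi>g(1) c2T(1)[of z] by (simp add: br_simps)
    qed
    \<comment> \<open>Suppose that some \<open>\<phi> z\<close> has a nonzero component along
      \<open>c2\<close>. Since \<open>z\<close> commutes with \<open>C'\<close>, the images of
      \<open>\<pi>\<^sup>2 T C'\<close>, which lie in \<open>C\<close>, are annihilated by
      \<open>T\<close>. Then \<open>\<pi>\<^sup>4 T T C'\<close> lies in the kernel of
      \<open>\<phi>\<close>, which is an invariant ideal and hence zero, contradicting
      \<open>TTw0\<close>.\<close>
    have \<phi>C: "\<phi> z \<in> C" if z0: "z \<in> C'" for z
    proof (rule ccontr)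
      assume nC: "\<phi> z \<notin> C"
      obtain \<beta> \<delta> where bd: "\<phi> z = \<beta> *s c2 + \<delta>" "\<delta> \<in> C"
        using N.\<phi>_closed[of z] z0 unfolding N_def C'_def by blast
      have nb: "\<not> nul \<beta>"
      proof
        assume "nul \<beta>"
        then have "\<beta> *s c2 = 0" using eff_nul lattice_eff[OF subalgD(2)[OF subN] c2N] by blast
        then show False using nC bd by simp
      qed
      have K1: "T (\<phi> (\<pi> *s (\<pi> *s T y))) = 0 \<and> \<phi> ((\<pi> * \<pi>) *s T y) \<in> C" if y: "y \<in> C'" for y
      proof -
        define z1 where "z1 = (\<pi> * \<pi>) *s T y"
        have z1: "z1 \<in> C'" unfolding z1_def using ppT y unfolding C'_def by blast
        obtain \<beta>' \<delta>' where bd': "\<phi> y = \<beta>' *s c2 + \<delta>'" "\<delta>' \<in> C"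
          using N.\<phi>_closed[of y] y unfolding N_def C'_def by blast
        have "\<phi> z1 = \<pi> *s (\<xi> *s T \<delta>' - \<beta>' *s T g)"
          unfolding z1_def \<phi>ppT[OF y] bd'(1) by (rule br_c2[OF \<xi>g(2) bd'(2)])
        moreover have "\<xi> *s T \<delta>' - \<beta>' *s T g \<in> C"
          using subspace_diff[OF sC] subspace_scale[OF sC] TC bd'(2) \<xi>g(2) by blast
        ultimately have \<phi>z1: "\<phi> z1 \<in> C" using subspace_scale[OF sC] by simp
        have "br (\<phi> z) (\<phi> z1) = \<phi> (br z z1)" using Q(5) z0 z1 unfolding C'_def by auto
        also have "\<dots> = 0" using ab z0 z1 \<phi>0 unfolding C'_def by simp
        finally have "br (\<beta> *s c2 + \<delta>) (0 *s c2 + \<phi> z1) = 0" using bd by simp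
        then have "\<pi> *s (\<beta> *s T (\<phi> z1)) = 0" using br_c2[OF bd(2) \<phi>z1, of \<beta> 0] by simp
        then have "(\<pi> * \<beta>) *s T (\<phi> z1) = 0" by simp
        then have "T (\<phi> z1) = 0"
          using lattice_torsion_free[OF latC TC[OF \<phi>z1]] nul_prime unif_not_nul nb by blast
        then show ?thesis using \<phi>z1 unfolding z1_def by simp
      qed
      \<comment> \<open>As \<open>\<phi> (\<pi>\<^sup>2 T y)\<close> is the bracket of
        \<open>\<phi> (\<pi> c2)\<close> with \<open>\<phi> y\<close>, this kernel is stable under
        \<open>\<pi> T\<close> and so is an ideal of \<open>N\<close>.\<close>
      define K where "K = {y \<in> C'. \<phi> y = 0}"
      have "subspace K" unfolding K_def
      proof (rule subspaceI)
        show "0 \<in> {y \<in> C'. \<phi> y = 0}" using subspace_0[OF sC'] \<phi>0 by simp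
      next
        fix x y assume "x \<in> {y \<in> C'. \<phi> y = 0}" "y \<in> {y \<in> C'. \<phi> y = 0}"
        then show "x + y \<in> {y \<in> C'. \<phi> y = 0}" using subspace_add[OF sC'] \<phi>add unfolding C'_def by auto
      next
        fix r x assume "x \<in> {y \<in> C'. \<phi> y = 0}"
        then show "r *s x \<in> {y \<in> C'. \<phi> y = 0}" using subspace_scale[OF sC'] \<phi>scale unfolding C'_def by auto
      qed
      moreover have "K \<subseteq> C" unfolding K_def C'_def by blast
      moreover have "\<pi> *s T y \<in> K" if y: "y \<in> K" for y
      proof -
        have yC: "y \<in> C'" "y \<in> C" "\<phi> y = 0" using y unfolding K_def C'_def by auto
        have pT: "\<pi> *s T y \<in> C'" using piC' TC yC by blast
        have "\<pi> *s \<phi> (\<pi> *s T y) = \<phi> ((\<pi> * \<pi>) *s T y)" using \<phi>scale[of "\<pi> *s T y" \<pi>] pT unfolding C'_def by simp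
        also have "\<dots> = 0" using \<phi>ppT[OF yC(1)] yC(3) by simp
        finally have "\<phi> (\<pi> *s T y) = 0"
          using lattice_torsion_free[OF N.C_lattice N.\<phi>_closed] unif_not_nul pT unfolding C'_def by blast
        then show ?thesis using pT unfolding K_def by blast
      qed
      ultimately have "ideal_of N K" using ideal_in_C by blast
      moreover have "K \<subseteq> Q" unfolding K_def C'_def by blast
      moreover have "\<phi> x \<in> K" if "x \<in> K" for x
        using that subspace_0[OF \<open>subspace K\<close>] unfolding K_def by auto
      ultimately have K0: "K = {0}" using Q(6) by blast
      define z1 where "z1 = (\<pi> * \<pi>) *s T (\<pi> *s w 0)"
      have pw: "\<pi> *s w 0 \<in> C'" using piC' w M2 by simp
      have z1: "z1 \<in> C'" unfolding z1_def using ppT pw unfolding C'_def by blast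
      have \<phi>z1: "T (\<phi> z1) = 0" "\<phi> z1 \<in> C" using K1[OF pw] unfolding z1_def by auto
      have "\<phi> ((\<pi> * \<pi>) *s T z1) = br (\<xi> *s c2 + g) (\<phi> z1)" using \<phi>ppT[OF z1] by simp
      also have "\<dots> = 0" using br_c2[OF \<xi>g(2) \<phi>z1(2), of \<xi> 0] \<phi>z1(1) by simp
      finally have "(\<pi> * \<pi>) *s T z1 \<in> K" using ppT z1 unfolding K_def C'_def by blast
      then have "(\<pi> * \<pi>) *s T z1 = 0" using K0 by blast
      then have "\<pi> ^ 5 *s T (T (w 0)) = 0"
        unfolding z1_def by (simp add: Tscale eval_nat_numeral algebra_simps)
      then show False using lattice_power_cancel[OF latC TC[OF TC[OF w]]] TTw0 M2 by simp
    qed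
    \<comment> \<open>Otherwise \<open>\<phi>C\<close> makes \<open>C\<close> itself a nonzero
      invariant ideal.\<close>
    have "\<not> C \<subseteq> Q"
    proof
      assume "C \<subseteq> Q"
      then have "C' = C" unfolding C'_def by blast
      then have "C = {0}" using ideal_in_C[of C] sC TC subspace_scale[OF sC] Q(6)[of C] \<phi>C \<open>C \<subseteq> Q\<close> by auto
      then show False using w[of 0] w0[of 0] M2 by auto
    qed
    then obtain z0 where z0: "z0 \<in> C" "z0 \<notin> Q" by blast
    \<comment> \<open>Subtracting an element of the abelian \<open>C\<close> moves \<open>c2\<close>
      into the domain and does not change its action on \<open>C\<close>. The coefficient
      \<open>u\<close> of the image is the factor up to which \<open>\<phi>\<close> commutes with
      \<open>\<pi> T\<close>.\<close>
    obtain r0 where r0: "c2 - r0 *s z0 \<in> Q" using N.cyclic[of z0 c2] z0 CN c2N by blast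
    obtain u g1 where ug: "\<phi> (c2 - r0 *s z0) = u *s c2 + g1" "g1 \<in> C"
      using N.\<phi>_closed[OF r0] unfolding N_def by blast
    have \<phi>T: "\<phi> (\<pi> *s T z) = u *s (\<pi> *s T (\<phi> z))" if z: "z \<in> C'" for z
    proof -
      have zC: "z \<in> C" "z \<in> Q" using z unfolding C'_def by auto
      have "br (c2 - r0 *s z0) z = \<pi> *s T z" using ab[OF z0(1) zC(1)] c2T by (simp add: br_simps)
      then have "\<phi> (\<pi> *s T z) = br (u *s c2 + g1) (\<phi> z)" using Q(5)[OF r0 zC(2)] ug(1) by simp
      also have "\<dots> = u *s (\<pi> *s T (\<phi> z))" using ab[OF ug(2) \<phi>C[OF z]] c2T by (simp add: br_simps)
      finally show ?thesis .
    qed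
    interpret D: partial_endo scale nul \<pi> C C' \<phi>
    proof
      show "\<exists>r. y - r *s x \<in> C'" if xy: "x \<in> C" "x \<notin> C'" "y \<in> C" for x y
      proof -
        obtain r where "y - r *s x \<in> Q" using N.cyclic[of x y] xy CN unfolding C'_def by blast
        moreover have "y - r *s x \<in> C" using xy subspace_diff[OF sC] subspace_scale[OF sC] by blast
        ultimately show ?thesis unfolding C'_def by blast
      qed
      show "lin_on C' \<phi>" using lin_on_subset[OF N.\<phi>_lin] unfolding C'_def by blast
    qed (use latC sC' piC' \<phi>C in \<open>auto simp: C'_def\<close>)
    have iterT: "z \<in> D.depth_ge n \<Longrightarrow> \<pi> *s T z \<in> D.depth_ge n \<and> (\<phi> ^^ n) (\<pi> *s T z) = u ^ n *s (\<pi> *s T ((\<phi> ^^ n) z))" for z n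
    proof (induction n arbitrary: z)
      case 0 then show ?case using TC subspace_scale[OF sC] by simp
    next
      case (Suc n)
      then have z: "z \<in> C'" "\<phi> z \<in> D.depth_ge n" using D.depth_ge_Suc by auto
      have IH: "\<pi> *s T (\<phi> z) \<in> D.depth_ge n" "(\<phi> ^^ n) (\<pi> *s T (\<phi> z)) = u ^ n *s (\<pi> *s T ((\<phi> ^^ n) (\<phi> z)))"
        using Suc.IH[OF z(2)] by auto
      have eq: "\<phi> (\<pi> *s T z) = u *s (\<pi> *s T (\<phi> z))" using \<phi>T[OF z(1)] .
      have "\<pi> *s T z \<in> D.depth_ge (Suc n)"
        unfolding D.depth_ge_Suc eq
        using piC' TC z(1) D.C'_subset IH(1) subspace_scale[OF D.depth_ge_subspace] by blast
      moreover have "(\<phi> ^^ Suc n) (\<pi> *s T z) = (\<phi> ^^ n) (u *s (\<pi> *s T (\<phi> z)))"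
        by (simp add: funpow_swap1 eq)
      then have "(\<phi> ^^ Suc n) (\<pi> *s T z) = u *s (u ^ n *s (\<pi> *s T ((\<phi> ^^ n) (\<phi> z))))"
        using lin_onD(2)[OF D.\<phi>_power_lin IH(1)] IH(2) by simp
      ultimately show ?case by (simp add: funpow_swap1 mult.assoc)
    qed
    have core_zero: "D.core = {0}" if "\<And>z. z \<in> D.core \<Longrightarrow> \<pi> *s T z \<in> D.core"
      using Q(6)[of D.core] ideal_in_C[OF D.core_subspace D.core_subset(1) that] D.core_subset(2) D.\<phi>_core
      unfolding C'_def by blast
    have core0: "D.core = {0}"
    proof (rule core_zero)
      fix z assume "z \<in> D.core" then show "\<pi> *s T z \<in> D.core" using iterT D.core_iff by blast
    qed
    have wi: "w 0 \<in> C" "w 0 \<noteq> 0" "\<pi> *s w 0 \<noteq> 0"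
      using w[of 0] w0[of 0] M2 lattice_torsion_free[OF latC w[of 0], of \<pi>] unif_not_nul by auto
    then have "\<not> (\<forall>x\<in>C. \<pi> *s x \<in> D.core)" using core0 by blast
    then obtain m where mm: "m \<ge> 1" "\<forall>n. \<forall>x\<in>C. \<pi> *s x \<in> D.depth_ge (n + m) \<longleftrightarrow> x \<in> D.depth_ge n"
      using D.depth_dichotomy by blast
    then have m: "m \<ge> 1" "\<And>n x. x \<in> C \<Longrightarrow> \<pi> *s x \<in> D.depth_ge (n + m) \<longleftrightarrow> x \<in> D.depth_ge n"
      by blast+
    have piD: "\<exists>y\<in>C. x = \<pi> *s y" if "x \<in> D.depth_ge m" for x
      using D.depth_eq_unif[OF mm core0 that] .
    note pw = D.unif_power_raises[OF mm] and pd = D.unif_power_depth[OF mm]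
    have Tw0: "T (w 0) \<in> C" "T (w 0) \<noteq> 0" using TC wi(1) TTw0 T0 by auto
    \<comment> \<open>If \<open>\<pi>\<close> divided \<open>u\<close>, then
      \<open>\<phi> ^^ n\<close> would send \<open>\<pi> T z\<close> to a multiple of
      \<open>\<pi> ^ Suc n\<close> for each \<open>z\<close> of depth at least \<open>n\<close>.
      Taking \<open>n = k * m\<close> and \<open>z\<close> the multiple of \<open>w 0\<close> by
      \<open>\<pi> ^ k\<close>, the depth of \<open>T (w 0)\<close> exceeds every bound.\<close>
    have u: "\<not> nul (u - \<pi> * s)" for s
    proof
      assume us: "nul (u - \<pi> * s)"
      have "T (w 0) \<in> D.depth_ge (k * m * m)" for k
      proof -
        let ?n = "k * m" and ?z = "\<pi> ^ k *s w 0"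
        have z: "?z \<in> D.depth_ge ?n" using pd[OF wi(1)] .
        let ?y = "T ((\<phi> ^^ ?n) ?z)"
        have yC: "?y \<in> C" using TC D.\<phi>_power_closed[OF z] .
        have us': "u *s v = (\<pi> * s) *s v" if "v \<in> C" for v using eff_cong[OF lattice_eff[OF latC that] us] .
        have un: "u ^ n *s v = \<pi> ^ n *s (s ^ n *s v)" if v: "v \<in> C" for n v
        proof (induction n)
          case (Suc n)
          have "u ^ Suc n *s v = u *s (\<pi> ^ n *s (s ^ n *s v))" using Suc by (metis power_Suc scale_scale)
          also have "\<dots> = (\<pi> * s) *s (\<pi> ^ n *s (s ^ n *s v))"
            using us' subspace_scale[OF sC] v by blast
          finally show ?case by (simp add: algebra_simps)
        qed simp
        have "(\<phi> ^^ ?n) (\<pi> *s T ?z) = u ^ ?n *s (\<pi> *s ?y)" using iterT[OF z] by blast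
        also have "\<dots> = \<pi> ^ (Suc ?n) *s (s ^ ?n *s ?y)"
          using un[OF subspace_scale[OF sC yC]] by (simp add: algebra_simps)
        also have "\<dots> \<in> D.depth_ge (Suc ?n * m)" using pd subspace_scale[OF sC yC] by blast
        finally have "\<pi> *s T ?z \<in> D.depth_ge (?n + Suc ?n * m)"
          using D.depth_ge_add iterT[OF z] by blast
        then have "\<pi> ^ Suc k *s T (w 0) \<in> D.depth_ge (?n * m + Suc k * m)"
          by (simp add: Tscale algebra_simps)
        then have "T (w 0) \<in> D.depth_ge (?n * m)" using pw[OF Tw0(1)] by blast
        then show ?thesis by simp
      qed
      moreover have "k \<le> k * m * m" for k using m(1) by simp
      ultimately have "T (w 0) \<in> D.depth_ge k" for k using D.depth_ge_mono by blast
      then have "T (w 0) \<in> D.core" using D.core_iff by blast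
      then show False using core0 Tw0(2) by blast
    qed
    then obtain u' where u': "nul (u * u' - 1)" using unit_or_div by blast
    have uinv: "u' ^ n *s (u ^ n *s v) = v" if v: "v \<in> C" for v n
    proof (induction n)
      case (Suc n)
      have "u' ^ Suc n *s (u ^ Suc n *s v) = (u * u') *s (u' ^ n *s (u ^ n *s v))" by (simp add: algebra_simps)
      also have "\<dots> = v" using Suc eff_cong[OF lattice_eff[OF latC v] u'] by simp
      finally show ?case .
    qed simp
    \<comment> \<open>The least depth of a vector in the image of \<open>T\<close>. As for
      \<open>\<pi>\<close> in \<open>depth_dichotomy\<close>, it follows that \<open>T\<close>
      raises every finite depth by exactly \<open>t\<close>; inverting \<open>u\<close> replaces
      commutation with \<open>\<phi>\<close>.\<close>
    define t where "t = (LEAST t. \<exists>z\<in>C. T z \<notin> D.depth_ge (Suc t))"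
    obtain t1 where "T (w 0) \<notin> D.depth_ge (Suc t1)"
      using core0 Tw0 D.core_iff D.depth_ge_mono by (metis le_Suc_eq order_refl singletonD subsetD)
    then have "\<exists>z\<in>C. T z \<notin> D.depth_ge (Suc t1)" using wi(1) by blast
    then have "\<exists>z\<in>C. T z \<notin> D.depth_ge (Suc t)" unfolding t_def by (rule LeastI)
    then obtain zt where zt: "zt \<in> C" "T zt \<notin> D.depth_ge (Suc t)" by blast
    have Tt: "T z \<in> D.depth_ge t" if "z \<in> C" for z
      using not_less_Least[of "t - 1" "\<lambda>t. \<exists>z\<in>C. T z \<notin> D.depth_ge (Suc t)"] TC that
      unfolding t_def[symmetric] by (cases t) auto
    have up: "T z \<in> D.depth_ge (n + t)" if z: "z \<in> D.depth_ge n" for z n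
    proof -
      have zC: "z \<in> C" using z D.depth_ge_subset by blast
      have "\<pi> *s T ((\<phi> ^^ n) z) \<in> D.depth_ge (t + m)"
        using Tt[OF D.\<phi>_power_closed[OF z]] m(2) D.depth_ge_subset by blast
      then have "(\<phi> ^^ n) (\<pi> *s T z) \<in> D.depth_ge (t + m)"
        using iterT[OF z] subspace_scale[OF D.depth_ge_subspace] by metis
      then have "\<pi> *s T z \<in> D.depth_ge (n + (t + m))" using D.depth_ge_add iterT[OF z] by blast
      then show ?thesis using m(2)[OF TC[OF zC], of "n + t"] by (simp add: add.assoc)
    qed
    have exact: "T z \<notin> D.depth_ge (Suc (j + t))" if z: "z \<in> D.depth_ge j" "z \<notin> D.depth_ge (Suc j)" for z j
    proof
      assume a: "T z \<in> D.depth_ge (Suc (j + t))"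
      have zC: "z \<in> C" using z D.depth_ge_subset by blast
      define y where "y = (\<phi> ^^ j) z"
      have y: "y \<in> C" "y \<notin> C'"
        using z D.\<phi>_power_closed D.depth_ge_add[of z j 1] D.depth_ge_1 unfolding y_def by auto
      have "\<pi> *s T z \<in> D.depth_ge (j + (Suc t + m))" using a m(2)[OF TC[OF zC], of "Suc (j + t)"] by (simp add: ac_simps)
      then have "u ^ j *s (\<pi> *s T y) \<in> D.depth_ge (Suc t + m)"
        using D.depth_ge_add iterT[OF z(1)] unfolding y_def by metis
      then have "u' ^ j *s (u ^ j *s (\<pi> *s T y)) \<in> D.depth_ge (Suc t + m)"
        by (rule subspace_scale[OF D.depth_ge_subspace])
      then have "\<pi> *s T y \<in> D.depth_ge (Suc t + m)"
        using uinv[OF subspace_scale[OF sC TC[OF y(1)]]] by metis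
      then have Ty: "T y \<in> D.depth_ge (Suc t)" using m(2)[OF TC[OF y(1)]] by blast
      obtain r where "zt - r *s y \<in> C'" using D.cyclic y zt(1) by blast
      then have "T (zt - r *s y) \<in> D.depth_ge (Suc t)" using up[of _ 1] D.depth_ge_1 by simp
      then have "T (zt - r *s y) + r *s T y \<in> D.depth_ge (Suc t)"
        using Ty subspace_add[OF D.depth_ge_subspace] subspace_scale[OF D.depth_ge_subspace] by blast
      then show False using zt(2) by (simp add: Tdiff Tscale)
    qed
    \<comment> \<open>Depth at least \<open>m\<close> forces divisibility by \<open>\<pi>\<close>,
      so \<open>w 0\<close> has a depth \<open>a < m\<close> and \<open>w i\<close> has depth
      \<open>a + i * t\<close>. One more application of \<open>T\<close> gives depth
      \<open>a + M * t\<close>, while divisibility by \<open>\<pi>\<^sup>2\<close> gives at least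
      \<open>2 * m\<close>.\<close>
    have "w 0 \<notin> D.depth_ge m" using piD nodiv0[of 0] M2 by fastforce
    then obtain a where a: "a < m" "w 0 \<in> D.depth_ge a" "w 0 \<notin> D.depth_ge (Suc a)"
      using D.exact_depth[OF wi(1)] by metis
    have exw: "w i \<in> D.depth_ge (a + i * t) \<and> w i \<notin> D.depth_ge (Suc (a + i * t))" if "i < M" for i
      using that
    proof (induction i)
      case 0 then show ?case using a by simp
    next
      case (Suc i)
      then have IH: "w i \<in> D.depth_ge (a + i * t)" "w i \<notin> D.depth_ge (Suc (a + i * t))" by auto
      have "a + Suc i * t = a + i * t + t" by simp
      then show ?case using up[OF IH(1)] exact[OF IH] Tw[of i] Suc.prems by metis
    qed
    obtain zl where zl: "zl \<in> C" "T (w (M - 1)) = (\<pi> * \<pi>) *s zl" using last unfolding T_def by blast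
    have "T (w (M - 1)) \<in> D.depth_ge (2 * m)"
      using pd[OF zl(1), of 2] zl(2) by (simp add: power2_eq_square)
    moreover have "T (w (M - 1)) \<notin> D.depth_ge (Suc (a + (M - 1) * t + t))"
      using exact exw[of "M - 1"] M2 by simp
    moreover have "a + (M - 1) * t + t = a + M * t" using M2 by (cases M) auto
    ultimately have len: "2 * m \<le> a + M * t"
      using D.depth_ge_mono[of "Suc (a + M * t)" "2 * m"] by (metis not_less_eq_eq subsetD)
    have t1: "t \<ge> 1" using len a(1) by (cases t) auto
    have TC1: "T y \<in> C'" if "y \<in> C" for y
      using Tt[OF that] D.depth_ge_mono[OF t1] D.depth_ge_1 by auto
    \<comment> \<open>\<open>w 0\<close> generates \<open>C\<close> modulo the image of
      \<open>T\<close>, and this image lies in the proper submodule \<open>C'\<close>.\<close>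
    have w0C': "w 0 \<notin> C'"
    proof
      assume "w 0 \<in> C'"
      then have "C \<subseteq> C'" using gen TC1 subspace_add[OF sC'] subspace_scale[OF sC'] by blast
      then show False using \<open>\<not> C \<subseteq> Q\<close> unfolding C'_def by blast
    qed
    then have a0: "a = 0" using a(2) D.depth_ge_mono[of 1 a] D.depth_ge_1 by (cases a) auto
    have m2: "m \<ge> 2"
    proof (rule ccontr)
      assume "\<not> m \<ge> 2"
      then have "m = 1" using m(1) by simp
      moreover obtain r where "w 1 - r *s w 0 \<in> C'" using D.cyclic[OF wi(1) w0C' w[of 1]] M2 by auto
      ultimately show False using piD[of "w 1 - r *s w 0"] nodiv[of 1 0] M2 D.depth_ge_1 by auto
    qed
    \<comment> \<open>If \<open>t \<ge> 2\<close>, a vector of \<open>C'\<close> is a multiple of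
      \<open>\<pi> *s w 0\<close> plus a vector in the image of \<open>T\<close>, and both have
      depth at least 2. So \<open>\<phi>\<close> would preserve \<open>C'\<close>, which would lie
      in the trivial core.\<close>
    have "t = 1"
    proof (rule ccontr)
      assume "t \<noteq> 1"
      then have t2: "t \<ge> 2" using t1 by simp
      have "x \<in> D.depth_ge 2" if x: "x \<in> C'" for x
      proof -
        obtain b y where bY: "y \<in> C" "x = b *s w 0 + T y" using gen x D.C'_subset by blast
        have "b *s w 0 = x - T y" using bY(2) by simp
        then have bw: "b *s w 0 \<in> C'" using subspace_diff[OF sC' x TC1[OF bY(1)]] by simp
        have "\<exists>s. nul (b - \<pi> * s)"
        proof (rule ccontr)
          assume "\<nexists>s. nul (b - \<pi> * s)"
          then obtain b' where b': "nul (b * b' - 1)" using unit_or_div by blast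
          have "b' *s (b *s w 0) \<in> C'" using subspace_scale[OF sC' bw] .
          then show False using w0C' eff_cong[OF lattice_eff[OF latC wi(1)] b'] by (simp add: mult.commute)
        qed
        then obtain s where "nul (b - \<pi> * s)" by blast
        then have "b *s w 0 = \<pi> *s (s *s w 0)" using eff_cong[OF lattice_eff[OF latC wi(1)]] by simp
        also have "\<dots> \<in> D.depth_ge m" using D.unif_in_depth[OF mm] subspace_scale[OF sC wi(1)] by blast
        finally have "b *s w 0 \<in> D.depth_ge 2" using D.depth_ge_mono[OF m2] by blast
        moreover have "T y \<in> D.depth_ge 2" using Tt[OF bY(1)] D.depth_ge_mono[OF t2] by blast
        ultimately show ?thesis using bY(2) subspace_add[OF D.depth_ge_subspace] by simp
      qed
      then have fwd: "\<phi> x \<in> C'" if "x \<in> C'" for x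
        using that D.depth_ge_Suc[of x 1] D.depth_ge_1 by (simp add: numeral_2_eq_2)
      have "x \<in> D.core" if x: "x \<in> C'" for x
      proof -
        have "(\<phi> ^^ i) x \<in> C'" for i by (induction i) (use x fwd in auto)
        then show ?thesis using x D.C'_subset unfolding D.core_def by blast
      qed
      then show False using core0 piC'[OF wi(1)] wi(3) by blast
    qed
    then have mM: "m < M" using len a0 m2 by simp
    then have "w m \<in> D.depth_ge m" using exw[of m] a0 \<open>t = 1\<close> by simp
    then show False using piD[of "w m"] nodiv0[OF mM] by blast
  qed
qed

text \<open>Over the field of fractions, let \<open>M\<close> be the degree of the minimal
  polynomial of \<open>br c\<close> at \<open>v\<close>. For \<open>M \<ge> 2\<close>, rescaling by
  powers of \<open>\<pi>\<close> yields the configuration excluded by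
  \<open>no_cyclic_action\<close>. So \<open>M = 1\<close>, and \<open>v\<close> is an eigenvector
  whose eigenvalue is integral, because otherwise \<open>v\<close> would be divisible by every power
  of \<open>\<pi>\<close>.\<close>

lemma line_action_scalar:
  assumes L: "hereditary L" "subalg L" and c: "c \<in> L" and A: "subspace A" "A \<subseteq> L"
    and ab: "\<And>x y. x \<in> A \<Longrightarrow> y \<in> A \<Longrightarrow> br x y = 0"
    and cA: "\<And>x. x \<in> A \<Longrightarrow> br c x \<in> A" and v: "v \<in> A"
  shows "\<exists>q. br c v = q *s v"
proof (cases "v = 0")
  case False
  define T where "T i = (br c ^^ i) v" for i
  have TS: "br c (T i) = T (Suc i)" for i unfolding T_def by simp
  have TA: "T i \<in> A" for i unfolding T_def by (induction i) (use v cA in auto)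
  have AG: "A \<subseteq> G" using A(2) subalgD(3)[OF L(2)] by blast
  have latA: "lattice A" using lattice_submodule[OF ambient_lattice A(1) AG] .
  define S where "S k = range (\<lambda>d. \<Sum>i<k. d i *s T i)" for k :: nat
  have S_mono: "S k \<subseteq> S k'" if "k \<le> k'" for k k'
  proof
    fix x assume "x \<in> S k"
    then obtain d where d: "x = (\<Sum>i<k. d i *s T i)" unfolding S_def by blast
    have "x = (\<Sum>i<k'. (if i < k then d i else 0) *s T i)" unfolding d
      using that by (intro sum.mono_neutral_cong_left) auto
    then show "x \<in> S k'" unfolding S_def by (rule range_eqI[where x = "\<lambda>i. if i < k then d i else 0"])
  qed
  have S_add: "x + y \<in> S k" if xy: "x \<in> S k" "y \<in> S k" for x y k
  proof -
    obtain d d' where "x = (\<Sum>i<k. d i *s T i)" "y = (\<Sum>i<k. d' i *s T i)" using xy unfolding S_def by blast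
    then have "x + y = (\<Sum>i<k. (d i + d' i) *s T i)" by (simp add: sum.distrib scale_left_distrib)
    then show ?thesis unfolding S_def by (rule range_eqI[where x = "\<lambda>i. d i + d' i"])
  qed
  have S_scale: "r *s x \<in> S k" if x: "x \<in> S k" for x r k
  proof -
    obtain d where "x = (\<Sum>i<k. d i *s T i)" using x unfolding S_def by blast
    then have "r *s x = (\<Sum>i<k. (r * d i) *s T i)" by (simp add: scale_sum_right)
    then show ?thesis unfolding S_def by (rule range_eqI[where x = "\<lambda>i. r * d i"])
  qed
  \<comment> \<open>The span of all iterates \<open>T i\<close>. As a submodule of a lattice it is
    finitely generated, so it equals some \<open>S K\<close>, and this produces a linear relation
    for \<open>T K\<close>.\<close>
  define U where "U = (\<Union>k. S k)"
  have "subspace U"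
  proof (rule subspaceI)
    show "0 \<in> U" unfolding U_def S_def by (auto intro!: exI[of _ 0])
    show "x + y \<in> U" if xy: "x \<in> U" "y \<in> U" for x y
    proof -
      obtain k k' where "x \<in> S k" "y \<in> S k'" using xy unfolding U_def by blast
      then have "x \<in> S (max k k')" "y \<in> S (max k k')"
        using S_mono[of k "max k k'"] S_mono[of k' "max k k'"] by auto
      then have "x + y \<in> S (max k k')" by (rule S_add)
      then show ?thesis unfolding U_def by blast
    qed
    show "r *s x \<in> U" if "x \<in> U" for x r using that S_scale unfolding U_def by blast
  qed
  moreover have "U \<subseteq> A"
    unfolding U_def S_def using TA subspace_scale[OF A(1)] by (auto intro!: subspace_sum[OF A(1)])
  ultimately have "lattice U" using lattice_submodule[OF latA] by blast
  then obtain n b where b: "basis n b U" unfolding lattice_def by blast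
  have "\<forall>i. \<exists>k. i < n \<longrightarrow> b i \<in> S k" using basis_mem[OF b] unfolding U_def by blast
  from choice[OF this] obtain k where k: "\<And>i. i < n \<Longrightarrow> b i \<in> S (k i)" by blast
  define K where "K = (\<Sum>i<n. k i)"
  have bK: "b i \<in> S K" if "i < n" for i
  proof -
    have "k i \<le> K" unfolding K_def using that by (intro member_le_sum) auto
    then show ?thesis using k that S_mono by blast
  qed
  have "T K \<in> S (Suc K)"
  proof -
    have "T K = (\<Sum>i<Suc K. (if i = K then 1 else 0) *s T i)" by simp
    then show ?thesis unfolding S_def by (rule range_eqI[where x = "\<lambda>i. if i = K then 1 else 0"])
  qed
  then obtain a where "T K = (\<Sum>i<n. a i *s b i)" using basisD(2)[OF b] unfolding U_def by blast
  moreover have "(\<Sum>i<m. a i *s b i) \<in> S K" if "m \<le> n" for m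
    using that
  proof (induction m)
    case 0 show ?case using S_scale[OF S_add, of 0] by (auto simp: S_def intro!: range_eqI[of _ _ "\<lambda>_. 0"])
  next
    case (Suc m) then show ?case using S_add S_scale bK by simp
  qed
  ultimately have "T K \<in> S K" by simp
  then obtain d0 where "T K = (\<Sum>i<K. d0 i *s T i)" unfolding S_def by blast
  then have "\<exists>r d. \<not> nul r \<and> r *s T K = (\<Sum>i<K. d i *s T i)"
    using unif_not_nul by (intro exI[of _ 1] exI[of _ d0]) simp
  define M where "M = (LEAST M. \<exists>r d. \<not> nul r \<and> r *s T M = (\<Sum>i<M. d i *s T i))"
  have "\<exists>r d. \<not> nul r \<and> r *s T M = (\<Sum>i<M. d i *s T i)"
    unfolding M_def by (rule LeastI) fact
  then obtain r d where rd: "\<not> nul r" "r *s T M = (\<Sum>i<M. d i *s T i)" by blast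
  have least: "nul r" if "k < M" "r *s T k = (\<Sum>i<k. d i *s T i)" for k r d
    using not_less_Least[of k "\<lambda>M. \<exists>r d. \<not> nul r \<and> r *s T M = (\<Sum>i<M. d i *s T i)"] that
    unfolding M_def[symmetric] by blast
  obtain e w where ew: "nul (w * r - \<pi> ^ e)" using not_nul_power[OF rd(1)] by blast
  have "(w * r) *s T M = (\<Sum>i<M. (w * d i) *s T i)"
    using arg_cong[OF rd(2), of "\<lambda>x. w *s x"] by (simp add: scale_sum_right)
  then have rel: "\<pi> ^ e *s T M = (\<Sum>i<M. (w * d i) *s T i)"
    using eff_cong[OF lattice_eff[OF latA TA] ew] by simp
  have "M \<noteq> 0"
  proof
    assume "M = 0"
    then have "\<pi> ^ e *s v = 0" using rel by (simp add: T_def)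
    then show False using lattice_power_cancel[OF latA v] False by blast
  qed
  have "\<not> M \<ge> 2"
  proof
    assume M2: "M \<ge> 2"
    \<comment> \<open>The exponent \<open>e + 2\<close> makes the relation monic with coefficients
      divisible by \<open>\<pi>\<^sup>2\<close>: the factor \<open>\<pi> ^ (j * M)\<close> in
      \<open>W M\<close> pays for \<open>\<pi> ^ e\<close>, for the \<open>\<pi> ^ (j * i)\<close>
      in each earlier \<open>W i\<close>, and for two more factors.\<close>
    define j where "j = e + 2"
    define c' where "c' = \<pi> ^ j *s c"
    define W where "W i = \<pi> ^ (j * i) *s T i" for i
    define C where "C = range (\<lambda>a. \<Sum>i<M. a i *s W i)"
    have WA: "W i \<in> A" for i unfolding W_def using TA subspace_scale[OF A(1)] by blast
    have CA: "C \<subseteq> A" unfolding C_def using WA subspace_scale[OF A(1)] by (auto intro!: subspace_sum[OF A(1)])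
    have ind: "\<forall>i<m. nul (a i)" if "m \<le> M" "(\<Sum>i<m. a i *s W i) = 0" for m a
      using that
    proof (induction m)
      case (Suc m)
      have "(- (a m * \<pi> ^ (j * m))) *s T m = (\<Sum>i<m. (a i * \<pi> ^ (j * i)) *s T i)"
        using Suc.prems(2) unfolding W_def by (simp add: add.commute neg_eq_iff_add_eq_0)
      then have "nul (- (a m * \<pi> ^ (j * m)))" using least Suc.prems(1) by (metis Suc_le_lessD)
      then have am: "nul (a m)" using nul_minus[of "- (a m * \<pi> ^ (j * m))"] nul_prime unif_power_not_nul by auto
      then have "(\<Sum>i<m. a i *s W i) = 0"
        using Suc.prems(2) eff_nul[OF lattice_eff[OF latA WA]] by simp
      then show ?case using Suc.IH Suc.prems(1) am by (auto simp: less_Suc_eq)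
    qed simp
    have bas: "basis M W C"
      unfolding basis_def C_def using ind[of M] lattice_eff[OF latA WA] by simp
    have stp: "br c' (W i) = W (Suc i)" for i
      unfolding c'_def W_def by (simp add: br_simps TS power_add algebra_simps)
    have "br c' (W (M - 1)) = W M" using stp[of "M - 1"] M2 by simp
    also have "\<dots> = \<pi> ^ (j * M - e) *s (\<pi> ^ e *s T M)"
    proof -
      have "e * 1 \<le> j * M" using M2 unfolding j_def by (intro mult_le_mono) auto
      then show ?thesis unfolding W_def by (simp flip: power_add)
    qed
    also have "\<dots> = (\<pi> * \<pi>) *s (\<Sum>i<M. (w * d i * \<pi> ^ (j * M - e - 2 - j * i)) *s W i)"
      unfolding rel scale_sum_right
    proof (rule sum.cong[OF refl])
      fix i assume "i \<in> {..<M}"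
      then have "Suc i \<le> M" by simp
      then have "j * Suc i \<le> j * M" by (rule mult_le_mono2)
      then have "e + 2 + j * i \<le> j * M" unfolding j_def by simp
      then have ex: "j * M - e = 2 + (j * M - e - 2 - j * i) + j * i" by linarith
      have "\<pi> ^ (j * M - e) = \<pi> * \<pi> * \<pi> ^ (j * M - e - 2 - j * i) * \<pi> ^ (j * i)"
        by (subst ex) (simp add: power_add power2_eq_square)
      then show "\<pi> ^ (j * M - e) *s (w * d i) *s T i =
          (\<pi> * \<pi>) *s (w * d i * \<pi> ^ (j * M - e - 2 - j * i)) *s W i"
        unfolding W_def by (simp add: algebra_simps)
    qed
    finally have "br c' (W (M - 1)) =
      (\<pi> * \<pi>) *s (\<Sum>i<M. (w * d i * \<pi> ^ (j * M - e - 2 - j * i)) *s W i)" .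
    then have lst: "\<exists>z\<in>C. br c' (W (M - 1)) = (\<pi> * \<pi>) *s z"
      by (rule bexI) (unfold C_def, rule range_eqI[where x = "\<lambda>i. w * d i * \<pi> ^ (j * M - e - 2 - j * i)"], rule refl)
    have c'L: "c' \<in> L" unfolding c'_def using subspace_scale[OF subalgD(1)[OF L(2)] c] .
    show False
    proof (rule no_cyclic_action[OF L c'L _ _ bas M2 stp lst])
      show "C \<subseteq> L" using CA A(2) by blast
      show "br x y = 0" if "x \<in> C" "y \<in> C" for x y using ab that CA by blast
    qed
  qed
  then have M1: "M = 1" using \<open>M \<noteq> 0\<close> by simp
  define d' where "d' = w * d 0"
  have rel1: "\<pi> ^ e *s br c v = d' *s v" using rel unfolding M1 T_def d'_def by simp
  show ?thesis
  proof (cases "nul d'")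
    case True
    then have "\<pi> ^ e *s br c v = 0" using rel1 eff_nul[OF lattice_eff[OF latA v]] by simp
    then have "br c v = 0 *s v" using lattice_power_cancel[OF latA cA[OF v]] by simp
    then show ?thesis ..
  next
    case nd: False
    obtain f u u' where fu: "nul (d' - \<pi> ^ f * u)" "nul (u * u' - 1)" using factor[OF nd] by blast
    have rel2: "\<pi> ^ e *s br c v = \<pi> ^ f *s (u *s v)"
      using rel1 eff_cong[OF lattice_eff[OF latA v] fu(1)] by simp
    have uv: "u *s v \<in> A" "u' *s (u *s v) = v"
      using subspace_scale[OF A(1) v] eff_cong[OF lattice_eff[OF latA v] fu(2)] by (auto simp: mult.commute)
    show ?thesis
    proof (cases "e \<le> f")
      case True
      then have "\<pi> ^ e *s br c v = \<pi> ^ e *s (\<pi> ^ (f - e) *s (u *s v))"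
        using rel2 by (simp flip: power_add mult.assoc)
      then have "br c v = \<pi> ^ (f - e) *s (u *s v)"
        using lattice_power_cancel_eq[OF latA cA[OF v] subspace_scale[OF A(1) uv(1)]] by blast
      then have "br c v = (\<pi> ^ (f - e) * u) *s v" by simp
      then show ?thesis ..
    next
      \<comment> \<open>An eigenvalue of negative valuation: \<open>v\<close> is a multiple of
        \<open>\<pi> *s br c v\<close>, and substituting this into itself divides \<open>v\<close>
        by every power of \<open>\<pi>\<close>.\<close>
      case ef: False
      then have "\<pi> ^ f *s (\<pi> ^ (e - f) *s br c v) = \<pi> ^ f *s (u *s v)"
        using rel2 by (simp flip: power_add)
      then have "\<pi> ^ (e - f) *s br c v = u *s v"
        using lattice_power_cancel_eq[OF latA subspace_scale[OF A(1) cA[OF v]] uv(1)] by blast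
      then have "v = u' *s (\<pi> ^ (e - f) *s br c v)" using uv(2) by simp
      moreover have "\<pi> ^ (e - f) = \<pi> * \<pi> ^ (e - f - 1)" using ef by (cases "e - f") auto
      ultimately obtain s where s: "v = (\<pi> * s) *s br c v"
        by (metis mult.assoc mult.commute scale_scale)
      have "\<exists>y\<in>A. v = \<pi> ^ n *s y" for n
      proof (induction n)
        case 0 show ?case using v by (intro bexI[of _ v]) simp_all
      next
        case (Suc n)
        then obtain y where y: "y \<in> A" "v = \<pi> ^ n *s y" by blast
        have "v = (\<pi> * s) *s br c (\<pi> ^ n *s y)" using s y(2) by simp
        then have "v = \<pi> ^ Suc n *s (s *s br c y)" by (simp add: br_simps algebra_simps)
        then show ?case using subspace_scale[OF A(1) cA[OF y(1)]] by blast
      qed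
      then have "v = 0" using lattice_separated[OF latA v] by blast
      then show ?thesis using False by blast
    qed
  qed
qed (auto intro: exI[of _ 0])

text \<open>Every vector is an eigenvector. For \<open>x\<close>, \<open>v\<close> and
  \<open>x + v\<close> with eigenvalues \<open>r\<close>, \<open>q\<close> and \<open>t\<close> this
  gives a linear relation between \<open>x\<close> and \<open>v\<close>; applying
  \<open>br c\<close> to the relation shows that \<open>r\<close> and \<open>q\<close> agree modulo
  \<open>nul\<close>.\<close>

lemma scalar_action:
  assumes L: "hereditary L" "subalg L" and c: "c \<in> L" and A: "subspace A" "A \<subseteq> L"
    and ab: "\<And>x y. x \<in> A \<Longrightarrow> y \<in> A \<Longrightarrow> br x y = 0"
    and cA: "\<And>x. x \<in> A \<Longrightarrow> br c x \<in> A"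
  shows "\<exists>q. \<forall>x\<in>A. br c x = q *s x"
proof (cases "A = {0}")
  case False
  note line = line_action_scalar[OF L c A ab cA]
  have AG: "A \<subseteq> G" using A(2) subalgD(3)[OF L(2)] by blast
  have latA: "lattice A" using lattice_submodule[OF ambient_lattice A(1) AG] .
  obtain v where v: "v \<in> A" "v \<noteq> 0" using False subspace_0[OF A(1)] by blast
  obtain q where q: "br c v = q *s v" using line v(1) by blast
  have "br c x = q *s x" if x: "x \<in> A" for x
  proof (cases "x = 0")
    case x0: False
    obtain r where r: "br c x = r *s x" using line x by blast
    obtain t where t: "br c (x + v) = t *s (x + v)" using line subspace_add[OF A(1) x v(1)] by blast
    have "r *s x + q *s v = t *s x + t *s v" using r q t by (simp add: br_simps scale_right_distrib)
    then have e: "(r - t) *s x = (t - q) *s v" by (simp add: algebra_simps)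
    then have "br c ((r - t) *s x) = br c ((t - q) *s v)" by (rule arg_cong)
    then have "(r - t) *s br c x = (t - q) *s br c v" unfolding br_scale_right .
    then have "((r - t) * r) *s x = (q * (t - q)) *s v" unfolding r q by (simp add: mult.commute)
    also have "\<dots> = q *s ((r - t) *s x)" using e by simp
    finally have "((r - t) * (r - q)) *s x = 0" by (simp add: algebra_simps)
    then have "nul (r - t) \<or> nul (r - q)" using lattice_torsion_free[OF latA x] x0 nul_prime by blast
    moreover have "nul (r - q)" if "nul (r - t)"
    proof -
      have "(t - q) *s v = 0" using e eff_nul[OF lattice_eff[OF latA x] that] by simp
      then have "nul (t - q)" using lattice_torsion_free[OF latA v(1)] v(2) by blast
      then show ?thesis using that nul_trans by blast
    qed
    ultimately have "nul (r - q)" by blast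
    then show ?thesis using r eff_cong[OF lattice_eff[OF latA x]] by simp
  qed simp
  then show ?thesis by blast
qed (auto intro: exI[of _ 0])

section \<open>Three-dimensional simple lattices\<close>

text \<open>The structure constants \<open>g1\<close>, \<open>g2\<close>, \<open>g3\<close> have widely spaced valuations. The matrix of a virtual
  endomorphism in the basis \<open>x\<close>, \<open>y\<close>, \<open>z\<close> is a multiple of its conjugated cofactor matrix, which makes it
  almost triangular with integral diagonal; hence it preserves a lattice.\<close>

lemma no_spaced_simple:
  assumes L: "hereditary L" "subalg L" and xyz: "x \<in> L" "y \<in> L" "z \<in> L"
    and b12: "br x y = g3 *s z" and b23: "br y z = g1 *s x" and b31: "br z x = g2 *s y"
    and ind: "\<And>r s t. r *s x + s *s y + t *s z = 0 \<Longrightarrow> nul r \<and> nul s \<and> nul t"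
    and g3: "\<not> nul g3" and g: "dv 3 g1" "nul (g2 - \<pi> ^ 3 * h2 * g1)" "nul (g3 - \<pi> ^ 3 * h3 * g2)"
  shows False
proof -
  define N where "N = span3 x y z"
  have sN: "subspace N" and gN: "x \<in> N" "y \<in> N" "z \<in> N"
    unfolding N_def using span3_subspace span3_gen by auto
  have NL: "N \<subseteq> L" unfolding N_def using span3_least[OF subalgD(1)[OF L(2)] xyz] .
  have b21: "br y x = - (g3 *s z)" "br z y = - (g1 *s x)" "br x z = - (g2 *s y)"
    using br_anti b12 b23 b31 by metis+
  have brN: "br (r1 *s x + r2 *s y + r3 *s z) (s1 *s x + s2 *s y + s3 *s z) =
      (g1 * (r2 * s3 - r3 * s2)) *s x + (g2 * (r3 * s1 - r1 * s3)) *s y + (g3 * (r1 * s2 - r2 * s1)) *s z"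
    for r1 r2 r3 s1 s2 s3
    by (simp add: br_simps b12 b23 b31 b21 algebra_simps)
  have subN: "subalg N" unfolding subalg_def
  proof (intro conjI ballI)
    fix v v' assume "v \<in> N" "v' \<in> N"
    then show "br v v' \<in> N" unfolding N_def by (elim span3E) (simp only: brN span3I)
  qed (use sN NL subalgD(3)[OF L(2)] in auto)
  have eqc: "nul (r - r') \<and> nul (s - s') \<and> nul (t - t')"
    if "r *s x + s *s y + t *s z = r' *s x + s' *s y + t' *s z" for r s t r' s' t'
    by (rule ind) (use that in \<open>simp add: algebra_simps\<close>)
  have ng: "\<not> nul g2" "\<not> nul g1"
  proof -
    show "\<not> nul g2" using g3 g(3) nul_cong nul_mult by blast
    then show "\<not> nul g1" using g(2) nul_cong nul_mult by blast
  qed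
  have dg: "dv 3 g1" "dv 3 g2" "dv 3 g3"
    using g dv_cong dv_mult_right[OF dv_mult_right[OF dv_power[of 3]]] by blast+
  have "x \<noteq> 0" using ind[of 1 0 0] unif_not_nul by auto
  then have "N \<noteq> {0}" using gN by auto
  then show False
  proof (rule self_simE[OF L(1) subN NL])
    fix Q \<phi> assume Q: "subalg Q" "Q \<subseteq> N" "Q \<noteq> N" "partial_endo scale nul \<pi> N Q \<phi>"
      "\<And>x y. x \<in> Q \<Longrightarrow> y \<in> Q \<Longrightarrow> \<phi> (br x y) = br (\<phi> x) (\<phi> y)"
      "\<And>I. ideal_of N I \<Longrightarrow> I \<subseteq> Q \<Longrightarrow> (\<And>x. x \<in> I \<Longrightarrow> \<phi> x \<in> I) \<Longrightarrow> I = {0}"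
    interpret N: partial_endo scale nul \<pi> N Q \<phi> by (rule Q(4))
    note piQ = N.unif_C'[OF gN(1)] N.unif_C'[OF gN(2)] N.unif_C'[OF gN(3)]
    obtain a1 a2 a3 where a: "\<phi> (\<pi> *s x) = a1 *s x + a2 *s y + a3 *s z"
      using N.\<phi>_closed[OF piQ(1)] unfolding N_def by (rule span3E)
    obtain b1 b2 b3 where b: "\<phi> (\<pi> *s y) = b1 *s x + b2 *s y + b3 *s z"
      using N.\<phi>_closed[OF piQ(2)] unfolding N_def by (rule span3E)
    obtain c1 c2 c3 where c: "\<phi> (\<pi> *s z) = c1 *s x + c2 *s y + c3 *s z"
      using N.\<phi>_closed[OF piQ(3)] unfolding N_def by (rule span3E)
    \<comment> \<open>For the three pairs of generators this expresses the matrix of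
      \<open>v \<mapsto> \<phi> (\<pi> *s v)\<close> by its own cofactors. The structure constants
      cancel on the diagonal; off the diagonal a ratio of two of them remains.\<close>
    have rel: "(\<pi> * h) *s \<phi> (\<pi> *s v'') = br (\<phi> (\<pi> *s v)) (\<phi> (\<pi> *s v'))"
      if "br v v' = h *s v''" "v \<in> N" "v' \<in> N" "v'' \<in> N" for v v' v'' h
    proof -
      have "br (\<phi> (\<pi> *s v)) (\<phi> (\<pi> *s v')) = \<phi> (br (\<pi> *s v) (\<pi> *s v'))" using Q(5) N.unif_C' that by simp
      also have "br (\<pi> *s v) (\<pi> *s v') = (\<pi> * h) *s (\<pi> *s v'')" using that(1) by (simp add: br_simps algebra_simps)
      also have "\<phi> \<dots> = (\<pi> * h) *s \<phi> (\<pi> *s v'')" using lin_onD(2)[OF N.\<phi>_lin] N.unif_C' that by blast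
      finally show ?thesis by simp
    qed
    have "(\<pi> * g3 * c1) *s x + (\<pi> * g3 * c2) *s y + (\<pi> * g3 * c3) *s z =
        (g1 * (a2 * b3 - a3 * b2)) *s x + (g2 * (a3 * b1 - a1 * b3)) *s y + (g3 * (a1 * b2 - a2 * b1)) *s z"
      using rel[OF b12 gN] unfolding a b c brN by (simp add: scale_right_distrib mult.assoc)
    from eqc[OF this] have "nul (g3 * (\<pi> * c3 - (a1 * b2 - a2 * b1)))" by (simp add: algebra_simps)
    then have C3: "nul (\<pi> * c3 - (a1 * b2 - a2 * b1))" using nul_prime g3 by blast
    have "(\<pi> * g1 * a1) *s x + (\<pi> * g1 * a2) *s y + (\<pi> * g1 * a3) *s z =
        (g1 * (b2 * c3 - b3 * c2)) *s x + (g2 * (b3 * c1 - b1 * c3)) *s y + (g3 * (b1 * c2 - b2 * c1)) *s z"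
      using rel[OF b23 gN(2,3,1)] unfolding a b c brN by (simp add: scale_right_distrib mult.assoc)
    from eqc[OF this] have A: "nul (g1 * (\<pi> * a1 - (b2 * c3 - b3 * c2)))"
      "nul (\<pi> * g1 * a2 - g2 * (b3 * c1 - b1 * c3))" "nul (\<pi> * g1 * a3 - g3 * (b1 * c2 - b2 * c1))"
      by (simp_all add: algebra_simps)
    have A1: "nul (\<pi> * a1 - (b2 * c3 - b3 * c2))" using A(1) nul_prime ng by blast
    have "(\<pi> * g2 * b1) *s x + (\<pi> * g2 * b2) *s y + (\<pi> * g2 * b3) *s z =
        (g1 * (c2 * a3 - c3 * a2)) *s x + (g2 * (c3 * a1 - c1 * a3)) *s y + (g3 * (c1 * a2 - c2 * a1)) *s z"
      using rel[OF b31 gN(3,1,2)] unfolding a b c brN by (simp add: scale_right_distrib mult.assoc)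
    from eqc[OF this] have B: "nul (g2 * (\<pi> * b2 - (c3 * a1 - c1 * a3)))"
      "nul (\<pi> * g2 * b3 - g3 * (c1 * a2 - c2 * a1))"
      by (simp_all add: algebra_simps)
    have B2: "nul (\<pi> * b2 - (c3 * a1 - c1 * a3))" using B(1) nul_prime ng by blast
    \<comment> \<open>The ratio \<open>h' / h\<close> contributes \<open>\<pi> ^ (k + 3)\<close>, of
      which one factor is spent on the \<open>\<pi>\<close> in front of \<open>q\<close>.\<close>
    have small: "dv (k + 2) q" if "nul (\<pi> * h * q - h' * d)" "nul (h' - \<pi> ^ (k + 3) * f * h)" "\<not> nul h"
      for h h' q d f k
    proof -
      have "h * (\<pi> * q - \<pi> ^ (k + 3) * (f * d)) = (\<pi> * h * q - h' * d) + d * (h' - \<pi> ^ (k + 3) * f * h)"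
        by (simp add: algebra_simps)
      then have "nul (\<pi> * q - \<pi> ^ (k + 3) * (f * d))" using that nul_add nul_mult nul_prime by metis
      then have "dv (Suc (k + 2)) (\<pi> * q)" using dvI[of "\<pi> * q" "k + 3"] by (simp add: numeral_3_eq_3)
      then show ?thesis by (rule dv_cancel)
    qed
    have a2: "dv 2 a2" using small[of g1 a2 g2 _ 0 h2] A(2) g(2) ng by (simp add: numeral_2_eq_2)
    have b3: "dv 2 b3" using small[of g2 b3 g3 _ 0 h3] B(2) g(3) ng by (simp add: numeral_2_eq_2)
    have "g3 - \<pi> ^ (3 + 3) * (h3 * h2) * g1 = (g3 - \<pi> ^ 3 * h3 * g2) + (\<pi> ^ 3 * h3) * (g2 - \<pi> ^ 3 * h2 * g1)"
      by (simp add: algebra_simps power_add)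
    then have "nul (g3 - \<pi> ^ (3 + 3) * (h3 * h2) * g1)" using g(2,3) nul_add nul_mult by metis
    then have "dv (3 + 2) a3" using small[OF A(3)] ng by blast
    then have a3: "dv 3 a3" by (rule dv_mono) simp
    have sq: "dv 2 (r * s)" if "dv 1 r" "dv 1 s" for r s using dv_mult[OF that] by (simp add: numeral_2_eq_2)
    have two: "dv 1 q" if "nul (\<pi> * q - (r - s))" "dv 2 r" "dv 2 s" for q r s
    proof -
      have "dv 2 (\<pi> * q)" using dv_cong[OF that(1)] dv_diff that(2,3) by blast
      then show ?thesis using dv_cancel[of 1 q] by (simp add: numeral_2_eq_2)
    qed
    have one: "dv 1 r" if "nul (\<pi> * q - (r - s))" "dv 2 s" for q r s
    proof -
      have "dv 1 (\<pi> * q)" using dv_mult_right[OF dv_unif] .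
      then have "dv 1 ((r - s) + s)"
        using dv_add[OF _ dv_mono[OF that(2), of 1], of "r - s"] dv_cong[OF that(1)] by simp
      then show ?thesis by simp
    qed
    have n: "dv 2 (a2 * b1)" "dv 2 (b3 * c2)" "dv 2 (c1 * a3)"
      using dv_mult_right[OF a2] dv_mult_right[OF b3] dv_mult_left[OF dv_mono[OF a3, of 2]] by auto
    \<comment> \<open>Modulo \<open>\<pi>\<close> the products of two diagonal entries vanish, so at
      least two of \<open>a1\<close>, \<open>b2\<close>, \<open>c3\<close> are divisible by
      \<open>\<pi>\<close>. Their product is then divisible by \<open>\<pi>\<^sup>2\<close>, and the
      cofactor equation makes the third entry divisible too.\<close>
    have p: "dv 1 a1 \<or> dv 1 b2" "dv 1 b2 \<or> dv 1 c3" "dv 1 c3 \<or> dv 1 a1"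
      using dv_prime one[OF C3 n(1)] one[OF A1 n(2)] one[OF B2 n(3)] by auto
    have diag: "dv 1 a1" "dv 1 b2" "dv 1 c3"
      using p two[OF A1 sq n(2)] two[OF B2 sq n(3)] two[OF C3 sq n(1)] by blast+
    \<comment> \<open>\<open>\<phi>\<close> preserves this staircase because the diagonal is
      divisible by \<open>\<pi>\<close>, the entries \<open>a2\<close> and \<open>b3\<close> by
      \<open>\<pi>\<^sup>2\<close> and \<open>a3\<close> by \<open>\<pi>\<^sup>3\<close>. It is an
      ideal because all structure constants are divisible by \<open>\<pi>\<^sup>3\<close>.\<close>
    define I where "I = span3 (\<pi> *s x) (\<pi> ^ 2 *s y) (\<pi> ^ 3 *s z)"
    have sI: "subspace I" unfolding I_def by (rule span3_subspace)
    have eN: "eff x" "eff y" "eff z" using lattice_eff[OF subalgD(2)[OF subN]] gN by auto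
    have inI: "r *s x + s *s y + t *s z \<in> I" if "dv 1 r" "dv 2 s" "dv 3 t" for r s t
    proof -
      obtain r' s' t' where "nul (r - \<pi> ^ 1 * r')" "nul (s - \<pi> ^ 2 * s')" "nul (t - \<pi> ^ 3 * t')"
        using \<open>dv 1 r\<close> \<open>dv 2 s\<close> \<open>dv 3 t\<close> unfolding dv_def by blast
      then have "r *s x + s *s y + t *s z = r' *s (\<pi> *s x) + s' *s (\<pi> ^ 2 *s y) + t' *s (\<pi> ^ 3 *s z)"
        using eff_cong[OF eN(1)] eff_cong[OF eN(2)] eff_cong[OF eN(3)] by (simp add: mult.commute)
      then show ?thesis unfolding I_def by (simp only: span3I)
    qed
    have gI: "\<pi> *s x \<in> I" "\<pi> ^ 2 *s y \<in> I" "\<pi> ^ 3 *s z \<in> I" unfolding I_def using span3_gen by auto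
    have gQ: "\<pi> *s x \<in> Q" "\<pi> ^ 2 *s y \<in> Q" "\<pi> ^ 3 *s z \<in> Q"
      using piQ subspace_scale[OF N.C'_subspace piQ(2), of \<pi>] subspace_scale[OF N.C'_subspace piQ(3), of "\<pi> * \<pi>"]
      by (simp_all add: power2_eq_square power3_eq_cube)
    have IQ: "I \<subseteq> Q" unfolding I_def using span3_least[OF N.C'_subspace gQ] .
    have "ideal_of N I" unfolding ideal_of_def
    proof (intro conjI ballI)
      show "subspace I" by (rule sI)
      show IN: "I \<subseteq> N" using IQ Q(2) by blast
      fix v v' assume "v \<in> N" "v' \<in> I"
      then have "v \<in> span3 x y z" "v' \<in> span3 x y z" using IN unfolding N_def by auto
      then obtain r1 r2 r3 s1 s2 s3 where "v = r1 *s x + r2 *s y + r3 *s z" "v' = s1 *s x + s2 *s y + s3 *s z"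
        by (elim span3E)
      then have "br v v' = (g1 * (r2 * s3 - r3 * s2)) *s x + (g2 * (r3 * s1 - r1 * s3)) *s y + (g3 * (r1 * s2 - r2 * s1)) *s z"
        using brN by simp
      also have "\<dots> \<in> I"
        by (intro inI dv_mult_right dv_mono[OF dg(1)] dv_mono[OF dg(2)] dg(3)) simp_all
      finally show "br v v' \<in> I" .
    qed
    moreover have "\<phi> v \<in> I" if v: "v \<in> I" for v
    proof -
      obtain r s t where rst: "v = r *s (\<pi> *s x) + s *s (\<pi> ^ 2 *s y) + t *s (\<pi> ^ 3 *s z)"
        using v unfolding I_def by (rule span3E)
      have "v = r *s (\<pi> *s x) + (s * \<pi>) *s (\<pi> *s y) + (t * \<pi> ^ 2) *s (\<pi> *s z)"
        unfolding rst by (simp add: power2_eq_square power3_eq_cube mult.assoc)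
      then have "\<phi> v = r *s \<phi> (\<pi> *s x) + (s * \<pi>) *s \<phi> (\<pi> *s y) + (t * \<pi> ^ 2) *s \<phi> (\<pi> *s z)"
        using lin_onD[OF N.\<phi>_lin] subspace_add[OF N.C'_subspace] subspace_scale[OF N.C'_subspace] piQ
        by (simp del: scale_scale)
      moreover have "\<phi> (\<pi> *s x) \<in> I" unfolding a using inI diag(1) a2 a3 by blast
      moreover have "(s * \<pi>) *s \<phi> (\<pi> *s y) \<in> I"
      proof -
        have "\<pi> *s \<phi> (\<pi> *s y) = (\<pi> * b1) *s x + (\<pi> * b2) *s y + (\<pi> * b3) *s z"
          unfolding b by (simp add: scale_right_distrib)
        moreover have "dv 1 (\<pi> * b1)" "dv 2 (\<pi> * b2)" "dv 3 (\<pi> * b3)"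
          using dv_mult_right[OF dv_unif] sq[OF dv_unif diag(2)] dv_mult[OF dv_unif b3] by (simp_all add: numeral_3_eq_3)
        ultimately have "s *s (\<pi> *s \<phi> (\<pi> *s y)) \<in> I" using inI subspace_scale[OF sI] by metis
        then show ?thesis by simp
      qed
      moreover have "(t * \<pi> ^ 2) *s \<phi> (\<pi> *s z) \<in> I"
      proof -
        have "\<pi> ^ 2 *s \<phi> (\<pi> *s z) = (\<pi> ^ 2 * c1) *s x + (\<pi> ^ 2 * c2) *s y + (\<pi> ^ 2 * c3) *s z"
          unfolding c by (simp add: scale_right_distrib)
        moreover have "dv 1 (\<pi> ^ 2 * c1)" "dv 2 (\<pi> ^ 2 * c2)" "dv 3 (\<pi> ^ 2 * c3)"
          using dv_mult_right[OF dv_mono[OF dv_power[of 2], of 1]] dv_mult_right[OF dv_power[of 2]]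
            dv_mult[OF dv_power[of 2] diag(3)] by simp_all
        ultimately have "t *s (\<pi> ^ 2 *s \<phi> (\<pi> *s z)) \<in> I" using inI subspace_scale[OF sI] by metis
        then show ?thesis by simp
      qed
      ultimately show ?thesis using subspace_add[OF sI] subspace_scale[OF sI] by simp
    qed
    ultimately have "I = {0}" using Q(6) IQ by blast
    then have "\<pi> *s x = 0" using gI(1) by blast
    then show False
      using \<open>x \<noteq> 0\<close> lattice_torsion_free[OF subalgD(2)[OF subN] gN(1)] unif_not_nul by blast
  qed
qed

text \<open>In the basis \<open>a + u\<close>, \<open>a - u\<close>, \<open>g\<close> the bracket is
  diagonal with structure constants \<open>- l\<close>, \<open>l\<close> and \<open>- 2\<close>.
  Scaling the basis vectors by \<open>\<pi>\<close> to the powers \<open>K + 2 * s\<close>,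
  \<open>K + s\<close> and \<open>K\<close> multiplies the constants by \<open>\<pi>\<close> to the
  powers \<open>K - s\<close>, \<open>K + s\<close> and \<open>K + 3 * s\<close>, which provides the
  spacing for \<open>no_spaced_simple\<close>.\<close>

lemma no_simple_triple:
  assumes L: "hereditary L" "subalg L" and aug: "a \<in> L" "u \<in> L" "g \<in> L"
    and au: "br a u = g" and ga: "br g a = l *s a" and gu: "br g u = - (l *s u)" and l: "\<not> nul l"
    and ind: "\<And>r s t. r *s a + s *s u + t *s g = 0 \<Longrightarrow> nul r \<and> nul s \<and> nul t"
  shows False
proof -
  obtain k l1 l2 where k: "nul (l - \<pi> ^ k * l1)" "nul (l1 * l2 - 1)" using factor[OF l] by blast
  \<comment> \<open>Consecutive exponents differ by \<open>2 * s\<close>; with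
    \<open>s = k + 3\<close> this leaves at least 3 after the valuation \<open>k\<close> of
    \<open>l\<close> is subtracted in the last ratio. The choice of \<open>K\<close> gives
    \<open>K - s = 3\<close>, which makes the first constant divisible by
    \<open>\<pi>\<^sup>3\<close>.\<close>
  define s where "s = k + 3"
  define K where "K = s + 3"
  define x where "x = \<pi> ^ (K + 2 * s) *s (a + u)"
  define y where "y = \<pi> ^ (K + s) *s (a - u)"
  define z where "z = \<pi> ^ K *s g"
  have ua: "br u a = - g" "br a g = - (l *s a)" "br u g = l *s u"
    unfolding br_anti[of u a] br_anti[of a g] br_anti[of u g] au ga gu by simp_all
  have b12: "br x y = (- 2 * \<pi> ^ (K + 3 * s)) *s z"
    unfolding x_def y_def z_def
    by (simp add: br_simps au ua power_add[symmetric] algebra_simps flip: scale_left_distrib mult_2)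
  have b23: "br y z = (- l * \<pi> ^ (K - s)) *s x"
  proof -
    have e: "(K + s) + K = (K - s) + (K + 2 * s)" unfolding K_def by simp
    have "br y z = \<pi> ^ ((K + s) + K) *s (- l *s (a + u))"
      unfolding y_def z_def by (simp add: br_simps ua power_add algebra_simps)
    then show ?thesis unfolding e x_def by (simp add: power_add algebra_simps)
  qed
  have b31: "br z x = (l * \<pi> ^ (K + s)) *s y"
  proof -
    have e: "K + (K + 2 * s) = (K + s) + (K + s)" by simp
    have "\<pi> ^ K * \<pi> ^ (K + 2 * s) * l = l * \<pi> ^ (K + s) * \<pi> ^ (K + s)"
      unfolding power_add[symmetric] e by (simp add: power_add)
    moreover have "br z x = (\<pi> ^ K * \<pi> ^ (K + 2 * s) * l) *s (a - u)"
      unfolding x_def z_def by (simp add: br_simps ga gu algebra_simps)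
    ultimately show ?thesis unfolding y_def by simp
  qed
  show False
  proof (rule no_spaced_simple[OF L _ _ _ b12 b23 b31])
    show "x \<in> L" "y \<in> L" "z \<in> L"
      unfolding x_def y_def z_def
      using subspace_scale[OF subalgD(1)[OF L(2)]] subspace_add[OF subalgD(1)[OF L(2)]]
        subspace_diff[OF subalgD(1)[OF L(2)]] aug by blast+
    show "\<not> nul (- 2 * \<pi> ^ (K + 3 * s))"
      using nul_prime[of "- 2"] two_not_nul unif_power_not_nul nul_minus[of "- 2"] by auto
    show "dv 3 (- l * \<pi> ^ (K - s))" unfolding K_def using dv_mult_left[OF dv_power[of 3], of "- l"] by simp
    have "l * \<pi> ^ (K + s) = \<pi> ^ 3 * (- (\<pi> ^ (2 * s - 3))) * (- l * \<pi> ^ (K - s))"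
    proof -
      have "K + s = 3 + (2 * s - 3) + (K - s)" unfolding K_def s_def by simp
      then show ?thesis by (simp only: power_add) (simp add: algebra_simps)
    qed
    then show "nul (l * \<pi> ^ (K + s) - \<pi> ^ 3 * (- (\<pi> ^ (2 * s - 3))) * (- l * \<pi> ^ (K - s)))"
      using nul_0 by simp
    have e: "K + 3 * s = 3 + (2 * s - 3 - k) + k + (K + s)" unfolding s_def by simp
    have "\<pi> ^ 3 * (- 2 * \<pi> ^ (2 * s - 3 - k) * l2) * (l * \<pi> ^ (K + s)) - (- 2 * \<pi> ^ (K + 3 * s)) =
        (- 2 * \<pi> ^ 3 * \<pi> ^ (2 * s - 3 - k) * \<pi> ^ (K + s)) * (l2 * (l - \<pi> ^ k * l1) + \<pi> ^ k * (l1 * l2 - 1))"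
      unfolding e by (simp only: power_add) (simp add: algebra_simps)
    then have "nul (\<pi> ^ 3 * (- 2 * \<pi> ^ (2 * s - 3 - k) * l2) * (l * \<pi> ^ (K + s)) - (- 2 * \<pi> ^ (K + 3 * s)))"
      using k nul_add nul_mult by metis
    then show "nul ((- 2 * \<pi> ^ (K + 3 * s)) - \<pi> ^ 3 * (- 2 * \<pi> ^ (2 * s - 3 - k) * l2) * (l * \<pi> ^ (K + s)))"
      by (simp only: nul_commute)
    fix r1 r2 r3 assume "r1 *s x + r2 *s y + r3 *s z = 0"
    then have "(r1 * \<pi> ^ (K + 2 * s) + r2 * \<pi> ^ (K + s)) *s a + (r1 * \<pi> ^ (K + 2 * s) - r2 * \<pi> ^ (K + s)) *s u +
        (r3 * \<pi> ^ K) *s g = 0"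
      unfolding x_def y_def z_def by (simp add: algebra_simps)
    from ind[OF this] have n: "nul (r1 * \<pi> ^ (K + 2 * s) + r2 * \<pi> ^ (K + s))"
      "nul (r1 * \<pi> ^ (K + 2 * s) - r2 * \<pi> ^ (K + s))" "nul (r3 * \<pi> ^ K)" by auto
    have "nul (2 * (r1 * \<pi> ^ (K + 2 * s)))" using nul_add[OF n(1,2)] by (simp add: algebra_simps)
    moreover have "nul (2 * (r2 * \<pi> ^ (K + s)))" using nul_diff[OF n(1,2)] by (simp add: algebra_simps)
    ultimately show "nul r1 \<and> nul r2 \<and> nul r3"
      using n(3) nul_prime two_not_nul unif_power_not_nul by blast
  qed
qed

section \<open>Hereditarily self-similar lattices are of scalar type\<close>

definition functional :: "'v set \<Rightarrow> ('v \<Rightarrow> 'r) \<Rightarrow> bool" where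
  "functional N l \<longleftrightarrow> (\<forall>x\<in>N. \<forall>y\<in>N. nul (l (x + y) - (l x + l y))) \<and> (\<forall>r. \<forall>x\<in>N. nul (l (r *s x) - r * l x))"

text \<open>The kernel of \<open>l\<close> is an abelian submodule on which each \<open>x\<close>
  acts as the scalar \<open>l x\<close>. Both families of models are covered at once, with
  \<open>l\<close> null in the abelian case, and the condition restricts to subalgebras.\<close>

definition scalar_type :: "'v set \<Rightarrow> bool" where
  "scalar_type N \<longleftrightarrow> (\<exists>l. functional N l \<and> (\<forall>x\<in>N. \<forall>y\<in>N. br x y = l x *s y - l y *s x))"

lemma functionalD:
  assumes "functional N l"
  shows "x \<in> N \<Longrightarrow> y \<in> N \<Longrightarrow> nul (l (x + y) - (l x + l y))" "x \<in> N \<Longrightarrow> nul (l (r *s x) - r * l x)"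
  using assms unfolding functional_def by auto

lemma functional_diff:
  assumes "functional N l" "subspace N" "x \<in> N" "y \<in> N"
  shows "nul (l (x - y) - (l x - l y))"
proof -
  have "nul (l (x + (-1) *s y) - (l x + l ((-1) *s y)))"
    using functionalD(1)[OF assms(1,3) subspace_scale[OF assms(2,4)]] .
  moreover have "nul (l ((-1) *s y) - (-1) * l y)" using functionalD(2)[OF assms(1,4)] .
  ultimately have "nul ((l (x + (-1) *s y) - (l x + l ((-1) *s y))) + (l ((-1) *s y) - (-1) * l y))"
    by (rule nul_add)
  then show ?thesis by (simp add: algebra_simps)
qed

lemma br_deriv: "br x (br y z) = br (br x y) z + br y (br x z)"
proof -
  have "br x (br y z) = - (br y (br z x) + br z (br x y))"
    using br_jacobi[of x y z] by (simp only: eq_neg_iff_add_eq_0 add.assoc)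
  then show ?thesis unfolding br_anti[of x z] br_anti[of "br x y" z] by (simp add: br_simps)
qed

lemma cong_mod_br:
  assumes B: "subalg B" and x: "x' \<in> B" "cong_mod B k x x'" and y: "y' \<in> B" "cong_mod B k y y'"
  shows "cong_mod B k (br x y) (br x' y')"
proof -
  obtain s t where st: "s \<in> B" "x = x' + \<pi> ^ k *s s" "t \<in> B" "y = y' + \<pi> ^ k *s t"
    using x y unfolding cong_mod_def by blast
  have "br x y = br x' y' + \<pi> ^ k *s (br s y' + br x' t + br s (\<pi> ^ k *s t))"
    unfolding st(2,4) by (simp add: br_simps algebra_simps)
  moreover have "br s y' + br x' t + br s (\<pi> ^ k *s t) \<in> B"
    using subalgD(1,4)[OF B] st x(1) y(1) subspace_add subspace_scale by meson
  ultimately show ?thesis unfolding cong_mod_def by blast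
qed

lemma subspace_sums:
  assumes "subspace S" "subspace T" shows "subspace {x + y |x y. x \<in> S \<and> y \<in> T}"
proof (rule subspaceI)
  show "0 \<in> {x + y |x y. x \<in> S \<and> y \<in> T}"
    using subspace_0[OF assms(1)] subspace_0[OF assms(2)] by (auto intro!: exI[of _ 0])
next
  fix v w assume "v \<in> {x + y |x y. x \<in> S \<and> y \<in> T}" "w \<in> {x + y |x y. x \<in> S \<and> y \<in> T}"
  then obtain x y x' y' where *: "v = x + y" "x \<in> S" "y \<in> T" "w = x' + y'" "x' \<in> S" "y' \<in> T" by blast
  then have "v + w = (x + x') + (y + y')" by simp
  then show "v + w \<in> {x + y |x y. x \<in> S \<and> y \<in> T}"
    using subspace_add[OF assms(1)] subspace_add[OF assms(2)] * by blast
next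
  fix r v assume "v \<in> {x + y |x y. x \<in> S \<and> y \<in> T}"
  then obtain x y where *: "v = x + y" "x \<in> S" "y \<in> T" by blast
  then have "r *s v = r *s x + r *s y" by (simp add: scale_right_distrib)
  then show "r *s v \<in> {x + y |x y. x \<in> S \<and> y \<in> T}"
    using subspace_scale[OF assms(1)] subspace_scale[OF assms(2)] * by blast
qed

section \<open>The inductive step\<close>

text \<open>The core \<open>B\<close> of a simple virtual endomorphism \<open>\<phi>\<close> is of scalar type by induction. The dynamics of
  \<open>\<phi>\<close> splits \<open>L\<close> into an expanded part \<open>A\<close>, an isometric part \<open>C\<close> and a contracted part \<open>U\<close> with
  \<open>B = C \<oplus> U\<close>, where \<open>B\<close> is the domain of all powers of \<open>\<phi>\<close>; the scalar actions on these parts are forced to agree.\<close>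

lemma scalar_type_step:
  assumes L: "hereditary L" "subalg L" and L0: "L \<noteq> {0}"
    and powerful: "\<And>x y. x \<in> L \<Longrightarrow> y \<in> L \<Longrightarrow> \<exists>z\<in>L. br x y = \<pi> *s z"
    and IH: "\<And>B. subalg B \<Longrightarrow> B \<subseteq> L \<Longrightarrow> isolated L B \<Longrightarrow> B \<noteq> L \<Longrightarrow> scalar_type B"
  shows "scalar_type L"
proof (rule self_simE[OF L order_refl L0])
  fix M \<phi> assume M: "subalg M" "M \<subseteq> L" "M \<noteq> L" "partial_endo scale nul \<pi> L M \<phi>"
    "\<And>x y. x \<in> M \<Longrightarrow> y \<in> M \<Longrightarrow> \<phi> (br x y) = br (\<phi> x) (\<phi> y)"
    "\<And>I. ideal_of L I \<Longrightarrow> I \<subseteq> M \<Longrightarrow> (\<And>x. x \<in> I \<Longrightarrow> \<phi> x \<in> I) \<Longrightarrow> I = {0}"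
  interpret P: partial_endo scale nul \<pi> L M \<phi> by (rule M(4))
  note sL = P.C_subspace and latL = P.C_lattice
  note tfL = lattice_torsion_free[OF latL]
  have effL: "r *s x = 0" if "x \<in> L" "nul r" for x r using eff_nul[OF lattice_eff[OF latL that(1)] that(2)] .
  have congL: "r *s x = s *s x" if "x \<in> L" "nul (r - s)" for x r s
    using eff_cong[OF lattice_eff[OF latL that(1)] that(2)] .
  note brL = subalgD(4)[OF L(2)]
  obtain x0 where x0: "x0 \<in> L" "x0 \<noteq> 0" using L0 subspace_0[OF sL] by blast
  \<comment> \<open>Otherwise the core contains all brackets, as they lie in \<open>\<pi> L\<close>;
    so it is an invariant ideal, hence zero. This selects the second alternative of
    \<open>depth_dichotomy\<close>.\<close>
  have "\<not> (\<forall>x\<in>L. \<pi> *s x \<in> P.core)"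
  proof
    assume a: "\<forall>x\<in>L. \<pi> *s x \<in> P.core"
    have "ideal_of L P.core" unfolding ideal_of_def
    proof (intro conjI ballI P.core_subspace P.core_subset)
      fix x y assume "x \<in> L" and y: "y \<in> P.core"
      then obtain z where "z \<in> L" "br x y = \<pi> *s z" using powerful[OF _ subsetD[OF P.core_subset(1) y]] by blast
      then show "br x y \<in> P.core" using a by simp
    qed
    then have "P.core = {0}" using M(6) P.core_subset P.\<phi>_core by blast
    then have "\<pi> *s x0 = 0" using a x0 by blast
    then show False using tfL x0 unif_not_nul by blast
  qed
  then obtain m where m: "m \<ge> 1" "\<forall>n. \<forall>x\<in>L. \<pi> *s x \<in> P.depth_ge (n + m) \<longleftrightarrow> x \<in> P.depth_ge n"
    using P.depth_dichotomy by blast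
  define B where "B = P.core"
  define E where "E = P.expand m"
  have \<phi>br: "br x y \<in> P.depth_ge n \<and> (\<phi> ^^ n) (br x y) = br ((\<phi> ^^ n) x) ((\<phi> ^^ n) y)"
    if "x \<in> P.depth_ge n" "y \<in> P.depth_ge n" for x y n
    using that
  proof (induction n arbitrary: x y)
    case 0 then show ?case using brL by simp
  next
    case (Suc n)
    then have *: "x \<in> M" "y \<in> M" "\<phi> x \<in> P.depth_ge n" "\<phi> y \<in> P.depth_ge n" using P.depth_ge_Suc by auto
    then show ?case
      using Suc.IH[OF *(3,4)] M(5)[OF *(1,2)] subalgD(4)[OF M(1) *(1,2)] P.depth_ge_Suc
      by (simp add: funpow_swap1)
  qed
  have \<phi>lin: "(\<phi> ^^ n) (r *s x) = r *s (\<phi> ^^ n) x" if "x \<in> P.depth_ge n" for n r x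
    using lin_onD(2)[OF P.\<phi>_power_lin that] .
  have Bd: "x \<in> P.depth_ge n" if "x \<in> B" for x n using that P.core_iff unfolding B_def by blast
  have BL: "B \<subseteq> L" and sB: "subspace B" using P.core_subset P.core_subspace unfolding B_def by auto
  have \<phi>B: "(\<phi> ^^ n) x \<in> B" if "x \<in> B" for x n using P.\<phi>_power_core that unfolding B_def by blast
  have subB: "subalg B" unfolding subalg_def
  proof (intro conjI ballI)
    show "B \<subseteq> G" using BL subalgD(3)[OF L(2)] by blast
    fix x y assume "x \<in> B" "y \<in> B"
    then show "br x y \<in> B" using \<phi>br Bd P.core_iff unfolding B_def by blast
  qed (rule sB)
  note latB = subalgD(2)[OF subB] and brB = subalgD(4)[OF subB]
  have "B \<noteq> L" using M(2,3) P.core_subset unfolding B_def by blast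
  moreover have "isolated L B" using P.core_isolated[OF m] unfolding B_def .
  ultimately have "scalar_type B" using IH subB BL by blast
  \<comment> \<open>For abelian \<open>B\<close> the zero form is chosen: in rank one every form
    describes the zero bracket, but \<open>muU\<close> below needs a form that is null on
    \<open>U\<close>.\<close>
  then obtain \<mu> where mu: "functional B \<mu>" "\<And>x y. x \<in> B \<Longrightarrow> y \<in> B \<Longrightarrow> br x y = \<mu> x *s y - \<mu> y *s x"
    "(\<forall>x\<in>B. \<forall>y\<in>B. br x y = 0) \<Longrightarrow> (\<forall>x. nul (\<mu> x))"
  proof (cases "\<forall>x\<in>B. \<forall>y\<in>B. br x y = 0")
    case True
    show ?thesis by (rule that[of "\<lambda>_. 0"]) (use True in \<open>auto simp: functional_def nul_0\<close>)
  next
    case False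
    then show ?thesis using that \<open>scalar_type B\<close> unfolding scalar_type_def by blast
  qed
  \<comment> \<open>The kernel of \<open>\<phi>\<close> is an ideal because \<open>[L, L] \<subseteq> \<pi> L \<subseteq> M\<close>.\<close>
  have inj1: "x = 0" if x: "x \<in> M" "\<phi> x = 0" for x
  proof -
    define K where "K = {x \<in> M. \<phi> x = 0}"
    have "subspace K" unfolding K_def
      using lin_onD[OF P.\<phi>_lin] subspace_0[OF P.C'_subspace] subspace_add[OF P.C'_subspace]
        subspace_scale[OF P.C'_subspace] lin_on_0[OF P.\<phi>_lin P.C'_subspace]
      by (intro subspaceI) auto
    moreover have "br x y \<in> K" if xy: "x \<in> L" "y \<in> K" for x y
    proof -
      have y: "y \<in> M" "\<phi> y = 0" "y \<in> L" using xy(2) M(2) unfolding K_def by auto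
      have brM: "br x y \<in> M" using powerful[OF xy(1) y(3)] P.unif_C' by auto
      have "\<pi> *s \<phi> (br x y) = \<phi> (br (\<pi> *s x) y)"
        using lin_onD(2)[OF P.\<phi>_lin brM] by (simp add: br_simps)
      also have "\<dots> = 0" using M(5)[OF P.unif_C'[OF xy(1)] y(1)] y(2) by simp
      finally have "\<phi> (br x y) = 0" using tfL P.\<phi>_closed[OF brM] unif_not_nul by blast
      then show ?thesis using brM unfolding K_def by blast
    qed
    ultimately have "ideal_of L K" using M(2) unfolding ideal_of_def K_def by auto
    moreover have "K \<subseteq> M" "\<And>x. x \<in> K \<Longrightarrow> \<phi> x \<in> K" using subspace_0[OF \<open>subspace K\<close>] unfolding K_def by auto
    ultimately have "K = {0}" using M(6) by blast
    then show ?thesis using x unfolding K_def by blast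
  qed
  have inj: "x = 0" if "x \<in> B" "(\<phi> ^^ n) x = 0" for x n
    using that
  proof (induction n)
    case (Suc n)
    have "(\<phi> ^^ n) x \<in> M" using \<phi>B[OF Suc.prems(1)] P.core_subset unfolding B_def by blast
    then show ?case using inj1 Suc by simp
  qed simp
  show ?thesis
  proof (rule P.expand_fitting[OF m, folded E_def B_def])
  fix \<epsilon> assume \<epsilon>: "lin_on L \<epsilon>" "\<epsilon> ` L \<subseteq> L" "\<And>x. x \<in> L \<Longrightarrow> \<epsilon> (\<epsilon> x) = \<epsilon> x"
    "\<And>x. x \<in> L \<Longrightarrow> \<epsilon> x = 0 \<longleftrightarrow> x \<in> B"
    "\<And>x k. x \<in> L \<Longrightarrow> \<epsilon> x = x \<Longrightarrow> \<exists>y\<in>L. \<epsilon> y = y \<and> (E ^^ k) y = x"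
    "\<And>x. x \<in> L \<Longrightarrow> \<forall>k. \<exists>y\<in>L. (E ^^ k) y = x \<Longrightarrow> \<epsilon> x = x"
  show ?thesis
  proof (rule fitting_projection[OF latB, of \<phi>])
  show "lin_on B \<phi>" using lin_on_subset[OF P.\<phi>_lin] P.core_subset unfolding B_def by blast
  show "\<phi> ` B \<subseteq> B" using P.\<phi>_core unfolding B_def by blast
  fix \<eta> assume \<eta>: "lin_on B \<eta>" "\<eta> ` B \<subseteq> B"
    "\<And>x. x \<in> B \<Longrightarrow> \<eta> (\<eta> x) = \<eta> x"
    "\<And>x. x \<in> B \<Longrightarrow> \<eta> x = x \<Longrightarrow> \<exists>y\<in>B. \<eta> y = y \<and> \<phi> y = x"
    "\<And>x. x \<in> B \<Longrightarrow> \<forall>n. \<exists>y\<in>B. (\<phi> ^^ n) y = x \<Longrightarrow> \<eta> x = x"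
    "\<And>k. \<exists>N. \<forall>x\<in>B. cong_mod B k (\<eta> x) ((\<phi> ^^ N) x)"
    "\<And>x k. x \<in> B \<Longrightarrow> \<eta> x = 0 \<Longrightarrow> \<exists>N. \<forall>n\<ge>N. \<exists>t\<in>B. (\<phi> ^^ n) x = \<pi> ^ k *s t"
    "\<And>x. x \<in> B \<Longrightarrow> \<forall>k. \<exists>n. \<exists>t\<in>B. (\<phi> ^^ n) x = \<pi> ^ k *s t \<Longrightarrow> \<eta> x = 0"
  define A where "A = {x \<in> L. \<epsilon> x = x}"
  define C where "C = {x \<in> B. \<eta> x = x}"
  define U where "U = {x \<in> B. \<eta> x = 0}"
  note \<epsilon>lin = lin_onD[OF \<epsilon>(1)] and \<eta>lin = lin_onD[OF \<eta>(1)]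
  have sA: "subspace A"
    unfolding A_def using \<epsilon>lin subspace_0[OF sL] subspace_add[OF sL] subspace_scale[OF sL] lin_on_0[OF \<epsilon>(1) sL]
    by (intro subspaceI) auto
  have sC: "subspace C"
    unfolding C_def using \<eta>lin subspace_0[OF sB] subspace_add[OF sB] subspace_scale[OF sB] lin_on_0[OF \<eta>(1) sB]
    by (intro subspaceI) auto
  have sU: "subspace U"
    unfolding U_def using \<eta>lin subspace_0[OF sB] subspace_add[OF sB] subspace_scale[OF sB] lin_on_0[OF \<eta>(1) sB]
    by (intro subspaceI) auto
  have AL: "A \<subseteq> L" and CB: "C \<subseteq> B" and UB: "U \<subseteq> B" unfolding A_def C_def U_def by auto
  have CL: "C \<subseteq> L" and UL: "U \<subseteq> L" using CB UB BL by auto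
  have AB: "x = 0" if "x \<in> A" "x \<in> B" for x using that \<epsilon>(4)[of x] unfolding A_def by auto
  have CU: "x = 0" if "x \<in> C" "x \<in> U" for x using that unfolding C_def U_def by auto
  have split: "\<epsilon> x \<in> A" "x - \<epsilon> x \<in> B" if x: "x \<in> L" for x
  proof -
    have ex: "\<epsilon> x \<in> L" using \<epsilon>(2) x by blast
    then show "\<epsilon> x \<in> A" using \<epsilon>(3)[OF x] unfolding A_def by blast
    have "\<epsilon> (x - \<epsilon> x) = 0" using lin_on_diff[OF \<epsilon>(1) sL x ex] \<epsilon>(3)[OF x] by simp
    then show "x - \<epsilon> x \<in> B" using \<epsilon>(4)[OF subspace_diff[OF sL x ex]] by blast
  qed
  have splitB: "\<eta> x \<in> C" "x - \<eta> x \<in> U" if x: "x \<in> B" for x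
  proof -
    have ex: "\<eta> x \<in> B" using \<eta>(2) x by blast
    then show "\<eta> x \<in> C" using \<eta>(3)[OF x] unfolding C_def by blast
    have "\<eta> (x - \<eta> x) = 0" using lin_on_diff[OF \<eta>(1) sB x ex] \<eta>(3)[OF x] by simp
    then show "x - \<eta> x \<in> U" using subspace_diff[OF sB x ex] unfolding U_def by blast
  qed
  obtain a0 where a0: "a0 \<in> A" "a0 \<noteq> 0"
  proof -
    have "\<exists>x\<in>L. x \<notin> B" using \<open>B \<noteq> L\<close> BL by blast
    then obtain x where x: "x \<in> L" "x \<notin> B" by blast
    then have "\<epsilon> x \<noteq> 0" using \<epsilon>(4) by blast
    then show ?thesis using that split(1)[OF x(1)] by blast
  qed
  \<comment> \<open>\<open>\<eta>\<close> is a limit of powers of \<open>\<phi>\<close>, which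
    preserve brackets on \<open>B\<close>. So \<open>C\<close> is a subalgebra and \<open>U\<close>
    an ideal of \<open>B\<close>.\<close>
  have \<eta>br: "\<eta> (br x y) = br (\<eta> x) (\<eta> y)" if x: "x \<in> B" and y: "y \<in> B" for x y
  proof (rule cong_mod_all[OF latB])
    have ex: "\<eta> x \<in> B" "\<eta> y \<in> B" using \<eta>(2) x y by auto
    show "\<eta> (br x y) \<in> B" "br (\<eta> x) (\<eta> y) \<in> B" using \<eta>(2) brB x y ex by auto
    fix k
    obtain N where N: "\<forall>x\<in>B. cong_mod B k (\<eta> x) ((\<phi> ^^ N) x)" using \<eta>(6) by blast
    have "cong_mod B k (br (\<eta> x) (\<eta> y)) (br ((\<phi> ^^ N) x) ((\<phi> ^^ N) y))"
      using cong_mod_br[OF subB \<phi>B[OF x] _ \<phi>B[OF y]] N x y by blast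
    moreover have "br ((\<phi> ^^ N) x) ((\<phi> ^^ N) y) = (\<phi> ^^ N) (br x y)" using \<phi>br Bd x y by simp
    moreover have "cong_mod B k (\<eta> (br x y)) ((\<phi> ^^ N) (br x y))" using N brB[OF x y] by blast
    ultimately show "cong_mod B k (\<eta> (br x y)) (br (\<eta> x) (\<eta> y))"
      using cong_mod_trans[OF sB] cong_mod_sym[OF sB] by metis
  qed
  \<comment> \<open>A form that defines the bracket vanishes on brackets: applied to
    \<open>\<mu> x *s y - \<mu> y *s x\<close> it gives a difference of equal products.\<close>
  have mu_br: "nul (\<mu> (br x y))" if x: "x \<in> B" and y: "y \<in> B" for x y
  proof -
    have "nul (\<mu> (\<mu> x *s y - \<mu> y *s x) - (\<mu> (\<mu> x *s y) - \<mu> (\<mu> y *s x)))"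
      using functional_diff[OF mu(1) sB] subspace_scale[OF sB] x y by blast
    moreover have "nul (\<mu> (\<mu> x *s y) - \<mu> x * \<mu> y)" "nul (\<mu> (\<mu> y *s x) - \<mu> y * \<mu> x)"
      using functionalD(2)[OF mu(1)] x y by auto
    ultimately have "nul ((\<mu> (\<mu> x *s y - \<mu> y *s x) - (\<mu> (\<mu> x *s y) - \<mu> (\<mu> y *s x))) +
        ((\<mu> (\<mu> x *s y) - \<mu> x * \<mu> y) - (\<mu> (\<mu> y *s x) - \<mu> y * \<mu> x)))"
      using nul_add nul_diff by blast
    then show ?thesis unfolding mu(2)[OF x y] by (simp add: mult.commute)
  qed
  \<comment> \<open>The powers of \<open>\<phi>\<close> contract \<open>u\<close> but preserve the scalar \<open>\<mu> u\<close> by which \<open>u\<close> acts on \<open>[u, B]\<close>.\<close>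
  have muU: "nul (\<mu> u)" if u: "u \<in> U" for u
  proof (rule ccontr)
    assume n: "\<not> nul (\<mu> u)"
    have uB: "u \<in> B" using u UB by blast
    have "\<exists>b\<in>B. br u b \<noteq> 0"
    proof (rule ccontr)
      assume "\<not> ?thesis"
      then have 0: "\<mu> u *s b = \<mu> b *s u \<and> br u b = 0" if "b \<in> B" for b using mu(2)[OF uB that] that by simp
      have "br b b' = 0" if b: "b \<in> B" "b' \<in> B" for b b'
      proof -
        have "\<mu> u *s br b b' = br (\<mu> b *s u) b'" using 0[OF b(1)] by (metis br_scale_left)
        also have "\<dots> = 0" using 0[OF b(2)] by (simp add: br_simps)
        finally show ?thesis using lattice_torsion_free[OF latB brB[OF b]] n by blast
      qed
      then show False using mu(3) n by blast
    qed
    then obtain b where b: "b \<in> B" "br u b \<noteq> 0" by blast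
    define y where "y = br u b"
    have yB: "y \<in> B" unfolding y_def using brB uB b by blast
    have uy: "br u y = \<mu> u *s y"
      using mu(2)[OF uB yB] effL[OF subsetD[OF BL uB] mu_br[OF uB b(1), folded y_def]] by simp
    have "nul (\<mu> u)"
    proof (rule nul_separated)
      fix k
      obtain n t where nt: "t \<in> B" "(\<phi> ^^ n) u = \<pi> ^ k *s t" using \<eta>(7)[of u k] u unfolding U_def by blast
      let ?u = "(\<phi> ^^ n) u" and ?y = "(\<phi> ^^ n) y"
      have "?y = br ?u ((\<phi> ^^ n) b)" unfolding y_def using \<phi>br Bd uB b(1) by blast
      then have ny: "nul (\<mu> ?y)" using mu_br \<phi>B uB b(1) by simp
      have "\<mu> u *s ?y = (\<phi> ^^ n) (br u y)" using uy \<phi>lin Bd yB by simp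
      also have "\<dots> = br ?u ?y" using \<phi>br Bd uB yB by blast
      also have "\<dots> = \<mu> ?u *s ?y" using mu(2)[OF \<phi>B[OF uB] \<phi>B[OF yB]] effL[OF _ ny] \<phi>B[OF uB] BL by fastforce
      finally have "nul (\<mu> u - \<mu> ?u)"
        using lattice_scale_cancel[OF latB \<phi>B[OF yB]] inj[OF yB] b(2) unfolding y_def by blast
      moreover have "nul (\<mu> ?u - \<pi> ^ k * \<mu> t)" unfolding nt(2) using functionalD(2)[OF mu(1) nt(1)] .
      ultimately show "\<exists>t. nul (\<mu> u - \<pi> ^ k * t)" using nul_trans by blast
    qed
    then show False using n by blast
  qed
  have brU: "br b u = \<mu> b *s u" if "b \<in> B" "u \<in> U" for b u
    using mu(2)[OF that(1) subsetD[OF UB that(2)]] effL[OF subsetD[OF BL that(1)] muU[OF that(2)]] by simp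
  have brUU: "br u u' = 0" if "u \<in> U" "u' \<in> U" for u u'
    using brU[OF subsetD[OF UB that(1)] that(2)] effL[OF subsetD[OF UL that(2)] muU[OF that(1)]] by simp
  have Epow: "(E ^^ k) x = (\<phi> ^^ (k * m)) (\<pi> ^ k *s x)" "\<pi> ^ k *s x \<in> P.depth_ge (k * m)" if "x \<in> L" for x k
    using P.expand_power[OF m that] P.unif_power_depth[OF m that] unfolding E_def by auto
  have EL: "(E ^^ k) x \<in> L" if "x \<in> L" for x k
    using P.\<phi>_power_closed Epow[OF that] by metis
  have Aback: "\<exists>y\<in>A. (E ^^ k) y = x" if "x \<in> A" for x k using \<epsilon>(5)[of x k] that unfolding A_def by blast
  \<comment> \<open>Only the first argument carries a factor \<open>\<pi> ^ k\<close>, and one such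
    factor is what \<open>E ^^ k\<close> on the right needs.\<close>
  have brE: "br ((E ^^ k) x) ((\<phi> ^^ (k * m)) b) = (E ^^ k) (br x b)" if x: "x \<in> L" and b: "b \<in> B" for x b k
  proof -
    have "br ((E ^^ k) x) ((\<phi> ^^ (k * m)) b) = (\<phi> ^^ (k * m)) (br (\<pi> ^ k *s x) b)"
      using \<phi>br[OF Epow(2)[OF x] Bd[OF b], of k] Epow(1)[OF x] by simp
    then show ?thesis using Epow(1)[OF brL[OF x subsetD[OF BL b]]] by (simp add: br_simps)
  qed
  \<comment> \<open>Pulling both arguments back along \<open>E ^^ k\<close> produces two factors
    \<open>\<pi> ^ k\<close>, and \<open>E ^^ k\<close> of the bracket absorbs only one. So the
    bracket is divisible by every power of \<open>\<pi>\<close>.\<close>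
  have brAA: "br x y = 0" if x: "x \<in> A" and y: "y \<in> A" for x y
  proof (rule lattice_separated[OF latL])
    show "br x y \<in> L" using brL AL x y by blast
    fix k
    obtain x' y' where x': "x' \<in> A" "(E ^^ k) x' = x" and y': "y' \<in> A" "(E ^^ k) y' = y"
      using Aback x y by blast
    have xyL: "x' \<in> L" "y' \<in> L" using x' y' AL by auto
    note d = Epow(2)[OF brL[OF xyL], of k]
    have "br x y = (\<phi> ^^ (k * m)) (br (\<pi> ^ k *s x') (\<pi> ^ k *s y'))"
      using \<phi>br[OF Epow(2)[OF xyL(1)] Epow(2)[OF xyL(2)], of k] Epow(1)[OF xyL(1)] Epow(1)[OF xyL(2)] x'(2) y'(2)
      by simp
    also have "\<dots> = (\<phi> ^^ (k * m)) (\<pi> ^ k *s (\<pi> ^ k *s br x' y'))" by (simp add: br_simps)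
    also have "\<dots> = \<pi> ^ k *s (E ^^ k) (br x' y')" using \<phi>lin[OF d] Epow(1)[OF brL[OF xyL]] by simp
    finally show "\<exists>z\<in>L. br x y = \<pi> ^ k *s z" using EL[OF brL[OF xyL]] by blast
  qed
  have Cback: "\<exists>c'\<in>C. (\<phi> ^^ n) c' = c" if "c \<in> C" for c n
    using that
  proof (induction n arbitrary: c)
    case (Suc n)
    obtain c1 where "c1 \<in> C" "\<phi> c1 = c" using \<eta>(4)[of c] Suc.prems unfolding C_def by blast
    moreover obtain c' where "c' \<in> C" "(\<phi> ^^ n) c' = c1" using Suc.IH \<open>c1 \<in> C\<close> by blast
    ultimately show ?case by (intro bexI[of _ c']) simp_all
  qed auto
  \<comment> \<open>Both arguments can be pulled back, so the bracket has preimages under all powers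
    of \<open>E\<close>, which characterizes \<open>A\<close>.\<close>
  have brCA: "br c a \<in> A" if c: "c \<in> C" and a: "a \<in> A" for c a
  proof -
    have "\<exists>y\<in>L. (E ^^ k) y = br c a" for k
    proof -
      obtain c' where c': "c' \<in> C" "(\<phi> ^^ (k * m)) c' = c" using Cback[OF c] by blast
      obtain a' where a': "a' \<in> A" "(E ^^ k) a' = a" using Aback[OF a] by blast
      have "br a c = (E ^^ k) (br a' c')" using brE[of a' c' k] a' c' AL CB by auto
      then have "br c a = - (E ^^ k) (br a' c')" using br_anti[of c a] by simp
      also have "\<dots> = (E ^^ k) (- br a' c')"
        using lin_onD(2)[OF lin_on_funpow[OF P.expand_lin[OF m] P.expand_closed[OF m]]
            brL[OF subsetD[OF AL a'(1)] subsetD[OF CL c'(1)]], of k "-1"]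
        unfolding E_def by simp
      finally have "br c a = (E ^^ k) (br c' a')" using br_anti[of c' a'] by simp
      then show ?thesis
        using brL[OF subsetD[OF CL c'(1)] subsetD[OF AL a'(1)]] by (intro bexI[of _ "br c' a'"]) simp_all
    qed
    moreover have "br c a \<in> L" using brL c a AL CL by blast
    ultimately show ?thesis using \<epsilon>(6) unfolding A_def by blast
  qed
  \<comment> \<open>\<open>E ^^ N\<close> of the bracket inherits the divisibility of
    \<open>(\<phi> ^^ (N * m)) u\<close>, which grows without bound; comparing depths puts the
    bracket into the core.\<close>
  have brLU: "br x u \<in> B" if x: "x \<in> L" and u: "u \<in> U" for x u
  proof -
    have w: "br x u \<in> L" using brL x u UL by blast
    have "br x u \<in> P.depth_ge j" for j
    proof -
      obtain N where N: "\<forall>n\<ge>N. \<exists>t\<in>B. (\<phi> ^^ n) u = \<pi> ^ j *s t" using \<eta>(7)[of u j] u unfolding U_def by blast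
      have "N * m \<ge> N" using m(1) by simp
      then obtain t where t: "t \<in> B" "(\<phi> ^^ (N * m)) u = \<pi> ^ j *s t" using N by blast
      have "(E ^^ N) (br x u) = br ((E ^^ N) x) ((\<phi> ^^ (N * m)) u)" using brE[OF x] u UB by auto
      also have "\<dots> = \<pi> ^ j *s br ((E ^^ N) x) t" unfolding t(2) by (simp add: br_simps)
      finally have "(\<phi> ^^ (N * m)) (\<pi> ^ N *s br x u) \<in> P.depth_ge (j * m)"
        using Epow(1)[OF w] Epow(2)[of "br ((E ^^ N) x) t" j] brL EL[OF x] t(1) BL by auto
      then have "\<pi> ^ N *s br x u \<in> P.depth_ge (j * m + N * m)"
        using Epow(2)[OF w, of N] P.depth_ge_add by (metis add.commute)
      then have "br x u \<in> P.depth_ge (j * m)" using P.unif_power_raises[OF m w] by blast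
      then show ?thesis using P.depth_ge_mono[of j "j * m"] m(1) by auto
    qed
    then show ?thesis using P.core_iff unfolding B_def by blast
  qed
  have "\<forall>c\<in>C. \<exists>q. \<forall>a\<in>A. br c a = q *s a"
    using scalar_action[OF L _ sA AL brAA brCA] CL by blast
  from bchoice[OF this] obtain lm where lam: "\<And>c a. c \<in> C \<Longrightarrow> a \<in> A \<Longrightarrow> br c a = lm c *s a" by blast
  have lam_eq: "nul (r - s)" if "r *s a0 = s *s a0" for r s
    using lattice_scale_cancel[OF latL _ _ that] a0 AL by blast
  have lam_unique: "nul (lm c - q)" if "c \<in> C" "br c a0 = q *s a0" for c q
    using lam_eq lam[OF that(1) a0(1)] that(2) by simp
  have lam_fun: "functional C lm" unfolding functional_def
  proof (intro conjI ballI allI)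
    fix x y assume xy: "x \<in> C" "y \<in> C"
    then show "nul (lm (x + y) - (lm x + lm y))"
      using lam_unique[OF subspace_add[OF sC xy]] lam a0 by (simp add: br_simps scale_left_distrib)
  next
    fix r x assume x: "x \<in> C"
    then show "nul (lm (r *s x) - r * lm x)"
      using lam_unique[OF subspace_scale[OF sC x]] lam a0 by (simp add: br_simps)
  qed
  have gam: "\<eta> (br c w) = br c (\<eta> w)" if "c \<in> C" "w \<in> B" for c w
    using \<eta>br[of c w] that unfolding C_def by auto
  \<comment> \<open>If the \<open>C\<close>-component \<open>g\<close> of \<open>[a, u]\<close> acted nontrivially, then \<open>a\<close>, \<open>u\<close>, \<open>g\<close> would span a copy of \<open>sl\<^sub>2\<close>.\<close>
  have key: "nul (\<mu> g) \<and> nul (lm g)" if a: "a \<in> A" and u: "u \<in> U" and g: "g = \<eta> (br a u)" "g \<noteq> 0" for a u g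
  proof -
    define w where "w = br a u"
    have w: "w \<in> B" unfolding w_def using brLU a u AL by blast
    have gC: "g \<in> C" and vU: "w - g \<in> U" using splitB[OF w] g unfolding w_def by auto
    have gL: "g \<in> L" "g \<in> B" using gC CL CB by auto
    \<comment> \<open>\<open>a\<close> and \<open>u\<close> are eigenvectors of \<open>c\<close>
      with eigenvalues \<open>lm c\<close> and \<open>\<mu> c\<close>, so their bracket
      \<open>w\<close> has the sum as eigenvalue. As \<open>\<eta>\<close> commutes with
      \<open>c\<close>, so does the component \<open>g\<close>; but the component in
      \<open>U\<close> has eigenvalue \<open>\<mu> c\<close>, and comparison yields
      \<open>cv\<close>.\<close>
    have cw: "br c w = (lm c + \<mu> c) *s w" if c: "c \<in> C" for c
    proof -
      have "br c w = br (br c a) u + br a (br c u)" unfolding w_def by (rule br_deriv)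
      then show ?thesis using lam[OF c a] brU[OF subsetD[OF CB c] u]
        unfolding w_def by (simp add: br_simps scale_left_distrib)
    qed
    have cg: "br c g = (lm c + \<mu> c) *s g" if c: "c \<in> C" for c
    proof -
      have "br c g = \<eta> (br c w)" using gam[OF c w] g(1) unfolding w_def by simp
      also have "\<dots> = (lm c + \<mu> c) *s g" unfolding cw[OF c] using \<eta>lin(2)[OF w] g(1) unfolding w_def by simp
      finally show ?thesis .
    qed
    have cv: "lm c *s (w - g) = 0" if c: "c \<in> C" for c
    proof -
      have "br c (w - g) = (lm c + \<mu> c) *s (w - g)"
        using cw[OF c] cg[OF c] by (simp add: br_simps scale_right_diff_distrib)
      moreover have "br c (w - g) = \<mu> c *s (w - g)" using brU[OF subsetD[OF CB c] vU] .
      ultimately show ?thesis by (simp add: scale_left_distrib)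
    qed
    \<comment> \<open>The eigenvalue of \<open>g\<close> is compared with the scalar-type formula in
      \<open>B\<close>. For \<open>c = g\<close> it gives \<open>lm g = - \<mu> g\<close> modulo
      \<open>nul\<close>, so \<open>g\<close> acts on \<open>a\<close> and \<open>u\<close> by
      opposite scalars, as in \<open>sl\<^sub>2\<close>.\<close>
    have rel: "lm c *s g = - (\<mu> g *s c)" if c: "c \<in> C" for c
    proof -
      have "(lm c + \<mu> c) *s g = \<mu> c *s g - \<mu> g *s c" using cg[OF c] mu(2)[of c g] c gC CB by auto
      then have "lm c *s g + \<mu> g *s c = 0" by (simp add: scale_left_distrib algebra_simps)
      then show ?thesis by (simp only: eq_neg_iff_add_eq_0)
    qed
    have "lm g *s g = (- \<mu> g) *s g" using rel[OF gC] by simp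
    then have opp: "nul (lm g - - \<mu> g)" using lattice_scale_cancel[OF latL gL(1) g(2)] by blast
    have "nul (\<mu> g)"
    proof (rule ccontr)
      assume n: "\<not> nul (\<mu> g)"
      have nl: "\<not> nul (lm g)" using n nul_cong[OF opp] nul_minus[of "- \<mu> g"] by auto
      have wg: "w = g"
      proof -
        have "w - g \<in> L" using vU UL by blast
        then show ?thesis using cv[OF gC] tfL nl by fastforce
      qed
      have "br g u = - (lm g *s u)"
        using brU[OF gL(2) u] congL[OF subsetD[OF UL u] opp] by simp
      moreover have "nul r \<and> nul s \<and> nul t" if r: "r *s a + s *s u + t *s g = 0" for r s t
      proof -
        have aw: "a \<noteq> 0" "u \<noteq> 0" using wg g(2) unfolding w_def by auto
        have sutg: "s *s u + t *s g \<in> B" using subspace_add[OF sB] subspace_scale[OF sB] u UB gL(2) by blast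
        have "r *s a = - (s *s u + t *s g)" using r by (simp only: eq_neg_iff_add_eq_0 add.assoc)
        then have "r *s a \<in> B" using subspace_neg[OF sB sutg] by simp
        then have ra: "r *s a = 0" using AB subspace_scale[OF sA a] by blast
        then have e: "t *s g = - (s *s u)" using r by (simp add: eq_neg_iff_add_eq_0 add.commute[of "t *s g"])
        then have "t *s g \<in> U" using subspace_neg[OF sU subspace_scale[OF sU u]] by simp
        then have tg: "t *s g = 0" using CU subspace_scale[OF sC gC] by blast
        then have "s *s u = 0" using e by simp
        then show ?thesis using ra tg tfL aw g(2) a u gL(1) AL UL by blast
      qed
      ultimately show False
        using no_simple_triple[OF L _ _ gL(1) _ lam[OF gC a] _ nl, of u] a u AL UL wg unfolding w_def by blast
    qed
    moreover have "nul (lm g)" using nul_cong[OF opp] calculation nul_minus by blast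
    ultimately show ?thesis by blast
  qed
  \<comment> \<open>\<open>\<Gamma>\<close> consists of the \<open>C\<close>-components of brackets
    of \<open>a\<close> with \<open>U\<close>. By \<open>key\<close> they commute with
    \<open>a\<close> and with \<open>U\<close>, so \<open>\<Gamma> + U\<close> is abelian and
    \<open>a\<close> acts on it as a scalar. This scalar kills the nonzero vector
    \<open>\<eta> (br a u)\<close> of \<open>\<Gamma>\<close>, so it is null and
    \<open>br a u = 0\<close>.\<close>
  have \<eta>0: "\<eta> (br a u) = 0" if a: "a \<in> A" and u: "u \<in> U" for a u
  proof (rule ccontr)
    assume n: "\<eta> (br a u) \<noteq> 0"
    define \<Gamma> where "\<Gamma> = (\<lambda>u. \<eta> (br a u)) ` U"
    have brB': "br a u' \<in> B" if "u' \<in> U" for u' using brLU a AL that by blast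
    have s\<Gamma>: "subspace \<Gamma>"
    proof (rule subspaceI)
      show "0 \<in> \<Gamma>" unfolding \<Gamma>_def using subspace_0[OF sU] lin_on_0[OF \<eta>(1) sB] by (intro image_eqI[of _ _ 0]) simp_all
    next
      fix x y assume "x \<in> \<Gamma>" "y \<in> \<Gamma>"
      then obtain u1 u2 where *: "u1 \<in> U" "u2 \<in> U" "x = \<eta> (br a u1)" "y = \<eta> (br a u2)" unfolding \<Gamma>_def by blast
      then have "x + y = \<eta> (br a (u1 + u2))" using \<eta>lin(1)[OF brB' brB'] by (simp add: br_simps)
      then show "x + y \<in> \<Gamma>" unfolding \<Gamma>_def using subspace_add[OF sU *(1,2)] by blast
    next
      fix r x assume "x \<in> \<Gamma>"
      then obtain u1 where *: "u1 \<in> U" "x = \<eta> (br a u1)" unfolding \<Gamma>_def by blast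
      then have "r *s x = \<eta> (br a (r *s u1))" using \<eta>lin(2)[OF brB'] by (simp add: br_simps)
      then show "r *s x \<in> \<Gamma>" unfolding \<Gamma>_def using subspace_scale[OF sU *(1)] by blast
    qed
    have \<Gamma>C: "\<Gamma> \<subseteq> C" unfolding \<Gamma>_def using splitB(1) brB' by blast
    have \<Gamma>mu: "nul (\<mu> g)" "br g a = 0" if gG: "g \<in> \<Gamma>" for g
    proof -
      obtain u1 where u1: "u1 \<in> U" "g = \<eta> (br a u1)" using gG unfolding \<Gamma>_def by blast
      have z: "nul (\<mu> 0)" using functionalD(2)[OF mu(1) subspace_0[OF sB], of 0] by simp
      show "nul (\<mu> g)" using key[OF a u1] z by blast
      have "br g a = lm g *s a" using lam a \<Gamma>C gG by blast
      then show "br g a = 0" using key[OF a u1] effL a AL by (cases "g = 0") auto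
    qed
    define W where "W = {x + y |x y. x \<in> \<Gamma> \<and> y \<in> U}"
    have WI: "x + y \<in> W" if "x \<in> \<Gamma>" "y \<in> U" for x y unfolding W_def using that by blast
    have sW: "subspace W" unfolding W_def using subspace_sums[OF s\<Gamma> sU] .
    have WB: "x \<in> B \<and> nul (\<mu> x)" if x: "x \<in> W" for x
    proof -
      obtain g u1 where gu: "x = g + u1" "g \<in> \<Gamma>" "u1 \<in> U" using x unfolding W_def by blast
      have gB: "g \<in> B" "u1 \<in> B" using gu \<Gamma>C CB UB by auto
      have "nul (\<mu> g + \<mu> u1)" using nul_add \<Gamma>mu(1)[OF gu(2)] muU[OF gu(3)] by blast
      then have "nul (\<mu> x)" using functionalD(1)[OF mu(1) gB] nul_cong gu(1) by blast
      then show ?thesis using subspace_add[OF sB gB] gu(1) by blast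
    qed
    have "\<exists>q. \<forall>x\<in>W. br a x = q *s x"
    proof (rule scalar_action[OF L _ sW])
      show "a \<in> L" using a AL by blast
      show "W \<subseteq> L" using WB BL by blast
      show "br x y = 0" if xy: "x \<in> W" "y \<in> W" for x y
        using mu(2)[of x y] WB[OF xy(1)] WB[OF xy(2)]
          effL[of y "\<mu> x"] effL[of x "\<mu> y"] subsetD[OF BL] by simp
      show "br a x \<in> W" if x: "x \<in> W" for x
      proof -
        obtain g u1 where gu: "x = g + u1" "g \<in> \<Gamma>" "u1 \<in> U" using x unfolding W_def by blast
        have "br a x = br a u1" using \<Gamma>mu(2)[OF gu(2)] br_anti[of g a] gu(1) by (simp add: br_simps)
        also have "\<dots> = \<eta> (br a u1) + (br a u1 - \<eta> (br a u1))" by simp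
        also have "\<dots> \<in> W" using WI splitB(2)[OF brB'[OF gu(3)]] gu(3) unfolding \<Gamma>_def by blast
        finally show ?thesis .
      qed
    qed
    then obtain q where q: "\<forall>x\<in>W. br a x = q *s x" by blast
    define g where "g = \<eta> (br a u)"
    have g: "g \<in> \<Gamma>" unfolding g_def \<Gamma>_def using u by blast
    have "g \<in> W" using WI[OF g subspace_0[OF sU]] by simp
    then have "q *s g = 0" using q \<Gamma>mu(2)[OF g] br_anti[of g a] by auto
    then have nq: "nul q" using tfL n \<Gamma>C CL g unfolding g_def by blast
    have "u \<in> W" using WI[OF subspace_0[OF s\<Gamma>] u] by simp
    then have "br a u = 0" using q effL[OF _ nq] u UL by auto
    then show False using n lin_on_0[OF \<eta>(1) sB] by simp
  qed
  have \<phi>U: "(\<phi> ^^ n) u \<in> U" if u: "u \<in> U" for u n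
  proof -
    have uB: "u \<in> B" "\<eta> u = 0" using u unfolding U_def by auto
    have "\<eta> ((\<phi> ^^ n) u) = 0"
    proof (rule \<eta>(8)[OF \<phi>B[OF uB(1)]], rule allI)
      fix k
      obtain N where "\<forall>i\<ge>N. \<exists>t\<in>B. (\<phi> ^^ i) u = \<pi> ^ k *s t" using \<eta>(7)[OF uB] by blast
      then have "\<exists>t\<in>B. (\<phi> ^^ N) ((\<phi> ^^ n) u) = \<pi> ^ k *s t" by (metis comp_apply funpow_add le_add1)
      then show "\<exists>i. \<exists>t\<in>B. (\<phi> ^^ i) ((\<phi> ^^ n) u) = \<pi> ^ k *s t" by blast
    qed
    then show ?thesis using \<phi>B[OF uB(1)] unfolding U_def by blast
  qed
  have brAUU: "br a u \<in> U" if "a \<in> A" "u \<in> U" for a u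
    using \<eta>0[OF that] brLU[of a u] AL that unfolding U_def by blast
  have brAU_scalar: "\<exists>q. \<forall>u\<in>U. br a u = q *s u" if a: "a \<in> A" for a
    using scalar_action[OF L _ sU UL brUU brAUU[OF a]] a AL by blast
  \<comment> \<open>If \<open>a = (E ^^ k) a'\<close>, equivariance shows that \<open>a\<close> acts
    on \<open>U\<close> as \<open>\<pi> ^ k\<close> times the scalar of \<open>a'\<close>. So the
    scalar of \<open>a\<close> is divisible by every power of \<open>\<pi>\<close>.\<close>
  have brAU: "br a u = 0" if a: "a \<in> A" and u: "u \<in> U" for a u
  proof (cases "u = 0")
    case False
    obtain q where q: "\<forall>u\<in>U. br a u = q *s u" using brAU_scalar[OF a] by blast
    have "nul q"
    proof (rule nul_separated)
      fix k
      obtain a' where a': "a' \<in> A" "(E ^^ k) a' = a" using Aback[OF a] by blast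
      obtain q' where q': "\<forall>u\<in>U. br a' u = q' *s u" using brAU_scalar[OF a'(1)] by blast
      have uB: "u \<in> B" "u \<in> L" using u UB UL by auto
      let ?u = "(\<phi> ^^ (k * m)) u"
      have "q *s ?u = br a ?u" using q \<phi>U[OF u] by simp
      also have "\<dots> = (E ^^ k) (q' *s u)" using brE[OF subsetD[OF AL a'(1)] uB(1), of k] a'(2) q' u by simp
      also have "\<dots> = (\<phi> ^^ (k * m)) ((\<pi> ^ k * q') *s u)"
        using Epow(1)[OF subspace_scale[OF sL uB(2)]] by simp
      also have "\<dots> = (\<pi> ^ k * q') *s ?u" using \<phi>lin Bd[OF uB(1)] by blast
      finally have "nul (q - \<pi> ^ k * q')"
        using lattice_scale_cancel[OF latB \<phi>B[OF uB(1)]] inj[OF uB(1)] False by blast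
      then show "\<exists>t. nul (q - \<pi> ^ k * t)" by blast
    qed
    then show ?thesis using q u effL UL by auto
  qed simp
  \<comment> \<open>\<open>c\<close> acts as a single scalar on the abelian \<open>A + U\<close>,
    and the nonzero vector \<open>a0\<close> identifies this scalar with
    \<open>lm c\<close>.\<close>
  have brCU: "br c u = lm c *s u" if c: "c \<in> C" and u: "u \<in> U" for c u
  proof -
    define W where "W = {x + y |x y. x \<in> A \<and> y \<in> U}"
    have sW: "subspace W" unfolding W_def using subspace_sums[OF sA sU] .
    have WI: "x + y \<in> W" if "x \<in> A" "y \<in> U" for x y unfolding W_def using that by blast
    have "\<exists>q. \<forall>x\<in>W. br c x = q *s x"
    proof (rule scalar_action[OF L _ sW])
      show "c \<in> L" using c CL by blast
      show "W \<subseteq> L" unfolding W_def using subspace_add[OF sL] AL UL by blast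
    next
      fix x y assume "x \<in> W" "y \<in> W"
      then obtain a u1 a' u2 where *: "x = a + u1" "a \<in> A" "u1 \<in> U" "y = a' + u2" "a' \<in> A" "u2 \<in> U"
        unfolding W_def by blast
      then show "br x y = 0"
        using brAA[OF *(2,5)] brAU[OF *(2,6)] brAU[OF *(5,3)] brUU[OF *(3,6)] br_anti[of a' u1]
        by (simp add: br_simps)
    next
      fix x assume "x \<in> W"
      then obtain a u1 where *: "x = a + u1" "a \<in> A" "u1 \<in> U" unfolding W_def by blast
      have "br c u1 \<in> U" using brU[OF subsetD[OF CB c] *(3)] subspace_scale[OF sU *(3)] by simp
      then show "br c x \<in> W" unfolding *(1) br_add_right using WI brCA[OF c *(2)] by blast
    qed
    then obtain q where q: "\<forall>x\<in>W. br c x = q *s x" by blast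
    have "a0 \<in> W" "u \<in> W" using WI[OF a0(1) subspace_0[OF sU]] WI[OF subspace_0[OF sA] u] by auto
    then have "nul (lm c - q)" "br c u = q *s u" using lam_unique[OF c] q by auto
    then show ?thesis using congL[of u "lm c" q] u UL by auto
  qed
  \<comment> \<open>The forms \<open>lm\<close> and \<open>\<mu>\<close> have to be compared on
    \<open>C\<close>. If they differ at some \<open>c1\<close>, then all of \<open>C\<close> turns
    out to be proportional to \<open>c1\<close> over the field of fractions, and both sides
    vanish.\<close>
  have brCC: "br c c' = lm c *s c' - lm c' *s c" if c: "c \<in> C" and c': "c' \<in> C" for c c'
  proof (cases "\<forall>c\<in>C. nul (lm c - \<mu> c)")
    case True
    have "br c c' = \<mu> c *s c' - \<mu> c' *s c" using mu(2) c c' CB by blast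
    moreover have "lm c *s c' = \<mu> c *s c'" "lm c' *s c = \<mu> c' *s c"
      using congL[OF subsetD[OF CL c']] congL[OF subsetD[OF CL c]] True c c' by blast+
    ultimately show ?thesis by simp
  next
    case False
    then obtain c1 where c1: "c1 \<in> C" "\<not> nul (lm c1 - \<mu> c1)" by blast
    have c1B: "c1 \<in> B" "c1 \<in> L" using c1 CB CL by auto
    \<comment> \<open>The action of \<open>c1\<close> on \<open>A + \<langle>d\<rangle>\<close> would have the two distinct eigenvalues \<open>lm c1\<close> and \<open>\<mu> c1\<close>.\<close>
    have kill: "d = 0" if d: "d \<in> C" "br c1 d = \<mu> c1 *s d" "br d a0 = 0" for d
    proof (rule ccontr)
      assume d0: "d \<noteq> 0"
      have nd: "nul (lm d)" using lam_unique[OF d(1), of 0] d(3) by simp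
      have dA: "br d a = 0" if "a \<in> A" for a using lam[OF d(1) that] effL[OF _ nd] that AL by auto
      define W where "W = {x + y |x y. x \<in> range (\<lambda>r. r *s d) \<and> y \<in> A}"
      have WI: "r *s d + y \<in> W" if "y \<in> A" for r y unfolding W_def using that by blast
      have sW: "subspace W" unfolding W_def using subspace_sums[OF subspace_range_scale sA] .
      have dL: "d \<in> L" using d CL by blast
      have "\<exists>q. \<forall>x\<in>W. br c1 x = q *s x"
      proof (rule scalar_action[OF L c1B(2) sW])
        show "W \<subseteq> L" unfolding W_def using subspace_add[OF sL] subspace_scale[OF sL dL] AL by blast
      next
        fix x y assume "x \<in> W" "y \<in> W"
        then obtain r a r' a' where *: "x = r *s d + a" "a \<in> A" "y = r' *s d + a'" "a' \<in> A"
          unfolding W_def by blast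
        then show "br x y = 0"
          using brAA[OF *(2,4)] dA[OF *(2)] dA[OF *(4)] br_anti[of d a] by (simp add: br_simps)
      next
        fix x assume "x \<in> W"
        then obtain r a where *: "x = r *s d + a" "a \<in> A" unfolding W_def by blast
        have "br c1 x = (r * \<mu> c1) *s d + br c1 a" unfolding *(1) using d(2) by (simp add: br_simps)
        then show "br c1 x \<in> W" using WI[OF brCA[OF c1(1) *(2)]] by simp
      qed
      then obtain q where q: "\<forall>x\<in>W. br c1 x = q *s x" by blast
      have "a0 \<in> W" "d \<in> W" using WI[OF a0(1), of 0] WI[OF subspace_0[OF sA], of 1] by auto
      then have "nul (lm c1 - q)" "\<mu> c1 *s d = q *s d" using lam_unique[OF c1(1)] q d(2) by auto
      then have "nul (lm c1 - q)" "nul (q - \<mu> c1)"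
        using lattice_scale_cancel[OF latL dL d0] nul_commute by blast+
      then show False using c1(2) nul_trans by blast
    qed
    \<comment> \<open>\<open>br c1 x\<close> is an eigenvector of \<open>c1\<close> with eigenvalue
      \<open>\<mu> c1\<close> by \<open>mu_br\<close>, and it annihilates \<open>a0\<close> because
      the scalar actions of \<open>c1\<close> and \<open>x\<close> on \<open>A\<close> commute. So
      \<open>kill\<close> applies.\<close>
    have d1: "br c1 x = 0 \<and> \<mu> c1 *s x = \<mu> x *s c1" if x: "x \<in> C" for x
    proof -
      have xB: "x \<in> B" using x CB by blast
      define d where "d = br c1 x"
      have dC: "d \<in> C" unfolding d_def
        using \<eta>br[OF c1B(1) xB] brB[OF c1B(1) xB] c1(1) x unfolding C_def by auto
      have "br d a0 = br c1 (br x a0) - br x (br c1 a0)" unfolding d_def using br_deriv[of c1 x a0] by simp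
      also have "\<dots> = 0" using lam[OF x a0(1)] lam[OF c1(1) a0(1)] by (simp add: br_simps mult.commute)
      finally have "br d a0 = 0" .
      moreover have "br c1 d = \<mu> c1 *s d"
        using mu(2)[OF c1B(1) subsetD[OF CB dC]] effL[OF c1B(2) mu_br[OF c1B(1) xB, folded d_def]] by simp
      ultimately have "d = 0" using kill dC by blast
      then show ?thesis using mu(2)[OF c1B(1) xB] unfolding d_def by simp
    qed
    have d2: "lm c1 *s x = lm x *s c1" if x: "x \<in> C" for x
    proof -
      have xB: "x \<in> B" using x CB by blast
      define d where "d = lm c1 *s x - lm x *s c1"
      have dC: "d \<in> C" unfolding d_def using subspace_diff[OF sC] subspace_scale[OF sC] x c1(1) by blast
      have a: "br d a0 = 0" unfolding d_def
        using lam[OF x a0(1)] lam[OF c1(1) a0(1)] by (simp add: br_simps mult.commute)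
      have "\<mu> c1 *s br x a0 = \<mu> x *s br c1 a0" using d1[OF x] by (metis br_scale_left)
      then have "(\<mu> c1 * lm x) *s a0 = (\<mu> x * lm c1) *s a0" using lam x c1(1) a0(1) by simp
      then have "nul (\<mu> c1 * lm x - \<mu> x * lm c1)" by (rule lam_eq)
      then have e: "(\<mu> c1 * lm x) *s c1 = (\<mu> x * lm c1) *s c1" using congL[OF c1B(2)] by blast
      have "\<mu> c1 *s d = lm c1 *s (\<mu> c1 *s x) - (\<mu> c1 * lm x) *s c1"
        unfolding d_def by (simp add: scale_right_diff_distrib mult.commute)
      then have "\<mu> c1 *s d = 0" unfolding e using d1[OF x] by (simp add: mult.commute)
      moreover have "br c1 d = 0" unfolding d_def using d1[OF x] by (simp add: br_simps)
      ultimately have "d = 0" using kill[OF dC _ a] by simp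
      then show ?thesis unfolding d_def by simp
    qed
    have zero: "br c c' = 0" if "\<not> nul r" "r *s c = s *s c1" for r s
    proof -
      have "r *s br c c' = s *s br c1 c'" using that(2) by (metis br_scale_left)
      then have "r *s br c c' = 0" using d1[OF c'] by simp
      then show ?thesis using tfL brL c c' CL that(1) by blast
    qed
    show ?thesis
    proof (cases "nul (lm c1)")
      case nl: False
      have "lm c1 *s (lm c *s c' - lm c' *s c) = lm c *s (lm c1 *s c') - lm c' *s (lm c1 *s c)"
        by (simp add: scale_right_diff_distrib mult.commute)
      also have "\<dots> = 0" unfolding d2[OF c] d2[OF c'] by (simp add: mult.commute)
      finally have "lm c *s c' - lm c' *s c = 0"
        using tfL subspace_diff[OF sL] subspace_scale[OF sL] c c' CL nl by blast
      then show ?thesis using zero[OF nl d2[OF c]] by simp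
    next
      case nl: True
      have nm: "\<not> nul (\<mu> c1)" using nul_diff[OF nl] c1(2) by blast
      have "c1 \<noteq> 0"
      proof
        assume "c1 = 0"
        then show False using nm functionalD(2)[OF mu(1) subspace_0[OF sB], of 0] by simp
      qed
      have nlx: "nul (lm x)" if x: "x \<in> C" for x
      proof -
        have "lm x *s c1 = 0" using d2[OF x] effL[OF subsetD[OF CL x] nl] by simp
        then show ?thesis using tfL[OF c1B(2)] \<open>c1 \<noteq> 0\<close> by blast
      qed
      have "br c c' = 0" using zero[OF nm] d1[OF c] by blast
      then show ?thesis
        using effL[OF subsetD[OF CL c'] nlx[OF c]] effL[OF subsetD[OF CL c] nlx[OF c']] by simp
    qed
  qed
  \<comment> \<open>The form reads off the \<open>C\<close>-component; it is null on
    \<open>A\<close> and \<open>U\<close>.\<close>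
  define l where "l x = lm (\<eta> (x - \<epsilon> x))" for x
  have part: "x = \<epsilon> x + \<eta> (x - \<epsilon> x) + ((x - \<epsilon> x) - \<eta> (x - \<epsilon> x))" for x by simp
  have parts: "\<epsilon> x \<in> A" "\<eta> (x - \<epsilon> x) \<in> C" "(x - \<epsilon> x) - \<eta> (x - \<epsilon> x) \<in> U" if "x \<in> L" for x
    using split[OF that] splitB[OF split(2)[OF that]] by auto
  have "functional L l" unfolding functional_def
  proof (intro conjI ballI allI)
    fix x y assume xy: "x \<in> L" "y \<in> L"
    have e: "(x + y) - \<epsilon> (x + y) = (x - \<epsilon> x) + (y - \<epsilon> y)" using \<epsilon>lin(1)[OF xy] by simp
    have "\<eta> ((x + y) - \<epsilon> (x + y)) = \<eta> (x - \<epsilon> x) + \<eta> (y - \<epsilon> y)"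
      unfolding e by (rule \<eta>lin(1)[OF split(2)[OF xy(1)] split(2)[OF xy(2)]])
    then show "nul (l (x + y) - (l x + l y))"
      unfolding l_def using functionalD(1)[OF lam_fun parts(2)[OF xy(1)] parts(2)[OF xy(2)]] by simp
  next
    fix r x assume x: "x \<in> L"
    have e: "r *s x - \<epsilon> (r *s x) = r *s (x - \<epsilon> x)" using \<epsilon>lin(2)[OF x] by (simp add: scale_right_diff_distrib)
    have "\<eta> (r *s x - \<epsilon> (r *s x)) = r *s \<eta> (x - \<epsilon> x)"
      unfolding e by (rule \<eta>lin(2)[OF split(2)[OF x]])
    then show "nul (l (r *s x) - r * l x)" unfolding l_def using functionalD(2)[OF lam_fun parts(2)[OF x]] by simp
  qed
  moreover have "br x y = l x *s y - l y *s x" if xy: "x \<in> L" "y \<in> L" for x y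
  proof -
    define a c u where "a = \<epsilon> x" "c = \<eta> (x - \<epsilon> x)" "u = (x - \<epsilon> x) - \<eta> (x - \<epsilon> x)"
    define a' c' u' where "a' = \<epsilon> y" "c' = \<eta> (y - \<epsilon> y)" "u' = (y - \<epsilon> y) - \<eta> (y - \<epsilon> y)"
    have x: "x = a + c + u" and y: "y = a' + c' + u'" unfolding a_c_u_def a'_c'_u'_def using part by auto
    have mem: "a \<in> A" "c \<in> C" "u \<in> U" "a' \<in> A" "c' \<in> C" "u' \<in> U"
      unfolding a_c_u_def a'_c'_u'_def using parts xy by auto
    have b: "br a a' = 0" "br a u' = 0" "br u u' = 0" "br u a' = 0"
      "br c a' = lm c *s a'" "br c u' = lm c *s u'" "br a c' = - (lm c' *s a)" "br u c' = - (lm c' *s u)"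
      "br c c' = lm c *s c' - lm c' *s c"
      using brAA brAU brUU lam brCU brCC br_anti[of a' u] br_anti[of c' a] br_anti[of c' u] mem by simp_all
    have "br x y = lm c *s y - lm c' *s x"
      unfolding x y by (simp add: br_simps b scale_right_distrib algebra_simps)
    then show ?thesis unfolding l_def a_c_u_def(2) a'_c'_u'_def(2) .
  qed
  ultimately show ?thesis unfolding scalar_type_def by blast
  qed
  qed
qed

end

section \<open>Changes of basis\<close>

context dvr_module
begin

lemma basisI:
  assumes "\<And>i. i < n \<Longrightarrow> eff (b i)" "\<And>c. (\<Sum>i<n. c i *s b i) \<in> N"
    "\<And>x. x \<in> N \<Longrightarrow> \<exists>c. x = (\<Sum>i<n. c i *s b i)"
    "\<And>c i. (\<Sum>i<n. c i *s b i) = 0 \<Longrightarrow> i < n \<Longrightarrow> nul (c i)"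
  shows "basis n b N"
proof -
  have "N = range (\<lambda>c. \<Sum>i<n. c i *s b i)"
  proof (intro equalityI subsetI)
    fix x assume "x \<in> N"
    then obtain c where "x = (\<Sum>i<n. c i *s b i)" using assms(3) by blast
    then show "x \<in> range (\<lambda>c. \<Sum>i<n. c i *s b i)" by (rule range_eqI[where x = c])
  qed (use assms(2) in auto)
  then show ?thesis using assms(1,4) by (simp add: basis_def)
qed

lemma basis_scale_unif:
  assumes b: "basis n b N"
  shows "basis n (\<lambda>i. \<pi> *s b i) ((\<lambda>x. \<pi> *s x) ` N)"
proof -
  have s: "(\<Sum>i<n. c i *s (\<pi> *s b i)) = \<pi> *s (\<Sum>i<n. c i *s b i)" for c
    by (simp add: scale_sum_right mult.commute)
  have "nul (c i)" if "(\<Sum>i<n. c i *s (\<pi> *s b i)) = 0" "i < n" for c i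
  proof -
    have "(\<Sum>i<n. c i *s b i) = 0"
      using basis_torsion_free[OF b basisD(3)[OF b]] that(1) unif_not_nul unfolding s by blast
    then show ?thesis using basisD(4)[OF b] that(2) by blast
  qed
  moreover have "(\<lambda>x. \<pi> *s x) ` N = range (\<lambda>c. \<Sum>i<n. c i *s (\<pi> *s b i))"
  proof -
    have "N = range (\<lambda>c. \<Sum>i<n. c i *s b i)" using b unfolding basis_def by blast
    then show ?thesis unfolding s by (auto simp: image_image)
  qed
  ultimately show ?thesis using basisD(1)[OF b] eff_scale unfolding basis_def by blast
qed

lemma basis_transpose:
  assumes b: "basis n b N" and ij: "i < n" "j < n"
  shows "basis n (\<lambda>k. b (transpose i j k)) N"
proof -
  have bij: "bij_betw (transpose i j) {..<n} {..<n}"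
    using ij by (intro bij_betw_byWitness[where f' = "transpose i j"]) (auto simp: transpose_def)
  have s: "(\<Sum>k<n. c k *s b (transpose i j k)) = (\<Sum>k<n. c (transpose i j k) *s b k)" for c
    using sum.reindex_bij_betw[OF bij, of "\<lambda>k. c (transpose i j k) *s b k"] by simp
  have lt: "transpose i j k < n" if "k < n" for k using that ij by (auto simp: transpose_def)
  have h1: "(\<Sum>k<n. c k *s b (transpose i j k)) \<in> N" for c unfolding s by (rule basisD(3)[OF b])
  have h2: "\<exists>c. x = (\<Sum>k<n. c k *s b (transpose i j k))" if x: "x \<in> N" for x
  proof -
    obtain c where "x = (\<Sum>k<n. c k *s b k)" using basisD(2)[OF b x] by blast
    then have "x = (\<Sum>k<n. c (transpose i j k) *s b (transpose i j k))" unfolding s by simp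
    then show ?thesis by (rule exI[where x = "\<lambda>k. c (transpose i j k)"])
  qed
  have h3: "nul (c k)" if "(\<Sum>k<n. c k *s b (transpose i j k)) = 0" "k < n" for c k
    using basisD(4)[OF b, of "\<lambda>k. c (transpose i j k)" "transpose i j k"] that lt unfolding s by simp
  show ?thesis by (rule basisI) (fact basisD(1)[OF b lt] h1 h2 h3)+
qed

text \<open>A triangular change of basis: the last vector is rescaled by a unit, and multiples of
  the result are subtracted from the others. The scalar \<open>u\<close>, inverse to
  \<open>w\<close>, serves to write down the inverse change of coordinates.\<close>

lemma basis_shear:
  assumes b: "basis (Suc k) b N" and uw: "nul (u * w - 1)"
  shows "basis (Suc k) (\<lambda>i. if i < k then b i - t i *s (w *s b k) else w *s b k) N" (is "basis _ ?b' _")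
proof -
  have s: "(\<Sum>i<Suc k. c i *s ?b' i) = (\<Sum>i<Suc k. (c(k := w * (c k - (\<Sum>i<k. c i * t i)))) i *s b i)" for c
  proof -
    have "(\<Sum>i<Suc k. c i *s ?b' i) = (\<Sum>i<k. c i *s b i - (c i * t i) *s (w *s b k)) + c k *s (w *s b k)"
      by (simp add: scale_right_diff_distrib mult.assoc)
    also have "(\<Sum>i<k. c i *s b i - (c i * t i) *s (w *s b k)) =
        (\<Sum>i<k. c i *s b i) - (\<Sum>i<k. c i * t i) *s (w *s b k)"
      unfolding sum_subtractf scale_sum_left ..
    also have "(\<Sum>i<k. c i *s b i) - (\<Sum>i<k. c i * t i) *s (w *s b k) + c k *s (w *s b k) =
        (\<Sum>i<k. c i *s b i) + (w * (c k - (\<Sum>i<k. c i * t i))) *s b k"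
      by (simp add: scale_left_diff_distrib right_diff_distrib mult.commute[of w])
    finally show ?thesis by simp
  qed
  have nw: "\<not> nul w" using uw nul_mult[of w u] nul_diff[of "u * w" "u * w - 1"] unif_not_nul by auto
  have h1: "(\<Sum>i<Suc k. c i *s ?b' i) \<in> N" for c unfolding s by (rule basisD(3)[OF b])
  have h2: "\<exists>c. x = (\<Sum>i<Suc k. c i *s ?b' i)" if x: "x \<in> N" for x
  proof -
    obtain d where d: "x = (\<Sum>i<Suc k. d i *s b i)" using basisD(2)[OF b x] by blast
    define c where "c = d(k := u * d k + (\<Sum>i<k. d i * t i))"
    have c: "c i = d i" if "i < k" for i using that unfolding c_def by simp
    have ck: "w * (c k - (\<Sum>i<k. c i * t i)) = w * u * d k"
      using c unfolding c_def by (simp add: algebra_simps)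
    have "d k - w * u * d k = - (d k * (u * w - 1))" by (simp add: algebra_simps)
    then have "nul (d k - w * u * d k)" using nul_minus nul_mult[OF uw] by metis
    then have nk: "nul (d k - w * (c k - (\<Sum>i<k. c i * t i)))" unfolding ck .
    have "(\<Sum>i<Suc k. d i *s b i) = (\<Sum>i<Suc k. (c(k := w * (c k - (\<Sum>i<k. c i * t i)))) i *s b i)"
    proof (rule basis_sum_cong[OF b])
      fix i assume "i < Suc k"
      then show "nul (d i - (c(k := w * (c k - (\<Sum>i<k. c i * t i)))) i)"
        using nk nul_0 c[of i] by (cases "i = k") simp_all
    qed
    then show ?thesis unfolding d s[symmetric] by blast
  qed
  have h3: "nul (c i)" if "(\<Sum>i<Suc k. c i *s ?b' i) = 0" "i < Suc k" for c i
  proof -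
    have n: "nul ((c(k := w * (c k - (\<Sum>i<k. c i * t i)))) j)" if "j < Suc k" for j
      using basisD(4)[OF b _ that] \<open>(\<Sum>i<Suc k. c i *s ?b' i) = 0\<close> unfolding s by blast
    have lt: "nul (c j)" if "j < k" for j using n[of j] that by simp
    then have "nul (\<Sum>i<k. c i * t i)" by (intro nul_sum nul_mult_right) auto
    moreover have "nul (c k - (\<Sum>i<k. c i * t i))" using n[of k] nul_prime nw by auto
    ultimately have "nul (c k)" using nul_cong by blast
    then show ?thesis using lt that(2) by (auto simp: less_Suc_eq)
  qed
  have h0: "eff (?b' i)" if i: "i < Suc k" for i
  proof -
    have "?b' i \<in> N"
      using basis_mem[OF b] i basis_subspace[OF b] subspace_diff subspace_scale by auto
    then show ?thesis by (rule basis_eff[OF b])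
  qed
  show ?thesis by (rule basisI) (fact h0 h1 h2 h3)+
qed

end

context lie_lattice_space
begin

section \<open>Induction on the rank\<close>

lemma functional_sum:
  assumes "functional N l" "subspace N" "\<And>i. i < (n::nat) \<Longrightarrow> b i \<in> N"
  shows "nul (l (\<Sum>i<n. c i *s b i) - (\<Sum>i<n. c i * l (b i)))"
  using assms(3)
proof (induction n)
  case 0 show ?case using functionalD(2)[OF assms(1) subspace_0[OF assms(2)], of 0] by simp
next
  case (Suc n)
  have m: "(\<Sum>i<n. c i *s b i) \<in> N" "b n \<in> N"
    using Suc.prems assms(2) by (auto intro!: subspace_sum subspace_scale)
  have 1: "nul (l ((\<Sum>i<n. c i *s b i) + c n *s b n) - (l (\<Sum>i<n. c i *s b i) + l (c n *s b n)))"
    using functionalD(1)[OF assms(1) m(1) subspace_scale[OF assms(2) m(2)]] .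
  have 2: "nul (l (\<Sum>i<n. c i *s b i) - (\<Sum>i<n. c i * l (b i)))" using Suc by auto
  have 3: "nul (l (c n *s b n) - c n * l (b n))" using functionalD(2)[OF assms(1) m(2)] .
  show ?case using nul_add[OF nul_add[OF 1 2] 3] by (simp add: algebra_simps)
qed

text \<open>If \<open>\<pi>\<close> divides all values of \<open>l\<close>, the quotient form works.
  Otherwise some \<open>l x0\<close> is a unit, and the hypothesis writes each \<open>y\<close> as a
  multiple of \<open>x0\<close> plus \<open>\<pi>\<close> times another vector. Iterating, all
  vectors are multiples of \<open>x0\<close> modulo every \<open>\<pi> ^ k\<close>, so all brackets
  vanish.\<close>

lemma scalar_type_divide:
  assumes N: "subalg N" and l: "functional N l"
    and b: "\<And>x y. x \<in> N \<Longrightarrow> y \<in> N \<Longrightarrow> \<pi> *s br x y = l x *s y - l y *s x"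
  shows "scalar_type N"
proof (cases "\<forall>x\<in>N. dv 1 (l x)")
  case True
  then have "\<forall>x\<in>N. \<exists>r. nul (l x - \<pi> * r)" unfolding dv_def by simp
  from bchoice[OF this] obtain l' where l': "\<And>x. x \<in> N \<Longrightarrow> nul (l x - \<pi> * l' x)" by blast
  note sN = subalgD(1)[OF N] and latN = subalgD(2)[OF N]
  have "functional N l'" unfolding functional_def
  proof (intro conjI ballI allI)
    fix x y assume xy: "x \<in> N" "y \<in> N"
    have "\<pi> * (l' (x + y) - (l' x + l' y)) = (l (x + y) - (l x + l y)) - (l (x + y) - \<pi> * l' (x + y)) +
        ((l x - \<pi> * l' x) + (l y - \<pi> * l' y))" by (simp add: algebra_simps)
    also have "nul \<dots>"
      using functionalD(1)[OF l xy] l'[OF subspace_add[OF sN xy]] l'[OF xy(1)] l'[OF xy(2)]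
      by (blast intro: nul_add nul_diff)
    finally show "nul (l' (x + y) - (l' x + l' y))" using nul_prime unif_not_nul by blast
  next
    fix r x assume x: "x \<in> N"
    have "\<pi> * (l' (r *s x) - r * l' x) = (l (r *s x) - r * l x) - (l (r *s x) - \<pi> * l' (r *s x)) +
        r * (l x - \<pi> * l' x)" by (simp add: algebra_simps)
    also have "nul \<dots>"
      using functionalD(2)[OF l x] l'[OF subspace_scale[OF sN x]] l'[OF x]
      by (blast intro: nul_add nul_diff nul_mult)
    finally show "nul (l' (r *s x) - r * l' x)" using nul_prime unif_not_nul by blast
  qed
  moreover have "br x y = l' x *s y - l' y *s x" if xy: "x \<in> N" "y \<in> N" for x y
  proof -
    have "\<pi> *s br x y = (\<pi> * l' x) *s y - (\<pi> * l' y) *s x"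
      using b[OF xy] eff_cong[OF lattice_eff[OF latN xy(2)] l'[OF xy(1)]]
        eff_cong[OF lattice_eff[OF latN xy(1)] l'[OF xy(2)]] by simp
    also have "\<dots> = \<pi> *s (l' x *s y - l' y *s x)" by (simp add: scale_right_diff_distrib)
    finally show ?thesis
      using lattice_unif_cancel_eq[OF latN] subalgD(4)[OF N xy] subspace_diff[OF sN] subspace_scale[OF sN] xy
      by blast
  qed
  ultimately show ?thesis unfolding scalar_type_def by blast
next
  case False
  note sN = subalgD(1)[OF N] and latN = subalgD(2)[OF N]
  obtain x0 where x0: "x0 \<in> N" "\<not> dv 1 (l x0)" using False by blast
  then obtain w where w: "nul (l x0 * w - 1)" using unit_or_div[of "l x0"] unfolding dv_def by auto
  have "\<exists>r. \<exists>t\<in>N. y = r *s x0 + \<pi> ^ k *s t" if y: "y \<in> N" for y k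
    using y
  proof (induction k arbitrary: y)
    case 0 then show ?case by (intro exI[of _ 0] bexI[of _ y]) simp_all
  next
    case (Suc k)
    have "l x0 *s y = \<pi> *s br x0 y + l y *s x0" using b[OF x0(1) Suc.prems] by simp
    then have "w *s (l x0 *s y) = \<pi> *s (w *s br x0 y) + (w * l y) *s x0"
      by (simp add: scale_right_distrib mult.commute)
    then have y: "y = \<pi> *s (w *s br x0 y) + (w * l y) *s x0"
      using eff_cong[OF lattice_eff[OF latN Suc.prems] w] by (simp add: mult.commute)
    have "w *s br x0 y \<in> N" using subalgD(4)[OF N x0(1) Suc.prems] subspace_scale[OF sN] by blast
    then obtain r t where "t \<in> N" "w *s br x0 y = r *s x0 + \<pi> ^ k *s t" using Suc.IH by blast
    then have "y = (\<pi> * r + w * l y) *s x0 + \<pi> ^ Suc k *s t"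
      by (subst y) (simp add: algebra_simps)
    then show ?case using \<open>t \<in> N\<close> by blast
  qed
  note dec = this
  have "br y z = 0" if yz: "y \<in> N" "z \<in> N" for y z
  proof (rule lattice_separated[OF latN subalgD(4)[OF N yz]])
    fix k
    obtain r t r' t' where *: "t \<in> N" "y = r *s x0 + \<pi> ^ k *s t" "t' \<in> N" "z = r' *s x0 + \<pi> ^ k *s t'"
      using dec yz by blast
    have "br y z = \<pi> ^ k *s (r *s br x0 t' + r' *s br t x0 + br t (\<pi> ^ k *s t'))"
      unfolding *(2,4) by (simp add: br_simps algebra_simps)
    moreover have "r *s br x0 t' + r' *s br t x0 + br t (\<pi> ^ k *s t') \<in> N"
      using subspace_add[OF sN] subspace_scale[OF sN] subalgD(4)[OF N] x0(1) *(1,3) by meson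
    ultimately show "\<exists>y'\<in>N. br y z = \<pi> ^ k *s y'" by blast
  qed
  then show ?thesis unfolding scalar_type_def
    by (intro exI[of _ "\<lambda>_. 0"]) (simp add: functional_def nul_0)
qed

text \<open>The inductive step needs brackets divisible by \<open>\<pi>\<close>, so it is applied to
  \<open>\<pi> L\<close>, which has the same rank. Multiplication by \<open>\<pi>\<close> identifies
  \<open>L\<close> with \<open>\<pi> L\<close> up to a factor \<open>\<pi>\<close> in the bracket,
  and \<open>scalar_type_divide\<close> removes this factor.\<close>

theorem hereditary_scalar_type:
  assumes "hereditary L" "subalg L" shows "scalar_type L"
proof -
  obtain n b where "basis n b L" using subalgD(2)[OF assms(2)] unfolding lattice_def by blast
  then show ?thesis using assms
  proof (induction n arbitrary: b L rule: less_induct)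
    case (less n)
    note b = less.prems(1) and hL = less.prems(2) and L = less.prems(3)
    note sL = subalgD(1)[OF L] and latL = subalgD(2)[OF L]
    define L1 where "L1 = (\<lambda>x. \<pi> *s x) ` L"
    have L1L: "L1 \<subseteq> L" unfolding L1_def using subspace_scale[OF sL] by blast
    have b1: "basis n (\<lambda>i. \<pi> *s b i) L1" unfolding L1_def using basis_scale_unif[OF b] .
    have brL1: "\<exists>z\<in>L1. br x y = \<pi> *s z" if xy: "x \<in> L1" "y \<in> L1" for x y
    proof -
      obtain x' y' where *: "x' \<in> L" "x = \<pi> *s x'" "y' \<in> L" "y = \<pi> *s y'" using xy unfolding L1_def by blast
      then have "br x y = \<pi> *s (\<pi> *s br x' y')" by (simp add: br_simps)
      then show ?thesis using subalgD(4)[OF L *(1,3)] unfolding L1_def by blast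
    qed
    have sub1: "subalg L1" unfolding subalg_def
    proof (intro conjI ballI)
      show "subspace L1" using basis_subspace[OF b1] .
      show "L1 \<subseteq> G" using L1L subalgD(3)[OF L] by blast
      fix x y assume "x \<in> L1" "y \<in> L1"
      then show "br x y \<in> L1" using brL1 subspace_scale[OF basis_subspace[OF b1]] by metis
    qed
    have h1: "hereditary L1" using hereditary_subset[OF hL L1L] .
    have "scalar_type L1"
    proof (cases "L1 = {0}")
      case True
      then show ?thesis unfolding scalar_type_def by (intro exI[of _ "\<lambda>_. 0"]) (simp add: functional_def nul_0)
    next
      case False
      show ?thesis
      proof (rule scalar_type_step[OF h1 sub1 False brL1])
        fix B assume B: "subalg B" "B \<subseteq> L1" "isolated L1 B" "B \<noteq> L1"
        then obtain k b' where "k < n" "basis k b' B" using submodule_basis[OF b1 subalgD(1)[OF B(1)] B(2)] by blast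
        then show "scalar_type B" using less.IH hereditary_subset[OF h1 B(2)] B(1) by blast
      qed
    qed
    then obtain l1 where l1: "functional L1 l1" "\<And>x y. x \<in> L1 \<Longrightarrow> y \<in> L1 \<Longrightarrow> br x y = l1 x *s y - l1 y *s x"
      unfolding scalar_type_def by blast
    define l where "l x = l1 (\<pi> *s x)" for x
    have piL: "\<pi> *s x \<in> L1" if "x \<in> L" for x using that unfolding L1_def by blast
    have "functional L l" unfolding functional_def l_def
      using functionalD[OF l1(1)] piL by (simp add: scale_right_distrib scale_left_commute[of \<pi>] del: scale_scale)
    moreover have "\<pi> *s br x y = l x *s y - l y *s x" if xy: "x \<in> L" "y \<in> L" for x y
    proof -
      have "\<pi> *s (\<pi> *s br x y) = br (\<pi> *s x) (\<pi> *s y)" by (simp add: br_simps)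
      also have "\<dots> = \<pi> *s (l x *s y - l y *s x)"
        unfolding l_def l1(2)[OF piL[OF xy(1)] piL[OF xy(2)]] by (simp add: scale_right_diff_distrib mult.commute)
      finally show ?thesis
        using lattice_unif_cancel_eq[OF latL] subalgD(4)[OF L xy] subspace_diff[OF sL] subspace_scale[OF sL] xy
        by blast
    qed
    ultimately show ?case by (rule scalar_type_divide[OF L])
  qed
qed

section \<open>Lattices of scalar type are self-similar\<close>

text \<open>A basis vector on which \<open>l\<close> has least valuation is normalized by a unit,
  moved to the last position and used to clear the values of \<open>l\<close> on the other
  vectors.\<close>

lemma adapted_basis:
  assumes b: "basis n b N" and l: "functional N l" and x: "x \<in> N" "\<not> nul (l x)"
  obtains k b' s where "n = Suc k" "basis n b' N" "nul (l (b' k) - \<pi> ^ s)" "\<And>i. i < k \<Longrightarrow> nul (l (b' i))"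
proof -
  note sN = basis_subspace[OF b]
  define Q where "Q s \<longleftrightarrow> (\<exists>i<n. \<exists>u w. nul (l (b i) - \<pi> ^ s * u) \<and> nul (u * w - 1))" for s
  have "\<exists>i<n. \<not> nul (l (b i))"
  proof (rule ccontr)
    assume a: "\<not> ?thesis"
    obtain c where c: "x = (\<Sum>i<n. c i *s b i)" using basisD(2)[OF b x(1)] by blast
    have "nul (\<Sum>i<n. c i * l (b i))" using a by (intro nul_sum nul_mult) auto
    moreover have "nul (l x - (\<Sum>i<n. c i * l (b i)))"
      unfolding c by (rule functional_sum[OF l sN]) (rule basis_mem[OF b])
    ultimately have "nul (l x)" using nul_cong by blast
    then show False using x(2) by blast
  qed
  then have Qex: "\<exists>s. Q s" unfolding Q_def using factor by metis
  define s where "s = (LEAST s. Q s)"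
  have "Q s" unfolding s_def using Qex by (rule LeastI_ex)
  then obtain i0 u w where i0: "i0 < n" "nul (l (b i0) - \<pi> ^ s * u)" "nul (u * w - 1)" unfolding Q_def by blast
  have div: "\<exists>t. nul (l (b i) - \<pi> ^ s * t)" if i: "i < n" for i
  proof (cases "nul (l (b i))")
    case True then show ?thesis by (intro exI[of _ 0]) simp
  next
    case False
    then obtain s' u' w' where *: "nul (l (b i) - \<pi> ^ s' * u')" "nul (u' * w' - 1)" using factor by blast
    then have "s \<le> s'" unfolding s_def using i by (intro Least_le) (auto simp: Q_def)
    then have "\<pi> ^ s' * u' = \<pi> ^ s * (\<pi> ^ (s' - s) * u')" by (simp flip: power_add mult.assoc)
    then show ?thesis using *(1) by metis
  qed
  obtain k where k: "n = Suc k" using i0(1) by (cases n) auto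
  define b1 where "b1 = (\<lambda>i. b (transpose i0 k i))"
  have b1: "basis (Suc k) b1 N" unfolding b1_def using basis_transpose[OF b i0(1), of k] k by simp
  have "\<forall>i. \<exists>t. i < n \<longrightarrow> nul (l (b1 i) - \<pi> ^ s * t)"
    using div i0(1) k unfolding b1_def by (auto simp: transpose_def)
  from choice[OF this] obtain t where t: "\<And>i. i < n \<Longrightarrow> nul (l (b1 i) - \<pi> ^ s * t i)" by blast
  define b' where "b' = (\<lambda>i. if i < k then b1 i - t i *s (w *s b1 k) else w *s b1 k)"
  have b': "basis n b' N" unfolding b'_def k using basis_shear[OF b1 i0(3)] .
  have bk: "b1 k \<in> N" using basis_mem[OF b1] by simp
  have lk: "nul (l (w *s b1 k) - \<pi> ^ s)"
  proof -
    have e: "b1 k = b i0" unfolding b1_def by simp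
    have "l (w *s b1 k) - \<pi> ^ s = (l (w *s b1 k) - w * l (b1 k)) + w * (l (b1 k) - \<pi> ^ s * u) + \<pi> ^ s * (u * w - 1)"
      by (simp add: algebra_simps)
    also have "nul \<dots>" using functionalD(2)[OF l bk] i0(2,3) unfolding e by (blast intro: nul_add nul_mult)
    finally show ?thesis .
  qed
  have li: "nul (l (b' i))" if i: "i < k" for i
  proof -
    have bi: "b1 i \<in> N" using basis_mem[OF b1] i by simp
    have ti: "nul (l (b1 i) - \<pi> ^ s * t i)" using t[of i] i k by simp
    have wb: "w *s b1 k \<in> N" using subspace_scale[OF sN bk] .
    have "l (b1 i - t i *s (w *s b1 k)) = (l (b1 i - t i *s (w *s b1 k)) - (l (b1 i) - l (t i *s (w *s b1 k)))) +
        (l (b1 i) - \<pi> ^ s * t i) - (l (t i *s (w *s b1 k)) - t i * l (w *s b1 k)) - t i * (l (w *s b1 k) - \<pi> ^ s)"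
      by (simp add: algebra_simps)
    also have "nul \<dots>"
      using functional_diff[OF l sN bi subspace_scale[OF sN wb]] ti functionalD(2)[OF l wb] lk
      by (blast intro: nul_add nul_diff nul_mult)
    finally show ?thesis using i unfolding b'_def by simp
  qed
  show thesis using that[OF k b'] lk li unfolding b'_def by simp
qed

text \<open>The shift divides the first of the coordinates \<open>0, \<dots>, q - 1\<close> by \<open>\<pi>\<close> and rotates them, so that its
  \<open>q\<close>-th power is division by \<open>\<pi>\<close>; it fixes the other coordinates.\<close>

lemma shift_self_sim:
  assumes N: "subalg N" and b: "basis n b N" and q: "0 < q" "q \<le> n"
    and l: "functional N l" "\<And>x y. x \<in> N \<Longrightarrow> y \<in> N \<Longrightarrow> br x y = l x *s y - l y *s x"
    and l0: "\<And>i. i < q \<Longrightarrow> nul (l (b i))"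
    and l1: "\<And>c. nul (l (\<Sum>i<n. c i *s b i)) \<Longrightarrow> \<forall>i. q \<le> i \<and> i < n \<longrightarrow> nul (c i)"
  shows "self_sim N"
proof -
  note sN = subalgD(1)[OF N] and latN = subalgD(2)[OF N]
  define lc where "lc c = (\<Sum>i<n. c i *s b i)" for c
  have lcN: "lc c \<in> N" for c unfolding lc_def using basisD(3)[OF b] .
  have lc_cong: "lc c = lc d" if "\<And>i. i < n \<Longrightarrow> nul (c i - d i)" for c d
    unfolding lc_def by (rule basis_sum_cong[OF b]) (rule that)
  have lc_uniq: "nul (c i - d i)" if "lc c = lc d" "i < n" for c d i
    using basis_unique[OF b that[unfolded lc_def]] .
  have lc_ex: "\<exists>c. x = lc c" if "x \<in> N" for x unfolding lc_def using basisD(2)[OF b that] .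
  have lc_add: "lc c + lc d = lc (\<lambda>i. c i + d i)" for c d
    unfolding lc_def by (simp add: scale_left_distrib sum.distrib)
  have lc_scale: "r *s lc c = lc (\<lambda>i. r * c i)" for c r
    unfolding lc_def by (simp add: scale_sum_right)
  have l_lc: "nul (l (lc c) - (\<Sum>i<n. c i * l (b i)))" for c
    unfolding lc_def by (rule functional_sum[OF l(1) sN]) (rule basis_mem[OF b])
  have n0: "0 < n" using q by simp
  define M where "M = {x \<in> N. \<exists>c e. x = lc c \<and> nul (c 0 - \<pi> * e)}"
  \<comment> \<open>\<open>e\<close> stands for coordinate 0 divided by \<open>\<pi>\<close>; it
    becomes coordinate \<open>q - 1\<close>.\<close>
  define sh where "sh c e i = (if Suc i < q then c (Suc i) else if Suc i = q then e else c i)" for c :: "nat \<Rightarrow> 'r" and e i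
  have Mex: "\<exists>c e. x = lc c \<and> nul (c 0 - \<pi> * e)" if "x \<in> M" for x using that unfolding M_def by blast
  have MI: "lc c \<in> M" if "nul (c 0 - \<pi> * e)" for c e unfolding M_def using that lcN by blast
  have ME: "\<exists>e. nul (c 0 - \<pi> * e)" if lcM: "lc c \<in> M" for c
  proof -
    obtain d e where de: "lc c = lc d" "nul (d 0 - \<pi> * e)" using Mex[OF lcM] by blast
    then show ?thesis using lc_uniq[OF de(1) n0] nul_trans by blast
  qed
  \<comment> \<open>The shift is defined on coordinates, which are unique only modulo
    \<open>nul\<close>; this makes it independent of their choice.\<close>
  have sh_cong: "lc (sh c e) = lc (sh d f)" if cd: "lc c = lc d" and e: "nul (c 0 - \<pi> * e)" and f: "nul (d 0 - \<pi> * f)" for c d e f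
  proof (rule lc_cong)
    fix i assume i: "i < n"
    have "\<pi> * (e - f) = (d 0 - \<pi> * f) - (c 0 - \<pi> * e) + (c 0 - d 0)" by (simp add: algebra_simps)
    also have "nul \<dots>" using e f lc_uniq[OF cd n0] by (blast intro: nul_add nul_diff)
    finally have "nul (e - f)" using nul_prime unif_not_nul by blast
    then show "nul (sh c e i - sh d f i)" unfolding sh_def using lc_uniq[OF cd] i q by auto
  qed
  have "\<forall>x\<in>M. \<exists>y. \<exists>c e. x = lc c \<and> nul (c 0 - \<pi> * e) \<and> y = lc (sh c e)" using Mex by blast
  from bchoice[OF this] obtain \<phi> where \<phi>0: "\<forall>x\<in>M. \<exists>c e. x = lc c \<and> nul (c 0 - \<pi> * e) \<and> \<phi> x = lc (sh c e)" by blast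
  have \<phi>: "\<phi> (lc c) = lc (sh c e)" if e: "nul (c 0 - \<pi> * e)" for c e
  proof -
    obtain d f where "lc c = lc d" "nul (d 0 - \<pi> * f)" "\<phi> (lc c) = lc (sh d f)" using \<phi>0 MI[of c e, OF e] by blast
    then show ?thesis using sh_cong e by metis
  qed
  have sM: "subspace M"
  proof (rule subspaceI)
    have "0 = lc (\<lambda>_. 0)" unfolding lc_def by simp
    then show "0 \<in> M" using MI[of "\<lambda>_. 0" 0] nul_0 by simp
  next
    fix x y assume "x \<in> M" "y \<in> M"
    then obtain c e d f where *: "x = lc c" "nul (c 0 - \<pi> * e)" "y = lc d" "nul (d 0 - \<pi> * f)" using Mex by meson
    have "nul ((c 0 + d 0) - \<pi> * (e + f))" using nul_add[OF *(2,4)] by (simp add: algebra_simps)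
    then show "x + y \<in> M" unfolding *(1,3) lc_add by (rule MI)
  next
    fix r x assume "x \<in> M"
    then obtain c e where *: "x = lc c" "nul (c 0 - \<pi> * e)" using Mex by meson
    have "nul (r * c 0 - \<pi> * (r * e))" using nul_mult[OF *(2), of r] by (simp add: algebra_simps)
    then show "r *s x \<in> M" unfolding *(1) lc_scale by (rule MI)
  qed
  have MN: "M \<subseteq> N" unfolding M_def by blast
  have \<phi>N: "\<phi> x \<in> N" if "x \<in> M" for x using \<phi>0 that lcN by metis
  have lin: "lin_on M \<phi>" unfolding lin_on_def
  proof (intro conjI ballI allI)
    fix x y assume "x \<in> M" "y \<in> M"
    then obtain c e d f where *: "x = lc c" "nul (c 0 - \<pi> * e)" "y = lc d" "nul (d 0 - \<pi> * f)" using Mex by meson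
    have "nul ((c 0 + d 0) - \<pi> * (e + f))" using nul_add[OF *(2,4)] by (simp add: algebra_simps)
    then have "\<phi> (x + y) = lc (sh (\<lambda>i. c i + d i) (e + f))" unfolding *(1,3) lc_add by (rule \<phi>)
    also have "sh (\<lambda>i. c i + d i) (e + f) = (\<lambda>i. sh c e i + sh d f i)" unfolding sh_def by auto
    finally show "\<phi> (x + y) = \<phi> x + \<phi> y" unfolding *(1,3) \<phi>[of c e, OF *(2)] \<phi>[of d f, OF *(4)] lc_add .
  next
    fix r x assume "x \<in> M"
    then obtain c e where *: "x = lc c" "nul (c 0 - \<pi> * e)" using Mex by meson
    have "nul (r * c 0 - \<pi> * (r * e))" using nul_mult[OF *(2), of r] by (simp add: algebra_simps)
    then have "\<phi> (r *s x) = lc (sh (\<lambda>i. r * c i) (r * e))" unfolding *(1) lc_scale by (rule \<phi>)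
    also have "sh (\<lambda>i. r * c i) (r * e) = (\<lambda>i. r * sh c e i)" unfolding sh_def by auto
    finally show "\<phi> (r *s x) = r *s \<phi> x" unfolding *(1) \<phi>[of c e, OF *(2)] lc_scale .
  qed
  \<comment> \<open>Only coordinates along vectors in the kernel of \<open>l\<close> are changed, so
    \<open>l\<close> is preserved, and with it the bracket.\<close>
  have l\<phi>: "nul (l (\<phi> x) - l x)" if x: "x \<in> M" for x
  proof -
    obtain c e where *: "x = lc c" "nul (c 0 - \<pi> * e)" using Mex[OF x] by blast
    have "nul (sh c e i * l (b i) - c i * l (b i))" for i
    proof (cases "i < q")
      case True then show ?thesis using l0 nul_diff nul_mult by blast
    next
      case False then show ?thesis unfolding sh_def by (simp add: nul_0)
    qed
    then have "nul (\<Sum>i<n. sh c e i * l (b i) - c i * l (b i))" by (intro nul_sum) blast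
    then have mid: "nul ((\<Sum>i<n. sh c e i * l (b i)) - (\<Sum>i<n. c i * l (b i)))" by (simp add: sum_subtractf)
    have "l (\<phi> x) - l x = (l (lc (sh c e)) - (\<Sum>i<n. sh c e i * l (b i))) +
        ((\<Sum>i<n. sh c e i * l (b i)) - (\<Sum>i<n. c i * l (b i))) - (l (lc c) - (\<Sum>i<n. c i * l (b i)))"
      unfolding *(1) \<phi>[of c e, OF *(2)] by simp
    also have "nul \<dots>" using mid l_lc by (blast intro: nul_add nul_diff)
    finally show ?thesis .
  qed
  have brM: "br x y \<in> M" if xy: "x \<in> M" "y \<in> M" for x y
    unfolding l(2)[OF subsetD[OF MN xy(1)] subsetD[OF MN xy(2)]]
    using subspace_diff[OF sM subspace_scale[OF sM xy(2)] subspace_scale[OF sM xy(1)]] .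
  have \<phi>br: "\<phi> (br x y) = br (\<phi> x) (\<phi> y)" if x: "x \<in> M" and y: "y \<in> M" for x y
  proof -
    have "\<phi> (br x y) = l x *s \<phi> y - l y *s \<phi> x"
      unfolding l(2)[OF subsetD[OF MN x] subsetD[OF MN y]]
      using lin_on_diff[OF lin sM subspace_scale[OF sM y] subspace_scale[OF sM x]]
        lin_onD(2)[OF lin x] lin_onD(2)[OF lin y] by simp
    also have "l x *s \<phi> y = l (\<phi> x) *s \<phi> y" using eff_cong[OF lattice_eff[OF latN \<phi>N[OF y]] l\<phi>[OF x]] by simp
    also have "l y *s \<phi> x = l (\<phi> y) *s \<phi> x" using eff_cong[OF lattice_eff[OF latN \<phi>N[OF x]] l\<phi>[OF y]] by simp
    finally show ?thesis using l(2)[OF \<phi>N[OF x] \<phi>N[OF y]] by simp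
  qed
  define b0 where "b0 = lc (\<lambda>i. if i = 0 then 1 else 0)"
  have "b0 \<notin> M"
  proof
    assume "b0 \<in> M"
    then obtain e where "nul (1 - \<pi> * e)" using ME[of "\<lambda>i. if i = 0 then 1 else 0"] unfolding b0_def by auto
    then show False using unif_not_unit nul_commute by blast
  qed
  have pi_M: "\<pi> *s x \<in> M" if x: "x \<in> N" for x
  proof -
    obtain c where c: "x = lc c" using lc_ex[OF x] by blast
    show ?thesis unfolding c lc_scale by (rule MI[of _ "c 0"]) (simp add: nul_0)
  qed
  have "prime_index N M" unfolding prime_index_def
  proof (intro conjI ballI impI)
    show "M \<noteq> N" using \<open>b0 \<notin> M\<close> lcN unfolding b0_def by blast
    show "\<pi> *s x \<in> M" if "x \<in> N" for x using pi_M[OF that] .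
    fix x y assume x: "x \<in> N" "x \<notin> M" and y: "y \<in> N"
    obtain c d where cd: "x = lc c" "y = lc d" using lc_ex x y by meson
    have "\<nexists>e. nul (c 0 - \<pi> * e)" using MI x(2) cd(1) by blast
    then obtain w where w: "nul (c 0 * w - 1)" using unit_or_div by blast
    have "y - (d 0 * w) *s x = lc d + (- (d 0 * w)) *s lc c" unfolding cd by simp
    also have "\<dots> = lc (\<lambda>i. d i + - (d 0 * w) * c i)" unfolding lc_scale lc_add ..
    also have "\<dots> \<in> M"
    proof (rule MI[of _ 0])
      have "d 0 + - (d 0 * w) * c 0 - \<pi> * 0 = - (d 0 * (c 0 * w - 1))" by (simp add: algebra_simps)
      then show "nul (d 0 + - (d 0 * w) * c 0 - \<pi> * 0)" using nul_minus nul_mult[OF w] by metis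
    qed
    finally show "\<exists>r. y - r *s x \<in> M" by blast
  qed
  moreover have "subalg M" unfolding subalg_def using sM MN subalgD(3)[OF N] brM by blast
  moreover have "I = {0}" if I: "ideal_of N I" "I \<subseteq> M" "\<phi> ` I \<subseteq> I" for I
  proof (rule ccontr)
    assume "I \<noteq> {0}"
    have sI: "subspace I" and IN: "I \<subseteq> N" and idI: "\<And>x y. x \<in> N \<Longrightarrow> y \<in> I \<Longrightarrow> br x y \<in> I"
      using I(1) unfolding ideal_of_def by auto
    obtain v where v: "v \<in> I" "v \<noteq> 0" using \<open>I \<noteq> {0}\<close> subspace_0[OF sI] by blast
    define J where "J = {x \<in> I. nul (l x)}"
    \<comment> \<open>An element \<open>v\<close> of the ideal with \<open>l v\<close> not null
      yields \<open>br (b 0) v = - (l v *s b 0)\<close>, a nonzero element of the ideal in the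
      kernel of \<open>l\<close>.\<close>
    obtain v0 where v0: "v0 \<in> J" "v0 \<noteq> 0"
    proof (cases "nul (l v)")
      case True then show ?thesis using that[of v] v unfolding J_def by blast
    next
      case False
      have b0N: "b 0 \<in> N" "b 0 \<noteq> 0" "nul (l (b 0))"
        using basis_mem[OF b n0] l0[OF q(1)] lc_uniq[of "\<lambda>i. if i = 0 then 1 else 0" "\<lambda>_. 0" 0] n0 unif_not_nul
        unfolding lc_def by (auto simp: if_distrib[of "\<lambda>r. r *s _"] cong: if_cong)
      have "br (b 0) v = - (l v *s b 0)"
        using l(2)[OF b0N(1) subsetD[OF IN v(1)]] eff_nul[OF lattice_eff[OF latN subsetD[OF IN v(1)]] b0N(3)] by simp
      then have "- (l v *s b 0) \<in> I" using idI[OF b0N(1) v(1)] by simp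
      then have "l v *s b 0 \<in> I" using subspace_neg[OF sI] by fastforce
      moreover have "l v *s b 0 \<noteq> 0" using lattice_torsion_free[OF latN b0N(1)] b0N(2) False by blast
      moreover have "nul (l (l v *s b 0))"
        using functionalD(2)[OF l(1) b0N(1), of "l v"] nul_mult[OF b0N(3), of "l v"] nul_cong by blast
      ultimately show ?thesis using that unfolding J_def by blast
    qed
    have JM: "J \<subseteq> M" using I(2) unfolding J_def by blast
    have \<phi>J: "\<phi> x \<in> J" if x: "x \<in> J" for x
      using I(3) l\<phi>[OF subsetD[OF JM x]] nul_cong x unfolding J_def by blast
    \<comment> \<open>By \<open>l1\<close> only the first \<open>q\<close> coordinates survive on
      \<open>J\<close>. After \<open>j\<close> steps the first \<open>j\<close> of them have been
      divided by \<open>\<pi>\<close> and moved to the end of the block, so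
      \<open>\<phi> ^^ q\<close> divides by \<open>\<pi>\<close> within \<open>J\<close>. Iteration
      makes each element of \<open>J\<close> divisible by all powers of
      \<open>\<pi>\<close>.\<close>
    have div: "\<exists>y\<in>J. x = \<pi> *s y" if x: "x \<in> J" for x
    proof -
      obtain c where c: "x = lc c" using lc_ex x JM MN by blast
      have nx: "nul (l (lc c))" using x c unfolding J_def by blast
      have tail: "nul (c i)" if "q \<le> i" "i < n" for i using l1[OF nx[unfolded lc_def]] that by blast
      have "j \<le> q \<Longrightarrow> \<exists>e. (\<forall>i<j. nul (c i - \<pi> * e i)) \<and>
          (\<phi> ^^ j) x = lc (\<lambda>i. if i + j < q then c (i + j) else if i < q then e (i + j - q) else 0)" for j
      proof (induction j)
        case 0
        have "lc c = lc (\<lambda>i. if i < q then c i else 0)" by (rule lc_cong) (use tail nul_0 in auto)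
        then show ?case using c by (intro exI[of _ "\<lambda>_. 0"]) (auto intro!: lc_cong simp: nul_0)
      next
        case (Suc j)
        then obtain e where e: "\<forall>i<j. nul (c i - \<pi> * e i)"
          "(\<phi> ^^ j) x = lc (\<lambda>i. if i + j < q then c (i + j) else if i < q then e (i + j - q) else 0)" by auto
        let ?c = "\<lambda>i. if i + j < q then c (i + j) else if i < q then e (i + j - q) else 0"
        have "(\<phi> ^^ j) x \<in> J" by (induction j) (use x \<phi>J in auto)
        then have "lc ?c \<in> M" using e(2) JM by auto
        then obtain f where f: "nul (?c 0 - \<pi> * f)" using ME by blast
        then have fj: "nul (c j - \<pi> * f)" using Suc.prems by simp
        have "(\<phi> ^^ Suc j) x = lc (sh ?c f)" using e(2) \<phi>[of ?c f, OF f] by simp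
        also have "sh ?c f = (\<lambda>i. if i + Suc j < q then c (i + Suc j) else if i < q then (e(j := f)) (i + Suc j - q) else 0)"
        proof
          fix i
          show "sh ?c f i = (if i + Suc j < q then c (i + Suc j) else if i < q then (e(j := f)) (i + Suc j - q) else 0)"
            using Suc.prems unfolding sh_def by auto
        qed
        finally show ?case using e(1) fj by (intro exI[of _ "e(j := f)"]) (auto simp: less_Suc_eq)
      qed
      from this[of q] obtain e where e: "\<forall>i<q. nul (c i - \<pi> * e i)"
        "(\<phi> ^^ q) x = lc (\<lambda>i. if i + q < q then c (i + q) else if i < q then e (i + q - q) else 0)" by auto
      have "(\<phi> ^^ q) x \<in> J" by (induction q) (use x \<phi>J in auto)
      moreover have "x = \<pi> *s (\<phi> ^^ q) x"
        unfolding c e(2)[unfolded c] lc_scale by (rule lc_cong) (use e(1) tail in auto)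
      ultimately show ?thesis by blast
    qed
    have "\<exists>y\<in>J. v0 = \<pi> ^ k *s y" for k
    proof (induction k)
      case 0 then show ?case using v0(1) by (intro bexI[of _ v0]) simp_all
    next
      case (Suc k)
      then obtain y where "y \<in> J" "v0 = \<pi> ^ k *s y" by blast
      moreover obtain z where "z \<in> J" "y = \<pi> *s z" using div \<open>y \<in> J\<close> by blast
      ultimately show ?case by (intro bexI[of _ z]) (simp_all add: mult.commute)
    qed
    then have "v0 = 0"
      using lattice_separated[OF latN, of v0] v0(1) JM MN by blast
    then show False using v0(2) by blast
  qed
  ultimately show ?thesis unfolding self_sim_def
    using lin MN \<phi>N \<phi>br by (intro exI[of _ M] exI[of _ \<phi>]) blast
qed

theorem scalar_type_self_sim:
  assumes N: "subalg N" "N \<noteq> {0}" "scalar_type N"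
  shows "self_sim N"
proof -
  obtain l where l: "functional N l" "\<And>x y. x \<in> N \<Longrightarrow> y \<in> N \<Longrightarrow> br x y = l x *s y - l y *s x"
    using N(3) unfolding scalar_type_def by blast
  obtain n b where b: "basis n b N" using subalgD(2)[OF N(1)] unfolding lattice_def by blast
  have n0: "0 < n"
  proof (rule ccontr)
    assume "\<not> 0 < n"
    then show False using b N(2) by (auto simp: basis_def)
  qed
  note sN = subalgD(1)[OF N(1)] and latN = subalgD(2)[OF N(1)]
  have abelian: "self_sim N" if ab: "\<And>x y. x \<in> N \<Longrightarrow> y \<in> N \<Longrightarrow> br x y = 0"
    by (rule shift_self_sim[OF N(1) b n0 order_refl, of "\<lambda>_. 0"]) (auto simp: functional_def nul_0 ab)
  show ?thesis
  proof (cases "\<exists>x\<in>N. \<not> nul (l x)")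
    case False
    then have "br x y = 0" if "x \<in> N" "y \<in> N" for x y
      using l(2)[OF that] eff_nul[OF lattice_eff[OF latN]] that by simp
    then show ?thesis by (rule abelian)
  next
    case True
    then obtain x0 where "x0 \<in> N" "\<not> nul (l x0)" by blast
    then obtain k b' s where b': "n = Suc k" "basis n b' N" "nul (l (b' k) - \<pi> ^ s)" "\<And>i. i < k \<Longrightarrow> nul (l (b' i))"
      using adapted_basis[OF b l(1)] by metis
    show ?thesis
    \<comment> \<open>In rank one the block of coordinates in the kernel of \<open>l\<close> would
      be empty; but then the bracket vanishes, and the zero form with all coordinates rotated
      serves.\<close>
    proof (cases "k = 0")
      case True
      have "br x y = 0" if xy: "x \<in> N" "y \<in> N" for x y
      proof -
        obtain c d where "x = (\<Sum>i<n. c i *s b' i)" "y = (\<Sum>i<n. d i *s b' i)" using basisD(2)[OF b'(2)] xy by meson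
        then have "x = c 0 *s b' 0" "y = d 0 *s b' 0" using b'(1) True by auto
        then show ?thesis by (simp add: br_simps)
      qed
      then show ?thesis by (rule abelian)
    next
      case False
      show ?thesis
      proof (rule shift_self_sim[OF N(1) b'(2) _ _ l b'(4)])
        show "0 < k" "k \<le> n" using False b'(1) by auto
        fix c assume nl: "nul (l (\<Sum>i<n. c i *s b' i))"
        have "nul (l (\<Sum>i<n. c i *s b' i) - (\<Sum>i<n. c i * l (b' i)))"
          by (rule functional_sum[OF l(1) sN]) (rule basis_mem[OF b'(2)])
        then have "nul (\<Sum>i<n. c i * l (b' i))" using nl nul_cong by blast
        then have "nul ((\<Sum>i<k. c i * l (b' i)) + c k * l (b' k))" unfolding b'(1) by simp
        moreover have "nul (\<Sum>i<k. c i * l (b' i))" using b'(4) by (intro nul_sum nul_mult) auto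
        ultimately have "nul (c k * l (b' k))" using nul_diff by fastforce
        moreover have "\<not> nul (l (b' k))" using b'(3) nul_cong unif_power_not_nul by blast
        ultimately show "\<forall>i. k \<le> i \<and> i < n \<longrightarrow> nul (c i)" using nul_prime b'(1) le_less_Suc_eq by blast
      qed
    qed
  qed
qed

theorem scalar_type_hereditary:
  assumes "scalar_type L" shows "hereditary L"
  unfolding hereditary_def
proof (intro allI impI)
  fix N assume N: "subalg N \<and> N \<subseteq> L \<and> N \<noteq> {0}"
  obtain l where l: "functional L l" "\<forall>x\<in>L. \<forall>y\<in>L. br x y = l x *s y - l y *s x"
    using assms unfolding scalar_type_def by blast
  have "functional N l" using l(1) N unfolding functional_def by (meson subsetD)
  then have "scalar_type N" using l(2) N unfolding scalar_type_def by (intro exI[of _ l]) auto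
  then show "self_sim N" using scalar_type_self_sim N by blast
qed

end

section \<open>The p-adic integers as scalars\<close>

lemma Zp_carrier_iff:
  "f \<in> carrier (Zp p) \<longleftrightarrow> (\<forall>n. f n \<in> {0..<int p ^ n}) \<and> (\<forall>n. f (Suc n) mod int p ^ n = f n)"
  by (simp add: Zp_def)

lemma Zp_ops:
  "(f \<oplus>\<^bsub>Zp p\<^esub> g) = (\<lambda>n. (f n + g n) mod int p ^ n)" "(f \<otimes>\<^bsub>Zp p\<^esub> g) = (\<lambda>n. (f n * g n) mod int p ^ n)"
  "\<zero>\<^bsub>Zp p\<^esub> = (\<lambda>n. 0)" "\<one>\<^bsub>Zp p\<^esub> = (\<lambda>n. 1 mod int p ^ n)"
  by (simp_all add: Zp_def)

lemma Zp_mod_Suc: "(x::int) mod int p ^ Suc n mod int p ^ n = x mod int p ^ n"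
  by (rule mod_mod_cancel) simp

lemma Zp_mkI:
  assumes "p > 0" "\<And>n. g (Suc n) mod int p ^ n = g n mod int p ^ n"
  shows "(\<lambda>n. g n mod int p ^ n) \<in> carrier (Zp p)"
  using assms by (simp add: Zp_carrier_iff Zp_mod_Suc del: power_Suc)

lemma Zp_mod: "f \<in> carrier (Zp p) \<Longrightarrow> f n mod int p ^ n = f n"
  by (simp add: Zp_carrier_iff)

lemma Zp_coherent: "f \<in> carrier (Zp p) \<Longrightarrow> f (n + k) mod int p ^ n = f n"
proof (induction k)
  case (Suc k)
  have "f (n + Suc k) mod int p ^ (n + k) = f (n + k)" using Suc.prems by (simp add: Zp_carrier_iff)
  then have "f (n + k) mod int p ^ n = f (n + Suc k) mod int p ^ n"
    using mod_mod_cancel[of "int p ^ n" "int p ^ (n + k)" "f (n + Suc k)"] by (simp add: power_add)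
  then show ?case using Suc by simp
qed (simp add: Zp_mod)

lemma Zp_closed:
  assumes "p > 0" "f \<in> carrier (Zp p)" "g \<in> carrier (Zp p)"
  shows "(\<lambda>n. (f n + g n) mod int p ^ n) \<in> carrier (Zp p)" "(\<lambda>n. (f n * g n) mod int p ^ n) \<in> carrier (Zp p)"
    "(\<lambda>n. (- f n) mod int p ^ n) \<in> carrier (Zp p)" "(\<lambda>n. 0) \<in> carrier (Zp p)"
    "(\<lambda>n. c mod int p ^ n) \<in> carrier (Zp p)"
proof -
  have c: "[f (Suc n) = f n] (mod int p ^ n)" "[g (Suc n) = g n] (mod int p ^ n)" for n
    using Zp_coherent[OF assms(2), of n 1] Zp_coherent[OF assms(3), of n 1]
      Zp_mod[OF assms(2)] Zp_mod[OF assms(3)] by (simp_all add: cong_def)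
  show "(\<lambda>n. (f n + g n) mod int p ^ n) \<in> carrier (Zp p)" "(\<lambda>n. (f n * g n) mod int p ^ n) \<in> carrier (Zp p)"
    "(\<lambda>n. (- f n) mod int p ^ n) \<in> carrier (Zp p)"
    using cong_add[OF c] cong_mult[OF c] cong_minus_minus_iff[THEN iffD2, OF c(1)]
    by (auto intro!: Zp_mkI[OF assms(1)] simp: cong_def)
  show "(\<lambda>n. 0) \<in> carrier (Zp p)" "(\<lambda>n. c mod int p ^ n) \<in> carrier (Zp p)"
    using Zp_mkI[OF assms(1), of "\<lambda>_. 0"] Zp_mkI[OF assms(1), of "\<lambda>_. c"] by simp_all
qed

text \<open>The product of the rings \<open>\<int>\<^sub>q\<close> over all \<open>q > 0\<close> (with \<open>q = Suc i\<close> at index \<open>i\<close>) is a single type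
  that acts on modules over any \<open>\<int>\<^sub>p\<close> through its component at \<open>p\<close>, so that type classes apply.\<close>

typedef adic = "{F :: nat \<Rightarrow> padic. \<forall>i. F i \<in> carrier (Zp (Suc i))}"
  by (rule exI[of _ "\<lambda>_ _. 0"]) (simp add: Zp_carrier_iff)

setup_lifting type_definition_adic

instantiation adic :: comm_ring_1
begin

lift_definition zero_adic :: adic is "\<lambda>_ _. 0"
  by (simp add: Zp_carrier_iff)

lift_definition one_adic :: adic is "\<lambda>i n. 1 mod int (Suc i) ^ n"
  using Zp_closed(5)[of "Suc _" "\<lambda>_. 0" "\<lambda>_. 0" 1] by (simp add: Zp_carrier_iff del: of_nat_Suc)

lift_definition plus_adic :: "adic \<Rightarrow> adic \<Rightarrow> adic" is "\<lambda>F G i n. (F i n + G i n) mod int (Suc i) ^ n"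
  using Zp_closed(1) by blast

lift_definition times_adic :: "adic \<Rightarrow> adic \<Rightarrow> adic" is "\<lambda>F G i n. (F i n * G i n) mod int (Suc i) ^ n"
  using Zp_closed(2) by blast

lift_definition uminus_adic :: "adic \<Rightarrow> adic" is "\<lambda>F i n. (- F i n) mod int (Suc i) ^ n"
  using Zp_closed(3) by blast

definition minus_adic :: "adic \<Rightarrow> adic \<Rightarrow> adic" where
  "minus_adic F G = F + - G"

instance
proof
  fix a b c :: adic
  show "a + b + c = a + (b + c)" by transfer (simp add: mod_simps add.assoc)
  show "a + b = b + a" by transfer (simp add: add.commute)
  show "0 + a = a" by transfer (simp add: Zp_mod del: of_nat_Suc)
  show "- a + a = 0" by transfer (simp add: mod_simps)
  show "a - b = a + - b" by (rule minus_adic_def)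
  show "a * b * c = a * (b * c)" by transfer (simp add: mod_simps mult.assoc)
  show "a * b = b * a" by transfer (simp add: mult.commute)
  show "1 * a = a" by transfer (simp add: mod_simps Zp_mod del: of_nat_Suc)
  show "(a + b) * c = a * c + b * c" by transfer (simp add: mod_simps distrib_right)
  show "(0::adic) \<noteq> 1"
  proof transfer
    have "(1::int) mod int (Suc 1) ^ 1 \<noteq> 0" by simp
    then show "(\<lambda>_ _. 0) \<noteq> (\<lambda>i n. 1 mod int (Suc i) ^ n)" by metis
  qed
qed

end

text \<open>The ring at \<open>Suc i\<close> sits at index \<open>i\<close>, hence the shift by
  one.\<close>

definition comp_at :: "nat \<Rightarrow> adic \<Rightarrow> padic" where
  "comp_at p F = Rep_adic F (p - 1)"

definition adic_of :: "nat \<Rightarrow> padic \<Rightarrow> adic" where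
  "adic_of p f = Abs_adic (\<lambda>i. if i = p - 1 then f else (\<lambda>_. 0))"

text \<open>Coordinate vectors of all ranks live in one type; the submodule \<open>G\<close> below
  fixes the rank.\<close>

definition vscale :: "adic \<Rightarrow> (nat \<Rightarrow> adic) \<Rightarrow> nat \<Rightarrow> adic" where
  "vscale r v = (\<lambda>i. r * v i)"

lemma vscale_apply [simp]: "vscale r v i = r * v i"
  by (simp add: vscale_def)

locale padic_prime =
  fixes p :: nat assumes prime_p: "prime p" and odd_p: "p > 2"
begin

lemma p_pos: "p > 0" and Suc_p: "Suc (p - 1) = p"
  using odd_p by auto

lemma comp_at_carrier [simp]: "comp_at p F \<in> carrier (Zp p)"
proof -
  have "\<forall>i. Rep_adic F i \<in> carrier (Zp (Suc i))" using Rep_adic[of F] by (rule CollectD)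
  then have "Rep_adic F (p - 1) \<in> carrier (Zp (Suc (p - 1)))" by (rule spec)
  then show ?thesis unfolding comp_at_def Suc_p .
qed

lemma comp_at_adic_of [simp]:
  assumes "f \<in> carrier (Zp p)" shows "comp_at p (adic_of p f) = f"
proof -
  have "(\<lambda>i. if i = p - 1 then f else (\<lambda>_. 0)) \<in> {F. \<forall>i. F i \<in> carrier (Zp (Suc i))}"
    using assms Suc_p Zp_closed(4)[of "Suc _"] by (auto simp: Zp_carrier_iff)
  then show ?thesis unfolding comp_at_def adic_of_def by (simp add: Abs_adic_inverse)
qed

lemma comp_at_ops:
  "comp_at p (F + G) n = (comp_at p F n + comp_at p G n) mod int p ^ n"
  "comp_at p (F * G) n = (comp_at p F n * comp_at p G n) mod int p ^ n"
  "comp_at p (- F) n = (- comp_at p F n) mod int p ^ n"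
  "comp_at p 0 n = 0" "comp_at p 1 n = 1 mod int p ^ n"
  unfolding comp_at_def plus_adic.rep_eq times_adic.rep_eq uminus_adic.rep_eq zero_adic.rep_eq one_adic.rep_eq Suc_p
  by (rule refl)+

lemma comp_at_minus: "comp_at p (F - G) n = (comp_at p F n - comp_at p G n) mod int p ^ n"
  unfolding minus_adic_def comp_at_ops mod_add_right_eq by simp

lemma comp_at_of_nat: "comp_at p (of_nat k) n = int k mod int p ^ n"
  by (induction k) (simp_all add: comp_at_ops mod_simps)

lemma comp_at_power: "comp_at p (F ^ k) n = (comp_at p F n) ^ k mod int p ^ n"
  by (induction k) (simp_all add: comp_at_ops mod_simps)

lemma comp_at_unif_power: "comp_at p (of_nat p ^ k) n = int p ^ k mod int p ^ n"
  by (simp add: comp_at_power comp_at_of_nat mod_simps)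

lemma comp_at_mod [simp]: "comp_at p F n mod int p ^ n = comp_at p F n"
  using Zp_mod comp_at_carrier by blast

lemma comp_at_0: "comp_at p F 0 = 0"
  using comp_at_mod[of F 0] by simp

lemma comp_at_coherent: "comp_at p F (n + k) mod int p ^ n = comp_at p F n"
  using Zp_coherent comp_at_carrier by blast

lemma comp_at_hom:
  "comp_at p (F + G) = comp_at p F \<oplus>\<^bsub>Zp p\<^esub> comp_at p G" "comp_at p (F * G) = comp_at p F \<otimes>\<^bsub>Zp p\<^esub> comp_at p G"
  "comp_at p 0 = \<zero>\<^bsub>Zp p\<^esub>" "comp_at p 1 = \<one>\<^bsub>Zp p\<^esub>"
  by (auto simp: Zp_ops comp_at_ops)

definition vanish :: "adic \<Rightarrow> bool" where
  "vanish F \<longleftrightarrow> comp_at p F = (\<lambda>_. 0)"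

lemma vanish_diff: "vanish (F - G) \<longleftrightarrow> comp_at p F = comp_at p G"
proof -
  have "(comp_at p F n - comp_at p G n) mod int p ^ n = 0 \<longleftrightarrow> comp_at p F n = comp_at p G n" for n
    by (metis comp_at_mod mod_0_imp_dvd mod_eq_dvd_iff dvd_imp_mod_0)
  then show ?thesis unfolding vanish_def fun_eq_iff comp_at_minus by simp
qed

text \<open>Division shifts the sequence: level \<open>n\<close> of the quotient is level
  \<open>n + k\<close> of the dividend divided by \<open>p ^ k\<close>.\<close>

lemma dvd_comp_at:
  assumes "comp_at p F k = 0" shows "\<exists>H. vanish (F - of_nat p ^ k * H)"
proof -
  let ?f = "comp_at p F"
  define g where "g n = ?f (n + k) div int p ^ k" for n
  have pk: "?f (n + k) = int p ^ k * g n" for n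
  proof -
    have "?f (n + k) mod int p ^ k = 0" using comp_at_coherent[of F k n] assms by (simp add: add.commute)
    then show ?thesis unfolding g_def by (simp add: mod_0_imp_dvd)
  qed
  have rng: "0 \<le> ?f n" "?f n < int p ^ n" for n
    using comp_at_carrier[of F] unfolding Zp_carrier_iff by auto
  have ppos: "int p ^ k > 0" using p_pos by simp
  have "g \<in> carrier (Zp p)" unfolding Zp_carrier_iff
  proof (intro conjI allI)
    fix n
    have "int p ^ k * g n < int p ^ k * int p ^ n" using rng(2)[of "n + k"] pk by (simp add: power_add mult.commute)
    moreover have "int p ^ k * 0 \<le> int p ^ k * g n" using rng(1)[of "n + k"] pk by simp
    ultimately show "g n \<in> {0..<int p ^ n}" using ppos by (simp add: mult_less_cancel_left mult_le_cancel_left zero_le_mult_iff)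
    have "int p ^ k * g (Suc n) mod (int p ^ k * int p ^ n) = int p ^ k * g n"
      using comp_at_coherent[of F "n + k" 1] pk[of n] pk[of "Suc n"] by (simp add: power_add mult.commute)
    then have "int p ^ k * (g (Suc n) mod int p ^ n) = int p ^ k * g n" by (simp only: mult_mod_right)
    then show "g (Suc n) mod int p ^ n = g n" using p_pos by simp
  qed
  then have g: "comp_at p (adic_of p g) = g" by simp
  have "comp_at p F n = comp_at p (of_nat p ^ k * adic_of p g) n" for n
    using comp_at_coherent[of F n k] pk[of n] by (simp add: comp_at_ops comp_at_unif_power g mod_simps)
  then show ?thesis using vanish_diff by blast
qed

text \<open>A nonzero residue modulo \<open>p\<close> makes every level invertible by coprimality,
  and the inverses at successive levels are coherent by cancellation.\<close>

lemma unit_comp_at: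
  assumes "comp_at p F 1 \<noteq> 0" shows "\<exists>H. vanish (F * H - 1)"
proof -
  let ?f = "comp_at p F"
  have "\<not> int p dvd ?f 1" using assms comp_at_mod[of F 1] by auto
  have cop: "coprime (?f n) (int p ^ n)" for n
  proof (cases n)
    case (Suc j)
    have "?f n mod int p = ?f 1" using comp_at_coherent[of F 1 j] Suc by simp
    then have "\<not> int p dvd ?f n" using assms by (metis dvd_imp_mod_0)
    then have "coprime (int p) (?f n)" using prime_p by (simp add: prime_imp_coprime)
    then show ?thesis by (simp add: coprime_commute)
  qed simp
  have "\<forall>n. \<exists>x. [?f n * x = 1] (mod int p ^ n)" using cong_solve_coprime_int cop by blast
  from choice[OF this] obtain x where x: "\<And>n. [?f n * x n = 1] (mod int p ^ n)" by blast
  have "(\<lambda>n. x n mod int p ^ n) \<in> carrier (Zp p)"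
  proof (rule Zp_mkI[OF p_pos])
    fix n
    have "[?f (Suc n) * x (Suc n) = 1] (mod int p ^ n)"
      using x[of "Suc n"] by (rule cong_dvd_modulus) simp
    moreover have "[?f (Suc n) = ?f n] (mod int p ^ n)"
      using comp_at_coherent[of F n 1] by (simp add: cong_def)
    ultimately have "[?f n * x (Suc n) = ?f n * x n] (mod int p ^ n)"
      using x[of n] by (meson cong_scalar_right cong_sym cong_trans)
    then show "x (Suc n) mod int p ^ n = x n mod int p ^ n" using cop cong_mult_lcancel unfolding cong_def by blast
  qed
  then have "comp_at p (F * adic_of p (\<lambda>n. x n mod int p ^ n)) n = comp_at p 1 n" for n
    using x[of n] by (simp add: comp_at_ops mod_simps cong_def)
  then show ?thesis using vanish_diff by blast
qed

sublocale dvr_module vscale vanish "of_nat p"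
proof
  fix r s :: adic and f :: "nat \<Rightarrow> adic" and k :: nat
  show "vscale r (x + y) = vscale r x + vscale r y" for x y by (auto simp: fun_eq_iff algebra_simps)
  show "vscale (r + s) x = vscale r x + vscale s x" for x by (auto simp: fun_eq_iff algebra_simps)
  show "vscale r (vscale s x) = vscale (r * s) x" for x by (auto simp: fun_eq_iff algebra_simps)
  show "vscale 1 x = x" for x by (simp add: fun_eq_iff)
  show "vanish 0" by (auto simp: vanish_def comp_at_ops)
  show "vanish (r + s)" if "vanish r" "vanish s" using that by (auto simp: vanish_def comp_at_ops)
  show "vanish (s * r)" if "vanish r" using that by (auto simp: vanish_def comp_at_ops)
  have p2: "int p > 1" using odd_p by simp
  show "\<not> vanish (of_nat p ^ k)"
  proof
    assume "vanish (of_nat p ^ k)"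
    then have "int p ^ k mod int p ^ Suc k = 0" unfolding vanish_def using comp_at_unif_power by metis
    moreover have "int p ^ k < int p ^ Suc k" using p2 by (intro power_strict_increasing) auto
    ultimately show False using p2 by simp
  qed
  show "\<not> vanish (of_nat p * s - 1)"
  proof
    assume "vanish (of_nat p * s - 1)"
    then have "comp_at p (of_nat p * s) 1 = comp_at p 1 1" using vanish_diff by simp
    then show False using p2 by (simp add: comp_at_ops comp_at_of_nat)
  qed
  show "\<exists>k u w. vanish (r - of_nat p ^ k * u) \<and> vanish (u * w - 1)" if r: "\<not> vanish r"
  proof -
    obtain n where "comp_at p r n \<noteq> 0" using r unfolding vanish_def by blast
    then have ex: "\<exists>n. comp_at p r (Suc n) \<noteq> 0" using comp_at_0 by (cases n) auto
    define k where "k = (LEAST n. comp_at p r (Suc n) \<noteq> 0)"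
    have k: "comp_at p r (Suc k) \<noteq> 0" unfolding k_def using ex by (rule LeastI_ex)
    have "comp_at p r k = 0"
    proof (cases k)
      case (Suc j) then show ?thesis using not_less_Least[of j "\<lambda>n. comp_at p r (Suc n) \<noteq> 0"] unfolding k_def by auto
    qed (simp add: comp_at_0)
    then obtain u where u: "vanish (r - of_nat p ^ k * u)" using dvd_comp_at by blast
    have "comp_at p u 1 \<noteq> 0"
    proof
      assume "comp_at p u 1 = 0"
      then have "comp_at p u (Suc k) mod int p = 0" using comp_at_coherent[of u 1 k] by simp
      then obtain t where "comp_at p u (Suc k) = int p * t" by (metis dvd_def mod_0_imp_dvd)
      moreover have "comp_at p r (Suc k) = comp_at p (of_nat p ^ k * u) (Suc k)" using u vanish_diff by simp
      ultimately have "comp_at p r (Suc k) = (int p ^ Suc k * t) mod int p ^ Suc k"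
        by (simp add: comp_at_ops comp_at_unif_power mod_simps mult.assoc mult.left_commute)
      then show False using k by simp
    qed
    then show ?thesis using u unit_comp_at by blast
  qed
  show "\<exists>s. \<forall>k. \<exists>t. vanish (s - (\<Sum>i<k. of_nat p ^ i * f i) - of_nat p ^ k * t)"
  proof -
    \<comment> \<open>The sum of the series is read along the diagonal: level \<open>n\<close> is
      taken from the partial sum \<open>S n\<close>, since later terms no longer change that
      level.\<close>
    define S where "S k = (\<Sum>i<k. of_nat p ^ i * f i)" for k
    have step: "comp_at p (S (Suc n)) n = comp_at p (S n) n" for n
      unfolding S_def by (simp add: comp_at_ops comp_at_unif_power mod_simps)
    have st: "comp_at p (S (k + n)) k = comp_at p (S k) k" for k n
    proof (induction n)
      case (Suc n)
      have "comp_at p (S (k + Suc n)) k = comp_at p (S (Suc (k + n))) (k + n) mod int p ^ k"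
        using comp_at_coherent[of "S (k + Suc n)" k n] by simp
      also have "\<dots> = comp_at p (S (k + n)) (k + n) mod int p ^ k" using step by simp
      also have "\<dots> = comp_at p (S (k + n)) k" by (rule comp_at_coherent)
      finally show ?case using Suc by simp
    qed simp
    have "(\<lambda>n. comp_at p (S n) n) \<in> carrier (Zp p)"
      using Zp_mkI[OF p_pos, of "\<lambda>n. comp_at p (S n) n"] comp_at_coherent[of _ _ 1] step by simp
    then have s: "comp_at p (adic_of p (\<lambda>n. comp_at p (S n) n)) n = comp_at p (S n) n" for n by simp
    show ?thesis
      by (rule exI[of _ "adic_of p (\<lambda>n. comp_at p (S n) n)"], rule allI, rule dvd_comp_at)
        (simp add: comp_at_minus s flip: S_def)
  qed
  show "\<exists>F. finite F \<and> (\<forall>r. \<exists>f\<in>F. \<exists>t. vanish (r - f - of_nat p ^ k * t))"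
  proof (intro exI[of _ "of_nat ` {..<p ^ k}"] conjI allI)
    fix r
    have rng: "0 \<le> comp_at p r k" "comp_at p r k < int p ^ k"
      using comp_at_carrier[of r] unfolding Zp_carrier_iff by auto
    obtain i where i: "comp_at p r k = int i" using rng(1) nonneg_int_cases by blast
    have "comp_at p (r - of_nat i) k = 0" using i by (simp add: comp_at_minus comp_at_of_nat mod_simps)
    then have "\<exists>t. vanish (r - of_nat i - of_nat p ^ k * t)" by (rule dvd_comp_at)
    moreover have "i < p ^ k" using rng(2) i by (simp flip: of_nat_power)
    ultimately show "\<exists>f\<in>of_nat ` {..<p ^ k}. \<exists>t. vanish (r - f - of_nat p ^ k * t)" by blast
  qed simp
qed

lemma two_not_vanish: "\<not> vanish 2"
proof
  assume "vanish 2"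
  then have "int 2 mod int p ^ 1 = 0" unfolding vanish_def using comp_at_of_nat[of 2 1] by simp
  then show False using odd_p by simp
qed

lemma residue: "\<exists>i<p. \<exists>t. vanish (r - of_nat i - of_nat p * t)"
proof -
  have rng: "0 \<le> comp_at p r 1" "comp_at p r 1 < int p"
    using comp_at_carrier[of r] unfolding Zp_carrier_iff by (auto dest!: spec[of _ 1])
  obtain i where i: "comp_at p r 1 = int i" using rng(1) nonneg_int_cases by blast
  have "comp_at p (r - of_nat i) 1 = 0" using i by (simp add: comp_at_minus comp_at_of_nat mod_simps)
  then have "\<exists>t. vanish (r - of_nat i - of_nat p ^ 1 * t)" by (rule dvd_comp_at)
  moreover have "i < p" using rng(2) i by simp
  ultimately show ?thesis by auto
qed

lemma of_nat_unit: assumes "0 < i" "i < p" shows "\<exists>w. vanish (of_nat i * w - 1)"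
  using assms by (intro unit_comp_at) (simp add: comp_at_of_nat)

text \<open>Scalars act through the component at \<open>p\<close>; vanishing of the other components
  makes an entry determined by this one component, which gives each element of the Lie lattice
  unique coordinates.\<close>

definition pure :: "adic \<Rightarrow> bool" where
  "pure F \<longleftrightarrow> (\<forall>i. i \<noteq> p - 1 \<longrightarrow> Rep_adic F i = (\<lambda>_. 0))"

lemma pure_eqI: "pure F \<Longrightarrow> pure G \<Longrightarrow> comp_at p F = comp_at p G \<Longrightarrow> F = G"
  unfolding pure_def comp_at_def by (metis Rep_adic_inject ext)

lemma pure_0: "pure 0" and pure_add: "pure F \<Longrightarrow> pure G \<Longrightarrow> pure (F + G)" and pure_mult: "pure F \<Longrightarrow> pure (r * F)"
  unfolding pure_def by (simp_all add: zero_adic.rep_eq plus_adic.rep_eq times_adic.rep_eq)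

lemma pure_adic_of: assumes "f \<in> carrier (Zp p)" shows "pure (adic_of p f)"
proof -
  have "(\<lambda>i. if i = p - 1 then f else (\<lambda>_. 0)) \<in> {F. \<forall>i. F i \<in> carrier (Zp (Suc i))}"
    using assms Suc_p Zp_closed(4)[of "Suc _"] by (auto simp: Zp_carrier_iff)
  then show ?thesis unfolding pure_def adic_of_def by (simp add: Abs_adic_inverse)
qed

text \<open>The quotient is a group of prime order \<open>p\<close>: it is killed by
  \<open>p\<close>, and each nontrivial element generates it by Lagrange's theorem. The scalar
  \<open>r\<close> can therefore be taken to be a natural number.\<close>

lemma prime_index_if_card_cosets:
  assumes N: "subspace N" and M: "subspace M" "M \<subseteq> N"
    and card: "card ((\<lambda>v. (\<lambda>m. m + v) ` M) ` N) = p"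
  shows "M \<noteq> N" "x \<in> N \<Longrightarrow> vscale (of_nat p) x \<in> M"
    "x \<in> N \<Longrightarrow> x \<notin> M \<Longrightarrow> y \<in> N \<Longrightarrow> \<exists>r. y - vscale r x \<in> M"
proof -
  define Q :: "(nat \<Rightarrow> adic) monoid" where "Q = \<lparr>carrier = N, monoid.mult = (+), one = 0\<rparr>"
  have ops: "carrier Q = N" "monoid.mult Q = (+)" "one Q = 0" unfolding Q_def by simp_all
  interpret Q: comm_group Q
  proof (rule comm_groupI)
    fix v assume "v \<in> carrier Q"
    then show "\<exists>y\<in>carrier Q. y \<otimes>\<^bsub>Q\<^esub> v = \<one>\<^bsub>Q\<^esub>"
      using subspace_neg[OF N] unfolding ops by (intro bexI[of _ "- v"]) auto
  qed (use subspace_0[OF N] subspace_add[OF N] in \<open>auto simp: ops add.assoc add.commute\<close>)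
  have inv: "inv\<^bsub>Q\<^esub> v = - v" if "v \<in> N" for v
    using that subspace_neg[OF N] by (intro Q.inv_equality) (auto simp: ops)
  have sub: "subgroup M Q"
    using M subspace_0[OF M(1)] subspace_add[OF M(1)] subspace_neg[OF M(1)] inv
    by (intro subgroup.intro) (auto simp: ops)
  interpret M: normal M Q using Q.subgroup_imp_normal[OF sub] .
  have coset: "M #>\<^bsub>Q\<^esub> v = (\<lambda>m. m + v) ` M" for v unfolding r_coset_def ops by auto
  let ?F = "Q Mod M"
  interpret F: group ?F by (rule M.factorgroup_is_group)
  have ordF: "order ?F = p"
    using card unfolding order_def FactGroup_def RCOSETS_def coset ops by (simp add: UNION_singleton_eq_range)
  have hom: "group_hom Q ?F (\<lambda>a. M #>\<^bsub>Q\<^esub> a)"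
    by (intro group_hom.intro group_hom_axioms.intro M.r_coset_hom_Mod Q.group_axioms F.group_axioms)
  have pow: "v [^]\<^bsub>Q\<^esub> n = vscale (of_nat n) v" if "v \<in> N" for v and n :: nat
    by (induction n) (auto simp: ops scale_left_distrib add.commute)
  have powF: "(M #>\<^bsub>Q\<^esub> v) [^]\<^bsub>?F\<^esub> n = M #>\<^bsub>Q\<^esub> vscale (of_nat n) v" if "v \<in> N" for v and n :: nat
    using group_hom.hom_nat_pow[OF hom, of v n] that pow by (simp add: ops)
  have inF: "M #>\<^bsub>Q\<^esub> v \<in> carrier ?F" if "v \<in> N" for v
    using that Q.rcosetsI[OF sub[THEN subgroup.subset], of v] unfolding FactGroup_def by (simp add: ops)
  have trivial: "v \<in> M" if "M #>\<^bsub>Q\<^esub> v = M" "v \<in> N" for v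
  proof -
    have "0 + v \<in> M #>\<^bsub>Q\<^esub> v" unfolding coset using subspace_0[OF M(1)] by blast
    then show ?thesis using that(1) by simp
  qed
  have oneF: "\<one>\<^bsub>?F\<^esub> = M" by (simp add: FactGroup_def)
  show "vscale (of_nat p) x \<in> M" if "x \<in> N"
  proof (rule trivial)
    have "(M #>\<^bsub>Q\<^esub> x) [^]\<^bsub>?F\<^esub> p = \<one>\<^bsub>?F\<^esub>" using F.pow_order_eq_1[OF inF[OF that]] ordF by simp
    then show "M #>\<^bsub>Q\<^esub> vscale (of_nat p) x = M" using powF[OF that] oneF by simp
    show "vscale (of_nat p) x \<in> N" using subspace_scale[OF N that] .
  qed
  show "M \<noteq> N"
  proof
    assume "M = N"
    then have "(\<lambda>v. (\<lambda>m. m + v) ` M) ` N \<subseteq> {M}"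
    proof -
      have "(\<lambda>m. m + v) ` N = N" if "v \<in> N" for v
      proof (intro equalityI subsetI)
        fix u assume "u \<in> N"
        then show "u \<in> (\<lambda>m. m + v) ` N" using subspace_diff[OF N _ that] by (intro image_eqI[of _ _ "u - v"]) auto
      qed (use subspace_add[OF N] that in auto)
      then show ?thesis using \<open>M = N\<close> by auto
    qed
    then have "card ((\<lambda>v. (\<lambda>m. m + v) ` M) ` N) \<le> 1" using card_mono[of "{M}"] by fastforce
    then show False using card odd_p by simp
  qed
  show "\<exists>r. y - vscale r x \<in> M" if x: "x \<in> N" "x \<notin> M" and y: "y \<in> N"
  proof -
    let ?x = "M #>\<^bsub>Q\<^esub> x"
    have fin: "finite (carrier ?F)" using ordF p_pos F.order_gt_0_iff_finite by simp
    have "F.ord ?x dvd p" using F.ord_dvd_group_order[OF inF[OF x(1)]] ordF by simp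
    moreover have "F.ord ?x \<noteq> 1"
    proof
      assume "F.ord ?x = 1"
      then have "?x = M" using F.ord_eq_1[OF inF[OF x(1)]] oneF by simp
      then show False using trivial x by blast
    qed
    ultimately have ordx: "F.ord ?x = p" using prime_p prime_nat_iff by blast
    have "inj_on (\<lambda>n. ?x [^]\<^bsub>?F\<^esub> n) {0..p - 1}"
      using F.ord_inj[OF inF[OF x(1)]] ordx by simp
    then have "card ((\<lambda>n. ?x [^]\<^bsub>?F\<^esub> n) ` {0..p - 1}) = p" using p_pos by (simp add: card_image)
    moreover have "(\<lambda>n. ?x [^]\<^bsub>?F\<^esub> n) ` {0..p - 1} \<subseteq> carrier ?F" using inF[OF x(1)] by auto
    ultimately have "(\<lambda>n. ?x [^]\<^bsub>?F\<^esub> n) ` {0..p - 1} = carrier ?F"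
      using card_subset_eq[OF fin] ordF unfolding order_def by simp
    then obtain n where "M #>\<^bsub>Q\<^esub> y = ?x [^]\<^bsub>?F\<^esub> (n::nat)" using inF[OF y] by (metis imageE)
    then have "M #>\<^bsub>Q\<^esub> y = M #>\<^bsub>Q\<^esub> vscale (of_nat n) x" using powF[OF x(1)] by simp
    moreover have "0 + y \<in> M #>\<^bsub>Q\<^esub> y" unfolding coset using subspace_0[OF M(1)] by blast
    ultimately obtain m where "m \<in> M" "y = m + vscale (of_nat n) x" unfolding coset by auto
    then show ?thesis by (intro exI[of _ "of_nat n"]) simp
  qed
qed

text \<open>For \<open>x\<close> outside \<open>M\<close>, the multiples of \<open>x\<close> by the
  natural numbers below \<open>p\<close> represent all cosets by \<open>residue\<close>. They
  represent distinct ones because the difference of two such numbers is a unit.\<close>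

lemma card_cosets_if_prime_index:
  assumes N: "subspace N" and M: "subspace M" "M \<subseteq> N" and ne: "M \<noteq> N"
    and pN: "\<And>x. x \<in> N \<Longrightarrow> vscale (of_nat p) x \<in> M"
    and cyc: "\<And>x y. x \<in> N \<Longrightarrow> x \<notin> M \<Longrightarrow> y \<in> N \<Longrightarrow> \<exists>r. y - vscale r x \<in> M"
    and eN: "\<And>x. x \<in> N \<Longrightarrow> eff x"
  shows "card ((\<lambda>v. (\<lambda>m. m + v) ` M) ` N) = p"
proof -
  obtain x where x: "x \<in> N" "x \<notin> M" using ne M(2) by blast
  define f where "f i = (\<lambda>m. m + vscale (of_nat i) x) ` M" for i
  have eq: "(\<lambda>m. m + v) ` M = (\<lambda>m. m + w) ` M" if "v - w \<in> M" for v w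
  proof (intro equalityI image_subsetI)
    fix m assume m: "m \<in> M"
    show "m + v \<in> (\<lambda>m. m + w) ` M" using subspace_add[OF M(1) m that] by (intro image_eqI[of _ _ "m + (v - w)"]) simp_all
    show "m + w \<in> (\<lambda>m. m + v) ` M" using subspace_diff[OF M(1) m that] by (intro image_eqI[of _ _ "m - (v - w)"]) simp_all
  qed
  have "f ` {..<p} = (\<lambda>v. (\<lambda>m. m + v) ` M) ` N"
  proof (intro equalityI image_subsetI)
    fix i show "f i \<in> (\<lambda>v. (\<lambda>m. m + v) ` M) ` N" unfolding f_def using subspace_scale[OF N x(1)] by blast
  next
    fix v assume v: "v \<in> N"
    obtain r where r: "v - vscale r x \<in> M" using cyc x v by blast
    obtain i t where i: "i < p" "vanish (r - of_nat i - of_nat p * t)" using residue by blast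
    have "vscale r x = vscale (of_nat i + of_nat p * t) x"
      using eff_cong[OF eN[OF x(1)], of r "of_nat i + of_nat p * t"] i(2) by (simp add: diff_diff_eq)
    also have "\<dots> = vscale (of_nat i) x + vscale t (vscale (of_nat p) x)"
      by (rule ext) (simp add: algebra_simps)
    finally have rx: "vscale r x = vscale (of_nat i) x + vscale t (vscale (of_nat p) x)" .
    have "v - vscale (of_nat i) x = (v - vscale r x) + vscale t (vscale (of_nat p) x)"
      unfolding rx by (simp only: diff_diff_eq[symmetric] diff_add_cancel)
    also have "\<dots> \<in> M" using subspace_add[OF M(1) r subspace_scale[OF M(1) pN[OF x(1)]]] .
    finally show "(\<lambda>m. m + v) ` M \<in> f ` {..<p}" unfolding f_def using eq i(1) by blast
  qed
  moreover have "inj_on f {..<p}"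
  proof (rule linorder_inj_onI')
    fix i j assume ij: "i \<in> {..<p}" "j \<in> {..<p}" "i < j"
    show "f i \<noteq> f j"
    proof
      assume "f i = f j"
      moreover have "0 + vscale (of_nat j) x \<in> f j" unfolding f_def using subspace_0[OF M(1)] by blast
      ultimately obtain m where m: "m \<in> M" "vscale (of_nat j) x = m + vscale (of_nat i) x" unfolding f_def by auto
      then have "m = vscale (of_nat j) x - vscale (of_nat i) x" by simp
      also have "\<dots> = vscale (of_nat (j - i)) x" using ij(3) by (simp add: of_nat_diff scale_left_diff_distrib)
      finally have mx: "vscale (of_nat (j - i)) x \<in> M" using m(1) by simp
      obtain w where w: "vanish (of_nat (j - i) * w - 1)" 
      proof -
        have "0 < j - i" "j - i < p" using ij by auto
        then show ?thesis using that of_nat_unit by blast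
      qed
      have "vscale w (vscale (of_nat (j - i)) x) \<in> M" using subspace_scale[OF M(1) mx] .
      moreover have "vscale w (vscale (of_nat (j - i)) x) = x"
        using eff_cong[OF eN[OF x(1)] w] by (simp add: mult.commute)
      ultimately show False using x(2) by simp
    qed
  qed
  ultimately show ?thesis by (metis card_image card_lessThan)
qed

end

section \<open>Coordinates of a Lie lattice\<close>

locale padic_lie = padic_prime p + lie_algebra "Zp p" L for p and L (structure) +
  fixes d :: nat and \<beta> :: "nat \<Rightarrow> 'a"
  assumes basis_bij: "inj_on \<beta> {..<d}" and fin_basis: "finite_basis (Zp p) L (\<beta> ` {..<d})"
begin

abbreviation "R \<equiv> Zp p"

definition \<kappa> :: "(nat \<Rightarrow> adic) \<Rightarrow> 'a" where
  "\<kappa> v = (\<Oplus>\<^bsub>L\<^esub>i\<in>{..<d}. comp_at p (v i) \<odot>\<^bsub>L\<^esub> \<beta> i)"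

text \<open>Exactly one coordinate vector for each element of \<open>L\<close>: entries are
  concentrated at \<open>p\<close> and vanish beyond the rank.\<close>

definition G :: "(nat \<Rightarrow> adic) set" where
  "G = {v. (\<forall>i. pure (v i)) \<and> (\<forall>i\<ge>d. v i = 0)}"

definition \<iota> :: "'a \<Rightarrow> nat \<Rightarrow> adic" where
  "\<iota> = the_inv_into G \<kappa>"

lemma \<beta>_carrier: "i < d \<Longrightarrow> \<beta> i \<in> carrier L"
  using fin_basis unfolding finite_basis_def by auto

lemma basis_expansion:
  "\<forall>x\<in>carrier L. \<exists>!c. c \<in> \<beta> ` {..<d} \<rightarrow>\<^sub>E carrier R \<and> x = (\<Oplus>\<^bsub>L\<^esub>b\<in>\<beta> ` {..<d}. c b \<odot>\<^bsub>L\<^esub> b)"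
  using fin_basis unfolding finite_basis_def by (elim conjE)

lemma \<kappa>_term: "i < d \<Longrightarrow> a \<in> carrier R \<Longrightarrow> a \<odot>\<^bsub>L\<^esub> \<beta> i \<in> carrier L"
  using \<beta>_carrier by simp

lemma \<kappa>_closed: "\<kappa> v \<in> carrier L"
  unfolding \<kappa>_def by (rule M.finsum_closed) (auto intro!: \<kappa>_term)

lemma \<kappa>_add: "\<kappa> (v + w) = \<kappa> v \<oplus>\<^bsub>L\<^esub> \<kappa> w"
proof -
  have "\<kappa> (v + w) = (\<Oplus>\<^bsub>L\<^esub>i\<in>{..<d}. comp_at p (v i) \<odot>\<^bsub>L\<^esub> \<beta> i \<oplus>\<^bsub>L\<^esub> comp_at p (w i) \<odot>\<^bsub>L\<^esub> \<beta> i)"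
    unfolding \<kappa>_def
    by (rule M.finsum_cong') (auto simp: comp_at_hom smult_l_distr \<beta>_carrier intro!: M.add.m_closed \<kappa>_term)
  also have "\<dots> = \<kappa> v \<oplus>\<^bsub>L\<^esub> \<kappa> w"
    unfolding \<kappa>_def by (rule M.finsum_addf) (auto intro!: \<kappa>_term)
  finally show ?thesis .
qed

lemma \<kappa>_scale: "\<kappa> (vscale r v) = comp_at p r \<odot>\<^bsub>L\<^esub> \<kappa> v"
proof -
  have "comp_at p r \<odot>\<^bsub>L\<^esub> \<kappa> v = (\<Oplus>\<^bsub>L\<^esub>i\<in>{..<d}. comp_at p r \<odot>\<^bsub>L\<^esub> (comp_at p (v i) \<odot>\<^bsub>L\<^esub> \<beta> i))"
    unfolding \<kappa>_def by (rule finsum_smult_ldistr) (auto intro!: \<kappa>_term)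
  also have "\<dots> = \<kappa> (vscale r v)"
    unfolding \<kappa>_def
    by (rule M.finsum_cong') (auto simp: comp_at_hom smult_assoc1 \<beta>_carrier intro!: smult_closed)
  finally show ?thesis by simp
qed

lemma finsum_\<beta>:
  assumes "c \<in> \<beta> ` {..<d} \<rightarrow> carrier R"
  shows "(\<Oplus>\<^bsub>L\<^esub>b\<in>\<beta> ` {..<d}. c b \<odot>\<^bsub>L\<^esub> b) = (\<Oplus>\<^bsub>L\<^esub>i\<in>{..<d}. c (\<beta> i) \<odot>\<^bsub>L\<^esub> \<beta> i)"
  using assms basis_bij \<beta>_carrier by (intro M.finsum_reindex) (auto intro!: smult_closed)

lemma G_subspace: "subspace G"
  unfolding G_def by (rule subspaceI) (auto simp: pure_0 pure_add pure_mult)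

lemma \<kappa>_bij: "bij_betw \<kappa> G (carrier L)"
  unfolding bij_betw_def
proof
  show "inj_on \<kappa> G"
  proof (rule inj_onI)
    fix v w assume vw: "v \<in> G" "w \<in> G" "\<kappa> v = \<kappa> w"
    define c where "c u = restrict (\<lambda>b. comp_at p (u (the_inv_into {..<d} \<beta> b))) (\<beta> ` {..<d})" for u
    have c: "c u \<in> \<beta> ` {..<d} \<rightarrow>\<^sub>E carrier R" "\<And>i. i < d \<Longrightarrow> c u (\<beta> i) = comp_at p (u i)" for u
      unfolding c_def using the_inv_into_f_f[OF basis_bij] by auto
    have k: "\<kappa> u = (\<Oplus>\<^bsub>L\<^esub>b\<in>\<beta> ` {..<d}. c u b \<odot>\<^bsub>L\<^esub> b)" for u
    proof -
      have "c u \<in> \<beta> ` {..<d} \<rightarrow> carrier R" using c(1) by auto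
      then show ?thesis unfolding finsum_\<beta>[OF \<open>c u \<in> \<beta> ` {..<d} \<rightarrow> carrier R\<close>] \<kappa>_def
        by (intro M.finsum_cong') (auto simp: c(2) intro!: \<kappa>_term)
    qed
    have "\<exists>!c. c \<in> \<beta> ` {..<d} \<rightarrow>\<^sub>E carrier R \<and> \<kappa> v = (\<Oplus>\<^bsub>L\<^esub>b\<in>\<beta> ` {..<d}. c b \<odot>\<^bsub>L\<^esub> b)"
      by (rule bspec[OF basis_expansion \<kappa>_closed])
    moreover have "c v \<in> \<beta> ` {..<d} \<rightarrow>\<^sub>E carrier R \<and> \<kappa> v = (\<Oplus>\<^bsub>L\<^esub>b\<in>\<beta> ` {..<d}. c v b \<odot>\<^bsub>L\<^esub> b)"
      using c(1) k by (intro conjI)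
    moreover have "c w \<in> \<beta> ` {..<d} \<rightarrow>\<^sub>E carrier R \<and> \<kappa> v = (\<Oplus>\<^bsub>L\<^esub>b\<in>\<beta> ` {..<d}. c w b \<odot>\<^bsub>L\<^esub> b)"
      unfolding vw(3) using c(1) k by (intro conjI)
    ultimately have "c v = c w" by (elim ex1E) (metis (no_types))
    then have "comp_at p (v i) = comp_at p (w i)" if "i < d" for i using c(2) that by metis
    then have "v i = w i" for i using vw(1,2) pure_eqI unfolding G_def by (cases "i < d") auto
    then show "v = w" by blast
  qed
  show "\<kappa> ` G = carrier L"
  proof (intro equalityI subsetI)
    fix x assume x: "x \<in> carrier L"
    obtain c where c: "c \<in> \<beta> ` {..<d} \<rightarrow>\<^sub>E carrier R" "x = (\<Oplus>\<^bsub>L\<^esub>b\<in>\<beta> ` {..<d}. c b \<odot>\<^bsub>L\<^esub> b)"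
      using ex1_implies_ex[OF bspec[OF basis_expansion x]] by (elim exE conjE) (rule that)
    define v where "v i = (if i < d then adic_of p (c (\<beta> i)) else 0)" for i
    have cR: "c (\<beta> i) \<in> carrier R" if "i < d" for i using c(1) that by auto
    have "v \<in> G" unfolding G_def v_def using cR pure_adic_of pure_0 by auto
    moreover have "\<kappa> v = x"
    proof -
      have "c \<in> \<beta> ` {..<d} \<rightarrow> carrier R" using c(1) by auto
      then show ?thesis unfolding c(2) finsum_\<beta>[OF \<open>c \<in> \<beta> ` {..<d} \<rightarrow> carrier R\<close>] \<kappa>_def
        by (intro M.finsum_cong') (auto simp: v_def cR intro!: \<kappa>_term)
    qed
    ultimately show "x \<in> \<kappa> ` G" by blast
  qed (use \<kappa>_closed in auto)
qed

lemma \<kappa>_\<iota> [simp]: "x \<in> carrier L \<Longrightarrow> \<kappa> (\<iota> x) = x"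
  unfolding \<iota>_def using \<kappa>_bij f_the_inv_into_f_bij_betw by metis

lemma \<iota>_\<kappa> [simp]: "v \<in> G \<Longrightarrow> \<iota> (\<kappa> v) = v"
  unfolding \<iota>_def using \<kappa>_bij the_inv_into_f_f unfolding bij_betw_def by metis

lemma \<iota>_G: "x \<in> carrier L \<Longrightarrow> \<iota> x \<in> G"
  using \<kappa>_bij \<iota>_\<kappa> unfolding bij_betw_def by (metis imageE)

lemma \<iota>_image: "\<iota> ` carrier L = G"
  using \<iota>_G \<iota>_\<kappa> \<kappa>_closed by (metis (no_types, lifting) equalityI image_iff image_subsetI subsetI)

lemma \<iota>_inj: "x \<in> carrier L \<Longrightarrow> y \<in> carrier L \<Longrightarrow> \<iota> x = \<iota> y \<longleftrightarrow> x = y"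
  using \<kappa>_\<iota> by metis

lemma \<iota>_add: "x \<in> carrier L \<Longrightarrow> y \<in> carrier L \<Longrightarrow> \<iota> (x \<oplus>\<^bsub>L\<^esub> y) = \<iota> x + \<iota> y"
  using \<iota>_\<kappa>[OF subspace_add[OF G_subspace \<iota>_G \<iota>_G]] \<kappa>_add by simp

lemma \<iota>_comp: "x \<in> carrier L \<Longrightarrow> \<iota> (comp_at p r \<odot>\<^bsub>L\<^esub> x) = vscale r (\<iota> x)"
  using \<iota>_\<kappa>[OF subspace_scale[OF G_subspace \<iota>_G]] \<kappa>_scale by simp

lemma \<iota>_smult: "a \<in> carrier R \<Longrightarrow> x \<in> carrier L \<Longrightarrow> \<iota> (a \<odot>\<^bsub>L\<^esub> x) = vscale (adic_of p a) (\<iota> x)"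
  using \<iota>_comp[of x "adic_of p a"] by simp

lemma \<iota>_0: "\<iota> \<zero>\<^bsub>L\<^esub> = 0"
proof -
  have "\<iota> \<zero>\<^bsub>L\<^esub> = \<iota> \<zero>\<^bsub>L\<^esub> + \<iota> \<zero>\<^bsub>L\<^esub>" using \<iota>_add[of "\<zero>\<^bsub>L\<^esub>" "\<zero>\<^bsub>L\<^esub>"] by simp
  then show ?thesis by simp
qed

lemma \<kappa>_0: "\<kappa> 0 = \<zero>\<^bsub>L\<^esub>"
  using \<kappa>_\<iota>[of "\<zero>\<^bsub>L\<^esub>"] \<iota>_0 by simp

lemma \<iota>_minus: assumes "x \<in> carrier L" shows "\<iota> (\<ominus>\<^bsub>L\<^esub> x) = - \<iota> x"
proof -
  have "\<iota> (\<ominus>\<^bsub>L\<^esub> x) + \<iota> x = 0" using \<iota>_add[of "\<ominus>\<^bsub>L\<^esub> x" x] assms \<iota>_0 by (simp add: M.l_neg)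
  then show ?thesis by (simp add: eq_neg_iff_add_eq_0)
qed

text \<open>\<open>\<kappa>\<close> is linear with values in the carrier on all vectors, not only on
  \<open>G\<close>, so the transported bracket satisfies its laws without membership conditions, as
  \<open>lie_lattice_space\<close> demands.\<close>

definition br :: "(nat \<Rightarrow> adic) \<Rightarrow> (nat \<Rightarrow> adic) \<Rightarrow> nat \<Rightarrow> adic" where
  "br v w = \<iota> (bracket L (\<kappa> v) (\<kappa> w))"

lemma sum_fun_apply: "(\<Sum>i\<in>A. f i) x = (\<Sum>i\<in>A. (f i :: nat \<Rightarrow> adic) x)"
  by (induction A rule: infinite_finite_induct) simp_all

text \<open>The entry is the idempotent of the factor at \<open>p\<close>, not the unit of
  \<open>adic\<close>, so that the vector belongs to \<open>G\<close>.\<close>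

definition unit_vec :: "nat \<Rightarrow> nat \<Rightarrow> adic" where
  "unit_vec i = (\<lambda>j. if j = i then adic_of p \<one>\<^bsub>R\<^esub> else 0)"

lemma G_basis: "basis d unit_vec G"
proof -
  let ?e = "adic_of p \<one>\<^bsub>R\<^esub>"
  have one: "\<one>\<^bsub>R\<^esub> \<in> carrier R" using R.one_closed .
  have e: "pure ?e" "comp_at p ?e = \<one>\<^bsub>R\<^esub>" using pure_adic_of one by auto
  have s: "(\<Sum>i<d. vscale (c i) (unit_vec i)) = (\<lambda>j. if j < d then c j * ?e else 0)" for c
    by (rule ext) (simp add: sum_fun_apply unit_vec_def if_distrib[of "(*) _"] cong: if_cong)
  have mul_e: "c * ?e = c" if "pure c" for c
    by (rule pure_eqI) (use that e pure_mult in \<open>auto simp: comp_at_hom\<close>)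
  show ?thesis
  proof (rule basisI)
    show "eff (unit_vec i)" if "i < d" for i unfolding eff_def
    proof (intro allI impI ext)
      fix r j assume "vanish r"
      then have "comp_at p (r * ?e) = comp_at p 0" unfolding vanish_def by (auto simp: comp_at_ops)
      then have "r * ?e = 0" using pure_eqI pure_mult[OF e(1)] pure_0 by blast
      then show "vscale r (unit_vec i) j = 0 j" unfolding unit_vec_def by simp
    qed
    show "(\<Sum>i<d. vscale (c i) (unit_vec i)) \<in> G" for c
      unfolding s G_def using pure_mult[OF e(1)] pure_0 by auto
    show "\<exists>c. v = (\<Sum>i<d. vscale (c i) (unit_vec i))" if "v \<in> G" for v
      unfolding s by (rule exI[of _ v]) (use that mul_e in \<open>auto simp: G_def\<close>)
    show "vanish (c i)" if "(\<Sum>i<d. vscale (c i) (unit_vec i)) = 0" "i < d" for c i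
    proof -
      have "c i * ?e = 0" using fun_cong[OF that(1), of i] that(2) unfolding s by simp
      then have "comp_at p (c i) = comp_at p 0" using comp_at_hom(2)[of "c i" ?e] e(2) by (simp add: comp_at_hom(3))
      then show ?thesis unfolding vanish_def by (simp add: comp_at_ops fun_eq_iff)
    qed
  qed
qed

sublocale lie_lattice_space vscale vanish "of_nat p" br G
proof
  note [simp] = \<kappa>_closed bracket_closed
  fix r :: adic and x y z :: "nat \<Rightarrow> adic"
  show "br (x + y) z = br x z + br y z" unfolding br_def by (simp add: \<kappa>_add bracket_add_left \<iota>_add)
  show "br x (y + z) = br x y + br x z" unfolding br_def by (simp add: \<kappa>_add bracket_add_right \<iota>_add)
  show "br (vscale r x) y = vscale r (br x y)" unfolding br_def by (simp add: \<kappa>_scale bracket_smult_left \<iota>_comp)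
  show "br x (vscale r y) = vscale r (br x y)" unfolding br_def by (simp add: \<kappa>_scale bracket_smult_right \<iota>_comp)
  show "br x x = 0" unfolding br_def by (simp add: bracket_self \<iota>_0)
  show "br x (br y z) + br y (br z x) + br z (br x y) = 0"
    unfolding br_def using jacobi[of "\<kappa> x" "\<kappa> y" "\<kappa> z"] by (simp add: \<iota>_0 flip: \<iota>_add)
  show "lattice G" unfolding lattice_def using G_basis by blast
  show "\<not> vanish 2" by (rule two_not_vanish)
qed

lemma \<kappa>_br: "\<kappa> (br v w) = bracket L (\<kappa> v) (\<kappa> w)"
  unfolding br_def using bracket_closed \<kappa>_closed by simp

lemma \<iota>_br: "x \<in> carrier L \<Longrightarrow> y \<in> carrier L \<Longrightarrow> \<iota> (bracket L x y) = br (\<iota> x) (\<iota> y)"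
  unfolding br_def by simp

lemma \<iota>_mem: "H \<subseteq> carrier L \<Longrightarrow> x \<in> carrier L \<Longrightarrow> \<iota> x \<in> \<iota> ` H \<longleftrightarrow> x \<in> H"
  using inj_on_image_mem_iff[of \<iota> "carrier L" x H] \<iota>_inj unfolding inj_on_def by blast

lemma \<kappa>_image: "H \<subseteq> carrier L \<Longrightarrow> \<kappa> ` \<iota> ` H = H"
  by (force simp: image_image)

lemma \<iota>_\<kappa>_image: "H \<subseteq> G \<Longrightarrow> \<iota> ` \<kappa> ` H = H"
  by (force simp: image_image)

section \<open>Transport of subalgebras, ideals and virtual endomorphisms\<close>

lemma submodule_iff:
  assumes H: "H \<subseteq> carrier L" shows "submodule H R L \<longleftrightarrow> subspace (\<iota> ` H)"
proof
  assume s: "submodule H R L"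
  note E = submoduleE[OF s]
  show "subspace (\<iota> ` H)"
  proof (rule subspaceI)
    obtain x where x: "x \<in> H" using E(2) by blast
    have "\<zero>\<^bsub>L\<^esub> = \<ominus>\<^bsub>L\<^esub> x \<oplus>\<^bsub>L\<^esub> x" using x H by (simp add: M.l_neg subsetD)
    then have "\<zero>\<^bsub>L\<^esub> \<in> H" using E(3,5) x by metis
    then show "0 \<in> \<iota> ` H" using \<iota>_0 by (metis image_eqI)
  next
    fix v w assume "v \<in> \<iota> ` H" "w \<in> \<iota> ` H"
    then obtain x y where "x \<in> H" "v = \<iota> x" "y \<in> H" "w = \<iota> y" by blast
    then show "v + w \<in> \<iota> ` H" using \<iota>_add[of x y] E(5)[of x y] H by (metis image_eqI subsetD)
  next
    fix r v assume "v \<in> \<iota> ` H"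
    then obtain x where "x \<in> H" "v = \<iota> x" by blast
    then show "vscale r v \<in> \<iota> ` H" using \<iota>_comp[of x r] E(4)[of "comp_at p r" x] H
      by (metis comp_at_carrier image_eqI subsetD)
  qed
next
  assume s: "subspace (\<iota> ` H)"
  show "submodule H R L"
  proof (rule submoduleI[OF H])
    show "\<zero>\<^bsub>L\<^esub> \<in> H" using subspace_0[OF s] \<iota>_mem[OF H, of "\<zero>\<^bsub>L\<^esub>"] \<iota>_0 by simp
    show "\<ominus>\<^bsub>L\<^esub> a \<in> H" if "a \<in> H" for a
      using subspace_neg[OF s, of "\<iota> a"] \<iota>_mem[OF H, of "\<ominus>\<^bsub>L\<^esub> a"] \<iota>_minus[of a] that H by auto
    show "a \<oplus>\<^bsub>L\<^esub> b \<in> H" if "a \<in> H" "b \<in> H" for a b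
    proof -
      have c: "a \<in> carrier L" "b \<in> carrier L" using that H by auto
      have "\<iota> a + \<iota> b \<in> \<iota> ` H" using subspace_add[OF s] that by blast
      then show ?thesis using \<iota>_mem[OF H M.a_closed[OF c]] \<iota>_add[OF c] by simp
    qed
    show "a \<odot>\<^bsub>L\<^esub> x \<in> H" if "a \<in> carrier R" "x \<in> H" for a x
    proof -
      have c: "x \<in> carrier L" using that H by auto
      have "vscale (adic_of p a) (\<iota> x) \<in> \<iota> ` H" using subspace_scale[OF s] that by blast
      then show ?thesis using \<iota>_mem[OF H smult_closed[OF that(1) c]] \<iota>_smult[OF that(1) c] by simp
    qed
  qed
qed

lemma subalgebra_iff:
  assumes H: "H \<subseteq> carrier L" shows "lie_subalgebra R L H \<longleftrightarrow> subalg (\<iota> ` H)"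
proof -
  have "(\<forall>x\<in>H. \<forall>y\<in>H. bracket L x y \<in> H) \<longleftrightarrow> (\<forall>v\<in>\<iota> ` H. \<forall>w\<in>\<iota> ` H. br v w \<in> \<iota> ` H)"
  proof -
    have "bracket L x y \<in> H \<longleftrightarrow> br (\<iota> x) (\<iota> y) \<in> \<iota> ` H" if "x \<in> H" "y \<in> H" for x y
      using \<iota>_mem[OF H bracket_closed, of x y] \<iota>_br[of x y] that H by auto
    then show ?thesis by simp
  qed
  moreover have "\<iota> ` H \<subseteq> G" using H \<iota>_G by blast
  ultimately show ?thesis unfolding lie_subalgebra_def subalg_def submodule_iff[OF H] by blast
qed

lemma subalgebra_carrier: "lie_subalgebra R L H \<Longrightarrow> H \<subseteq> carrier L"
  unfolding lie_subalgebra_def using submoduleE(1) by blast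

text \<open>Self-similarity of a subalgebra is stated for \<open>L\<close> with restricted carrier,
  whereas the coordinates refer to \<open>L\<close> itself.\<close>

lemma submodule_restrict_iff:
  assumes N: "lie_subalgebra R L N"
  shows "submodule M R (L\<lparr>carrier := N\<rparr>) \<longleftrightarrow> M \<subseteq> N \<and> submodule M R L"
proof -
  have sN: "subgroup N (add_monoid L)" using N unfolding lie_subalgebra_def submodule_def by blast
  have e: "add_monoid (L\<lparr>carrier := N\<rparr>) = (add_monoid L)\<lparr>carrier := N\<rparr>" by simp
  have "subgroup M ((add_monoid L)\<lparr>carrier := N\<rparr>) \<longleftrightarrow> M \<subseteq> N \<and> subgroup M (add_monoid L)"
    using M.add.incl_subgroup[OF sN, of M] M.add.subgroup_incl[OF _ sN, of M]
      subgroup.subset[of M "(add_monoid L)\<lparr>carrier := N\<rparr>"] by auto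
  then show ?thesis unfolding submodule_def submodule_axioms_def e by auto
qed

lemma ideal_iff:
  assumes N: "lie_subalgebra R L N"
  shows "lie_ideal R (L\<lparr>carrier := N\<rparr>) I \<longleftrightarrow> I \<subseteq> N \<and> ideal_of (\<iota> ` N) (\<iota> ` I)"
proof (cases "I \<subseteq> N")
  case True
  have NL: "N \<subseteq> carrier L" and IL: "I \<subseteq> carrier L" using subalgebra_carrier[OF N] True by auto
  have "(\<forall>x\<in>N. \<forall>y\<in>I. bracket L x y \<in> I) \<longleftrightarrow> (\<forall>v\<in>\<iota> ` N. \<forall>w\<in>\<iota> ` I. br v w \<in> \<iota> ` I)"
  proof -
    have "bracket L x y \<in> I \<longleftrightarrow> br (\<iota> x) (\<iota> y) \<in> \<iota> ` I" if "x \<in> N" "y \<in> I" for x y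
      using \<iota>_mem[OF IL bracket_closed, of x y] \<iota>_br[of x y] that NL IL by auto
    then show ?thesis by simp
  qed
  then show ?thesis
    unfolding lie_ideal_def ideal_of_def submodule_restrict_iff[OF N] submodule_iff[OF IL] using True by auto
next
  case False
  then show ?thesis unfolding lie_ideal_def submodule_restrict_iff[OF N] by blast
qed

lemma card_rcosets:
  assumes N: "lie_subalgebra R L N" and M: "M \<subseteq> N"
  shows "card (a_rcosets\<^bsub>L\<lparr>carrier := N\<rparr>\<^esub> M) = card ((\<lambda>v. (\<lambda>m. m + v) ` (\<iota> ` M)) ` (\<iota> ` N))"
proof -
  have NL: "N \<subseteq> carrier L" using subalgebra_carrier[OF N] .
  have cos: "a_rcosets\<^bsub>L\<lparr>carrier := N\<rparr>\<^esub> M = (\<lambda>x. (\<lambda>m. m \<oplus>\<^bsub>L\<^esub> x) ` M) ` N"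
    unfolding A_RCOSETS_defs r_coset_def by auto
  have im: "\<iota> ` ((\<lambda>m. m \<oplus>\<^bsub>L\<^esub> x) ` M) = (\<lambda>m. m + \<iota> x) ` (\<iota> ` M)" if "x \<in> N" for x
    unfolding image_image by (rule image_cong) (use \<iota>_add that NL M in auto)
  have "inj_on ((`) \<iota>) ((\<lambda>x. (\<lambda>m. m \<oplus>\<^bsub>L\<^esub> x) ` M) ` N)"
  proof (rule inj_on_image)
    have "inj_on \<iota> (carrier L)" using \<iota>_inj by (intro inj_onI) blast
    then show "inj_on \<iota> (\<Union> ((\<lambda>x. (\<lambda>m. m \<oplus>\<^bsub>L\<^esub> x) ` M) ` N))"
      by (rule inj_on_subset) (use M.a_closed NL M in auto)
  qed
  then have "card ((\<lambda>x. (\<lambda>m. m \<oplus>\<^bsub>L\<^esub> x) ` M) ` N) = card ((`) \<iota> ` ((\<lambda>x. (\<lambda>m. m \<oplus>\<^bsub>L\<^esub> x) ` M) ` N))"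
    by (simp add: card_image)
  also have "(`) \<iota> ` ((\<lambda>x. (\<lambda>m. m \<oplus>\<^bsub>L\<^esub> x) ` M) ` N) = (\<lambda>x. (\<lambda>m. m + \<iota> x) ` (\<iota> ` M)) ` N"
    unfolding image_image[of "(`) \<iota>"] using im by (rule image_cong[OF refl])
  also have "\<dots> = (\<lambda>v. (\<lambda>m. m + v) ` (\<iota> ` M)) ` (\<iota> ` N)" unfolding image_image ..
  finally show ?thesis unfolding cos .
qed

lemma index_iff:
  assumes N: "lie_subalgebra R L N" and M: "lie_subalgebra R L M" "M \<subseteq> N"
  shows "card (a_rcosets\<^bsub>L\<lparr>carrier := N\<rparr>\<^esub> M) = p \<longleftrightarrow> prime_index (\<iota> ` N) (\<iota> ` M)"
proof -
  have s: "subalg (\<iota> ` N)" "subalg (\<iota> ` M)" using subalgebra_iff subalgebra_carrier N M(1) by auto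
  note sN = subalgD(1)[OF s(1)] and sM = subalgD(1)[OF s(2)]
  have MN: "\<iota> ` M \<subseteq> \<iota> ` N" using M(2) by blast
  show ?thesis unfolding card_rcosets[OF N M(2)]
  proof
    assume "card ((\<lambda>v. (\<lambda>m. m + v) ` \<iota> ` M) ` \<iota> ` N) = p"
    from prime_index_if_card_cosets[OF sN sM MN this]
    show "prime_index (\<iota> ` N) (\<iota> ` M)" unfolding prime_index_def by blast
  next
    assume "prime_index (\<iota> ` N) (\<iota> ` M)"
    then show "card ((\<lambda>v. (\<lambda>m. m + v) ` \<iota> ` M) ` \<iota> ` N) = p"
      unfolding prime_index_def
      by (intro card_cosets_if_prime_index[OF sN sM MN] lattice_eff[OF subalgD(2)[OF s(1)]]) blast+
  qed
qed

text \<open>Virtual endomorphisms correspond by conjugation with the coordinate maps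
  \<open>\<iota>\<close> and \<open>\<kappa>\<close>, which match domains, indices and invariant
  ideals.\<close>

lemma self_similar_iff:
  assumes N: "lie_subalgebra R L N"
  shows "self_similar R p (L\<lparr>carrier := N\<rparr>) \<longleftrightarrow> self_sim (\<iota> ` N)"
proof
  note NL = subalgebra_carrier[OF N]
  assume "self_similar R p (L\<lparr>carrier := N\<rparr>)"
  then obtain M \<phi> where M: "lie_subalgebra R (L\<lparr>carrier := N\<rparr>) M" "card (a_rcosets\<^bsub>L\<lparr>carrier := N\<rparr>\<^esub> M) = p"
    and \<phi>: "\<phi> \<in> lie_hom R (L\<lparr>carrier := M\<rparr>) (L\<lparr>carrier := N\<rparr>)"
    and simple: "\<not> (\<exists>I. lie_ideal R (L\<lparr>carrier := N\<rparr>) I \<and> I \<noteq> {\<zero>\<^bsub>L\<^esub>} \<and> I \<subseteq> M \<and> \<phi> ` I \<subseteq> I)"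
    unfolding self_similar_def simple_virtual_endomorphism_def virtual_endomorphism_def by auto
  have M': "M \<subseteq> N" "lie_subalgebra R L M"
    using M(1) unfolding lie_subalgebra_def submodule_restrict_iff[OF N] by auto
  have MsL: "M \<subseteq> carrier L" using M'(1) NL by blast
  have h: "\<And>x. x \<in> M \<Longrightarrow> \<phi> x \<in> N" "\<And>x y. x \<in> M \<Longrightarrow> y \<in> M \<Longrightarrow> \<phi> (x \<oplus>\<^bsub>L\<^esub> y) = \<phi> x \<oplus>\<^bsub>L\<^esub> \<phi> y"
    "\<And>a x. a \<in> carrier R \<Longrightarrow> x \<in> M \<Longrightarrow> \<phi> (a \<odot>\<^bsub>L\<^esub> x) = a \<odot>\<^bsub>L\<^esub> \<phi> x"
    "\<And>x y. x \<in> M \<Longrightarrow> y \<in> M \<Longrightarrow> \<phi> (bracket L x y) = bracket L (\<phi> x) (\<phi> y)"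
    using \<phi> unfolding lie_hom_def by auto
  define \<psi> where "\<psi> = \<iota> \<circ> \<phi> \<circ> \<kappa>"
  have \<psi>: "\<psi> (\<iota> x) = \<iota> (\<phi> x)" if "x \<in> M" for x unfolding \<psi>_def using that MsL by auto
  have c: "x \<in> M \<Longrightarrow> x \<in> carrier L" "x \<in> M \<Longrightarrow> \<phi> x \<in> carrier L" for x using MsL NL h(1) by auto
  have "lin_on (\<iota> ` M) \<psi>" unfolding lin_on_def
  proof (intro conjI ballI allI)
    fix v w assume "v \<in> \<iota> ` M" "w \<in> \<iota> ` M"
    then obtain x y where xy: "x \<in> M" "v = \<iota> x" "y \<in> M" "w = \<iota> y" by blast
    have "x \<oplus>\<^bsub>L\<^esub> y \<in> M" using M'(2) xy submoduleE(5) unfolding lie_subalgebra_def by blast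
    then have "\<psi> (\<iota> (x \<oplus>\<^bsub>L\<^esub> y)) = \<iota> (\<phi> x \<oplus>\<^bsub>L\<^esub> \<phi> y)" using \<psi> h(2) xy by simp
    then show "\<psi> (v + w) = \<psi> v + \<psi> w" using \<psi> xy \<iota>_add c by simp
  next
    fix r v assume "v \<in> \<iota> ` M"
    then obtain x where x: "x \<in> M" "v = \<iota> x" by blast
    have "comp_at p r \<odot>\<^bsub>L\<^esub> x \<in> M" using M'(2) x submoduleE(4) unfolding lie_subalgebra_def by auto
    then have "\<psi> (\<iota> (comp_at p r \<odot>\<^bsub>L\<^esub> x)) = \<iota> (comp_at p r \<odot>\<^bsub>L\<^esub> \<phi> x)" using \<psi> h(3) x by simp
    then show "\<psi> (vscale r v) = vscale r (\<psi> v)" using \<psi> x \<iota>_comp c by simp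
  qed
  moreover have "\<psi> ` (\<iota> ` M) \<subseteq> \<iota> ` N" using \<psi> h(1) by auto
  moreover have "\<psi> (br v w) = br (\<psi> v) (\<psi> w)" if vw: "v \<in> \<iota> ` M" "w \<in> \<iota> ` M" for v w
  proof -
    obtain x y where xy: "x \<in> M" "v = \<iota> x" "y \<in> M" "w = \<iota> y" using vw by blast
    have "bracket L x y \<in> M" using M'(2) xy unfolding lie_subalgebra_def by blast
    then have "\<psi> (\<iota> (bracket L x y)) = \<iota> (bracket L (\<phi> x) (\<phi> y))" using \<psi> h(4) xy by simp
    then show ?thesis using \<psi> xy \<iota>_br c by simp
  qed
  moreover have "\<not> (\<exists>I. ideal_of (\<iota> ` N) I \<and> I \<noteq> {0} \<and> I \<subseteq> \<iota> ` M \<and> \<psi> ` I \<subseteq> I)"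
  proof
    assume "\<exists>I. ideal_of (\<iota> ` N) I \<and> I \<noteq> {0} \<and> I \<subseteq> \<iota> ` M \<and> \<psi> ` I \<subseteq> I"
    then obtain I where I: "ideal_of (\<iota> ` N) I" "I \<noteq> {0}" "I \<subseteq> \<iota> ` M" "\<psi> ` I \<subseteq> I" by blast
    obtain J where J: "J \<subseteq> M" "I = \<iota> ` J" using I(3) by (meson subset_imageE)
    have JN: "J \<subseteq> N" using J(1) M'(1) by blast
    have "lie_ideal R (L\<lparr>carrier := N\<rparr>) J" using ideal_iff[OF N] I(1) JN J(2) by blast
    moreover have "J \<noteq> {\<zero>\<^bsub>L\<^esub>}" using I(2) J(2) \<iota>_0 by auto
    moreover have "\<phi> x \<in> J" if x: "x \<in> J" for x
    proof -
      have "\<iota> (\<phi> x) \<in> \<iota> ` J" using I(4) J x \<psi> by (metis image_eqI subsetD)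
      then show ?thesis using \<iota>_mem[of J "\<phi> x"] JN NL c x J(1) by blast
    qed
    ultimately show False using simple J(1) by blast
  qed
  moreover have "subalg (\<iota> ` M)" using subalgebra_iff[OF MsL] M'(2) by blast
  moreover have "prime_index (\<iota> ` N) (\<iota> ` M)" using index_iff[OF N M'(2,1)] M(2) by blast
  ultimately show "self_sim (\<iota> ` N)" unfolding self_sim_def using M'(1)
    by (intro exI[of _ "\<iota> ` M"] exI[of _ \<psi>]) blast
next
  note NL = subalgebra_carrier[OF N]
  assume "self_sim (\<iota> ` N)"
  then obtain M' \<psi> where M': "subalg M'" "M' \<subseteq> \<iota> ` N" "prime_index (\<iota> ` N) M'" "lin_on M' \<psi>"
    "\<psi> ` M' \<subseteq> \<iota> ` N" "\<forall>x\<in>M'. \<forall>y\<in>M'. \<psi> (br x y) = br (\<psi> x) (\<psi> y)"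
    "\<not> (\<exists>I. ideal_of (\<iota> ` N) I \<and> I \<noteq> {0} \<and> I \<subseteq> M' \<and> \<psi> ` I \<subseteq> I)"
    unfolding self_sim_def by (elim exE conjE) (rule that)
  obtain M where M: "M \<subseteq> N" "M' = \<iota> ` M" using M'(2) by (meson subset_imageE)
  have MsL: "M \<subseteq> carrier L" using M(1) NL by blast
  have sM: "lie_subalgebra R L M" using subalgebra_iff[OF MsL] M'(1) M(2) by blast
  define \<phi> where "\<phi> = \<kappa> \<circ> \<psi> \<circ> \<iota>"
  have \<psi>G: "\<psi> (\<iota> x) \<in> \<iota> ` N" if "x \<in> M" for x using M'(5) M(2) that by blast
  have \<phi>: "\<iota> (\<phi> x) = \<psi> (\<iota> x)" "\<phi> x \<in> N" if x: "x \<in> M" for x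
  proof -
    obtain y where y: "y \<in> N" "\<psi> (\<iota> x) = \<iota> y" using \<psi>G[OF x] by blast
    then have "\<phi> x = y" unfolding \<phi>_def using NL by auto
    then show "\<iota> (\<phi> x) = \<psi> (\<iota> x)" "\<phi> x \<in> N" using y by auto
  qed
  have c: "x \<in> M \<Longrightarrow> x \<in> carrier L" "x \<in> M \<Longrightarrow> \<phi> x \<in> carrier L" for x using MsL NL \<phi>(2) by auto
  have "\<phi> \<in> lie_hom R (L\<lparr>carrier := M\<rparr>) (L\<lparr>carrier := N\<rparr>)" unfolding lie_hom_def
  proof (intro CollectI conjI ballI)
    show "\<phi> \<in> carrier (L\<lparr>carrier := M\<rparr>) \<rightarrow> carrier (L\<lparr>carrier := N\<rparr>)" using \<phi>(2) by simp
    show "\<phi> (x \<oplus>\<^bsub>L\<lparr>carrier := M\<rparr>\<^esub> y) = \<phi> x \<oplus>\<^bsub>L\<lparr>carrier := N\<rparr>\<^esub> \<phi> y"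
      if "x \<in> carrier (L\<lparr>carrier := M\<rparr>)" "y \<in> carrier (L\<lparr>carrier := M\<rparr>)" for x y
    proof -
      have xy: "x \<in> M" "y \<in> M" using that by auto
      have "x \<oplus>\<^bsub>L\<^esub> y \<in> M" using sM xy submoduleE(5) unfolding lie_subalgebra_def by blast
      then have "\<iota> (\<phi> (x \<oplus>\<^bsub>L\<^esub> y)) = \<iota> (\<phi> x \<oplus>\<^bsub>L\<^esub> \<phi> y)"
        using \<phi> xy \<iota>_add c lin_onD(1)[OF M'(4)] M(2) by simp
      then have "\<phi> (x \<oplus>\<^bsub>L\<^esub> y) = \<phi> x \<oplus>\<^bsub>L\<^esub> \<phi> y"
        using \<iota>_inj c(2)[OF \<open>x \<oplus>\<^bsub>L\<^esub> y \<in> M\<close>] M.a_closed[OF c(2)[OF xy(1)] c(2)[OF xy(2)]] by blast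
      then show ?thesis by simp
    qed
    show "\<phi> (a \<odot>\<^bsub>L\<lparr>carrier := M\<rparr>\<^esub> x) = a \<odot>\<^bsub>L\<lparr>carrier := N\<rparr>\<^esub> \<phi> x"
      if "a \<in> carrier R" "x \<in> carrier (L\<lparr>carrier := M\<rparr>)" for a x
    proof -
      have x: "x \<in> M" using that by auto
      have ax: "a \<odot>\<^bsub>L\<^esub> x \<in> M" using sM x that(1) submoduleE(4) unfolding lie_subalgebra_def by blast
      then have "\<iota> (\<phi> (a \<odot>\<^bsub>L\<^esub> x)) = \<iota> (a \<odot>\<^bsub>L\<^esub> \<phi> x)"
        using \<phi> x \<iota>_smult[OF that(1)] c lin_onD(2)[OF M'(4)] M(2) by simp
      then have "\<phi> (a \<odot>\<^bsub>L\<^esub> x) = a \<odot>\<^bsub>L\<^esub> \<phi> x"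
        using \<iota>_inj c(2)[OF ax] smult_closed[OF that(1) c(2)[OF x]] by blast
      then show ?thesis by simp
    qed
    show "\<phi> (bracket (L\<lparr>carrier := M\<rparr>) x y) = bracket (L\<lparr>carrier := N\<rparr>) (\<phi> x) (\<phi> y)"
      if "x \<in> carrier (L\<lparr>carrier := M\<rparr>)" "y \<in> carrier (L\<lparr>carrier := M\<rparr>)" for x y
    proof -
      have xy: "x \<in> M" "y \<in> M" using that by auto
      have b: "bracket L x y \<in> M" using sM xy unfolding lie_subalgebra_def by blast
      then have "\<iota> (\<phi> (bracket L x y)) = \<iota> (bracket L (\<phi> x) (\<phi> y))"
        using \<phi> xy \<iota>_br c M'(6) M(2) by simp
      then have "\<phi> (bracket L x y) = bracket L (\<phi> x) (\<phi> y)"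
        using \<iota>_inj c(2)[OF b] bracket_closed[OF c(2)[OF xy(1)] c(2)[OF xy(2)]] by blast
      then show ?thesis by simp
    qed
  qed
  moreover have "\<not> (\<exists>I. lie_ideal R (L\<lparr>carrier := N\<rparr>) I \<and> I \<noteq> {\<zero>\<^bsub>L\<^esub>} \<and> I \<subseteq> M \<and> \<phi> ` I \<subseteq> I)"
  proof
    assume "\<exists>I. lie_ideal R (L\<lparr>carrier := N\<rparr>) I \<and> I \<noteq> {\<zero>\<^bsub>L\<^esub>} \<and> I \<subseteq> M \<and> \<phi> ` I \<subseteq> I"
    then obtain I where I: "lie_ideal R (L\<lparr>carrier := N\<rparr>) I" "I \<noteq> {\<zero>\<^bsub>L\<^esub>}" "I \<subseteq> M" "\<phi> ` I \<subseteq> I" by blast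
    have "ideal_of (\<iota> ` N) (\<iota> ` I)" using ideal_iff[OF N] I(1) by blast
    moreover have "\<iota> ` I \<noteq> {0}"
    proof
      assume "\<iota> ` I = {0}"
      then have "\<kappa> ` (\<iota> ` I) = {\<zero>\<^bsub>L\<^esub>}" using \<kappa>_0 by simp
      then show False using I(2,3) \<kappa>_image[of I] MsL by auto
    qed
    moreover have "\<iota> ` I \<subseteq> M'" using I(3) M(2) by blast
    moreover have "\<psi> ` (\<iota> ` I) \<subseteq> \<iota> ` I"
    proof
      fix w assume "w \<in> \<psi> ` (\<iota> ` I)"
      then obtain x where x: "x \<in> I" "w = \<psi> (\<iota> x)" by blast
      then have "w = \<iota> (\<phi> x)" using \<phi>(1) I(3) by auto
      then show "w \<in> \<iota> ` I" using I(4) x(1) by blast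
    qed
    ultimately show False using M'(7) by blast
  qed
  moreover have "lie_subalgebra R (L\<lparr>carrier := N\<rparr>) M"
    using sM M(1) unfolding lie_subalgebra_def submodule_restrict_iff[OF N] by simp
  moreover have "card (a_rcosets\<^bsub>L\<lparr>carrier := N\<rparr>\<^esub> M) = p" using index_iff[OF N sM M(1)] M'(3) M(2) by blast
  ultimately show "self_similar R p (L\<lparr>carrier := N\<rparr>)"
    unfolding self_similar_def simple_virtual_endomorphism_def virtual_endomorphism_def
    by (intro exI[of _ M] exI[of _ \<phi>]) simp
qed

theorem strongly_hereditarily_iff:
  assumes "carrier L \<noteq> {\<zero>\<^bsub>L\<^esub>}"
  shows "strongly_hereditarily_self_similar R p L \<longleftrightarrow> scalar_type G"
proof -
  have sL: "lie_subalgebra R L (carrier L)"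
    unfolding lie_subalgebra_def using carrier_is_submodule bracket_closed by blast
  have sG: "subalg G" using subalgebra_iff[OF order_refl] sL \<iota>_image by simp
  have ne: "\<iota> ` H \<noteq> {0} \<longleftrightarrow> H \<noteq> {\<zero>\<^bsub>L\<^esub>}" if "H \<subseteq> carrier L" for H
  proof
    assume "H \<noteq> {\<zero>\<^bsub>L\<^esub>}"
    then show "\<iota> ` H \<noteq> {0}" using \<kappa>_image[OF that] \<kappa>_0 by (metis image_empty image_insert)
  qed (use \<iota>_0 in auto)
  have "strongly_hereditarily_self_similar R p L \<longleftrightarrow>
      (\<forall>N. lie_subalgebra R L N \<and> N \<noteq> {\<zero>\<^bsub>L\<^esub>} \<longrightarrow> self_similar R p (L\<lparr>carrier := N\<rparr>))"
  proof
    assume a: "\<forall>N. lie_subalgebra R L N \<and> N \<noteq> {\<zero>\<^bsub>L\<^esub>} \<longrightarrow> self_similar R p (L\<lparr>carrier := N\<rparr>)"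
    then have "self_similar R p (L\<lparr>carrier := carrier L\<rparr>)" using sL assms by blast
    then have "self_similar R p L" by simp
    then show "strongly_hereditarily_self_similar R p L"
      unfolding strongly_hereditarily_self_similar_def using a by blast
  qed (simp add: strongly_hereditarily_self_similar_def)
  also have "\<dots> \<longleftrightarrow> (\<forall>N. lie_subalgebra R L N \<and> N \<noteq> {\<zero>\<^bsub>L\<^esub>} \<longrightarrow> self_sim (\<iota> ` N))"
    using self_similar_iff by blast
  also have "\<dots> \<longleftrightarrow> hereditary G"
  proof
    assume a: "\<forall>N. lie_subalgebra R L N \<and> N \<noteq> {\<zero>\<^bsub>L\<^esub>} \<longrightarrow> self_sim (\<iota> ` N)"
    show "hereditary G" unfolding hereditary_def
    proof (intro allI impI)
      fix N' assume N': "subalg N' \<and> N' \<subseteq> G \<and> N' \<noteq> {0}"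
      have e: "\<iota> ` (\<kappa> ` N') = N'" using \<iota>_\<kappa>_image N' by blast
      have c: "\<kappa> ` N' \<subseteq> carrier L" using \<kappa>_closed by blast
      have "lie_subalgebra R L (\<kappa> ` N')" "\<kappa> ` N' \<noteq> {\<zero>\<^bsub>L\<^esub>}"
        using subalgebra_iff[OF c] ne[OF c] N' unfolding e by auto
      then show "self_sim N'" using a e by metis
    qed
  next
    assume h: "hereditary G"
    show "\<forall>N. lie_subalgebra R L N \<and> N \<noteq> {\<zero>\<^bsub>L\<^esub>} \<longrightarrow> self_sim (\<iota> ` N)"
    proof (intro allI impI)
      fix N assume N: "lie_subalgebra R L N \<and> N \<noteq> {\<zero>\<^bsub>L\<^esub>}"
      then have NL: "N \<subseteq> carrier L" using subalgebra_carrier by blast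
      then have "subalg (\<iota> ` N)" "\<iota> ` N \<subseteq> G" "\<iota> ` N \<noteq> {0}" using N subalgebra_iff[OF NL] ne[OF NL] \<iota>_G by auto
      then show "self_sim (\<iota> ` N)" using h unfolding hereditary_def by blast
    qed
  qed
  also have "\<dots> \<longleftrightarrow> scalar_type G" using hereditary_scalar_type[OF _ sG] scalar_type_hereditary by blast
  finally show ?thesis .
qed

end

section \<open>Comparison with the models\<close>

lemma (in cring) abelian_lie_group: "abelian_group (abelian_lie R n)"
proof (rule abelian_groupI)
  fix v assume v: "v \<in> carrier (abelian_lie R n)"
  show "\<exists>w\<in>carrier (abelian_lie R n). w \<oplus>\<^bsub>abelian_lie R n\<^esub> v = \<zero>\<^bsub>abelian_lie R n\<^esub>"
    using v by (intro bexI[of _ "\<lambda>i\<in>{..<n}. \<ominus> v i"]) (auto simp: abelian_lie_def l_neg PiE_iff intro!: restrict_ext)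
next
  fix v assume "v \<in> carrier (abelian_lie R n)"
  then show "\<zero>\<^bsub>abelian_lie R n\<^esub> \<oplus>\<^bsub>abelian_lie R n\<^esub> v = v"
    by (auto simp: abelian_lie_def PiE_iff extensional_def fun_eq_iff)
qed (auto simp: abelian_lie_def PiE_iff a_ac intro!: restrict_ext)

text \<open>The bracket of the semidirect model contains a subtraction, which is defined through
  inverses in the additive group; here it is evaluated entrywise.\<close>

lemma (in cring) abelian_lie_minus:
  assumes "v \<in> carrier (abelian_lie R n)" "w \<in> carrier (abelian_lie R n)"
  shows "v \<ominus>\<^bsub>abelian_lie R n\<^esub> w = (\<lambda>i\<in>{..<n}. v i \<oplus> \<ominus> w i)"
proof -
  interpret V: abelian_group "abelian_lie R n" by (rule abelian_lie_group)
  have "\<ominus>\<^bsub>abelian_lie R n\<^esub> w = (\<lambda>i\<in>{..<n}. \<ominus> w i)"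
    using assms(2)
    by (intro V.minus_equality) (auto simp: abelian_lie_def l_neg PiE_iff intro!: restrict_ext)
  then show ?thesis unfolding a_minus_def by (auto simp: abelian_lie_def intro!: restrict_ext)
qed

context padic_lie
begin

lemma comp_at_uminus: "comp_at p (- F) = \<ominus>\<^bsub>R\<^esub> comp_at p F"
proof -
  have "comp_at p (- F) \<oplus>\<^bsub>R\<^esub> comp_at p F = \<zero>\<^bsub>R\<^esub>"
    unfolding comp_at_hom(1,3)[symmetric] by simp
  then show ?thesis using R.minus_equality by simp
qed

lemma comp_at_diff: "comp_at p (F - H) = comp_at p F \<oplus>\<^bsub>R\<^esub> \<ominus>\<^bsub>R\<^esub> comp_at p H"
  using comp_at_hom(1)[of F "- H"] comp_at_uminus by simp

lemma add_pow_one: "[n] \<cdot>\<^bsub>R\<^esub> \<one>\<^bsub>R\<^esub> = comp_at p (of_nat n)" for n :: nat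
  by (induction n) (simp_all add: comp_at_hom R.add.nat_pow_Suc R.a_comm)

text \<open>The coefficients picked by \<open>SOME\<close> are unique modulo \<open>vanish\<close>,
  so their components at \<open>p\<close> do not depend on the choice.\<close>

definition coord :: "(nat \<Rightarrow> nat \<Rightarrow> adic) \<Rightarrow> 'a \<Rightarrow> nat \<Rightarrow> padic" where
  "coord b x = (\<lambda>i\<in>{..<d}. comp_at p ((SOME c. \<iota> x = (\<Sum>j<d. vscale (c j) (b j))) i))"

context
  fixes b assumes b: "basis d b G"
begin

lemma coord_eq:
  assumes "\<iota> x = (\<Sum>j<d. vscale (c j) (b j))"
  shows "coord b x = (\<lambda>i\<in>{..<d}. comp_at p (c i))"
proof -
  let ?c = "SOME c. \<iota> x = (\<Sum>j<d. vscale (c j) (b j))"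
  have "\<iota> x = (\<Sum>j<d. vscale (?c j) (b j))"
    by (rule someI[of "\<lambda>c. \<iota> x = (\<Sum>j<d. vscale (c j) (b j))", OF assms])
  then have "(\<Sum>j<d. vscale (?c j) (b j)) = (\<Sum>j<d. vscale (c j) (b j))" using assms by simp
  then have "vanish (?c i - c i)" if "i < d" for i using basis_unique[OF b _ that] by blast
  then show ?thesis unfolding coord_def vanish_diff by (intro restrict_ext) simp
qed

lemma coord_exists: "x \<in> carrier L \<Longrightarrow> \<exists>c. \<iota> x = (\<Sum>j<d. vscale (c j) (b j))"
  using basisD(2)[OF b \<iota>_G] .

lemma coord_bij: "bij_betw (coord b) (carrier L) ({..<d} \<rightarrow>\<^sub>E carrier R)"
  unfolding bij_betw_def
proof
  show "inj_on (coord b) (carrier L)"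
  proof (rule inj_onI)
    fix x y assume x: "x \<in> carrier L" and y: "y \<in> carrier L" and e: "coord b x = coord b y"
    obtain c c' where c: "\<iota> x = (\<Sum>j<d. vscale (c j) (b j))" and c': "\<iota> y = (\<Sum>j<d. vscale (c' j) (b j))"
      using coord_exists x y by meson
    have "vanish (c i - c' i)" if "i < d" for i
      using fun_cong[OF e[unfolded coord_eq[OF c] coord_eq[OF c']], of i] that vanish_diff by simp
    then have "\<iota> x = \<iota> y" unfolding c c' by (rule basis_sum_cong[OF b])
    then show "x = y" using \<iota>_inj x y by blast
  qed
  show "coord b ` carrier L = {..<d} \<rightarrow>\<^sub>E carrier R"
  proof (intro equalityI subsetI)
    fix f assume f: "f \<in> {..<d} \<rightarrow>\<^sub>E carrier R"
    define v where "v = (\<Sum>j<d. vscale (adic_of p (f j)) (b j))"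
    have "v \<in> G" unfolding v_def by (rule basisD(3)[OF b])
    then have "\<iota> (\<kappa> v) = (\<Sum>j<d. vscale (adic_of p (f j)) (b j))" unfolding v_def by simp
    then have "coord b (\<kappa> v) = (\<lambda>i\<in>{..<d}. comp_at p (adic_of p (f i)))" by (rule coord_eq)
    also have "\<dots> = f" using f by (auto simp: PiE_iff extensional_def fun_eq_iff)
    finally show "f \<in> coord b ` carrier L" using \<kappa>_closed by (intro image_eqI[of _ _ "\<kappa> v"]) simp_all
  qed (auto simp: coord_def)
qed

lemma coord_add:
  assumes "x \<in> carrier L" "y \<in> carrier L"
  shows "coord b (x \<oplus>\<^bsub>L\<^esub> y) = (\<lambda>i\<in>{..<d}. coord b x i \<oplus>\<^bsub>R\<^esub> coord b y i)"
proof -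
  obtain c c' where c: "\<iota> x = (\<Sum>j<d. vscale (c j) (b j))" and c': "\<iota> y = (\<Sum>j<d. vscale (c' j) (b j))"
    using coord_exists assms by meson
  have "\<iota> (x \<oplus>\<^bsub>L\<^esub> y) = (\<Sum>j<d. vscale (c j + c' j) (b j))"
    using \<iota>_add[OF assms] c c' by (simp add: scale_left_distrib sum.distrib)
  from coord_eq[OF this] show ?thesis
    unfolding coord_eq[OF c] coord_eq[OF c'] by (auto simp: comp_at_hom intro!: restrict_ext)
qed

lemma coord_smult:
  assumes "a \<in> carrier R" "x \<in> carrier L"
  shows "coord b (a \<odot>\<^bsub>L\<^esub> x) = (\<lambda>i\<in>{..<d}. a \<otimes>\<^bsub>R\<^esub> coord b x i)"
proof -
  obtain c where c: "\<iota> x = (\<Sum>j<d. vscale (c j) (b j))" using coord_exists assms(2) by blast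
  have "\<iota> (a \<odot>\<^bsub>L\<^esub> x) = (\<Sum>j<d. vscale (adic_of p a * c j) (b j))"
    using \<iota>_smult[OF assms] c by (simp add: scale_sum_right)
  from coord_eq[OF this] show ?thesis
    unfolding coord_eq[OF c] using assms(1) by (auto simp: comp_at_hom intro!: restrict_ext)
qed

end

lemma bracket_eq_br: "x \<in> carrier L \<Longrightarrow> y \<in> carrier L \<Longrightarrow> bracket L x y = \<kappa> (br (\<iota> x) (\<iota> y))"
  by (simp add: \<kappa>_br)

lemma abelian_isomorphic:
  assumes "\<And>v w. v \<in> G \<Longrightarrow> w \<in> G \<Longrightarrow> br v w = 0"
  shows "lie_isomorphic R L (abelian_lie R d)"
proof -
  note b = G_basis
  have "bracket L x y = \<zero>\<^bsub>L\<^esub>" if "x \<in> carrier L" "y \<in> carrier L" for x y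
    using bracket_eq_br[OF that] assms[OF \<iota>_G[OF that(1)] \<iota>_G[OF that(2)]] \<kappa>_0 by simp
  moreover have "coord unit_vec \<zero>\<^bsub>L\<^esub> = (\<lambda>i\<in>{..<d}. \<zero>\<^bsub>R\<^esub>)"
  proof -
    have "\<iota> \<zero>\<^bsub>L\<^esub> = (\<Sum>j<d. vscale 0 (unit_vec j))" using \<iota>_0 by simp
    from coord_eq[OF b this] show ?thesis by (simp add: comp_at_hom)
  qed
  ultimately have "coord unit_vec \<in> lie_hom R L (abelian_lie R d)"
    using coord_bij[OF b] coord_add[OF b] coord_smult[OF b]
    unfolding lie_hom_def bij_betw_def by (auto simp: abelian_lie_def)
  moreover have "bij_betw (coord unit_vec) (carrier L) (carrier (abelian_lie R d))"
    using coord_bij[OF b] by (simp add: abelian_lie_def)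
  ultimately show ?thesis unfolding lie_isomorphic_def by blast
qed

text \<open>The last basis vector plays the canonical generator. Since \<open>l\<close> is
  \<open>p ^ s\<close> on it and null on the other basis vectors, \<open>l\<close> is
  \<open>p ^ s\<close> times the last coordinate.\<close>

lemma semidirect_isomorphic:
  assumes dk: "d = Suc k" and b: "basis d b G"
    and l: "functional G l" "\<And>x y. x \<in> G \<Longrightarrow> y \<in> G \<Longrightarrow> br x y = vscale (l x) y - vscale (l y) x"
    and lk: "vanish (l (b k) - of_nat p ^ s)" and li: "\<And>i. i < k \<Longrightarrow> vanish (l (b i))"
  shows "lie_isomorphic R L (scalar_semidirect R k ([(p ^ s)] \<cdot>\<^bsub>R\<^esub> \<one>\<^bsub>R\<^esub>))"
proof -
  define \<sigma> where "\<sigma> = [(p ^ s)] \<cdot>\<^bsub>R\<^esub> \<one>\<^bsub>R\<^esub>"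
  have \<sigma>: "\<sigma> = comp_at p (of_nat p ^ s)" unfolding \<sigma>_def add_pow_one by simp
  let ?V = "abelian_lie R k" and ?S = "scalar_semidirect R k \<sigma>"
  define \<Phi> where "\<Phi> x = (coord b x k, \<lambda>i\<in>{..<k}. coord b x i)" for x
  have cR: "coord b x i \<in> carrier R" if "x \<in> carrier L" "i < d" for x i
    using coord_bij[OF b] that unfolding bij_betw_def by auto
  have lx: "comp_at p (l (\<iota> x)) = coord b x k \<otimes>\<^bsub>R\<^esub> \<sigma>" if x: "x \<in> carrier L" for x
  proof -
    obtain c where c: "\<iota> x = (\<Sum>j<d. vscale (c j) (b j))" using coord_exists[OF b x] by blast
    have "vanish (l (\<iota> x) - (\<Sum>i<d. c i * l (b i)))"
      unfolding c by (rule functional_sum[OF l(1) G_subspace]) (rule basis_mem[OF b])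
    moreover have "vanish ((\<Sum>i<d. c i * l (b i)) - c k * of_nat p ^ s)"
    proof -
      have "(\<Sum>i<d. c i * l (b i)) - c k * of_nat p ^ s = (\<Sum>i<k. c i * l (b i)) + c k * (l (b k) - of_nat p ^ s)"
        unfolding dk by (simp add: algebra_simps)
      also have "vanish \<dots>" using lk li by (intro nul_add nul_sum nul_mult) auto
      finally show ?thesis .
    qed
    ultimately have "vanish (l (\<iota> x) - c k * of_nat p ^ s)" by (rule nul_trans)
    then show ?thesis unfolding vanish_diff coord_eq[OF b c] \<sigma> using dk by (simp add: comp_at_hom)
  qed
  have coord_br: "coord b (bracket L x y) i =
      ((coord b x k \<otimes>\<^bsub>R\<^esub> \<sigma>) \<otimes>\<^bsub>R\<^esub> coord b y i) \<oplus>\<^bsub>R\<^esub> \<ominus>\<^bsub>R\<^esub> ((coord b y k \<otimes>\<^bsub>R\<^esub> \<sigma>) \<otimes>\<^bsub>R\<^esub> coord b x i)"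
    if x: "x \<in> carrier L" and y: "y \<in> carrier L" and i: "i < d" for x y i
  proof -
    obtain c c' where c: "\<iota> x = (\<Sum>j<d. vscale (c j) (b j))" and c': "\<iota> y = (\<Sum>j<d. vscale (c' j) (b j))"
      using coord_exists[OF b] x y by meson
    have "\<iota> (bracket L x y) = vscale (l (\<iota> x)) (\<iota> y) - vscale (l (\<iota> y)) (\<iota> x)"
      using \<iota>_br[OF x y] l(2)[OF \<iota>_G[OF x] \<iota>_G[OF y]] by simp
    also have "vscale (l (\<iota> x)) (\<iota> y) = (\<Sum>j<d. vscale (l (\<iota> x) * c' j) (b j))"
      unfolding c' scale_sum_right scale_scale ..
    also have "vscale (l (\<iota> y)) (\<iota> x) = (\<Sum>j<d. vscale (l (\<iota> y) * c j) (b j))"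
      unfolding c scale_sum_right scale_scale ..
    also have "(\<Sum>j<d. vscale (l (\<iota> x) * c' j) (b j)) - (\<Sum>j<d. vscale (l (\<iota> y) * c j) (b j)) =
        (\<Sum>j<d. vscale (l (\<iota> x) * c' j - l (\<iota> y) * c j) (b j))"
      unfolding scale_left_diff_distrib sum_subtractf ..
    finally have "coord b (bracket L x y) i = comp_at p (l (\<iota> x) * c' i - l (\<iota> y) * c i)"
      using coord_eq[OF b] i by simp
    then show ?thesis
      using i unfolding comp_at_diff comp_at_hom lx[OF x] lx[OF y] coord_eq[OF b c] coord_eq[OF b c'] by simp
  qed
  have kd: "k < d" using dk by simp
  \<comment> \<open>In the last coordinate the two terms of \<open>coord_br\<close> agree by
    commutativity, so brackets have no component along the generator.\<close>
  have zero_k: "coord b (bracket L x y) k = \<zero>\<^bsub>R\<^esub>" if x: "x \<in> carrier L" and y: "y \<in> carrier L" for x y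
  proof -
    have c: "coord b x k \<in> carrier R" "coord b y k \<in> carrier R" "\<sigma> \<in> carrier R" using cR x y dk unfolding \<sigma> by auto
    have "(coord b y k \<otimes>\<^bsub>R\<^esub> \<sigma>) \<otimes>\<^bsub>R\<^esub> coord b x k = (coord b x k \<otimes>\<^bsub>R\<^esub> \<sigma>) \<otimes>\<^bsub>R\<^esub> coord b y k"
      using c by (simp add: R.m_ac)
    then show ?thesis unfolding coord_br[OF x y kd] using c by (simp add: R.r_neg)
  qed
  have "\<Phi> \<in> lie_hom R L ?S" unfolding lie_hom_def
  proof (intro CollectI conjI ballI)
    show "\<Phi> \<in> carrier L \<rightarrow> carrier ?S"
      unfolding \<Phi>_def scalar_semidirect_def abelian_lie_def Let_def using cR dk by auto
    show "\<Phi> (x \<oplus>\<^bsub>L\<^esub> y) = \<Phi> x \<oplus>\<^bsub>?S\<^esub> \<Phi> y" if "x \<in> carrier L" "y \<in> carrier L" for x y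
      unfolding \<Phi>_def scalar_semidirect_def abelian_lie_def Let_def coord_add[OF b that]
      using dk by (auto intro!: restrict_ext)
    show "\<Phi> (a \<odot>\<^bsub>L\<^esub> x) = a \<odot>\<^bsub>?S\<^esub> \<Phi> x" if "a \<in> carrier R" "x \<in> carrier L" for a x
      unfolding \<Phi>_def scalar_semidirect_def abelian_lie_def Let_def coord_smult[OF b that]
      using dk by (auto intro!: restrict_ext)
    fix x y assume x: "x \<in> carrier L" and y: "y \<in> carrier L"
    have mem: "(\<lambda>i\<in>{..<k}. coord b x i) \<in> carrier ?V" "(\<lambda>i\<in>{..<k}. coord b y i) \<in> carrier ?V"
      using cR x y dk by (auto simp: abelian_lie_def)
    have sR: "coord b x k \<otimes>\<^bsub>R\<^esub> \<sigma> \<in> carrier R" "coord b y k \<otimes>\<^bsub>R\<^esub> \<sigma> \<in> carrier R"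
      using cR x y dk unfolding \<sigma> by auto
    have sm: "a \<odot>\<^bsub>?V\<^esub> v \<in> carrier ?V" if "a \<in> carrier R" "v \<in> carrier ?V" for a v
      using that by (auto simp: abelian_lie_def PiE_iff)
    have "bracket ?S (\<Phi> x) (\<Phi> y) = (\<zero>\<^bsub>R\<^esub>, \<lambda>i\<in>{..<k}. coord b (bracket L x y) i)"
    proof -
      let ?v = "\<lambda>z. \<lambda>i\<in>{..<k}. coord b z i"
      have smE: "a \<odot>\<^bsub>?V\<^esub> v = (\<lambda>i\<in>{..<k}. a \<otimes>\<^bsub>R\<^esub> v i)" for a v by (simp add: abelian_lie_def)
      have "bracket ?S (\<Phi> x) (\<Phi> y) = (\<zero>\<^bsub>R\<^esub>, (coord b x k \<otimes>\<^bsub>R\<^esub> \<sigma>) \<odot>\<^bsub>?V\<^esub> ?v y \<ominus>\<^bsub>?V\<^esub> (coord b y k \<otimes>\<^bsub>R\<^esub> \<sigma>) \<odot>\<^bsub>?V\<^esub> ?v x)"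
        unfolding \<Phi>_def by (simp add: scalar_semidirect_def Let_def)
      also have "\<dots> = (\<zero>\<^bsub>R\<^esub>, ?v (bracket L x y))"
        unfolding R.abelian_lie_minus[OF sm[OF sR(1) mem(2)] sm[OF sR(2) mem(1)]]
        unfolding smE by (auto simp: coord_br[OF x y less_trans[OF _ kd]] intro!: restrict_ext)
      finally show ?thesis .
    qed
    then show "\<Phi> (bracket L x y) = bracket ?S (\<Phi> x) (\<Phi> y)"
      unfolding \<Phi>_def zero_k[OF x y] by simp
  qed
  moreover have "bij_betw \<Phi> (carrier L) (carrier ?S)"
  proof -
    have "bij_betw (\<lambda>f. (f k, \<lambda>i\<in>{..<k}. f i)) ({..<d} \<rightarrow>\<^sub>E carrier R) (carrier R \<times> ({..<k} \<rightarrow>\<^sub>E carrier R))"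
      unfolding dk
    proof (rule bij_betw_byWitness[where f' = "\<lambda>(a, v). \<lambda>i\<in>{..<Suc k}. if i = k then a else v i"])
      show "\<forall>f\<in>{..<Suc k} \<rightarrow>\<^sub>E carrier R. (\<lambda>(a, v). \<lambda>i\<in>{..<Suc k}. if i = k then a else v i) (f k, \<lambda>i\<in>{..<k}. f i) = f"
      proof
        fix f assume f: "f \<in> {..<Suc k} \<rightarrow>\<^sub>E carrier R"
        have "(\<lambda>i\<in>{..<Suc k}. if i = k then f k else (\<lambda>i\<in>{..<k}. f i) i) = f"
          by (rule extensionalityI[of _ "{..<Suc k}"]) (use f in \<open>simp_all add: PiE_def\<close>)
        then show "(\<lambda>(a, v). \<lambda>i\<in>{..<Suc k}. if i = k then a else v i) (f k, \<lambda>i\<in>{..<k}. f i) = f" by simp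
      qed
      show "\<forall>q\<in>carrier R \<times> ({..<k} \<rightarrow>\<^sub>E carrier R).
          (\<lambda>f. (f k, \<lambda>i\<in>{..<k}. f i)) ((\<lambda>(a, v). \<lambda>i\<in>{..<Suc k}. if i = k then a else v i) q) = q"
      proof
        fix q assume "q \<in> carrier R \<times> ({..<k} \<rightarrow>\<^sub>E carrier R)"
        then obtain a v where q: "q = (a, v)" and v: "v \<in> {..<k} \<rightarrow>\<^sub>E carrier R" by blast
        have "(\<lambda>i\<in>{..<k}. (\<lambda>i\<in>{..<Suc k}. if i = k then a else v i) i) = v"
          by (rule extensionalityI[of _ "{..<k}"]) (use v in \<open>simp_all add: PiE_def\<close>)
        then show "(\<lambda>f. (f k, \<lambda>i\<in>{..<k}. f i)) ((\<lambda>(a, v). \<lambda>i\<in>{..<Suc k}. if i = k then a else v i) q) = q"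
          by (simp add: q)
      qed
      show "(\<lambda>f. (f k, \<lambda>i\<in>{..<k}. f i)) ` ({..<Suc k} \<rightarrow>\<^sub>E carrier R) \<subseteq> carrier R \<times> ({..<k} \<rightarrow>\<^sub>E carrier R)"
        by (intro image_subsetI SigmaI restrict_PiE_iff[THEN iffD2] ballI)
          (erule PiE_mem, simp)+
      show "(\<lambda>(a, v). \<lambda>i\<in>{..<Suc k}. if i = k then a else v i) ` (carrier R \<times> ({..<k} \<rightarrow>\<^sub>E carrier R))
          \<subseteq> {..<Suc k} \<rightarrow>\<^sub>E carrier R"
      proof (rule image_subsetI)
        fix q assume "q \<in> carrier R \<times> ({..<k} \<rightarrow>\<^sub>E carrier R)"
        then obtain a v where q: "q = (a, v)" "a \<in> carrier R" and v: "v \<in> {..<k} \<rightarrow>\<^sub>E carrier R" by blast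
        have "(if i = k then a else v i) \<in> carrier R" if "i \<in> {..<Suc k}" for i
          using q(2) PiE_mem[OF v, of i] that by (auto simp: less_Suc_eq)
        then show "(\<lambda>(a, v). \<lambda>i\<in>{..<Suc k}. if i = k then a else v i) q \<in> {..<Suc k} \<rightarrow>\<^sub>E carrier R"
          unfolding q(1) split restrict_PiE_iff by blast
      qed
    qed
    then have "bij_betw ((\<lambda>f. (f k, \<lambda>i\<in>{..<k}. f i)) \<circ> coord b) (carrier L) (carrier R \<times> ({..<k} \<rightarrow>\<^sub>E carrier R))"
      using coord_bij[OF b] bij_betw_trans by blast
    then show ?thesis unfolding \<Phi>_def comp_def scalar_semidirect_def abelian_lie_def Let_def by simp
  qed
  ultimately show ?thesis unfolding lie_isomorphic_def \<sigma>_def by blast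
qed

section \<open>From the models back to scalar type\<close>

lemma scalar_type_if_abelian:
  assumes "lie_isomorphic R L (abelian_lie R n)" shows "scalar_type G"
proof -
  obtain \<phi> where \<phi>: "\<phi> \<in> lie_hom R L (abelian_lie R n)" "bij_betw \<phi> (carrier L) (carrier (abelian_lie R n))"
    using assms unfolding lie_isomorphic_def by blast
  have br0: "\<phi> (bracket L x y) = (\<lambda>i\<in>{..<n}. \<zero>\<^bsub>R\<^esub>)" if "x \<in> carrier L" "y \<in> carrier L" for x y
    using \<phi>(1) that unfolding lie_hom_def by (simp add: abelian_lie_def)
  have "bracket L x y = \<zero>\<^bsub>L\<^esub>" if xy: "x \<in> carrier L" "y \<in> carrier L" for x y
  proof -
    have "\<phi> (bracket L x y) = \<phi> (bracket L x x)" using br0[OF xy] br0[OF xy(1,1)] by simp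
    then have "bracket L x y = bracket L x x"
      using \<phi>(2) bracket_closed xy unfolding bij_betw_def inj_on_def by blast
    then show ?thesis using bracket_self xy(1) by simp
  qed
  then have "br v w = 0" for v w unfolding br_def using \<kappa>_closed \<iota>_0 by simp
  then show ?thesis unfolding scalar_type_def
    by (intro exI[of _ "\<lambda>_. 0"]) (simp add: functional_def nul_0)
qed

text \<open>The form \<open>t\<close> is the first component of the image, times \<open>c\<close>.
  The combination of \<open>x\<close> and \<open>y\<close> with coefficients \<open>- t y\<close>
  and \<open>t x\<close> has the same image as their bracket, since its first components cancel by
  commutativity.\<close>

lemma scalar_type_if_semidirect:
  assumes "lie_isomorphic R L (scalar_semidirect R n c)" and c: "c \<in> carrier R" shows "scalar_type G"
proof -
  let ?V = "abelian_lie R n" and ?S = "scalar_semidirect R n c"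
  obtain \<phi> where \<phi>: "\<phi> \<in> lie_hom R L ?S" "bij_betw \<phi> (carrier L) (carrier ?S)"
    using assms unfolding lie_isomorphic_def by blast
  have h: "\<And>x. x \<in> carrier L \<Longrightarrow> \<phi> x \<in> carrier ?S"
    "\<And>x y. x \<in> carrier L \<Longrightarrow> y \<in> carrier L \<Longrightarrow> \<phi> (x \<oplus>\<^bsub>L\<^esub> y) = \<phi> x \<oplus>\<^bsub>?S\<^esub> \<phi> y"
    "\<And>a x. a \<in> carrier R \<Longrightarrow> x \<in> carrier L \<Longrightarrow> \<phi> (a \<odot>\<^bsub>L\<^esub> x) = a \<odot>\<^bsub>?S\<^esub> \<phi> x"
    "\<And>x y. x \<in> carrier L \<Longrightarrow> y \<in> carrier L \<Longrightarrow> \<phi> (bracket L x y) = bracket ?S (\<phi> x) (\<phi> y)"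
    using \<phi>(1) unfolding lie_hom_def by auto
  have S_add: "(a, v) \<oplus>\<^bsub>?S\<^esub> (a', v') = (a \<oplus>\<^bsub>R\<^esub> a', \<lambda>i\<in>{..<n}. v i \<oplus>\<^bsub>R\<^esub> v' i)"
    and S_smult: "r \<odot>\<^bsub>?S\<^esub> (a, v) = (r \<otimes>\<^bsub>R\<^esub> a, \<lambda>i\<in>{..<n}. r \<otimes>\<^bsub>R\<^esub> v i)" for a v a' v' r
    by (simp_all add: scalar_semidirect_def abelian_lie_def Let_def)
  define t where "t x = fst (\<phi> x) \<otimes>\<^bsub>R\<^esub> c" for x
  have fR: "fst (\<phi> x) \<in> carrier R" if "x \<in> carrier L" for x
    using h(1)[OF that] by (auto simp: scalar_semidirect_def Let_def)
  have tR: "t x \<in> carrier R" if "x \<in> carrier L" for x using fR[OF that] c unfolding t_def by simp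
  have brt: "bracket L x y = t x \<odot>\<^bsub>L\<^esub> y \<oplus>\<^bsub>L\<^esub> (\<ominus>\<^bsub>R\<^esub> t y) \<odot>\<^bsub>L\<^esub> x" if x: "x \<in> carrier L" and y: "y \<in> carrier L" for x y
  proof -
    obtain a v a' v' where av: "\<phi> x = (a, v)" "\<phi> y = (a', v')" by fastforce
    have m: "a \<in> carrier R" "a' \<in> carrier R" "v \<in> carrier ?V" "v' \<in> carrier ?V"
      using h(1)[OF x] h(1)[OF y] unfolding av by (auto simp: scalar_semidirect_def Let_def)
    have vi: "v i \<in> carrier R" "v' i \<in> carrier R" if "i < n" for i using m(3,4) that by (auto simp: abelian_lie_def)
    have t: "t x = a \<otimes>\<^bsub>R\<^esub> c" "t y = a' \<otimes>\<^bsub>R\<^esub> c" unfolding t_def av by simp_all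
    note cl = smult_closed[OF tR[OF x] y] smult_closed[OF R.a_inv_closed[OF tR[OF y]] x]
    have "\<phi> (t x \<odot>\<^bsub>L\<^esub> y \<oplus>\<^bsub>L\<^esub> (\<ominus>\<^bsub>R\<^esub> t y) \<odot>\<^bsub>L\<^esub> x) =
        (t x \<otimes>\<^bsub>R\<^esub> a' \<oplus>\<^bsub>R\<^esub> (\<ominus>\<^bsub>R\<^esub> t y) \<otimes>\<^bsub>R\<^esub> a,
          \<lambda>i\<in>{..<n}. t x \<otimes>\<^bsub>R\<^esub> v' i \<oplus>\<^bsub>R\<^esub> (\<ominus>\<^bsub>R\<^esub> t y) \<otimes>\<^bsub>R\<^esub> v i)"
      unfolding h(2)[OF cl] h(3)[OF tR[OF x] y] h(3)[OF R.a_inv_closed[OF tR[OF y]] x] av S_smult S_add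
      by (auto intro!: restrict_ext)
    also have "t x \<otimes>\<^bsub>R\<^esub> a' \<oplus>\<^bsub>R\<^esub> (\<ominus>\<^bsub>R\<^esub> t y) \<otimes>\<^bsub>R\<^esub> a = \<zero>\<^bsub>R\<^esub>"
    proof -
      have "t y \<otimes>\<^bsub>R\<^esub> a = t x \<otimes>\<^bsub>R\<^esub> a'" unfolding t using m(1,2) c by (simp add: R.m_ac)
      then show ?thesis using tR[OF x] tR[OF y] m(1,2) by (simp add: R.l_minus R.r_neg)
    qed
    also have "(\<lambda>i\<in>{..<n}. t x \<otimes>\<^bsub>R\<^esub> v' i \<oplus>\<^bsub>R\<^esub> (\<ominus>\<^bsub>R\<^esub> t y) \<otimes>\<^bsub>R\<^esub> v i) =
        (t x \<odot>\<^bsub>?V\<^esub> v') \<ominus>\<^bsub>?V\<^esub> (t y \<odot>\<^bsub>?V\<^esub> v)"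
    proof -
      have sm: "r \<odot>\<^bsub>?V\<^esub> u \<in> carrier ?V" if "r \<in> carrier R" "u \<in> carrier ?V" for r u
        using that by (auto simp: abelian_lie_def PiE_iff)
      show ?thesis unfolding R.abelian_lie_minus[OF sm[OF tR[OF x] m(4)] sm[OF tR[OF y] m(3)]]
        using tR[OF y] vi by (auto simp: abelian_lie_def R.l_minus intro!: restrict_ext)
    qed
    also have "(\<zero>\<^bsub>R\<^esub>, (t x \<odot>\<^bsub>?V\<^esub> v') \<ominus>\<^bsub>?V\<^esub> (t y \<odot>\<^bsub>?V\<^esub> v)) = \<phi> (bracket L x y)"
      unfolding h(4)[OF x y] av t by (simp add: scalar_semidirect_def Let_def)
    finally show ?thesis
      using \<phi>(2) bracket_closed[OF x y] M.a_closed[OF cl] unfolding bij_betw_def inj_on_def by metis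
  qed
  define l where "l v = adic_of p (t (\<kappa> v))" for v
  have cl: "comp_at p (l v) = t (\<kappa> v)" for v unfolding l_def using tR \<kappa>_closed by simp
  have "functional G l" unfolding functional_def vanish_diff comp_at_hom cl \<kappa>_add \<kappa>_scale
  proof (intro conjI ballI allI)
    fix v w
    obtain a u a' u' where "\<phi> (\<kappa> v) = (a, u)" "\<phi> (\<kappa> w) = (a', u')" by fastforce
    then show "t (\<kappa> v \<oplus>\<^bsub>L\<^esub> \<kappa> w) = t (\<kappa> v) \<oplus>\<^bsub>R\<^esub> t (\<kappa> w)"
      unfolding t_def using h(2)[OF \<kappa>_closed \<kappa>_closed, of v w] S_add fR[OF \<kappa>_closed, of v] fR[OF \<kappa>_closed, of w] c
      by (simp add: R.l_distr)
  next
    fix r v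
    obtain a u where "\<phi> (\<kappa> v) = (a, u)" by fastforce
    then show "t (comp_at p r \<odot>\<^bsub>L\<^esub> \<kappa> v) = comp_at p r \<otimes>\<^bsub>R\<^esub> t (\<kappa> v)"
      unfolding t_def using h(3)[OF _ \<kappa>_closed, of "comp_at p r" v] S_smult fR[OF \<kappa>_closed, of v] c
      by (simp add: R.m_assoc)
  qed
  moreover have "br v w = vscale (l v) w - vscale (l w) v" if v: "v \<in> G" and w: "w \<in> G" for v w
  proof -
    note tk = tR[OF \<kappa>_closed]
    have "br v w = \<iota> (t (\<kappa> v) \<odot>\<^bsub>L\<^esub> \<kappa> w \<oplus>\<^bsub>L\<^esub> \<ominus>\<^bsub>L\<^esub> (t (\<kappa> w) \<odot>\<^bsub>L\<^esub> \<kappa> v))"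
      unfolding br_def brt[OF \<kappa>_closed \<kappa>_closed] smult_l_minus[OF tk \<kappa>_closed] ..
    also have "\<dots> = \<iota> (t (\<kappa> v) \<odot>\<^bsub>L\<^esub> \<kappa> w) - \<iota> (t (\<kappa> w) \<odot>\<^bsub>L\<^esub> \<kappa> v)"
      using tk \<kappa>_closed by (simp add: \<iota>_add \<iota>_minus)
    also have "\<dots> = vscale (l v) w - vscale (l w) v"
      unfolding \<iota>_smult[OF tk \<kappa>_closed] l_def \<iota>_\<kappa>[OF v] \<iota>_\<kappa>[OF w] ..
    finally show ?thesis .
  qed
  ultimately show ?thesis unfolding scalar_type_def by blast
qed

lemma rank_zero_iff: "carrier L = {\<zero>\<^bsub>L\<^esub>} \<longleftrightarrow> d = 0"
proof
  assume "carrier L = {\<zero>\<^bsub>L\<^esub>}"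
  then have G0: "G = {0}" using \<iota>_image \<iota>_0 by auto
  show "d = 0"
  proof (rule ccontr)
    assume "d \<noteq> 0"
    then have "0 < d" by simp
    have "(\<Sum>i<d. vscale 1 (unit_vec i)) = 0" using basisD(3)[OF G_basis, of "\<lambda>_. 1"] G0 by blast
    from basisD(4)[OF G_basis this \<open>0 < d\<close>] show False using unif_not_nul by simp
  qed
next
  assume "d = 0"
  then have "G = {0}" unfolding G_def by (auto simp: pure_0 fun_eq_iff)
  moreover have "carrier L = \<kappa> ` G" using \<kappa>_bij unfolding bij_betw_def by simp
  ultimately show "carrier L = {\<zero>\<^bsub>L\<^esub>}" using \<kappa>_0 by simp
qed

theorem strongly_hereditarily_self_similar_iff:
  "strongly_hereditarily_self_similar R p L \<longleftrightarrow>
    (d \<ge> 1 \<and> lie_isomorphic R L (abelian_lie R d)) \<or>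
    (d \<ge> 2 \<and> (\<exists>s::nat. lie_isomorphic R L (scalar_semidirect R (d - 1) ([(p ^ s)] \<cdot>\<^bsub>R\<^esub> \<one>\<^bsub>R\<^esub>))))"
    (is "_ \<longleftrightarrow> ?models")
proof (cases "d = 0")
  case True
  then have c: "carrier L = {\<zero>\<^bsub>L\<^esub>}" using rank_zero_iff by blast
  \<comment> \<open>The zero lattice has no proper submodule, hence no subalgebra of prime index; so
    both sides are false in rank zero.\<close>
  have "\<not> self_similar R p L"
  proof
    assume "self_similar R p L"
    then have "self_similar R p (L\<lparr>carrier := carrier L\<rparr>)" by simp
    moreover have "lie_subalgebra R L (carrier L)"
      unfolding lie_subalgebra_def using carrier_is_submodule bracket_closed by blast
    ultimately have "self_sim (\<iota> ` carrier L)" using self_similar_iff by blast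
    then have "self_sim {0}" unfolding c by (simp add: \<iota>_0)
    then obtain M where "subalg M" "M \<subseteq> {0}" "prime_index {0} M"
      unfolding self_sim_def by (elim exE conjE) (rule that)
    moreover from this(1) have "0 \<in> M" unfolding subalg_def using subspace_0 by simp
    ultimately show False unfolding prime_index_def by (simp add: subset_singleton_iff)
  qed
  then show ?thesis using True unfolding strongly_hereditarily_self_similar_def by simp
next
  case False
  then have "carrier L \<noteq> {\<zero>\<^bsub>L\<^esub>}" using rank_zero_iff by blast
  note iff = strongly_hereditarily_iff[OF this]
  have "?models" if st: "scalar_type G"
  proof -
    obtain l where l: "functional G l" "\<And>x y. x \<in> G \<Longrightarrow> y \<in> G \<Longrightarrow> br x y = vscale (l x) y - vscale (l y) x"
      using st unfolding scalar_type_def by blast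
    show ?thesis
    proof (cases "\<exists>x\<in>G. \<not> vanish (l x)")
      case True
      then obtain x where x: "x \<in> G" "\<not> vanish (l x)" by blast
      show ?thesis
      proof (rule adapted_basis[OF G_basis l(1) x])
        fix k b s assume k: "d = Suc k" "basis d b G" "vanish (l (b k) - of_nat p ^ s)"
          "\<And>i. i < k \<Longrightarrow> vanish (l (b i))"
        show ?thesis
        \<comment> \<open>In rank one the form may be nonzero although the bracket vanishes; this
          case belongs to the abelian model.\<close>
        proof (cases "k = 0")
          case True
          have "br v w = 0" if vw: "v \<in> G" "w \<in> G" for v w
          proof -
            obtain c c' where "v = (\<Sum>i<d. vscale (c i) (b i))" "w = (\<Sum>i<d. vscale (c' i) (b i))"
              using basisD(2)[OF k(2)] vw by meson
            then have "v = vscale (c 0) (b 0)" "w = vscale (c' 0) (b 0)" using k(1) True by auto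
            then show ?thesis by (simp add: br_simps)
          qed
          then show ?thesis using abelian_isomorphic k(1) by auto
        next
          case False
          then show ?thesis using semidirect_isomorphic[OF k(1,2) l k(3,4)] k(1) by auto
        qed
      qed
    next
      case no: False
      have "br v w = 0" if "v \<in> G" "w \<in> G" for v w
        using l(2)[OF that] no that eff_nul[OF lattice_eff[OF ambient_lattice]] by simp
      then show ?thesis using abelian_isomorphic False by auto
    qed
  qed
  moreover have "scalar_type G" if "?models"
    using that scalar_type_if_abelian scalar_type_if_semidirect add_pow_one by (metis comp_at_carrier)
  ultimately show ?thesis using iff by blast
qed

end

theorem theoremE:
  fixes p d :: nat and L :: "(padic, 'a, 'm) lie_algebra_scheme"
  assumes "prime p" and "p \<ge> 5"
    and "lie_lattice (Zp p) L" and "has_rank (Zp p) L d"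
  shows "strongly_hereditarily_self_similar (Zp p) p L \<longleftrightarrow>
    (d \<ge> 1 \<and> lie_isomorphic (Zp p) L (abelian_lie (Zp p) d)) \<or>
    (d \<ge> 2 \<and> (\<exists>s::nat. lie_isomorphic (Zp p) L
        (scalar_semidirect (Zp p) (d - 1) ([(p ^ s)] \<cdot>\<^bsub>Zp p\<^esub> \<one>\<^bsub>Zp p\<^esub>))))"
proof -
  obtain B where B: "finite_basis (Zp p) L B" "card B = d" using assms(4) unfolding has_rank_def by blast
  then have "finite B" unfolding finite_basis_def by blast
  then obtain \<beta> where "bij_betw \<beta> {..<d} B"
    using ex_bij_betw_nat_finite[of B] B(2) by (auto simp: atLeast0LessThan)
  then have \<beta>: "inj_on \<beta> {..<d}" "\<beta> ` {..<d} = B" unfolding bij_betw_def by auto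
  have "lie_algebra (Zp p) L" using assms(3) unfolding lie_lattice_def by blast
  then interpret padic_lie p L d \<beta>
    using assms(1,2) B(1) \<beta>
    by (intro padic_lie.intro padic_prime.intro padic_lie_axioms.intro) auto
  show ?thesis by (rule strongly_hereditarily_self_similar_iff)
qed

end
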